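(* Let $(M,\langle\,,\rangle)$ be a complete, non-compact, connected Riemannian manifold of dimension $m\ge2$, let $D\in C^0(M)$ be a positive weight, and let $\varphi\in C^0([0,+\infty))\cap C^1((0,+\infty))$ be non-negative with $\varphi(0)=0$ and $\varphi(t)\le At^\delta$ on $(0,+\infty)$ for some $A,\delta>0$. Given $\sigma,\mu,\chi\in\mathbb R$, let $\eta=\mu+(\sigma-1)(1+\delta-\chi)$ and assume $$\sigma\ge0,\qquad\sigma-\eta\ge0,\qquad0\le\chi<\delta.$$ Let $u\in C^1(M)$ be a non-constant function such that $$\hat u=\limsup_{r(x)\to+\infty}\frac{u(x)}{r(x)^\sigma}<+\infty,$$ and suppose that $$\liminf_{R\to+\infty}\frac{\log\mathrm{vol}_DB_R}{R^{\sigma-\eta}}=d_0<+\infty\ \text{ if }\sigma-\eta>0,\qquad\liminf_{R\to+\infty}\frac{\log\mathrm{vol}_DB_R}{\log R}=d_0<+\infty\ \text{ if }\sigma-\eta=0.$$ Suppose that $\gamma\in\mathbb R$ is such that $\Omega_\gamma=\{x\in M:u(x)>\gamma\}$ is non-empty, and that, for a constant $K\in\mathbb R$, the inequality $$\mathrm{div}\bigl(D|\nabla u|^{-1}\varphi(|\nabla u|)\nabla u\bigr)\ge K(1+r(x))^{-\mu}|\nabla u|^\chi D(x)$$ holds weakly on $\Omega_\gamma$. Then $$K\le C\,\max\{\hat u,0\}^{\delta-\chi},$$ where, if $\sigma-\eta>0$, $$C=\begin{cases}0&\text{if }\sigma=0,\\ A\,d_0(\sigma-\eta)^{1+\delta-\chi}&\text{if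 }\sigma>0,\ \eta<0,\\ A\,d_0\,\sigma^{\delta-\chi}(\sigma-\eta)&\text{if }\sigma>0,\ \eta\ge0,\end{cases}$$ and, if $\sigma-\eta=0$, $$C=\begin{cases}0&\text{if }\sigma=0,\ \text{ or if }\sigma>0\text{ and }\delta(\sigma-1)+d_0-1\le0,\\ A\,\sigma^{\delta-\chi}\,[\delta(\sigma-1)+d_0-1]&\text{if }\sigma>0\text{ and }\delta(\sigma-1)+d_0-1>0.\end{cases}$$
   Context: $r(x)=\mathrm{dist}(x,o)$ is the Riemannian distance from a fixed origin $o\in M$; $B_R$ is the geodesic ball of radius $R$ centered at $o$; $dV$ is the Riemannian volume element; $\mathrm{vol}_D(\Omega)=\int_\Omega D\,dV$. The vector field $|\nabla u|^{-1}\varphi(|\nabla u|)\nabla u$ is understood to be $0$ where $\nabla u=0$. The inequality holds weakly on $\Omega_\gamma$ if $-\int_{\Omega_\gamma}|\nabla u|^{-1}\varphi(|\nabla u|)\langle\nabla u,\nabla\psi\rangle D\,dV\ge K\int_{\Omega_\gamma}(1+r)^{-\mu}|\nabla u|^\chi\,\psi\,D\,dV$ for every non-negative test function $\psi$ compactly supported in $\Omega_\gamma$ (e.g. $\psi\in C_c^\infty(\Omega_\gamma)$). *)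

theory Defs
  imports "HOL-Analysis.Analysis"
begin

text \<open>
  Riemannian manifolds without boundary. The underlying topological space is a whole type
  (required to be Hausdorff and second countable where the notions are used), and the dimension
  is the cardinality of the index type of the model space \<open>real ^ 'm\<close>. Tensor fields are given
  by their components in the charts of an atlas.
\<close>

subsection \<open>Functions of class \<open>C\<^sup>k\<close> on open subsets of Euclidean space\<close>

primrec Ck_on :: "nat \<Rightarrow> 'a::euclidean_space set \<Rightarrow> ('a \<Rightarrow> 'b::real_normed_vector) \<Rightarrow> bool" where
  "Ck_on 0 S f \<longleftrightarrow> continuous_on S f"
| "Ck_on (Suc k) S f \<longleftrightarrow> f differentiable_on S \<and>
     (\<forall>i\<in>Basis. Ck_on k S (\<lambda>x. frechet_derivative f (at x) i))"

definition smooth_on :: "'a::euclidean_space set \<Rightarrow> ('a \<Rightarrow> 'b::real_normed_vector) \<Rightarrow> bool" where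
  "smooth_on S f \<longleftrightarrow> (\<forall>k. Ck_on k S f)"

subsection \<open>Riemannian manifolds\<close>

text \<open>
  A chart is a pair \<open>(U, \<kappa>)\<close>; the values of \<open>\<kappa>\<close> outside \<open>U\<close> are irrelevant.
  \<open>gram M c p\<close> is the matrix \<open>(g\<^sub>i\<^sub>j)\<close> of the metric at the point \<open>p\<close> (not at its coordinates)
  with respect to the coordinate frame of the chart \<open>c\<close>.
\<close>

type_synonym ('a, 'm) chart = "'a set \<times> ('a \<Rightarrow> real ^ 'm)"

record ('a, 'm::finite) riemannian_structure =
  atlas :: "('a, 'm) chart set"
  gram :: "('a, 'm) chart \<Rightarrow> 'a \<Rightarrow> real ^ 'm ^ 'm"

definition is_chart :: "('a::topological_space, 'm::finite) chart \<Rightarrow> bool" where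
  "is_chart c \<longleftrightarrow> open (fst c) \<and> open (snd c ` fst c) \<and>
     (\<exists>h. homeomorphism (fst c) (snd c ` fst c) (snd c) h)"

definition param :: "('a, 'm::finite) chart \<Rightarrow> real ^ 'm \<Rightarrow> 'a" where
  "param c = inv_into (fst c) (snd c)"

definition transition :: "('a, 'm::finite) chart \<Rightarrow> ('a, 'm) chart \<Rightarrow> real ^ 'm \<Rightarrow> real ^ 'm" where
  "transition c d = snd d \<circ> param c"

definition smooth_atlas :: "('a::topological_space, 'm::finite) chart set \<Rightarrow> bool" where
  "smooth_atlas \<A> \<longleftrightarrow>
     (\<forall>c\<in>\<A>. is_chart c) \<and> (\<Union>c\<in>\<A>. fst c) = UNIV \<and>
     (\<forall>c\<in>\<A>. \<forall>d\<in>\<A>. smooth_on (snd c ` (fst c \<inter> fst d)) (transition c d))"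

text \<open>
  The last clause is the transformation law \<open>G\<^sub>c = J\<^sup>T G\<^sub>d J\<close>, with \<open>J\<close> the Jacobian of the change
  of coordinates from \<open>c\<close> to \<open>d\<close>.
\<close>

definition riemannian_manifold ::
  "('a::topological_space, 'm::finite) riemannian_structure \<Rightarrow> bool" where
  "riemannian_manifold M \<longleftrightarrow>
     smooth_atlas (atlas M) \<and>
     (\<forall>c\<in>atlas M.
        smooth_on (snd c ` fst c) (\<lambda>x. gram M c (param c x)) \<and>
        (\<forall>p\<in>fst c. transpose (gram M c p) = gram M c p \<and>
           (\<forall>v. v \<noteq> 0 \<longrightarrow> v \<bullet> (gram M c p *v v) > 0))) \<and>
     (\<forall>c\<in>atlas M. \<forall>d\<in>atlas M. \<forall>p\<in>fst c \<inter> fst d.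
        let J = matrix (frechet_derivative (transition c d) (at (snd c p)))
        in gram M c p = transpose J ** gram M d p ** J)"

text \<open>
  Chart-independent quantities at a point are computed in an arbitrarily chosen chart around it.
\<close>

definition chart_at :: "('a, 'm::finite) riemannian_structure \<Rightarrow> 'a \<Rightarrow> ('a, 'm) chart" where
  "chart_at M p = (SOME c. c \<in> atlas M \<and> p \<in> fst c)"

text \<open>The inner product at \<open>p\<close> of the tangent vectors with components \<open>v\<close>, \<open>w\<close> in the chart \<open>c\<close>.\<close>

definition metric_in :: "('a, 'm::finite) riemannian_structure \<Rightarrow> ('a, 'm) chart \<Rightarrow> 'a \<Rightarrow>
    real ^ 'm \<Rightarrow> real ^ 'm \<Rightarrow> real" where
  "metric_in M c p v w = v \<bullet> (gram M c p *v w)"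

subsection \<open>Length, distance, completeness\<close>

text \<open>
  One-sided derivatives at the end points are included, so that the speed of a piecewise
  \<open>C\<^sup>1\<close> curve is bounded; the library's \<open>piecewise_C1_differentiable_on\<close> does not ensure this.
\<close>

definition C1_curve_on :: "('a::topological_space, 'm::finite) riemannian_structure \<Rightarrow>
    real \<Rightarrow> real \<Rightarrow> (real \<Rightarrow> 'a) \<Rightarrow> bool" where
  "C1_curve_on M a b \<gamma> \<longleftrightarrow> continuous_on {a..b} \<gamma> \<and>
     (\<forall>c\<in>atlas M. \<exists>v. continuous_on {t\<in>{a..b}. \<gamma> t \<in> fst c} v \<and>
        (\<forall>t\<in>{a..b}. \<gamma> t \<in> fst c \<longrightarrow>
           (snd c \<circ> \<gamma> has_vector_derivative v t) (at t within {a..b})))"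

definition piecewise_C1_curve :: "('a::topological_space, 'm::finite) riemannian_structure \<Rightarrow>
    (real \<Rightarrow> 'a) \<Rightarrow> bool" where
  "piecewise_C1_curve M \<gamma> \<longleftrightarrow>
     (\<exists>(n::nat) s. s 0 = 0 \<and> s n = 1 \<and>
        (\<forall>i<n. s i < s (Suc i) \<and> C1_curve_on M (s i) (s (Suc i)) \<gamma>))"

definition speed :: "('a, 'm::finite) riemannian_structure \<Rightarrow> (real \<Rightarrow> 'a) \<Rightarrow> real \<Rightarrow> real" where
  "speed M \<gamma> t =
     (let c = chart_at M (\<gamma> t); v = vector_derivative (snd c \<circ> \<gamma>) (at t)
      in sqrt (metric_in M c (\<gamma> t) v v))"

definition curve_length :: "('a, 'm::finite) riemannian_structure \<Rightarrow> (real \<Rightarrow> 'a) \<Rightarrow> real" where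
  "curve_length M \<gamma> = integral {0..1} (speed M \<gamma>)"

definition rdist :: "('a::topological_space, 'm::finite) riemannian_structure \<Rightarrow>
    'a \<Rightarrow> 'a \<Rightarrow> real" where
  "rdist M x y = Inf {curve_length M \<gamma> | \<gamma>. piecewise_C1_curve M \<gamma> \<and> \<gamma> 0 = x \<and> \<gamma> 1 = y}"

definition geodesic_ball :: "('a::topological_space, 'm::finite) riemannian_structure \<Rightarrow>
    'a \<Rightarrow> real \<Rightarrow> 'a set" where
  "geodesic_ball M x R = {y. rdist M x y < R}"

definition complete_manifold :: "('a::topological_space, 'm::finite) riemannian_structure \<Rightarrow> bool"
  where "complete_manifold M \<longleftrightarrow> Metric_space.mcomplete UNIV (rdist M)"

subsection \<open>Functions on the manifold and their gradients\<close>

definition Ck_function :: "('a, 'm::finite) riemannian_structure \<Rightarrow> nat \<Rightarrow> ('a \<Rightarrow> real) \<Rightarrow> bool"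
  where "Ck_function M k f \<longleftrightarrow> (\<forall>c\<in>atlas M. Ck_on k (snd c ` fst c) (f \<circ> param c))"

definition smooth_function :: "('a, 'm::finite) riemannian_structure \<Rightarrow> ('a \<Rightarrow> real) \<Rightarrow> bool"
  where "smooth_function M f \<longleftrightarrow> (\<forall>k. Ck_function M k f)"

text \<open>Components \<open>g\<^sup>i\<^sup>j \<partial>\<^sub>j f\<close> of the gradient of \<open>f\<close> in the chart \<open>c\<close>.\<close>

definition grad_in :: "('a, 'm::finite) riemannian_structure \<Rightarrow> ('a, 'm) chart \<Rightarrow>
    ('a \<Rightarrow> real) \<Rightarrow> 'a \<Rightarrow> real ^ 'm" where
  "grad_in M c f p = matrix_inv (gram M c p) *v
     (\<chi> j. frechet_derivative (f \<circ> param c) (at (snd c p)) (axis j 1))"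

definition grad_inner :: "('a, 'm::finite) riemannian_structure \<Rightarrow>
    ('a \<Rightarrow> real) \<Rightarrow> ('a \<Rightarrow> real) \<Rightarrow> 'a \<Rightarrow> real" where
  "grad_inner M f h p =
     (let c = chart_at M p in metric_in M c p (grad_in M c f p) (grad_in M c h p))"

definition grad_norm :: "('a, 'm::finite) riemannian_structure \<Rightarrow> ('a \<Rightarrow> real) \<Rightarrow> 'a \<Rightarrow> real" where
  "grad_norm M f p = sqrt (grad_inner M f f p)"

subsection \<open>Riemannian volume\<close>

text \<open>
  The Riemannian volume is the unique Borel measure that in each chart has density
  \<open>sqrt (det (g\<^sub>i\<^sub>j))\<close> with respect to Lebesgue measure.
\<close>

definition riemannian_volume :: "('a::topological_space, 'm::finite) riemannian_structure \<Rightarrow>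
    'a measure" where
  "riemannian_volume M = (THE \<nu>. sets \<nu> = sets borel \<and>
     (\<forall>c\<in>atlas M. \<forall>A\<in>sets borel. A \<subseteq> fst c \<longrightarrow>
        emeasure \<nu> A =
          (\<integral>\<^sup>+x\<in>snd c ` A. ennreal (sqrt (det (gram M c (param c x)))) \<partial>lborel)))"

definition weighted_vol :: "('a::topological_space, 'm::finite) riemannian_structure \<Rightarrow>
    ('a \<Rightarrow> real) \<Rightarrow> 'a set \<Rightarrow> real" where
  "weighted_vol M D \<Omega> = (LINT x:\<Omega>|riemannian_volume M. D x)"

subsection \<open>The differential inequality and the constant\<close>

text \<open>
  Real powers of a non-negative base with \<open>t\<^sup>0 = 1\<close> also for \<open>t = 0\<close>, whereas \<open>0 powr 0 = 0\<close>.
\<close>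

definition rpow :: "real \<Rightarrow> real \<Rightarrow> real" where
  "rpow t a = (if a = 0 then 1 else t powr a)"

definition test_function :: "('a::topological_space, 'm::finite) riemannian_structure \<Rightarrow>
    'a set \<Rightarrow> ('a \<Rightarrow> real) \<Rightarrow> bool" where
  "test_function M \<Omega> \<psi> \<longleftrightarrow> smooth_function M \<psi> \<and>
     compact (closure {x. \<psi> x \<noteq> 0}) \<and> closure {x. \<psi> x \<noteq> 0} \<subseteq> \<Omega>"

text \<open>
  Weak form on \<open>\<Omega>\<close> of
  \<open>div (D |\<nabla>u|\<^sup>-\<^sup>1 \<phi>(|\<nabla>u|) \<nabla>u) \<ge> K (1 + r)\<^sup>-\<^sup>\<mu> |\<nabla>u|\<^sup>\<chi> D\<close>, \<open>r\<close> being the distance from \<open>org\<close>.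
  The exponent \<open>\<chi>\<close> is called \<open>chi\<close>, the symbol being taken by the vector binder.
  Since \<open>inverse 0 = 0\<close>, the vector field vanishes where \<open>\<nabla>u = 0\<close>.
\<close>

definition weak_inequality :: "('a::topological_space, 'm::finite) riemannian_structure \<Rightarrow>
    'a \<Rightarrow> ('a \<Rightarrow> real) \<Rightarrow> (real \<Rightarrow> real) \<Rightarrow> real \<Rightarrow> real \<Rightarrow> real \<Rightarrow> ('a \<Rightarrow> real) \<Rightarrow> 'a set \<Rightarrow> bool" where
  "weak_inequality M org D \<phi> K \<mu> chi u \<Omega> \<longleftrightarrow>
     (\<forall>\<psi>. test_function M \<Omega> \<psi> \<and> (\<forall>x. 0 \<le> \<psi> x) \<longrightarrow>
        - (LINT x:\<Omega>|riemannian_volume M.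
             inverse (grad_norm M u x) * \<phi> (grad_norm M u x) * grad_inner M u \<psi> x * D x)
        \<ge> K * (LINT x:\<Omega>|riemannian_volume M.
             (1 + rdist M org x) powr (- \<mu>) * rpow (grad_norm M u x) chi * \<psi> x * D x))"

definition bound_const :: "real \<Rightarrow> real \<Rightarrow> real \<Rightarrow> real \<Rightarrow> real \<Rightarrow> real \<Rightarrow> real" where
  "bound_const A \<delta> chi \<sigma> \<eta> d\<^sub>0 =
     (if \<sigma> - \<eta> > 0 then
        (if \<sigma> = 0 then 0
         else if \<eta> < 0 then A * d\<^sub>0 * (\<sigma> - \<eta>) powr (1 + \<delta> - chi)
         else A * d\<^sub>0 * \<sigma> powr (\<delta> - chi) * (\<sigma> - \<eta>))
      else
        (if \<sigma> = 0 \<or> \<delta> * (\<sigma> - 1) + d\<^sub>0 - 1 \<le> 0 then 0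
         else A * \<sigma> powr (\<delta> - chi) * (\<delta> * (\<sigma> - 1) + d\<^sub>0 - 1)))"

end

theory Submission
  imports Defs "HOL-Real_Asymp.Real_Asymp"
begin

text \<open>
  The bound is obtained by testing the inequality with a function that decays so fast at infinity
  that the volume growth is outweighed. Write \<open>r\<close> for the distance from the origin, \<open>\<rho>\<close> for a function
  of class \<open>C\<^sup>1\<close> slightly above \<open>r\<close> with gradient of length at most \<open>1 + e\<close>, \<open>X = 1 + \<rho>\<close>, and let \<open>H\<close> be
  a primitive of \<open>X\<^sup>\<sigma>\<^sup>-\<^sup>\<eta>\<^sup>-\<^sup>1\<close>. Suppose that \<open>0 \<le> u - c \<le> b X\<^sup>\<sigma>\<close> on \<open>{u > \<gamma>'}\<close>. The test function is
  \<open>\<psi> = \<zeta>\<^sup>N \<lambda>(u) E\<close>, where \<open>\<zeta>\<close> is a radial cut-off between \<open>\<theta> R\<close> and \<open>R\<close>, \<open>\<lambda>\<close> is an increasing function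
  vanishing on \<open>(-\<infinity>, \<gamma>']\<close>, and \<open>E = exp (q (u - c) X\<^sup>-\<^sup>\<eta> - q b X\<^sup>\<sigma>\<^sup>-\<^sup>\<eta> - \<beta> H(X))\<close>; the bound on \<open>u\<close> gives
  \<open>E \<le> exp (- \<beta> H(X))\<close>.

  Let \<open>s = |\<nabla>u|\<close> and \<open>t = s X\<^sup>1\<^sup>-\<^sup>\<sigma>\<close>. Differentiating \<open>E\<close> in the direction of \<open>\<nabla>u\<close> produces a gain
  proportional to \<open>q t\<close>, differentiating it radially a loss of at most \<open>q S + \<beta>\<close> with
  \<open>S = b max \<sigma> (\<sigma> - \<eta>)\<close> (\<open>radial_coefficient_bound\<close>), and the source term, by \<open>\<phi> \<le> A s\<^sup>\<delta>\<close>, is worth at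
  least \<open>(K / A) t\<^sup>-\<^sup>a\<close> with \<open>a = \<delta> - \<chi>\<close>; all of them in units of \<open>\<phi>(s) X\<^sup>\<sigma>\<^sup>-\<^sup>\<eta>\<^sup>-\<^sup>1\<close>, by the
  definition of \<open>\<eta>\<close> (\<open>main_term_bound\<close>). For the optimal \<open>q\<close> the convex function \<open>q t + (K / A) t\<^sup>-\<^sup>a\<close> has
  its minimum at \<open>t = S\<close> (\<open>parameter_choice\<close>), so that the gain wins pointwise if \<open>K > A \<beta> S\<^sup>a\<close>. What
  remains is the error of the cut-off, which is at most
  \<open>vol\<^sub>D(B\<^sub>R) R\<^sup>-\<^sup>1\<^sup>-\<^sup>\<delta> (1 + R)\<^bsup>max (\<eta> \<delta>) 0\<^esup> exp (- \<beta> H(1 + \<theta> R))\<close> up to a constant (\<open>estimate\<close>). If \<open>\<beta>\<close> is such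
  that this tends to \<open>0\<close> along a sequence of radii, the weak inequality fails, since the gradient
  does not vanish identically on \<open>{u > \<gamma>'}\<close> (\<open>ex_grad_nonzero\<close>). Hence \<open>K \<le> A \<beta> S\<^sup>a\<close>
  (\<open>bound_by_rate\<close>).

  By the assumption on the volume, every \<open>\<beta> > d\<^sub>0 (\<sigma> - \<eta>)\<close> is admissible if \<open>\<sigma> > \<eta>\<close>, and every positive
  \<open>\<beta> > \<delta> (\<sigma> - 1) + d\<^sub>0 - 1\<close> if \<open>\<sigma> = \<eta>\<close>. If \<open>u\<close> is unbounded above, one may take \<open>c = 0\<close>, any \<open>b\<close> above the
  positive part of the limit superior, and \<open>\<gamma>'\<close> large, and the claim follows in the limit. If \<open>u\<close> is
  bounded above, the choice \<open>c = \<gamma>'\<close> close to the supremum makes \<open>b\<close> arbitrarily small, so \<open>K \<le> 0\<close>.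

  Four facts of Riemannian geometry are used on the way. The Riemannian volume exists
  (\<open>is_volume_unique_exists\<close>), by the change of variables formula. Closed balls are compact
  (\<open>compact_rdist_cball\<close>, the Hopf-Rinow theorem), so that \<open>\<psi>\<close> has compact support. The weak inequality
  extends to test functions of class \<open>C\<^sup>1\<close> (\<open>weak_form_C1\<close>), and the distance is approximated by functions
  of class \<open>C\<^sup>1\<close> with almost the same Lipschitz constant (\<open>smooth_rdist\<close>); both follow by mollification in
  charts.
\<close>

section \<open>Calculus of functions of class \<open>C\<^sup>k\<close>\<close>

lemma Ck_on_cong:
  assumes "open S" "\<And>x. x \<in> S \<Longrightarrow> f x = g x" "Ck_on k S f"
  shows "Ck_on k S g"
  using assms(2,3)
proof (induction k arbitrary: f g)
  case 0
  then show ?case by (auto intro: continuous_on_eq)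
next
  case (Suc k)
  have d: "frechet_derivative f (at x) = frechet_derivative g (at x)" "g differentiable (at x)" if x: "x \<in> S" for x
  proof -
    have "f differentiable (at x)"
      using Suc.prems(2) x assms(1) differentiable_on_eq_differentiable_at[of S f] by simp
    then have f: "(f has_derivative frechet_derivative f (at x)) (at x)"
      by (simp add: frechet_derivative_works)
    have g: "(g has_derivative frechet_derivative f (at x)) (at x)"
      by (rule has_derivative_transform_within_open[OF f assms(1) x]) (use Suc.prems in auto)
    show "frechet_derivative f (at x) = frechet_derivative g (at x)" using frechet_derivative_at[OF g] .
    show "g differentiable (at x)" using g by (auto simp: differentiable_def)
  qed
  have "Ck_on k S (\<lambda>x. frechet_derivative g (at x) i)" if "i \<in> Basis" for i
    by (rule Suc.IH[of "\<lambda>x. frechet_derivative f (at x) i"]) (use Suc.prems d that in auto)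
  moreover have "g differentiable_on S" using d by (auto simp: differentiable_on_def intro: differentiable_at_withinI)
  ultimately show ?case by simp
qed

text \<open>The derivative may be supplied as any family of maps \<open>f'\<close>. This is what makes the closure
  properties below provable by induction: the derivative of a sum, product or composite is given by
  a formula, and the induction hypothesis applies to that formula.\<close>

lemma Ck_on_Suc_iff:
  assumes "open S"
  shows "Ck_on (Suc k) S f \<longleftrightarrow> (\<exists>f'. (\<forall>x\<in>S. (f has_derivative f' x) (at x)) \<and>
     (\<forall>i\<in>Basis. Ck_on k S (\<lambda>x. f' x i)))" (is "?l \<longleftrightarrow> ?r")
proof
  assume ?l
  then have "\<forall>x\<in>S. (f has_derivative frechet_derivative f (at x)) (at x)"
    using assms differentiable_on_eq_differentiable_at[of S f] by (simp add: frechet_derivative_works)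
  then show ?r using \<open>?l\<close> by auto
next
  assume ?r
  then obtain f' where f': "\<And>x. x\<in>S \<Longrightarrow> (f has_derivative f' x) (at x)"
    "\<And>i. i\<in>Basis \<Longrightarrow> Ck_on k S (\<lambda>x. f' x i)" by blast
  have "f differentiable_on S"
    using f'(1) has_derivative_at_withinI unfolding differentiable_on_def differentiable_def by blast
  moreover have "Ck_on k S (\<lambda>x. frechet_derivative f (at x) i)" if "i \<in> Basis" for i
    by (rule Ck_on_cong[OF assms _ f'(2)[OF that]]) (use f' frechet_derivative_at in metis)
  ultimately show ?l by simp
qed

lemma Ck_on_SucI:
  assumes "open S" "\<And>x. x \<in> S \<Longrightarrow> (f has_derivative f' x) (at x)"
    "\<And>i. i \<in> Basis \<Longrightarrow> Ck_on k S (\<lambda>x. f' x i)"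
  shows "Ck_on (Suc k) S f"
  using assms by (subst Ck_on_Suc_iff) blast+

lemma Ck_on_SucE:
  assumes "open S" "Ck_on (Suc k) S f"
  obtains f' where "\<And>x. x \<in> S \<Longrightarrow> (f has_derivative f' x) (at x)"
    "\<And>i. i \<in> Basis \<Longrightarrow> Ck_on k S (\<lambda>x. f' x i)"
proof -
  obtain f' where "(\<forall>x\<in>S. (f has_derivative f' x) (at x)) \<and> (\<forall>i\<in>Basis. Ck_on k S (\<lambda>x. f' x i))"
    using iffD1[OF Ck_on_Suc_iff[OF assms(1)] assms(2)] by (elim exE)
  then show ?thesis using that[of f'] by simp
qed

lemma Ck_on_subset: "Ck_on k S f \<Longrightarrow> T \<subseteq> S \<Longrightarrow> Ck_on k T f"
proof (induction k arbitrary: f)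
  case 0 then show ?case using continuous_on_subset by auto
next
  case (Suc k) then show ?case using differentiable_on_subset by auto
qed

lemma Ck_on_SucD: "Ck_on (Suc k) S f \<Longrightarrow> Ck_on k S f"
proof (induction k arbitrary: f)
  case 0 then show ?case by (simp add: differentiable_imp_continuous_on)
next
  case (Suc k)
  then show ?case by (metis Ck_on.simps(2))
qed

lemma Ck_on_local:
  assumes "\<And>x. x \<in> S \<Longrightarrow> \<exists>U. open U \<and> x \<in> U \<and> Ck_on k U f"
  shows "Ck_on k S f"
  using assms
proof (induction k arbitrary: f)
  case 0
  have "\<exists>U. open U \<and> x \<in> U \<and> continuous_on U f" if "x \<in> S" for x using 0[OF that] by simp
  then show ?case
    by (simp, metis continuous_at_imp_continuous_on continuous_on_eq_continuous_at)
next
  case (Suc k)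
  have "f differentiable (at x)" if "x \<in> S" for x
    using Suc.prems[OF that] by (auto simp: differentiable_on_def) (metis at_within_open)
  moreover have "Ck_on k S (\<lambda>x. frechet_derivative f (at x) i)" if "i \<in> Basis" for i
    by (rule Suc.IH) (use Suc.prems that in \<open>metis Ck_on.simps(2)\<close>)
  ultimately show ?case by (auto simp: differentiable_on_def intro: differentiable_at_withinI)
qed

lemma Ck_on_const: "Ck_on k S (\<lambda>x. c)"
proof (induction k arbitrary: c)
  case (Suc k) then show ?case by (auto simp: frechet_derivative_const)
qed auto

lemma Ck_on_bounded_linear: "bounded_linear L \<Longrightarrow> open S \<Longrightarrow> Ck_on k S L"
proof (cases k)
  case (Suc n)
  assume "bounded_linear L" "open S"
  then show ?thesis unfolding Suc
    by (intro Ck_on_SucI[where f' = "\<lambda>x. L"] Ck_on_const)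
       (auto simp: bounded_linear_imp_has_derivative)
qed (auto simp: linear_continuous_on)

lemma Ck_on_bounded_linear_comp:
  assumes L: "bounded_linear L" and S: "open S"
  shows "Ck_on k S f \<Longrightarrow> Ck_on k S (\<lambda>x. L (f x))"
proof (induction k arbitrary: f)
  case 0 then show ?case using L by (simp add: bounded_linear.continuous_on)
next
  case (Suc k)
  obtain f' where f': "\<And>x. x \<in> S \<Longrightarrow> (f has_derivative f' x) (at x)"
    "\<And>i. i \<in> Basis \<Longrightarrow> Ck_on k S (\<lambda>x. f' x i)" by (rule Ck_on_SucE[OF S Suc.prems]) blast
  show ?case
    by (rule Ck_on_SucI[OF S, where f' = "\<lambda>x v. L (f' x v)"])
       (use f' Suc.IH in \<open>auto intro: bounded_linear.has_derivative[OF L]\<close>)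
qed

lemma Ck_on_add:
  assumes S: "open S"
  shows "Ck_on k S f \<Longrightarrow> Ck_on k S g \<Longrightarrow> Ck_on k S (\<lambda>x. f x + g x)"
proof (induction k arbitrary: f g)
  case 0 then show ?case by (simp add: continuous_on_add)
next
  case (Suc k)
  obtain f' where f': "\<And>x. x \<in> S \<Longrightarrow> (f has_derivative f' x) (at x)"
    "\<And>i. i \<in> Basis \<Longrightarrow> Ck_on k S (\<lambda>x. f' x i)" by (rule Ck_on_SucE[OF S Suc.prems(1)]) blast
  obtain g' where g': "\<And>x. x \<in> S \<Longrightarrow> (g has_derivative g' x) (at x)"
    "\<And>i. i \<in> Basis \<Longrightarrow> Ck_on k S (\<lambda>x. g' x i)" by (rule Ck_on_SucE[OF S Suc.prems(2)]) blast
  show ?case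
    by (rule Ck_on_SucI[OF S, where f' = "\<lambda>x v. f' x v + g' x v"])
       (use f' g' Suc.IH has_derivative_add in auto)
qed

lemma Ck_on_sum:
  assumes "open S" "\<And>i. i \<in> I \<Longrightarrow> Ck_on k S (f i)"
  shows "Ck_on k S (\<lambda>x. \<Sum>i\<in>I. f i x)"
  using assms(2)
  by (induction I rule: infinite_finite_induct) (auto intro: Ck_on_const Ck_on_add[OF assms(1)])

lemma Ck_on_bilinear:
  assumes B: "bounded_bilinear B" and S: "open S"
  shows "Ck_on k S f \<Longrightarrow> Ck_on k S g \<Longrightarrow> Ck_on k S (\<lambda>x. B (f x) (g x))"
proof (induction k arbitrary: f g)
  case 0 then show ?case using bounded_bilinear.continuous_on[OF B] by auto
next
  case (Suc k)
  obtain f' where f': "\<And>x. x \<in> S \<Longrightarrow> (f has_derivative f' x) (at x)"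
    "\<And>i. i \<in> Basis \<Longrightarrow> Ck_on k S (\<lambda>x. f' x i)" by (rule Ck_on_SucE[OF S Suc.prems(1)]) blast
  obtain g' where g': "\<And>x. x \<in> S \<Longrightarrow> (g has_derivative g' x) (at x)"
    "\<And>i. i \<in> Basis \<Longrightarrow> Ck_on k S (\<lambda>x. g' x i)" by (rule Ck_on_SucE[OF S Suc.prems(2)]) blast
  show ?case
  proof (rule Ck_on_SucI[OF S, where f' = "\<lambda>x v. B (f x) (g' x v) + B (f' x v) (g x)"])
    show "((\<lambda>x. B (f x) (g x)) has_derivative (\<lambda>v. B (f x) (g' x v) + B (f' x v) (g x))) (at x)"
      if "x \<in> S" for x using bounded_bilinear.FDERIV[OF B f'(1)[OF that] g'(1)[OF that]] .
    show "Ck_on k S (\<lambda>x. B (f x) (g' x i) + B (f' x i) (g x))" if "i \<in> Basis" for i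
      using Suc.IH Ck_on_SucD[OF Suc.prems(1)] Ck_on_SucD[OF Suc.prems(2)] f'(2) g'(2) that
      by (intro Ck_on_add[OF S]) blast+
  qed
qed

text \<open>The partial derivatives of \<open>f \<circ> g\<close> are sums of products of partial derivatives of \<open>g\<close> with
  partial derivatives of \<open>f\<close> composed with \<open>g\<close>, and the latter are covered by the induction hypothesis.\<close>

lemma Ck_on_compose:
  fixes g :: "'a::euclidean_space \<Rightarrow> 'b::euclidean_space"
  assumes S: "open S" and T: "open T" and gST: "\<And>x. x \<in> S \<Longrightarrow> g x \<in> T"
  shows "Ck_on k T f \<Longrightarrow> Ck_on k S g \<Longrightarrow> Ck_on k S (\<lambda>x. f (g x))"
proof (induction k arbitrary: f)
  case 0 then show ?case
    using gST by (auto intro!: continuous_on_compose2[of T f S g])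
next
  case (Suc k)
  obtain f' where f': "\<And>x. x \<in> T \<Longrightarrow> (f has_derivative f' x) (at x)"
    "\<And>i. i \<in> Basis \<Longrightarrow> Ck_on k T (\<lambda>x. f' x i)" by (rule Ck_on_SucE[OF T Suc.prems(1)]) blast
  obtain g' where g': "\<And>x. x \<in> S \<Longrightarrow> (g has_derivative g' x) (at x)"
    "\<And>i. i \<in> Basis \<Longrightarrow> Ck_on k S (\<lambda>x. g' x i)" by (rule Ck_on_SucE[OF S Suc.prems(2)]) blast
  show ?case
  proof (rule Ck_on_SucI[OF S, where f' = "\<lambda>x v. f' (g x) (g' x v)"])
    show "((\<lambda>x. f (g x)) has_derivative (\<lambda>v. f' (g x) (g' x v))) (at x)" if "x \<in> S" for x
      using has_derivative_compose[OF g'(1)[OF that] f'(1)[OF gST[OF that]]] .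
    fix i :: 'a assume i: "i \<in> Basis"
    have *: "(\<Sum>b\<in>Basis. (g' x i \<bullet> b) *\<^sub>R f' (g x) b) = f' (g x) (g' x i)" if "x \<in> S" for x
    proof -
      have "linear (f' (g x))" using f'(1)[OF gST[OF that]] has_derivative_linear by blast
      have "f' (g x) (g' x i) = f' (g x) (\<Sum>b\<in>Basis. (g' x i \<bullet> b) *\<^sub>R b)"
        by (simp add: euclidean_representation)
      also have "\<dots> = (\<Sum>b\<in>Basis. (g' x i \<bullet> b) *\<^sub>R f' (g x) b)"
        using \<open>linear (f' (g x))\<close> by (simp add: linear_sum linear_scale)
      finally show ?thesis by simp
    qed
    have "Ck_on k S (\<lambda>x. \<Sum>b\<in>Basis. (g' x i \<bullet> b) *\<^sub>R f' (g x) b)"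
      using Suc.IH[OF f'(2) Ck_on_SucD[OF Suc.prems(2)]] g'(2)[OF i]
      by (intro Ck_on_sum[OF S] Ck_on_bilinear[OF bounded_bilinear_scaleR S]
          Ck_on_bounded_linear_comp[OF bounded_linear_inner_left S]) blast+
    then show "Ck_on k S (\<lambda>x. f' (g x) (g' x i))"
      by (rule Ck_on_cong[OF S, rotated]) (use * in auto)
  qed
qed

section \<open>Functions vanishing to infinite order\<close>

text \<open>The functions \<open>exp (- 1 / t) / t\<^sup>k\<close>, extended by zero to \<open>t \<le> 0\<close>. The derivative of each of them is
  a linear combination of two others, which gives smoothness by induction.\<close>

primrec flat_exp :: "nat \<Rightarrow> real \<Rightarrow> real" where
  "flat_exp 0 t = (if t \<le> 0 then 0 else exp (- inverse t))"
| "flat_exp (Suc k) t = flat_exp k t / t"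

lemma flat_exp_eq: "flat_exp k t = (if t \<le> 0 then 0 else exp (- inverse t) / t ^ k)"
  by (induction k) auto

lemma flat_exp_deriv:
  "(flat_exp k has_real_derivative (flat_exp (k+2) t - real k * flat_exp (k+1) t)) (at t)"
proof -
  consider "t < 0" | "t > 0" | "t = 0" by linarith
  then show ?thesis
  proof cases
    case 1
    have "((\<lambda>_. 0) has_real_derivative 0) (at t)" by simp
    then have "(flat_exp k has_real_derivative 0) (at t)"
      by (rule has_field_derivative_transform_within_open[of _ _ _ "{..<0}"]) (use 1 in \<open>auto simp: flat_exp_eq\<close>)
    then show ?thesis using 1 by (simp add: flat_exp_eq)
  next
    case 2
    have "((\<lambda>t. exp (- inverse t) / t ^ k) has_real_derivative
        (exp (- inverse t) / t^(k+2) - real k * (exp (- inverse t) / t^(k+1)))) (at t)"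
    proof -
      have "((\<lambda>t. exp (- inverse t) * inverse t ^ k) has_real_derivative
          exp (- inverse t) * (inverse t)\<^sup>2 * inverse t ^ k
          + exp (- inverse t) * (real k * inverse t ^ (k - 1) * (- (inverse t)\<^sup>2))) (at t)"
        using 2 by (auto intro!: derivative_eq_intros simp: power2_eq_square)
      moreover have "real k * inverse t ^ (k - 1) * (- (inverse t)\<^sup>2) = - real k * inverse t ^ (k + 1)"
        by (cases k) (auto simp: power2_eq_square algebra_simps)
      then have "exp (- inverse t) * (inverse t)\<^sup>2 * inverse t ^ k
          + exp (- inverse t) * (real k * inverse t ^ (k - 1) * (- (inverse t)\<^sup>2))
        = exp (- inverse t) / t^(k+2) - real k * (exp (- inverse t) / t^(k+1))"
        by (simp only:) (simp add: divide_inverse power_inverse power2_eq_square algebra_simps)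
      moreover have "(\<lambda>t::real. exp (- inverse t) * inverse t ^ k) = (\<lambda>t. exp (- inverse t) / t ^ k)"
        by (rule ext) (simp add: field_simps)
      ultimately show ?thesis by simp
    qed
    then have "(flat_exp k has_real_derivative
        (exp (- inverse t) / t^(k+2) - real k * (exp (- inverse t) / t^(k+1)))) (at t)"
      by (rule has_field_derivative_transform_within_open[of _ _ _ "{0<..}"]) (use 2 in \<open>auto simp: flat_exp_eq\<close>)
    then show ?thesis using 2 by (simp add: flat_exp_eq)
  next
    case 3
    (* At the origin the difference quotients tend to 0 since the exponential beats every power. *)
    have "((\<lambda>x::real. x ^ (k+1) / exp x) \<longlongrightarrow> 0) at_top" by (rule tendsto_power_div_exp_0)
    then have "((\<lambda>y. inverse y ^ (k+1) / exp (inverse y)) \<longlongrightarrow> 0) (at_right (0::real))"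
      by (rule filterlim_compose[OF _ filterlim_inverse_at_top_right])
    moreover have "eventually (\<lambda>y. inverse y ^ (k+1) / exp (inverse y) = (flat_exp k y - flat_exp k 0) / (y - 0)) (at_right (0::real))"
      by (rule eventually_at_rightI[of 0 1]) (auto simp: flat_exp_eq field_simps exp_minus)
    ultimately have r: "((\<lambda>y. (flat_exp k y - flat_exp k 0) / (y - 0)) \<longlongrightarrow> 0) (at_right (0::real))"
      by (rule Lim_transform_eventually)
    have "eventually (\<lambda>y. 0 = (flat_exp k y - flat_exp k 0) / (y - 0)) (at_left (0::real))"
      by (rule eventually_at_leftI[of "-1" 0]) (auto simp: flat_exp_eq)
    then have l: "((\<lambda>y. (flat_exp k y - flat_exp k 0) / (y - 0)) \<longlongrightarrow> 0) (at_left (0::real))"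
      by (rule Lim_transform_eventually[rotated]) auto
    have "((\<lambda>y. (flat_exp k y - flat_exp k 0) / (y - 0)) \<longlongrightarrow> 0) (at 0)"
      using l r by (simp add: filterlim_at_split)
    then have "(flat_exp k has_real_derivative 0) (at 0)" by (simp add: has_field_derivative_iff)
    then show ?thesis using 3 by (simp add: flat_exp_eq)
  qed
qed

lemma Ck_on_flat_exp: "Ck_on k UNIV (flat_exp n)"
proof (induction k arbitrary: n)
  case 0
  show ?case using flat_exp_deriv by (simp, meson DERIV_continuous continuous_at_imp_continuous_on)
next
  case (Suc k)
  show ?case
  proof (rule Ck_on_SucI[where f' = "\<lambda>t v. (flat_exp (n+2) t - real n * flat_exp (n+1) t) * v"])
    show "(flat_exp n has_derivative (\<lambda>v. (flat_exp (n+2) t - real n * flat_exp (n+1) t) * v)) (at t)" for t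
      using flat_exp_deriv[of n t] by (simp only: has_field_derivative_def)
    have "Ck_on k UNIV (\<lambda>t. flat_exp (n+2) t + (- real n) *\<^sub>R flat_exp (n+1) t)"
      by (intro Ck_on_add Ck_on_bounded_linear_comp[OF bounded_linear_scaleR_right] Suc.IH) auto
    then show "Ck_on k UNIV (\<lambda>t. (flat_exp (n+2) t - real n * flat_exp (n+1) t) * i)"
      if "i \<in> Basis" for i using that by simp
  qed auto
qed

lemma Ck_on_imp_continuous_on: "Ck_on k S f \<Longrightarrow> continuous_on S f"
  by (induction k) (simp, metis Ck_on_SucD)

section \<open>Mollification\<close>

definition conv :: "('a::euclidean_space \<Rightarrow> real) \<Rightarrow> ('a \<Rightarrow> real) \<Rightarrow> 'a \<Rightarrow> real" where
  "conv g h x = (LINT y|lborel. g (x - y) * h y)"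

text \<open>On points near a given one the convolution is an integral over one fixed box, so that the results
  on integrals depending on a parameter apply.\<close>

lemma conv_cbox:
  fixes h :: "'a::euclidean_space \<Rightarrow> real"
  assumes g: "continuous_on UNIV g" "\<And>x. norm x > d \<Longrightarrow> g x = 0" and h: "continuous_on UNIV h"
    and c: "cball x d \<subseteq> cbox a b"
  shows "conv g h x = integral (cbox a b) (\<lambda>y. g (x - y) * h y)"
    "integrable lborel (\<lambda>y. g (x - y) * h y)"
proof -
  have cont: "continuous_on S (\<lambda>y. g (x - y) * h y)" for S
    by (intro continuous_intros continuous_on_compose2[OF g(1)] continuous_on_subset[OF h]) auto
  have eq: "indicator (cbox a b) y *\<^sub>R (g (x - y) * h y) = g (x - y) * h y" for y
  proof (cases "y \<in> cbox a b")
    case False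
    then have "y \<notin> cball x d" using c by blast
    then have "g (x - y) = 0" using g(2)[of "x - y"] by (simp add: dist_norm)
    then show ?thesis by simp
  qed auto
  have i: "integrable lborel (\<lambda>y. indicator (cbox a b) y *\<^sub>R (g (x - y) * h y))"
    by (rule borel_integrable_compact[OF compact_cbox cont])
  then show "integrable lborel (\<lambda>y. g (x - y) * h y)" unfolding eq .
  have "set_integrable lborel (cbox a b) (\<lambda>y. g (x - y) * h y)"
    using i by (simp add: set_integrable_def)
  from set_borel_integral_eq_integral(2)[OF this]
  show "conv g h x = integral (cbox a b) (\<lambda>y. g (x - y) * h y)"
    unfolding conv_def set_lebesgue_integral_def eq .
qed

lemma conv_reflect:
  fixes h :: "'a::euclidean_space \<Rightarrow> real"
  assumes g: "continuous_on UNIV g" and h: "continuous_on UNIV h"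
  shows "conv g h x = (LINT z|lborel. g z * h (x - z))"
proof -
  have e: "lborel = density (distr lborel borel (\<lambda>z::'a. x + (\<Sum>j\<in>Basis. (- 1 * (z \<bullet> j)) *\<^sub>R j))) (\<lambda>_. (\<Prod>j\<in>(Basis::'a set). \<bar>- 1 :: real\<bar>))"
    by (rule lborel_affine_euclidean) auto
  have T: "(\<lambda>z::'a. x + (\<Sum>j\<in>Basis. (- 1 * (z \<bullet> j)) *\<^sub>R j)) = (\<lambda>z. x - z)"
    by (auto simp: sum_negf euclidean_representation)
  have l: "lborel = distr lborel borel (\<lambda>z::'a. x - z)"
    using e unfolding T by (simp add: density_1)
  have m: "g \<in> borel_measurable borel" "h \<in> borel_measurable borel"
    using g h by (auto intro: borel_measurable_continuous_onI)
  have "conv g h x = (LINT y|distr lborel borel (\<lambda>z::'a. x - z). g (x - y) * h y)"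
    unfolding conv_def using l by simp
  also have "\<dots> = (LINT z|lborel. g (x - (x - z)) * h (x - z))"
    using m by (subst integral_distr) auto
  finally show ?thesis by simp
qed

text \<open>All derivatives fall on the kernel \<open>g\<close>; the function \<open>h\<close> need only be continuous.\<close>

lemma Ck_on_conv:
  fixes h :: "'a::euclidean_space \<Rightarrow> real"
  assumes h: "continuous_on UNIV h"
  shows "Ck_on k UNIV g \<Longrightarrow> (\<And>x. norm x > d \<Longrightarrow> g x = 0) \<Longrightarrow> Ck_on k UNIV (conv g h)"
proof (induction k arbitrary: g)
  case 0
  then have g: "continuous_on UNIV g" by simp
  have "isCont (conv g h) x0" for x0
  proof -
    obtain a where a: "cball x0 (1 + d) \<subseteq> cbox (- a) a"
      using bounded_subset_cbox_symmetric[OF bounded_cball] by blast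
    have "continuous_on (ball x0 1) (\<lambda>x. integral (cbox (- a) a) (\<lambda>y. g (x - y) * h y))"
      by (rule integral_continuous_on_param)
         (auto simp: split_beta intro!: continuous_intros continuous_on_compose2[OF g] continuous_on_compose2[OF h])
    moreover have "integral (cbox (- a) a) (\<lambda>y. g (x - y) * h y) = conv g h x" if "x \<in> ball x0 1" for x
    proof -
      have "cball x d \<subseteq> cbox (- a) a"
      proof
        fix y assume "y \<in> cball x d"
        then have "dist x0 y \<le> 1 + d" using that dist_triangle[of x0 y x] by auto
        then show "y \<in> cbox (- a) a" using a by auto
      qed
      from conv_cbox(1)[OF g 0(2) h this] show ?thesis by simp
    qed
    ultimately have "continuous_on (ball x0 1) (conv g h)"
      by (rule continuous_on_eq)
    then show ?thesis by (simp add: continuous_on_eq_continuous_at)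
  qed
  then show ?case by (simp add: continuous_at_imp_continuous_on)
next
  case (Suc k)
  obtain g' where g': "\<And>x. (g has_derivative g' x) (at x)"
    "\<And>i. i \<in> Basis \<Longrightarrow> Ck_on k UNIV (\<lambda>x. g' x i)" by (rule Ck_on_SucE[OF open_UNIV Suc.prems(1)]) blast
  have g: "continuous_on UNIV g" using Ck_on_imp_continuous_on[OF Suc.prems(1)] .
  have g'0: "g' x v = 0" if "norm x > d" for x v
  proof -
    have "open {x::'a. d < norm x}" by (intro open_Collect_less continuous_intros)
    then have "(g has_derivative (\<lambda>v. 0)) (at x)"
      by (rule has_derivative_transform_within_open[OF has_derivative_const[of 0]])
         (use Suc.prems(2) that in auto)
    then show ?thesis using has_derivative_unique[OF g'(1)] by metis
  qed
  define G where "G x = Blinfun (g' x)" for x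
  have G: "blinfun_apply (G x) = g' x" for x
    unfolding G_def using g'(1) has_derivative_bounded_linear bounded_linear_Blinfun_apply by blast
  have Gc: "continuous_on UNIV G"
    by (rule continuous_on_blinfun_componentwise) (use g'(2) Ck_on_imp_continuous_on in \<open>auto simp: G\<close>)
  have g'c: "continuous_on UNIV (\<lambda>x. g' x v)" for v
    using continuous_on_compose2[OF continuous_on_id, of UNIV] unfolding G[symmetric]
    by (intro continuous_intros Gc)
  show ?case
  proof (rule Ck_on_SucI[OF open_UNIV, where f' = "\<lambda>x v. conv (\<lambda>x. g' x v) h x"])
    show "Ck_on k UNIV (conv (\<lambda>x. g' x i) h)" if "i \<in> Basis" for i
      by (rule Suc.IH) (use g'(2) that g'0 in auto)
    fix x0 :: 'a
    obtain a where a: "cball x0 (1 + d) \<subseteq> cbox (- a) a"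
      using bounded_subset_cbox_symmetric[OF bounded_cball] by blast
    have sub: "cball x d \<subseteq> cbox (- a) a" if "x \<in> ball x0 1" for x
    proof
      fix y assume "y \<in> cball x d"
      then have "dist x0 y \<le> 1 + d" using that dist_triangle[of x0 y x] by (auto simp: )
      then show "y \<in> cbox (- a) a" using a by auto
    qed
    have "((\<lambda>x. integral (cbox (- a) a) (\<lambda>y. g (x - y) * h y)) has_derivative
        blinfun_apply (integral (cbox (- a) a) (\<lambda>y. h y *\<^sub>R G (x0 - y)))) (at x0 within ball x0 1)"
    proof (rule leibniz_rule)
      show "((\<lambda>x. g (x - t) * h t) has_derivative blinfun_apply (h t *\<^sub>R G (x - t))) (at x within ball x0 1)" for x t
      proof -
        have "((\<lambda>x. g (x - t)) has_derivative (\<lambda>v. g' (x - t) v)) (at x within ball x0 1)"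
          by (rule has_derivative_compose[of "\<lambda>x. x - t" "\<lambda>v. v" x _ g, OF _ g'(1)]) (auto intro!: derivative_eq_intros)
        from has_derivative_mult_left[OF this, of "h t"]
        show ?thesis by (simp add: scaleR_blinfun.rep_eq G mult.commute)
      qed
      show "(\<lambda>y. g (x - y) * h y) integrable_on cbox (- a) a" for x
        by (intro integrable_continuous continuous_intros continuous_on_compose2[OF g] continuous_on_subset[OF h]) auto
      show "continuous_on (ball x0 1 \<times> cbox (- a) a) (\<lambda>(x, t). h t *\<^sub>R G (x - t))"
        by (auto simp: split_beta intro!: continuous_intros continuous_on_compose2[OF Gc] continuous_on_compose2[OF h])
    qed auto
    moreover have "blinfun_apply (integral (cbox (- a) a) (\<lambda>y. h y *\<^sub>R G (x0 - y))) = (\<lambda>v. conv (\<lambda>x. g' x v) h x0)"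
    proof
      fix v
      have "(\<lambda>y. h y *\<^sub>R G (x0 - y)) integrable_on cbox (- a) a"
        by (intro integrable_continuous continuous_intros continuous_on_compose2[OF Gc] continuous_on_subset[OF h]) auto
      then show "blinfun_apply (integral (cbox (- a) a) (\<lambda>y. h y *\<^sub>R G (x0 - y))) v = conv (\<lambda>x. g' x v) h x0"
        by (subst blinfun_apply_integral) (auto simp: scaleR_blinfun.rep_eq G mult.commute g'0
           conv_cbox(1)[OF g'c _ h, where d=d, OF _ sub[of x0]])
    qed
    ultimately have "((\<lambda>x. integral (cbox (- a) a) (\<lambda>y. g (x - y) * h y)) has_derivative
        (\<lambda>v. conv (\<lambda>x. g' x v) h x0)) (at x0)"
      by (simp add: at_within_open[of x0 "ball x0 1"])
    then show "(conv g h has_derivative (\<lambda>v. conv (\<lambda>x. g' x v) h x0)) (at x0)"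
      by (rule has_derivative_transform_within_open[of _ _ _ _ "ball x0 1"])
         (use conv_cbox(1)[OF g Suc.prems(2) h sub] in auto)
  qed
qed

definition moll :: "real \<Rightarrow> 'a::euclidean_space \<Rightarrow> real" where
  "moll d x = flat_exp 0 (d\<^sup>2 - x \<bullet> x) / (LINT x|lborel. flat_exp 0 (d\<^sup>2 - (x::'a) \<bullet> x))"

lemma moll:
  fixes d :: real
  assumes d: "d > 0"
  shows Ck_on_moll: "Ck_on k UNIV (moll d :: 'a::euclidean_space \<Rightarrow> real)"
    and moll_nonneg: "moll d (x::'a) \<ge> 0"
    and moll_eq_0: "norm (x::'a) > d \<Longrightarrow> moll d x = 0"
    and moll_integrable: "integrable lborel (moll d :: 'a \<Rightarrow> real)"
    and moll_integral: "(LINT x|lborel. moll d (x::'a)) = 1"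
proof -
  define f where "f = (\<lambda>x::'a. flat_exp 0 (d\<^sup>2 - x \<bullet> x))"
  have "Ck_on k UNIV (\<lambda>x::'a. d\<^sup>2 + (-1) *\<^sub>R (x \<bullet> x))" for k
    by (intro Ck_on_add Ck_on_const Ck_on_bounded_linear_comp[OF bounded_linear_scaleR_right]
        Ck_on_bilinear[OF bounded_bilinear_inner] Ck_on_bounded_linear[OF bounded_linear_ident]) auto
  then have ck: "Ck_on k UNIV f" for k unfolding f_def
    using Ck_on_compose[OF open_UNIV open_UNIV _ Ck_on_flat_exp[of k 0], of "\<lambda>x::'a. d\<^sup>2 - x \<bullet> x"] by simp
  have f0: "f x \<ge> 0" for x by (simp add: f_def)
  have fz: "f x = 0" if "norm x \<ge> d" for x
  proof -
    have "d\<^sup>2 \<le> x \<bullet> x" using that d by (simp add: power2_norm_eq_inner[symmetric] power_mono)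
    then show ?thesis by (simp add: f_def)
  qed
  have c: "continuous_on UNIV f" using Ck_on_imp_continuous_on[OF ck] .
  have "(\<lambda>x. indicator (cball 0 d) x *\<^sub>R f x) = f" using fz by (auto simp: indicator_def fun_eq_iff)
  then have int: "integrable lborel f"
    using borel_integrable_compact[OF compact_cball[of 0 d] continuous_on_subset[OF c]] by simp
  (* The normalizing integral is positive: the integrand is bounded below on the ball of radius d/2. *)
  have low: "exp (- inverse (3/4 * d\<^sup>2)) * indicator (cball 0 (d/2)) x \<le> f x" for x
  proof (cases "x \<in> cball 0 (d/2)")
    case True
    then have "x \<bullet> x \<le> (d/2)\<^sup>2" by (simp add: power2_norm_eq_inner[symmetric] power_mono)
    then have *: "3/4 * d\<^sup>2 \<le> d\<^sup>2 - x \<bullet> x" by (simp add: power2_eq_square)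
    have **: "3/4 * d\<^sup>2 > 0" using d by simp
    have "inverse (d\<^sup>2 - x \<bullet> x) \<le> inverse (3/4 * d\<^sup>2)"
      by (rule le_imp_inverse_le[OF * **])
    moreover have "0 < d\<^sup>2 - x \<bullet> x" using * ** by linarith
    ultimately show ?thesis using True by (simp add: f_def)
  qed (use f0 in auto)
  have "0 < exp (- inverse (3/4 * d\<^sup>2)) * measure lborel (cball (0::'a) (d/2))"
    using content_cball_pos[of "d/2" "0::'a"] d by simp
  also have "\<dots> = (LINT x|lborel. exp (- inverse (3/4 * d\<^sup>2)) * indicator (cball 0 (d/2)) (x::'a))"
    by simp
  also have "\<dots> \<le> (LINT x|lborel. f x)"
    by (intro integral_mono int low integrable_mult_right integrable_real_indicator)
       (use emeasure_bounded_finite[OF bounded_cball] in auto)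
  finally have pos: "(LINT x|lborel. f x) > 0" .
  have mf: "moll d = (\<lambda>x::'a. inverse (LINT x|lborel. f x) *\<^sub>R f x)"
    by (auto simp: moll_def f_def fun_eq_iff divide_inverse)
  show "Ck_on k UNIV (moll d :: 'a \<Rightarrow> real)" unfolding mf
    by (rule Ck_on_bounded_linear_comp[OF bounded_linear_scaleR_right open_UNIV ck])
  show "moll d (x::'a) \<ge> 0" unfolding mf using pos f0[of x] by simp
  show "norm (x::'a) > d \<Longrightarrow> moll d x = 0" unfolding mf using fz[of x] by simp
  show "integrable lborel (moll d :: 'a \<Rightarrow> real)" unfolding mf using int by simp
  show "(LINT x|lborel. moll d (x::'a)) = 1" unfolding mf using pos by simp
qed

lemma Ck_on_conv_moll:
  "d > 0 \<Longrightarrow> continuous_on UNIV h \<Longrightarrow> Ck_on k UNIV (conv (moll d) h)"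
  by (rule Ck_on_conv[where d=d]) (auto intro: Ck_on_moll moll_eq_0)

text \<open>The reflected form of the convolution with a mollifier is an average.\<close>

lemma conv_moll:
  fixes h :: "'a::euclidean_space \<Rightarrow> real"
  assumes d: "d > 0" and h: "continuous_on UNIV h"
  shows "conv (moll d) h x = (LINT z|lborel. moll d z * h (x - z))"
    "integrable lborel (\<lambda>z. moll d z * h (x - z))"
proof -
  have c: "continuous_on UNIV (moll d :: 'a \<Rightarrow> real)" using Ck_on_imp_continuous_on[OF Ck_on_moll[OF d]] .
  show "conv (moll d) h x = (LINT z|lborel. moll d z * h (x - z))" by (rule conv_reflect[OF c h])
  have "(\<lambda>z. indicator (cball 0 d) z *\<^sub>R (moll d z * h (x - z))) = (\<lambda>z. moll d z * h (x - z))"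
    using moll_eq_0[OF d, where 'a='a] by (force simp: indicator_def fun_eq_iff not_le)
  moreover have "integrable lborel (\<lambda>z. indicator (cball 0 d) z *\<^sub>R (moll d z * h (x - z)))"
    by (rule borel_integrable_compact[OF compact_cball])
       (auto intro!: continuous_intros continuous_on_compose2[OF h] continuous_on_subset[OF c])
  ultimately show "integrable lborel (\<lambda>z. moll d z * h (x - z))" by simp
qed

lemma moll_average_bound:
  fixes f :: "'a::euclidean_space \<Rightarrow> real"
  assumes d: "d > 0" and int: "integrable lborel (\<lambda>z. moll d z * f z)"
    and b: "\<And>z. norm z \<le> d \<Longrightarrow> \<bar>f z\<bar> \<le> e"
  shows "\<bar>LINT z|lborel. moll d z * f z\<bar> \<le> e"
proof -
  have "\<bar>moll d z * f z\<bar> \<le> e * moll d z" for z :: 'a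
  proof (cases "norm z \<le> d")
    case True
    then show ?thesis using b[OF True] moll_nonneg[OF d, of z] by (simp add: abs_mult mult.commute[of e] mult_left_mono)
  qed (use moll_eq_0[OF d, of z] in auto)
  then have "\<bar>LINT z|lborel. moll d z * f z\<bar> \<le> (LINT z|lborel. e * moll d (z::'a))"
    by (intro order_trans[OF integral_abs_bound] integral_mono integrable_abs int)
       (use moll_integrable[OF d] in auto)
  then show ?thesis using moll_integral[OF d, where 'a='a] by simp
qed

lemma conv_moll_close:
  fixes h :: "'a::euclidean_space \<Rightarrow> real"
  assumes d: "d > 0" and h: "continuous_on UNIV h" and b: "\<And>y. dist x y \<le> d \<Longrightarrow> \<bar>h y - h x\<bar> \<le> e"
  shows "\<bar>conv (moll d) h x - h x\<bar> \<le> e"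
proof -
  have i: "integrable lborel (\<lambda>z. moll d z * (h (x - z) - h x))"
    using conv_moll(2)[OF d h, of x] moll_integrable[OF d, where 'a='a] by (simp add: right_diff_distrib)
  have "(LINT z|lborel. moll d z * (h (x - z) - h x)) = conv (moll d) h x - h x"
    using conv_moll[OF d h, of x] moll_integrable[OF d, where 'a='a] moll_integral[OF d, where 'a='a]
    by (simp add: right_diff_distrib)
  moreover have "\<bar>LINT z|lborel. moll d z * (h (x - z) - h x)\<bar> \<le> e"
    by (rule moll_average_bound[OF d i]) (simp add: b dist_norm)
  ultimately show ?thesis by simp
qed

text \<open>Increments of a mollified function are averages of increments of \<open>h\<close> at nearby points. Hence, if
  \<open>h\<close> differs from the linear map \<open>L\<close> by a function whose increments are bounded by a positively
  homogeneous \<open>N\<close>, the derivative of the mollified function differs from \<open>L\<close> by at most \<open>N\<close>. For \<open>L\<close>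
  the derivative of \<open>h\<close> this yields approximation in \<open>C\<^sup>1\<close>; for \<open>L = 0\<close> it says that mollification
  preserves Lipschitz bounds with respect to any norm, in particular that of a Riemannian metric at
  one point.\<close>

lemma conv_moll_derivative_close:
  fixes h L N :: "'a::euclidean_space \<Rightarrow> real"
  assumes d: "d > 0" and h: "continuous_on UNIV h" and L: "linear L"
    and N: "\<And>c v. N (c *\<^sub>R v) = \<bar>c\<bar> * N v"
    and b: "\<And>y z. dist x y \<le> 2 * d \<Longrightarrow> dist x z \<le> 2 * d \<Longrightarrow> \<bar>h y - h z - L (y - z)\<bar> \<le> N (y - z)"
    and D: "(conv (moll d) h has_derivative D) (at x)"
  shows "\<bar>D v - L v\<bar> \<le> N v"
proof -
  have lin: "bounded_linear D" using D has_derivative_bounded_linear by blast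
  have inc: "\<bar>conv (moll d) h (x + t *\<^sub>R v) - conv (moll d) h x - t * L v\<bar> \<le> \<bar>t\<bar> * N v"
    if t: "\<bar>t\<bar> * norm v \<le> d" for t
  proof -
    have i: "integrable lborel (\<lambda>z. moll d z * (h (x + t *\<^sub>R v - z) - h (x - z) - t * L v))"
      using conv_moll(2)[OF d h, of x] conv_moll(2)[OF d h, of "x + t *\<^sub>R v"] moll_integrable[OF d, where 'a='a]
      by (simp add: right_diff_distrib)
    have "(LINT z|lborel. moll d z * (h (x + t *\<^sub>R v - z) - h (x - z) - t * L v))
        = conv (moll d) h (x + t *\<^sub>R v) - conv (moll d) h x - t * L v"
      using conv_moll[OF d h, of x] conv_moll[OF d h, of "x + t *\<^sub>R v"]
        moll_integrable[OF d, where 'a='a] moll_integral[OF d, where 'a='a]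
      by (simp add: right_diff_distrib)
    moreover have "\<bar>LINT z|lborel. moll d z * (h (x + t *\<^sub>R v - z) - h (x - z) - t * L v)\<bar> \<le> \<bar>t\<bar> * N v"
    proof (rule moll_average_bound[OF d i])
      fix z :: 'a assume z: "norm z \<le> d"
      have "norm (x - (x + t *\<^sub>R v - z)) \<le> norm z + norm (t *\<^sub>R v)"
        using norm_triangle_ineq4[of z "t *\<^sub>R v"] by simp
      then have "dist x (x + t *\<^sub>R v - z) \<le> 2 * d" using z t by (simp add: dist_norm)
      moreover have "dist x (x - z) \<le> 2 * d" using z d by (simp add: dist_norm)
      ultimately have "\<bar>h (x + t *\<^sub>R v - z) - h (x - z) - L ((x + t *\<^sub>R v - z) - (x - z))\<bar>
          \<le> N ((x + t *\<^sub>R v - z) - (x - z))" by (rule b)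
      then show "\<bar>h (x + t *\<^sub>R v - z) - h (x - z) - t * L v\<bar> \<le> \<bar>t\<bar> * N v"
        using N[of t v] linear_scale[OF L, of t v] by simp
    qed
    ultimately show ?thesis by simp
  qed
  have "((\<lambda>t. conv (moll d) h (x + t *\<^sub>R v)) has_vector_derivative D v) (at 0)"
  proof -
    have "((\<lambda>t. x + t *\<^sub>R v) has_derivative (\<lambda>t. t *\<^sub>R v)) (at 0)"
      by (auto intro!: derivative_eq_intros)
    from has_derivative_compose[OF this, of "conv (moll d) h" D] D
    show ?thesis unfolding has_vector_derivative_def using lin
      by (simp add: linear_simps)
  qed
  then have "((\<lambda>t. (conv (moll d) h (x + t *\<^sub>R v) - conv (moll d) h (x + 0 *\<^sub>R v)) / (t - 0)) \<longlongrightarrow> D v) (at 0)"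
    by (simp only: has_real_derivative_iff_has_vector_derivative[symmetric] has_field_derivative_iff)
  then have lim: "((\<lambda>t. \<bar>(conv (moll d) h (x + t *\<^sub>R v) - conv (moll d) h x) / t - L v\<bar>) \<longlongrightarrow> \<bar>D v - L v\<bar>) (at 0)"
    by (intro tendsto_intros) simp
  have "eventually (\<lambda>t. \<bar>(conv (moll d) h (x + t *\<^sub>R v) - conv (moll d) h x) / t - L v\<bar> \<le> N v) (at (0::real))"
    unfolding eventually_at
  proof (intro exI conjI ballI impI)
    show "0 < d / (norm v + 1)" using d by (simp add: add_nonneg_pos)
    fix t :: real assume t: "t \<noteq> 0 \<and> dist t 0 < d / (norm v + 1)"
    then have "\<bar>t\<bar> * (norm v + 1) < d" by (simp add: pos_less_divide_eq add_nonneg_pos)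
    then have "\<bar>t\<bar> * norm v \<le> d" by (simp add: distrib_left)
    from inc[OF this] have "\<bar>t\<bar> * \<bar>(conv (moll d) h (x + t *\<^sub>R v) - conv (moll d) h x) / t - L v\<bar> \<le> \<bar>t\<bar> * N v"
      using t unfolding abs_mult[symmetric] right_diff_distrib by simp
    then show "\<bar>(conv (moll d) h (x + t *\<^sub>R v) - conv (moll d) h x) / t - L v\<bar> \<le> N v"
      using t by simp
  qed
  from tendsto_upperbound[OF lim this] show ?thesis by simp
qed

section \<open>Matrices and quadratic forms\<close>

lemma inner_matrix_vector_transpose:
  fixes A :: "real^'n^'m" shows "x \<bullet> (A *v y) = (transpose A *v x) \<bullet> y"
  by (simp add: dot_lmul_matrix)

lemma matrix_inv_works:
  fixes A :: "real^'n^'n" assumes "invertible A"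
  shows "matrix_inv A *v (A *v x) = x" "A *v (matrix_inv A *v x) = x"
proof -
  have "A ** matrix_inv A = mat 1 \<and> matrix_inv A ** A = mat 1"
    using assms unfolding matrix_inv_def invertible_def by (rule someI_ex)
  then show "matrix_inv A *v (A *v x) = x" "A *v (matrix_inv A *v x) = x"
    by (simp_all add: matrix_vector_mul_assoc)
qed

lemma invertible_if_injective:
  fixes A :: "real^'n^'n" assumes "\<And>v. A *v v = 0 \<Longrightarrow> v = 0"
  shows "invertible A"
  using assms matrix_left_invertible_ker[of A] invertible_left_inverse[of A] by blast

lemma continuous_on_matrix_det:
  fixes A :: "'a::topological_space \<Rightarrow> real^'n^'n"
  assumes "\<And>i j. continuous_on S (\<lambda>x. A x $ i $ j)"
  shows "continuous_on S (\<lambda>x. det (A x))"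
  unfolding det_def by (intro continuous_intros assms)

text \<open>By Cramer's rule.\<close>

lemma continuous_on_matrix_inv_mult:
  fixes A :: "'a::topological_space \<Rightarrow> real^'n^'n"
  assumes A: "continuous_on S A" and b: "continuous_on S b" and inv: "\<And>x. x \<in> S \<Longrightarrow> invertible (A x)"
  shows "continuous_on S (\<lambda>x. matrix_inv (A x) *v b x)"
proof -
  have e: "continuous_on S (\<lambda>x. A x $ i $ j)" "continuous_on S (\<lambda>x. b x $ i)" for i j
    by (intro continuous_intros A b)+
  have "continuous_on S (\<lambda>x. \<chi> k. det(\<chi> i j. if j=k then b x$i else A x$i$j) / det (A x))"
  proof (intro continuous_on_vec_lambda continuous_on_divide continuous_on_matrix_det ballI)
    show "continuous_on S (\<lambda>x. (\<chi> i j. if j = k then b x $ i else A x $ i $ j) $ i' $ j')" for k i' j'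
      using e by (cases "j' = k") auto
    show "continuous_on S (\<lambda>x. A x $ i $ j)" for i j by (rule e)
    show "det (A x) \<noteq> 0" if "x \<in> S" for x using inv[OF that] invertible_det_nz by blast
  qed
  moreover have "(\<chi> k. det(\<chi> i j. if j=k then b x$i else A x$i$j) / det (A x)) = matrix_inv (A x) *v b x" if "x \<in> S" for x
  proof -
    have "det (A x) \<noteq> 0" using inv[OF that] invertible_det_nz by blast
    then show ?thesis using cramer[of "A x" "matrix_inv (A x) *v b x" "b x"] matrix_inv_works(2)[OF inv[OF that]] by metis
  qed
  ultimately show ?thesis by (rule continuous_on_eq)
qed

lemma quadratic_form_cauchy_schwarz:
  fixes B :: "'v::real_vector \<Rightarrow> 'v \<Rightarrow> real"
  assumes add: "\<And>x y z. B (x + y) z = B x z + B y z" and sc: "\<And>c x z. B (c *\<^sub>R x) z = c * B x z"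
    and sym: "\<And>x y. B x y = B y x" and pos: "\<And>x. 0 \<le> B x x"
  shows "\<bar>B x y\<bar> \<le> sqrt (B x x) * sqrt (B y y)"
proof -
  (* A non-negative quadratic polynomial in t has non-positive discriminant. *)
  have q: "0 \<le> B x x * t\<^sup>2 + 2 * t * B x y + B y y" for t
  proof -
    have "B (t *\<^sub>R x + y) (t *\<^sub>R x + y) = t * (t * B x x) + t * B x y + t * B x y + B y y"
      using add sc sym[of _ "t *\<^sub>R x + y"] by (simp add: add sc sym[of y x] algebra_simps)
    then show ?thesis using pos[of "t *\<^sub>R x + y"] by (simp add: power2_eq_square algebra_simps)
  qed
  have "(B x y)\<^sup>2 \<le> B x x * B y y"
  proof (cases "B x x = 0")
    case True
    have "B x y = 0"
    proof (rule ccontr)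
      assume n: "B x y \<noteq> 0"
      from q[of "- (B y y + 1) / (2 * B x y)"] True n show False by (simp add: field_simps)
    qed
    then show ?thesis using True by simp
  next
    case False
    then have p: "B x x > 0" using pos[of x] by simp
    from q[of "- B x y / B x x"] have "0 \<le> (B y y * B x x - (B x y)\<^sup>2) / B x x"
      using p by (simp add: field_simps power2_eq_square)
    then show ?thesis using p by (simp add: zero_le_divide_iff mult.commute)
  qed
  then have "sqrt ((B x y)\<^sup>2) \<le> sqrt (B x x * B y y)" by (rule real_sqrt_le_mono)
  then show ?thesis by (simp add: real_sqrt_mult)
qed

section \<open>Charts and changes of coordinates\<close>

locale riemannian =
  fixes M :: "('a::{t2_space, second_countable_topology}, 'm::finite) riemannian_structure"
  assumes manifold: "riemannian_manifold M"
begin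

abbreviation dom :: "('a, 'm) chart \<Rightarrow> 'a set" where "dom c \<equiv> fst c"
abbreviation coord :: "('a, 'm) chart \<Rightarrow> 'a \<Rightarrow> real^'m" where "coord c \<equiv> snd c"

lemma atlas_chart: "c \<in> atlas M \<Longrightarrow> is_chart c"
  using manifold by (auto simp: riemannian_manifold_def smooth_atlas_def)

lemma chart_cover: "\<exists>c\<in>atlas M. p \<in> dom c"
proof -
  have "p \<in> (\<Union>c\<in>atlas M. fst c)" using manifold unfolding riemannian_manifold_def smooth_atlas_def by auto
  then show ?thesis by blast
qed

lemma chart_at: "chart_at M p \<in> atlas M" "p \<in> dom (chart_at M p)"
proof -
  have "\<exists>c. c \<in> atlas M \<and> p \<in> fst c" using chart_cover[of p] by blast
  from someI_ex[OF this] show "chart_at M p \<in> atlas M" "p \<in> dom (chart_at M p)"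
    by (simp_all add: chart_at_def)
qed

context
  fixes c :: "('a, 'm) chart"
  assumes c: "c \<in> atlas M"
begin

lemma open_dom: "open (dom c)" and open_coord_dom: "open (coord c ` dom c)"
  using atlas_chart[OF c] by (auto simp: is_chart_def)

lemma inj_on_coord: "inj_on (coord c) (dom c)"
  using atlas_chart[OF c] unfolding is_chart_def homeomorphism_def by (metis inj_on_inverseI)

lemma param_coord [simp]: "p \<in> dom c \<Longrightarrow> param c (coord c p) = p"
  unfolding param_def using inj_on_coord by simp

lemma coord_param: "x \<in> coord c ` dom c \<Longrightarrow> coord c (param c x) = x"
  unfolding param_def by (rule f_inv_into_f)

lemma param_in_dom: "x \<in> coord c ` dom c \<Longrightarrow> param c x \<in> dom c"
  unfolding param_def by (rule inv_into_into)

lemma continuous_on_coord: "continuous_on (dom c) (coord c)"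
  using atlas_chart[OF c] by (auto simp: is_chart_def homeomorphism_def)

lemma continuous_on_param: "continuous_on (coord c ` dom c) (param c)"
proof -
  obtain h where h: "homeomorphism (dom c) (coord c ` dom c) (coord c) h"
    using atlas_chart[OF c] by (auto simp: is_chart_def)
  then have "continuous_on (coord c ` dom c) h" by (simp add: homeomorphism_def)
  moreover have "h x = param c x" if "x \<in> coord c ` dom c" for x
    using h that by (auto simp: homeomorphism_def)
  ultimately show ?thesis by (rule continuous_on_eq)
qed

lemma open_coord_image: "open W \<Longrightarrow> open (coord c ` (dom c \<inter> W))"
proof -
  assume W: "open W"
  have "coord c ` (dom c \<inter> W) = (coord c ` dom c) \<inter> param c -` W"
    by (auto simp: coord_param param_in_dom intro: rev_image_eqI)
  then show ?thesis using continuous_open_preimage[OF continuous_on_param open_coord_dom W] by simp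
qed

lemma open_coord_Int_vimage: "open T \<Longrightarrow> open (dom c \<inter> coord c -` T)"
  using continuous_open_preimage[OF continuous_on_coord open_dom] by blast

lemma open_param_image:
  assumes T: "open T" "T \<subseteq> coord c ` dom c" shows "open (param c ` T)"
proof -
  have "param c ` T = dom c \<inter> coord c -` T"
    using T(2) by (auto simp: coord_param param_in_dom subset_iff image_iff) (metis T(2) coord_param image_iff param_coord subsetD)+
  then show ?thesis using open_coord_Int_vimage[OF T(1)] by simp
qed

lemma compact_param_image: "compact K \<Longrightarrow> K \<subseteq> coord c ` dom c \<Longrightarrow> compact (param c ` K)"
  by (rule compact_continuous_image[OF continuous_on_subset[OF continuous_on_param]])

lemma Ck_on_gram: "Ck_on k (coord c ` dom c) (\<lambda>x. gram M c (param c x))"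
  using manifold c by (auto simp: riemannian_manifold_def smooth_on_def)

lemma transpose_gram: "p \<in> dom c \<Longrightarrow> transpose (gram M c p) = gram M c p"
  and gram_pos: "p \<in> dom c \<Longrightarrow> v \<noteq> 0 \<Longrightarrow> v \<bullet> (gram M c p *v v) > 0"
  using manifold c by (auto simp: riemannian_manifold_def)

lemma gram_nonneg: "p \<in> dom c \<Longrightarrow> v \<bullet> (gram M c p *v v) \<ge> 0"
  using gram_pos[of p v] by (cases "v = 0") auto

lemma invertible_gram: "p \<in> dom c \<Longrightarrow> invertible (gram M c p)"
proof (rule invertible_if_injective)
  fix v assume p: "p \<in> dom c" and "gram M c p *v v = 0"
  then show "v = 0" using gram_pos[OF p, of v] by auto
qed

lemma continuous_on_gram: "continuous_on (dom c) (gram M c)"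
proof -
  have "continuous_on (dom c) (\<lambda>p. gram M c (param c (coord c p)))"
    by (rule continuous_on_compose2[OF Ck_on_imp_continuous_on[OF Ck_on_gram[of 0]] continuous_on_coord]) auto
  then show ?thesis by (rule continuous_on_eq) simp
qed

end

definition jac :: "('a, 'm) chart \<Rightarrow> ('a, 'm) chart \<Rightarrow> 'a \<Rightarrow> real^'m^'m" where
  "jac c d p = matrix (frechet_derivative (transition c d) (at (coord c p)))"

context
  fixes c d :: "('a, 'm) chart"
  assumes c: "c \<in> atlas M" and d: "d \<in> atlas M"
begin

lemma Ck_on_transition: "Ck_on k (coord c ` (dom c \<inter> dom d)) (transition c d)"
  using manifold c d by (auto simp: riemannian_manifold_def smooth_atlas_def smooth_on_def)

lemma transition_coord: "p \<in> dom c \<Longrightarrow> transition c d (coord c p) = coord d p"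
  by (simp add: transition_def c)

lemma transition_derivative:
  assumes p: "p \<in> dom c" "p \<in> dom d"
  shows "(transition c d has_derivative (\<lambda>v. jac c d p *v v)) (at (coord c p))"
proof -
  have o: "open (coord c ` (dom c \<inter> dom d))" by (rule open_coord_image[OF c open_dom[OF d]])
  have "transition c d differentiable (at (coord c p))"
    using Ck_on_transition[of 1] differentiable_on_eq_differentiable_at[OF o] p by auto
  then have der: "(transition c d has_derivative frechet_derivative (transition c d) (at (coord c p))) (at (coord c p))"
    by (simp add: frechet_derivative_works)
  have eq: "frechet_derivative (transition c d) (at (coord c p)) = (\<lambda>v. jac c d p *v v)"
    unfolding jac_def by (rule matrix_vector_mul(2)[OF has_derivative_linear[OF der], symmetric])
  from der show ?thesis unfolding eq .
qed

lemma gram_change: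
  "p \<in> dom c \<Longrightarrow> p \<in> dom d \<Longrightarrow> gram M c p = transpose (jac c d p) ** gram M d p ** jac c d p"
proof -
  have "\<forall>c\<in>atlas M. \<forall>d\<in>atlas M. \<forall>p\<in>fst c \<inter> fst d. gram M c p = transpose (jac c d p) ** gram M d p ** jac c d p"
    using manifold unfolding riemannian_manifold_def Let_def jac_def by (elim conjE)
  then show "p \<in> dom c \<Longrightarrow> p \<in> dom d \<Longrightarrow> gram M c p = transpose (jac c d p) ** gram M d p ** jac c d p"
    using c d by blast
qed

lemma invertible_jac: "p \<in> dom c \<Longrightarrow> p \<in> dom d \<Longrightarrow> invertible (jac c d p)"
proof (rule invertible_if_injective)
  fix v assume p: "p \<in> dom c" "p \<in> dom d" and 0: "jac c d p *v v = 0"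
  have "gram M c p *v v = 0"
    unfolding gram_change[OF p] matrix_vector_mul_assoc[symmetric] 0 by simp
  then show "v = 0" using gram_pos[OF c p(1), of v] by auto
qed

lemma metric_in_change:
  assumes p: "p \<in> dom c" "p \<in> dom d"
  shows "metric_in M c p v w = metric_in M d p (jac c d p *v v) (jac c d p *v w)"
  unfolding metric_in_def gram_change[OF p] matrix_vector_mul_assoc[symmetric]
  by (simp only: inner_matrix_vector_transpose[of v "transpose (jac c d p)"] transpose_transpose)

end

section \<open>Differentials and gradients\<close>

text \<open>Differentials at \<open>p\<close> are recorded as covectors in a chart: under a change of chart they are
  multiplied by the transposed Jacobian, and inner products of gradients become the inner products
  \<open>dual_inner\<close> of covectors, with matrix \<open>G\<^sup>-\<^sup>1\<close>.\<close>

definition has_differential :: "('a, 'm) chart \<Rightarrow> ('a \<Rightarrow> real) \<Rightarrow> 'a \<Rightarrow> real^'m \<Rightarrow> bool" where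
  "has_differential c f p w \<longleftrightarrow> (f \<circ> param c has_derivative (\<lambda>v. w \<bullet> v)) (at (coord c p))"

definition dual_inner :: "('a, 'm) chart \<Rightarrow> 'a \<Rightarrow> real^'m \<Rightarrow> real^'m \<Rightarrow> real" where
  "dual_inner c p w w' = (matrix_inv (gram M c p) *v w) \<bullet> w'"

lemma has_differential_change:
  assumes c: "c \<in> atlas M" and d: "d \<in> atlas M" and p: "p \<in> dom c" "p \<in> dom d"
    and f: "has_differential d f p w"
  shows "has_differential c f p (transpose (jac c d p) *v w)"
proof -
  have "((\<lambda>x. (f \<circ> param d) (transition c d x)) has_derivative (\<lambda>v. w \<bullet> (jac c d p *v v))) (at (coord c p))"
    by (rule has_derivative_compose[OF transition_derivative[OF c d p]])
       (use f in \<open>unfold has_differential_def transition_coord[OF c d p(1)]\<close>)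
  then have "(f \<circ> param c has_derivative (\<lambda>v. w \<bullet> (jac c d p *v v))) (at (coord c p))"
    by (rule has_derivative_transform_within_open[OF _ open_coord_image[OF c open_dom[OF d]]])
       (use p in \<open>auto simp: transition_def c d\<close>)
  then show ?thesis by (simp add: has_differential_def inner_matrix_vector_transpose)
qed

text \<open>From \<open>G\<^sub>c = J\<^sup>T G\<^sub>d J\<close> one gets \<open>G\<^sub>c\<^sup>-\<^sup>1 = J\<^sup>-\<^sup>1 G\<^sub>d\<^sup>-\<^sup>1 J\<^sup>-\<^sup>T\<close>, which cancels the factors \<open>J\<^sup>T\<close> of the covectors.\<close>

lemma dual_inner_change:
  assumes c: "c \<in> atlas M" and d: "d \<in> atlas M" and p: "p \<in> dom c" "p \<in> dom d"
  shows "dual_inner c p (transpose (jac c d p) *v w) (transpose (jac c d p) *v w') = dual_inner d p w w'"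
proof -
  let ?J = "jac c d p"
  define a where "a = matrix_inv (gram M c p) *v (transpose ?J *v w)"
  have "transpose ?J *v (gram M d p *v (?J *v a)) = gram M c p *v a"
    unfolding gram_change[OF c d p] by (simp add: matrix_vector_mul_assoc matrix_mul_assoc)
  also have "\<dots> = transpose ?J *v w" unfolding a_def by (rule matrix_inv_works(2)[OF invertible_gram[OF c p(1)]])
  finally have "gram M d p *v (?J *v a) = w"
    using matrix_inv_works(1)[OF transpose_invertible[OF invertible_jac[OF c d p]]] by metis
  then have "?J *v a = matrix_inv (gram M d p) *v w"
    using matrix_inv_works(1)[OF invertible_gram[OF d p(2)]] by metis
  moreover have "a \<bullet> (transpose ?J *v w') = (?J *v a) \<bullet> w'"
    by (simp only: inner_matrix_vector_transpose[of a "transpose ?J"] transpose_transpose)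
  ultimately show ?thesis by (simp add: dual_inner_def a_def)
qed

lemma has_differential_unique:
  "has_differential c f p w \<Longrightarrow> (\<chi> j. frechet_derivative (f \<circ> param c) (at (coord c p)) (axis j 1)) = w"
  unfolding has_differential_def by (drule frechet_derivative_at[symmetric]) (simp add: vec_eq_iff inner_axis)

text \<open>The inner product of two gradients is defined in a chart chosen by a choice operator; it may be
  computed in any chart around the point.\<close>

lemma grad_inner_eq:
  assumes c: "c \<in> atlas M" and p: "p \<in> dom c"
    and f: "has_differential c f p w" and h: "has_differential c h p w'"
  shows "grad_inner M f h p = dual_inner c p w w'"
proof -
  let ?d = "chart_at M p" let ?J = "jac ?d c p"
  have f': "has_differential ?d f p (transpose ?J *v w)" and h': "has_differential ?d h p (transpose ?J *v w')"
    using has_differential_change[OF chart_at(1) c chart_at(2) p] f h by auto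
  have "grad_inner M f h p = metric_in M ?d p (matrix_inv (gram M ?d p) *v (transpose ?J *v w))
     (matrix_inv (gram M ?d p) *v (transpose ?J *v w'))"
    by (simp add: grad_inner_def Let_def grad_in_def has_differential_unique[OF f'] has_differential_unique[OF h'])
  also have "\<dots> = dual_inner ?d p (transpose ?J *v w) (transpose ?J *v w')"
    unfolding metric_in_def dual_inner_def matrix_inv_works(2)[OF invertible_gram[OF chart_at]] ..
  finally show ?thesis using dual_inner_change[OF chart_at(1) c chart_at(2) p] by simp
qed

lemma dual_inner_add: "dual_inner c p (x + y) z = dual_inner c p x z + dual_inner c p y z"
  and dual_inner_add_right: "dual_inner c p z (x + y) = dual_inner c p z x + dual_inner c p z y"
  and dual_inner_scaleR: "dual_inner c p (a *\<^sub>R x) z = a * dual_inner c p x z"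
  and dual_inner_scaleR_right: "dual_inner c p z (a *\<^sub>R x) = a * dual_inner c p z x"
  by (simp_all add: dual_inner_def matrix_vector_right_distrib matrix_vector_mult_scaleR inner_add_left inner_add_right)

lemma dual_inner_sym:
  assumes c: "c \<in> atlas M" and p: "p \<in> dom c"
  shows "dual_inner c p x y = dual_inner c p y x"
proof -
  let ?G = "gram M c p"
  have "dual_inner c p x y = (matrix_inv ?G *v x) \<bullet> (?G *v (matrix_inv ?G *v y))"
    by (simp add: dual_inner_def matrix_inv_works(2)[OF invertible_gram[OF c p]])
  also have "\<dots> = (?G *v (matrix_inv ?G *v x)) \<bullet> (matrix_inv ?G *v y)"
    by (simp only: inner_matrix_vector_transpose transpose_gram[OF c p])
  finally show ?thesis
    by (simp add: dual_inner_def matrix_inv_works(2)[OF invertible_gram[OF c p]] inner_commute)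
qed

lemma dual_inner_eq_metric:
  assumes c: "c \<in> atlas M" and p: "p \<in> dom c"
  shows "dual_inner c p x x = metric_in M c p (matrix_inv (gram M c p) *v x) (matrix_inv (gram M c p) *v x)"
  by (simp add: dual_inner_def metric_in_def matrix_inv_works(2)[OF invertible_gram[OF c p]])

lemma dual_inner_nonneg: "c \<in> atlas M \<Longrightarrow> p \<in> dom c \<Longrightarrow> dual_inner c p x x \<ge> 0"
  by (simp add: dual_inner_eq_metric metric_in_def gram_nonneg)

lemma dual_inner_eq_0:
  assumes c: "c \<in> atlas M" and p: "p \<in> dom c" and 0: "dual_inner c p x x = 0"
  shows "x = 0"
proof -
  have "matrix_inv (gram M c p) *v x = 0"
    using 0 gram_pos[OF c p] unfolding dual_inner_eq_metric[OF c p] metric_in_def by force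
  then show ?thesis using matrix_inv_works(2)[OF invertible_gram[OF c p], of x] by simp
qed

lemma dual_inner_cauchy_schwarz:
  assumes c: "c \<in> atlas M" and p: "p \<in> dom c"
  shows "\<bar>dual_inner c p x y\<bar> \<le> sqrt (dual_inner c p x x) * sqrt (dual_inner c p y y)"
  by (rule quadratic_form_cauchy_schwarz)
     (use c p in \<open>auto simp: dual_inner_add dual_inner_scaleR dual_inner_nonneg intro: dual_inner_sym\<close>)

text \<open>It is enough to test the hypothesis on the vector \<open>v = G\<^sup>-\<^sup>1 w\<close> dual to \<open>w\<close>.\<close>

lemma dual_norm_le:
  assumes c: "c \<in> atlas M" and p: "p \<in> dom c" and C: "C \<ge> 0"
    and b: "\<And>v. w \<bullet> v \<le> C * sqrt (metric_in M c p v v)"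
  shows "sqrt (dual_inner c p w w) \<le> C"
proof -
  define n where "n = sqrt (dual_inner c p w w)"
  have n: "n \<ge> 0" "n * n = dual_inner c p w w" using dual_inner_nonneg[OF c p] by (simp_all add: n_def)
  let ?v = "matrix_inv (gram M c p) *v w"
  have "w \<bullet> ?v = n * n" unfolding n(2) by (simp add: dual_inner_def inner_commute)
  moreover have "sqrt (metric_in M c p ?v ?v) = n" by (simp add: n_def dual_inner_eq_metric[OF c p])
  ultimately have "n * n \<le> C * n" using b[of ?v] by simp
  then have "n \<le> C" using n(1) C by (cases "n = 0") (auto simp: mult_le_cancel_right)
  then show ?thesis by (simp add: n_def)
qed

section \<open>Functions of class \<open>C\<^sup>k\<close> on open subsets of the manifold\<close>

text \<open>The local version of \<open>Ck_function\<close>. Openness of the set is part of the predicate, so that local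
  statements about differentiability can be glued.\<close>

definition Ck_fun_on :: "nat \<Rightarrow> 'a set \<Rightarrow> ('a \<Rightarrow> real) \<Rightarrow> bool" where
  "Ck_fun_on k W f \<longleftrightarrow> open W \<and> (\<forall>c\<in>atlas M. Ck_on k (coord c ` (dom c \<inter> W)) (f \<circ> param c))"

lemma Ck_function_iff: "Ck_function M k f \<longleftrightarrow> Ck_fun_on k UNIV f"
  by (simp add: Ck_function_def Ck_fun_on_def)

definition differential :: "('a, 'm) chart \<Rightarrow> ('a \<Rightarrow> real) \<Rightarrow> 'a \<Rightarrow> real^'m" where
  "differential c f p = (\<chi> j. frechet_derivative (f \<circ> param c) (at (coord c p)) (axis j 1))"

lemma has_differential:
  assumes f: "Ck_fun_on 1 W f" and c: "c \<in> atlas M" and p: "p \<in> dom c" "p \<in> W"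
  shows "has_differential c f p (differential c f p)"
proof -
  have o: "open (coord c ` (dom c \<inter> W))" using f open_coord_image[OF c] by (simp add: Ck_fun_on_def)
  have "f \<circ> param c differentiable (at (coord c p))"
    using f c p differentiable_on_eq_differentiable_at[OF o] by (auto simp: Ck_fun_on_def)
  then have der: "(f \<circ> param c has_derivative frechet_derivative (f \<circ> param c) (at (coord c p))) (at (coord c p))"
    by (simp add: frechet_derivative_works)
  have eq: "frechet_derivative (f \<circ> param c) (at (coord c p)) = (\<lambda>v. differential c f p \<bullet> v)"
  proof
    fix v
    have l: "linear (frechet_derivative (f \<circ> param c) (at (coord c p)))" using has_derivative_linear[OF der] .
    have "frechet_derivative (f \<circ> param c) (at (coord c p)) v
        = frechet_derivative (f \<circ> param c) (at (coord c p)) (\<Sum>j\<in>UNIV. v $ j *\<^sub>R axis j 1)"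
      using basis_expansion[of v] by (simp add: scalar_mult_eq_scaleR)
    also have "\<dots> = (\<Sum>j\<in>UNIV. v $ j * differential c f p $ j)"
      by (simp add: linear_sum[OF l] linear_scale[OF l] differential_def)
    finally show "frechet_derivative (f \<circ> param c) (at (coord c p)) v = differential c f p \<bullet> v"
      by (simp add: inner_vec_def mult.commute)
  qed
  from der show ?thesis unfolding has_differential_def eq .
qed

lemma continuous_on_differential:
  assumes f: "Ck_fun_on 1 W f" and c: "c \<in> atlas M"
  shows "continuous_on (dom c \<inter> W) (differential c f)"
  unfolding differential_def
proof (intro continuous_on_vec_lambda)
  fix j
  have "continuous_on (coord c ` (dom c \<inter> W)) (\<lambda>x. frechet_derivative (f \<circ> param c) (at x) (axis j 1))"
    using f c axis_in_Basis_iff[of j "1::real"] by (auto simp: Ck_fun_on_def)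
  from continuous_on_compose2[OF this continuous_on_subset[OF continuous_on_coord[OF c]]]
  show "continuous_on (dom c \<inter> W) (\<lambda>p. frechet_derivative (f \<circ> param c) (at (coord c p)) (axis j 1))"
    by auto
qed

lemma continuous_on_by_charts:
  assumes "open W" "\<And>c. c \<in> atlas M \<Longrightarrow> continuous_on (dom c \<inter> W) f"
  shows "continuous_on W f"
proof -
  have "isCont f p" if "p \<in> W" for p
  proof -
    obtain c where c: "c \<in> atlas M" "p \<in> dom c" using chart_cover by blast
    then show ?thesis using assms(2)[OF c(1)] open_dom[OF c(1)] assms(1) that
      by (metis IntI continuous_on_eq_continuous_at open_Int)
  qed
  then show ?thesis by (simp add: continuous_at_imp_continuous_on)
qed

lemma Ck_fun_on_imp_continuous_on:
  assumes f: "Ck_fun_on k W f" shows "continuous_on W f"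
proof (rule continuous_on_by_charts)
  fix c assume c: "c \<in> atlas M"
  have "continuous_on (coord c ` (dom c \<inter> W)) (f \<circ> param c)"
    using f c unfolding Ck_fun_on_def by (blast intro: Ck_on_imp_continuous_on)
  from continuous_on_compose2[OF this continuous_on_subset[OF continuous_on_coord[OF c]], of "dom c \<inter> W"]
  have "continuous_on (dom c \<inter> W) (\<lambda>p. (f \<circ> param c) (coord c p))" by auto
  then show "continuous_on (dom c \<inter> W) f" by (rule continuous_on_eq) (simp add: c)
qed (use f in \<open>simp add: Ck_fun_on_def\<close>)

lemma continuous_on_grad_inner:
  assumes f: "Ck_fun_on 1 W f" and h: "Ck_fun_on 1 W h"
  shows "continuous_on W (grad_inner M f h)"
proof (rule continuous_on_by_charts)
  fix c assume c: "c \<in> atlas M"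
  have "continuous_on (dom c \<inter> W) (\<lambda>p. (matrix_inv (gram M c p) *v differential c f p) \<bullet> differential c h p)"
    by (intro continuous_intros continuous_on_matrix_inv_mult continuous_on_differential[OF f c]
        continuous_on_differential[OF h c] continuous_on_subset[OF continuous_on_gram[OF c]] invertible_gram[OF c]) auto
  then show "continuous_on (dom c \<inter> W) (grad_inner M f h)"
    by (rule continuous_on_eq)
       (use grad_inner_eq[OF c _ has_differential[OF f c] has_differential[OF h c]] in \<open>auto simp: dual_inner_def\<close>)
qed (use f in \<open>simp add: Ck_fun_on_def\<close>)

lemma grad_norm_nonneg: "Ck_fun_on 1 W f \<Longrightarrow> p \<in> W \<Longrightarrow> grad_inner M f f p \<ge> 0"
  using grad_inner_eq[OF chart_at has_differential[OF _ chart_at] has_differential[OF _ chart_at]]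
    dual_inner_nonneg[OF chart_at] by metis

lemma grad_inner_cauchy_schwarz:
  assumes f: "Ck_fun_on 1 W f" and h: "Ck_fun_on 1 W h" and p: "p \<in> W"
  shows "\<bar>grad_inner M f h p\<bar> \<le> grad_norm M f p * grad_norm M h p"
  unfolding grad_norm_def
  using dual_inner_cauchy_schwarz[OF chart_at[of p], of "differential (chart_at M p) f p" "differential (chart_at M p) h p"]
    grad_inner_eq[OF chart_at has_differential[OF f chart_at p] has_differential[OF f chart_at p]]
    grad_inner_eq[OF chart_at has_differential[OF h chart_at p] has_differential[OF h chart_at p]]
    grad_inner_eq[OF chart_at has_differential[OF f chart_at p] has_differential[OF h chart_at p]] by simp

lemma Ck_fun_on_add: "Ck_fun_on k W f \<Longrightarrow> Ck_fun_on k W g \<Longrightarrow> Ck_fun_on k W (\<lambda>p. f p + g p)"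
  unfolding Ck_fun_on_def using Ck_on_add[OF open_coord_image, of _ W k "f \<circ> param _" "g \<circ> param _"]
  by (simp add: o_def)

lemma Ck_fun_on_mult: "Ck_fun_on k W f \<Longrightarrow> Ck_fun_on k W g \<Longrightarrow> Ck_fun_on k W (\<lambda>p. f p * g p)"
  unfolding Ck_fun_on_def
  using Ck_on_bilinear[OF bounded_bilinear_mult open_coord_image, of _ W k "f \<circ> param _" "g \<circ> param _"]
  by (simp add: o_def)

lemma Ck_fun_on_const: "open W \<Longrightarrow> Ck_fun_on k W (\<lambda>p. a)"
  by (simp add: Ck_fun_on_def o_def Ck_on_const)

lemma Ck_fun_on_sum:
  "open W \<Longrightarrow> (\<And>i. i \<in> I \<Longrightarrow> Ck_fun_on k W (f i)) \<Longrightarrow> Ck_fun_on k W (\<lambda>p. \<Sum>i\<in>I. f i p)"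
  by (induction I rule: infinite_finite_induct) (auto intro: Ck_fun_on_const Ck_fun_on_add)

lemma Ck_fun_on_compose:
  fixes P :: "real \<Rightarrow> real"
  assumes P: "Ck_on k T P" and T: "open T" and f: "Ck_fun_on k W f" and fT: "\<And>p. p \<in> W \<Longrightarrow> f p \<in> T"
  shows "Ck_fun_on k W (\<lambda>p. P (f p))"
  unfolding Ck_fun_on_def
proof (intro conjI ballI)
  show o: "open W" using f by (simp add: Ck_fun_on_def)
  fix c assume c: "c \<in> atlas M"
  have "Ck_on k (coord c ` (dom c \<inter> W)) (\<lambda>x. P ((f \<circ> param c) x))"
  proof (rule Ck_on_compose[OF open_coord_image[OF c o] T _ P])
    show "Ck_on k (coord c ` (dom c \<inter> W)) (f \<circ> param c)" using f c by (simp add: Ck_fun_on_def)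
  qed (use c fT in auto)
  then show "Ck_on k (coord c ` (dom c \<inter> W)) ((\<lambda>p. P (f p)) \<circ> param c)" by (simp add: o_def)
qed

lemma Ck_fun_on_subset: "Ck_fun_on k W f \<Longrightarrow> V \<subseteq> W \<Longrightarrow> open V \<Longrightarrow> Ck_fun_on k V f"
  unfolding Ck_fun_on_def by (meson Ck_on_subset Int_mono image_mono subset_refl)

lemma Ck_fun_on_cong:
  assumes f: "Ck_fun_on k W f" and eq: "\<And>p. p \<in> W \<Longrightarrow> f p = g p" shows "Ck_fun_on k W g"
  unfolding Ck_fun_on_def
proof (intro conjI ballI)
  show o: "open W" using f by (simp add: Ck_fun_on_def)
  fix c assume c: "c \<in> atlas M"
  show "Ck_on k (coord c ` (dom c \<inter> W)) (g \<circ> param c)"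
    by (rule Ck_on_cong[OF open_coord_image[OF c o], of "f \<circ> param c"])
       (use f c eq in \<open>auto simp: Ck_fun_on_def\<close>)
qed

lemma Ck_fun_on_local:
  assumes "\<And>p. p \<in> W \<Longrightarrow> \<exists>V. Ck_fun_on k V f \<and> p \<in> V" and W: "open W"
  shows "Ck_fun_on k W f"
  unfolding Ck_fun_on_def
proof (intro conjI ballI W Ck_on_local)
  fix c x assume c: "c \<in> atlas M" and x: "x \<in> coord c ` (dom c \<inter> W)"
  then obtain p where p: "p \<in> dom c" "p \<in> W" "x = coord c p" by auto
  obtain V where V: "Ck_fun_on k V f" "p \<in> V" using assms(1)[OF p(2)] by blast
  show "\<exists>U. open U \<and> x \<in> U \<and> Ck_on k U (f \<circ> param c)"
    using V p c open_coord_image[OF c] by (intro exI[of _ "coord c ` (dom c \<inter> V)"]) (auto simp: Ck_fun_on_def)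
qed

definition chart_extend :: "('a, 'm) chart \<Rightarrow> (real^'m \<Rightarrow> real) \<Rightarrow> 'a \<Rightarrow> real" where
  "chart_extend c h p = (if p \<in> dom c then h (coord c p) else 0)"

lemma Ck_fun_on_chart:
  assumes c: "c \<in> atlas M" and h: "Ck_on k (coord c ` dom c) h"
  shows "Ck_fun_on k (dom c) (\<lambda>p. h (coord c p))"
  unfolding Ck_fun_on_def
proof (intro conjI ballI open_dom[OF c])
  fix d assume d: "d \<in> atlas M"
  have "Ck_on k (coord d ` (dom d \<inter> dom c)) (\<lambda>x. h (transition d c x))"
    by (rule Ck_on_compose[OF open_coord_image[OF d open_dom[OF c]] open_coord_dom[OF c] _ h Ck_on_transition[OF d c]])
       (auto simp: transition_coord[OF d c])
  then show "Ck_on k (coord d ` (dom d \<inter> dom c)) ((\<lambda>p. h (coord c p)) \<circ> param d)"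
    by (rule Ck_on_cong[OF open_coord_image[OF d open_dom[OF c]], rotated]) (simp add: transition_def)
qed

lemma Ck_fun_on_zero: "open W \<Longrightarrow> (\<And>p. p \<in> W \<Longrightarrow> f p = 0) \<Longrightarrow> Ck_fun_on k W f"
  by (rule Ck_fun_on_cong[OF Ck_fun_on_const[of W k 0]]) auto

text \<open>The domain of the chart and the complement of the compact set \<open>param c ` K\<close>, where the function
  vanishes, form an open cover of the manifold.\<close>

lemma Ck_fun_on_chart_extend:
  assumes c: "c \<in> atlas M" and h: "Ck_on k (coord c ` dom c) h"
    and K: "compact K" "K \<subseteq> coord c ` dom c" "\<And>x. x \<notin> K \<Longrightarrow> h x = 0"
  shows "Ck_fun_on k UNIV (chart_extend c h)"
proof (rule Ck_fun_on_local)
  fix p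
  have cl: "closed (param c ` K)" by (rule compact_imp_closed[OF compact_param_image[OF c K(1,2)]])
  show "\<exists>V. Ck_fun_on k V (chart_extend c h) \<and> p \<in> V"
  proof (cases "p \<in> dom c")
    case True
    have "Ck_fun_on k (dom c) (chart_extend c h)"
      by (rule Ck_fun_on_cong[OF Ck_fun_on_chart[OF c h]]) (simp add: chart_extend_def)
    then show ?thesis using True by blast
  next
    case False
    have "Ck_fun_on k (- param c ` K) (chart_extend c h)"
    proof (rule Ck_fun_on_zero)
      fix q assume q: "q \<in> - param c ` K"
      then have "q \<in> dom c \<Longrightarrow> coord c q \<notin> K" using param_coord[OF c] by (metis ComplD imageI)
      then show "chart_extend c h q = 0" by (auto simp: chart_extend_def K(3))
    qed (use cl in auto)
    moreover have "p \<in> - param c ` K" using False K(2) param_in_dom[OF c] by auto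
    ultimately show ?thesis by blast
  qed
qed auto

end

section \<open>Change of variables for injective maps of class \<open>C\<^sup>1\<close>\<close>

text \<open>A copy of a finite type, well-ordered by an enumeration. The theorem
  \<open>has_measure_differentiable_image\<close> on the measure of the image of a differentiable map is stated
  for vectors indexed by a well-ordered type. Reindexing coordinates preserves Lebesgue measure and
  determinants, and so carries the theorem over to vectors indexed by any finite type.\<close>

typedef 'm wo = "UNIV :: 'm set" by auto

instance wo :: (finite) finite
proof
  have "(UNIV :: 'a wo set) = Abs_wo ` UNIV" by (metis Abs_wo_cases surj_def)
  then show "finite (UNIV :: 'a wo set)" by (metis finite finite_imageI)
qed

instantiation wo :: (finite) wellorder
begin

definition less_eq_wo :: "'a wo \<Rightarrow> 'a wo \<Rightarrow> bool" where
  "x \<le> y \<longleftrightarrow> to_nat (Rep_wo x) \<le> to_nat (Rep_wo y)"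

definition less_wo :: "'a wo \<Rightarrow> 'a wo \<Rightarrow> bool" where
  "x < y \<longleftrightarrow> to_nat (Rep_wo x) < to_nat (Rep_wo y)"

instance
proof
  fix P :: "'a wo \<Rightarrow> bool" and a
  assume *: "\<And>x. (\<And>y. y < x \<Longrightarrow> P y) \<Longrightarrow> P x"
  show "P a"
    by (induction "to_nat (Rep_wo a)" arbitrary: a rule: less_induct) (use * less_wo_def in blast)
qed (auto simp: less_eq_wo_def less_wo_def Rep_wo_inject)

end

definition to_wo :: "real^'m \<Rightarrow> real^('m::finite) wo" where "to_wo x = (\<chi> i. x $ Rep_wo i)"
definition from_wo :: "real^('m::finite) wo \<Rightarrow> real^'m" where "from_wo x = (\<chi> i. x $ Abs_wo i)"

lemma to_from_wo [simp]: "to_wo (from_wo x) = x" "from_wo (to_wo y) = y"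
  by (simp_all add: to_wo_def from_wo_def vec_eq_iff Rep_wo_inverse Abs_wo_inverse)

lemma linear_wo: "linear to_wo" "linear from_wo"
  by (auto simp: linear_iff to_wo_def from_wo_def vec_eq_iff)

lemma bounded_linear_wo: "bounded_linear to_wo" "bounded_linear from_wo"
  using linear_wo linear_conv_bounded_linear by auto

lemma continuous_on_wo: "continuous_on S to_wo" "continuous_on T from_wo"
  using bounded_linear_wo linear_continuous_on by auto

lemma measurable_wo [measurable]: "to_wo \<in> borel_measurable borel" "from_wo \<in> borel_measurable borel"
  using continuous_on_wo by (auto intro: borel_measurable_continuous_onI)

lemma bij_Rep_wo: "bij Rep_wo"
  by (rule bijI') (auto simp: Rep_wo_inject intro: Abs_wo_inverse[symmetric])

lemma prod_Basis_vec:
  fixes f :: "real^'n::finite \<Rightarrow> 'b::comm_monoid_mult"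
  shows "(\<Prod>b\<in>Basis. f b) = (\<Prod>i\<in>UNIV. f (axis i 1))"
proof -
  have "(Basis :: (real^'n) set) = range (\<lambda>i. axis i 1)" by (auto simp: Basis_vec_def)
  moreover have "inj (\<lambda>i::'n. axis i (1::real))" by (auto simp: inj_on_def axis_eq_axis)
  ultimately show ?thesis using prod.reindex[of "\<lambda>i::'n. axis i (1::real)" UNIV f] by (simp only: o_def)
qed

lemma distr_lborel_to_wo: "distr lborel borel (to_wo :: real^'m::finite \<Rightarrow> _) = lborel"
proof (rule lborel_eqI[symmetric])
  fix l u :: "real^('m wo)"
  assume lu: "\<And>b. b \<in> Basis \<Longrightarrow> l \<bullet> b \<le> u \<bullet> b"
  have lu': "l $ i \<le> u $ i" for i using lu[of "axis i 1"] axis_in_Basis_iff[of i "1::real"] by (simp add: inner_axis)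
  have box: "to_wo -` box l u = box (from_wo l) (from_wo u)"
  proof -
    have "(\<forall>i. l $ i < x $ Rep_wo i \<and> x $ Rep_wo i < u $ i) \<longleftrightarrow> (\<forall>i. l $ Abs_wo i < x $ i \<and> x $ i < u $ Abs_wo i)" for x :: "real^'m"
      by (metis Abs_wo_inverse Rep_wo_inverse UNIV_I)
    then show ?thesis by (auto simp: mem_box_cart to_wo_def from_wo_def)
  qed
  have "emeasure (distr lborel borel (to_wo :: real^'m \<Rightarrow> _)) (box l u) = emeasure lborel (to_wo -` box l u :: (real^'m) set)"
    by (subst emeasure_distr) auto
  also have "\<dots> = ennreal (\<Prod>b\<in>Basis. (from_wo u - from_wo l :: real^'m) \<bullet> b)"
    unfolding box by (rule emeasure_lborel_box) (auto simp: Basis_vec_def inner_axis from_wo_def lu')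
  also have "(\<Prod>b\<in>Basis. (from_wo u - from_wo l :: real^'m) \<bullet> b) = (\<Prod>i\<in>UNIV. u $ Abs_wo i - l $ Abs_wo i)"
    by (simp add: prod_Basis_vec inner_axis from_wo_def)
  also have "\<dots> = (\<Prod>i\<in>UNIV. u $ i - l $ i)"
    by (rule prod.reindex_bij_witness[of _ Rep_wo Abs_wo]) (auto simp: Rep_wo_inverse Abs_wo_inverse)
  also have "\<dots> = (\<Prod>b\<in>Basis. (u - l) \<bullet> b)"
    by (simp add: prod_Basis_vec inner_axis)
  finally show "emeasure (distr lborel borel (to_wo :: real^'m \<Rightarrow> _)) (box l u) = ennreal (\<Prod>b\<in>Basis. (u - l) \<bullet> b)" .
qed simp

lemma sign_conjugate:
  fixes f :: "'a::finite \<Rightarrow> 'b::finite"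
  assumes f: "bij f" and p: "p permutes UNIV"
  shows "sign (f \<circ> p \<circ> inv f) = sign p"
proof -
  have "map_permutation UNIV f p = f \<circ> p \<circ> inv f"
    using f by (simp add: map_permutation_def restrict_id_def bij_is_surj fun_eq_iff)
  then show ?thesis using sign_map_permutation[of f UNIV p] f p by (simp add: bij_is_inj)
qed

text \<open>Conjugation by \<open>f\<close> matches the permutations of the two index types and preserves signs.\<close>

lemma det_reindex:
  fixes f :: "'b::finite \<Rightarrow> 'a::finite" and A :: "real^'a^'a"
  assumes f: "bij f"
  shows "det (\<chi> i j. A $ f i $ f j) = det A"
proof -
  have inv: "inv f (f x) = x" "f (inv f y) = y" for x y
    using f by (auto simp: bij_is_inj bij_is_surj surj_f_inv_f)
  have bi: "bij (inv f)" using f by (rule bij_imp_bij_inv)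
  have pm: "f \<circ> p \<circ> inv f permutes UNIV" if "p permutes UNIV" for p
    using that f bi by (metis bij_comp bij_imp_permutes permutes_bij UNIV_I)
  have pm': "inv f \<circ> p \<circ> f permutes UNIV" if "p permutes UNIV" for p
    using that f bi by (metis bij_comp bij_imp_permutes permutes_bij UNIV_I)
  show ?thesis unfolding det_def
  proof (rule sum.reindex_bij_witness[of _ "\<lambda>p. inv f \<circ> p \<circ> f" "\<lambda>p. f \<circ> p \<circ> inv f"])
    fix p assume p: "p \<in> {p. p permutes (UNIV :: 'b set)}"
    have "(\<Prod>i\<in>UNIV. A $ i $ (f \<circ> p \<circ> inv f) i) = (\<Prod>i\<in>UNIV. A $ f i $ f (p i))"
      by (rule prod.reindex_bij_witness[of _ f "inv f"]) (auto simp: inv)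
    then show "of_int (sign (f \<circ> p \<circ> inv f)) * (\<Prod>i\<in>UNIV. A $ i $ (f \<circ> p \<circ> inv f) i)
        = of_int (sign p) * (\<Prod>i\<in>UNIV. (\<chi> i j. A $ f i $ f j) $ i $ p i)"
      using sign_conjugate[OF f, of p] p by simp
  qed (auto simp: fun_eq_iff inv pm pm')
qed

text \<open>For a set \<open>B\<close> on which the Jacobian has finite integral this is the change of variables theorem
  for Henstock-Kurzweil integrals; the same theorem shows that the integral is finite as soon as the
  image has finite measure, which settles the other case.\<close>

lemma emeasure_C1_image_wo:
  fixes T :: "real^'n::{finite,wellorder} \<Rightarrow> real^'n::_"
  assumes B: "B \<in> sets borel" "B \<subseteq> S" and S: "open S" and TB: "T ` B \<in> sets borel"
    and T: "\<And>x. x \<in> S \<Longrightarrow> (T has_derivative (\<lambda>v. J x *v v)) (at x)" and inj: "inj_on T S"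
    and J: "continuous_on S (\<lambda>x. det (J x))"
  shows "emeasure lborel (T ` B) = (\<integral>\<^sup>+x\<in>B. ennreal \<bar>det (J x)\<bar> \<partial>lborel)"
proof -
  define g where "g x = indicator B x * \<bar>det (J x)\<bar>" for x
  have g0: "g x \<ge> 0" for x by (simp add: g_def)
  have gm: "g \<in> borel_measurable borel"
  proof -
    have "(\<lambda>x. indicator S x *\<^sub>R \<bar>det (J x)\<bar>) \<in> borel_measurable borel"
      by (rule borel_measurable_continuous_on_indicator) (use S J in \<open>auto intro!: continuous_intros\<close>)
    then have "(\<lambda>x. indicator B x * (indicator S x *\<^sub>R \<bar>det (J x)\<bar>)) \<in> borel_measurable borel"
      using B by auto
    moreover have "(\<lambda>x. indicator B x * (indicator S x *\<^sub>R \<bar>det (J x)\<bar>)) = g"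
      using B by (auto simp: g_def indicator_def fun_eq_iff)
    ultimately show ?thesis by simp
  qed
  have gn: "(\<integral>\<^sup>+x\<in>B. ennreal \<bar>det (J x)\<bar> \<partial>lborel) = (\<integral>\<^sup>+x. ennreal (g x) \<partial>lborel)"
    by (intro nn_integral_cong) (auto simp: g_def indicator_def)
  have key: "T ` B \<in> lmeasurable \<and> measure lebesgue (T ` B) = m \<longleftrightarrow> (g has_integral m) UNIV" for m
  proof -
    have "T ` B \<in> lmeasurable \<and> measure lebesgue (T ` B) = m \<longleftrightarrow>
        ((\<lambda>x. \<bar>det (matrix (\<lambda>v. J x *v v))\<bar>) has_integral m) B"
    proof (rule has_measure_differentiable_image)
      show "(T has_derivative (\<lambda>v. J x *v v)) (at x within B)" if "x \<in> B" for x
        using T B that by (blast intro: has_derivative_at_withinI)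
    qed (use B inj inj_on_subset in auto)
    also have "\<dots> \<longleftrightarrow> (g has_integral m) UNIV"
      by (subst has_integral_restrict_UNIV[symmetric]) (rule has_integral_cong, auto simp: g_def)
    finally show ?thesis .
  qed
  have TBs: "emeasure lborel (T ` B) = emeasure lebesgue (T ` B)" using TB by simp
  show ?thesis
  proof (cases "(\<integral>\<^sup>+x. ennreal (g x) \<partial>lborel) = \<infinity>")
    case False
    then obtain r where r: "r \<ge> 0" "(\<integral>\<^sup>+x. ennreal (g x) \<partial>lborel) = ennreal r"
      by (metis ennreal_cases infinity_ennreal_def)
    then have "(g has_integral r) UNIV" using nn_integral_has_integral[OF gm g0] by simp
    then have "T ` B \<in> lmeasurable" "measure lebesgue (T ` B) = r" using key by blast+
    then show ?thesis unfolding gn r(2) TBs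
      using emeasure_eq_ennreal_measure[of lebesgue "T ` B"] fmeasurableD2[of "T ` B" lebesgue] by simp
  next
    case True
    have "T ` B \<notin> lmeasurable"
    proof
      assume "T ` B \<in> lmeasurable"
      then have "(g has_integral measure lebesgue (T ` B)) UNIV" using key by blast
      then show False using nn_integral_has_integral_lborel[OF gm g0] True by simp
    qed
    then show ?thesis unfolding gn True TBs using TB by (auto simp: fmeasurable_def not_less top_unique)
  qed
qed

lemma emeasure_C1_image:
  fixes T :: "real^'m::finite \<Rightarrow> real^'m"
  assumes B: "B \<in> sets borel" "B \<subseteq> S" and S: "open S" and TB: "T ` B \<in> sets borel"
    and T: "\<And>x. x \<in> S \<Longrightarrow> (T has_derivative (\<lambda>v. J x *v v)) (at x)" and inj: "inj_on T S"
    and J: "continuous_on S (\<lambda>x. det (J x))"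
  shows "emeasure lborel (T ` B) = (\<integral>\<^sup>+x\<in>B. ennreal \<bar>det (J x)\<bar> \<partial>lborel)"
proof -
  define T' where "T' = to_wo \<circ> T \<circ> from_wo"
  define J' where "J' y = (\<chi> i j. J (from_wo y) $ Rep_wo i $ Rep_wo j)" for y
  have detJ': "det (J' y) = det (J (from_wo y))" for y
    unfolding J'_def by (rule det_reindex[OF bij_Rep_wo])
  have J'v: "J' y *v v = to_wo (J (from_wo y) *v from_wo v)" for y v
  proof -
    have "(\<Sum>j\<in>UNIV. J (from_wo y) $ Rep_wo i $ Rep_wo j * v $ j) = (\<Sum>j\<in>UNIV. J (from_wo y) $ Rep_wo i $ j * v $ Abs_wo j)" for i
      by (rule sum.reindex_bij_witness[of _ Abs_wo Rep_wo]) (auto simp: Rep_wo_inverse Abs_wo_inverse)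
    then show ?thesis by (simp add: J'_def to_wo_def from_wo_def matrix_vector_mult_def vec_eq_iff)
  qed
  have img: "to_wo ` X = from_wo -` X" for X :: "(real^'m) set"
    by (auto simp: image_iff) (metis to_from_wo(1))
  have T'img: "T' ` (to_wo ` B) = to_wo ` (T ` B)" by (auto simp: T'_def image_iff)
  have bor: "to_wo ` X \<in> sets borel" if "X \<in> sets borel" for X :: "(real^'m) set"
    unfolding img using measurable_sets_borel[OF measurable_wo(2)] that by auto
  have em: "emeasure lborel (to_wo ` X) = emeasure lborel X" if X: "X \<in> sets borel" for X :: "(real^'m) set"
  proof -
    have "emeasure lborel (to_wo ` X) = emeasure (distr lborel borel to_wo) (to_wo ` X)"
      by (simp add: distr_lborel_to_wo)
    also have "\<dots> = emeasure lborel (to_wo -` (to_wo ` X))"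
      using bor[OF X] by (subst emeasure_distr) auto
    also have "to_wo -` (to_wo ` X) = X" by (auto simp: image_iff) (metis to_from_wo(2))
    finally show ?thesis .
  qed
  have "emeasure lborel (T ` B) = emeasure lborel (T' ` (to_wo ` B))"
    unfolding T'img using em[OF TB] by simp
  also have "\<dots> = (\<integral>\<^sup>+y\<in>to_wo ` B. ennreal \<bar>det (J' y)\<bar> \<partial>lborel)"
  proof (rule emeasure_C1_image_wo[where S = "to_wo ` S" and J = J'])
    show "to_wo ` B \<in> sets borel" "T' ` (to_wo ` B) \<in> sets borel" unfolding T'img using bor B(1) TB by auto
    show "open (to_wo ` S)" unfolding img by (rule open_vimage[OF S continuous_on_wo(2)])
    show "(T' has_derivative (\<lambda>v. J' y *v v)) (at y)" if "y \<in> to_wo ` S" for y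
    proof -
      have "from_wo y \<in> S" using that by auto
      from has_derivative_compose[OF bounded_linear_imp_has_derivative[OF bounded_linear_wo(2)] T[OF this]]
      have "((\<lambda>y. T (from_wo y)) has_derivative (\<lambda>v. J (from_wo y) *v from_wo v)) (at y)" .
      from bounded_linear.has_derivative[OF bounded_linear_wo(1) this]
      show ?thesis by (simp add: T'_def o_def J'v)
    qed
    show "inj_on T' (to_wo ` S)" using inj by (auto simp: inj_on_def T'_def) (metis to_from_wo(2))
    have "continuous_on (to_wo ` S) (\<lambda>y. det (J (from_wo y)))"
      by (rule continuous_on_compose2[OF J continuous_on_wo(2)]) auto
    then show "continuous_on (to_wo ` S) (\<lambda>y. det (J' y))" by (simp add: detJ')
  qed (use B in auto)
  also have "\<dots> = (\<integral>\<^sup>+y. indicator B (from_wo y) * ennreal \<bar>det (J (from_wo y))\<bar> \<partial>distr lborel borel to_wo)"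
    unfolding distr_lborel_to_wo
    by (intro nn_integral_cong) (simp add: detJ' img indicator_def)
  also have "\<dots> = (\<integral>\<^sup>+x. indicator B (from_wo (to_wo x)) * ennreal \<bar>det (J (from_wo (to_wo x)))\<bar> \<partial>lborel)"
  proof -
    have "(\<lambda>x. indicator S x *\<^sub>R \<bar>det (J x)\<bar>) \<in> borel_measurable borel"
      by (rule borel_measurable_continuous_on_indicator) (use S J in \<open>auto intro!: continuous_intros\<close>)
    then have "(\<lambda>x. indicator B x * ennreal (indicator S x *\<^sub>R \<bar>det (J x)\<bar>)) \<in> borel_measurable borel"
      using B by auto
    also have "(\<lambda>x. indicator B x * ennreal (indicator S x *\<^sub>R \<bar>det (J x)\<bar>)) = (\<lambda>x. indicator B x * ennreal \<bar>det (J x)\<bar>)"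
      using B by (auto simp: indicator_def fun_eq_iff)
    finally have m: "(\<lambda>x. indicator B x * ennreal \<bar>det (J x)\<bar>) \<in> borel_measurable borel" .
    have "(\<lambda>y. indicator B (from_wo y) * ennreal \<bar>det (J (from_wo y))\<bar>) \<in> borel_measurable borel"
      using measurable_compose[OF measurable_wo(2) m] by simp
    then show ?thesis by (subst nn_integral_distr) simp_all
  qed
  finally show ?thesis by (simp add: mult.commute)
qed

text \<open>Both sides are the integrals of \<open>f\<close> with respect to two measures which agree on all Borel sets by
  the previous lemma.\<close>

lemma nn_integral_C1_image:
  fixes T :: "real^'m::finite \<Rightarrow> real^'m"
  assumes S: "open S" and TS: "open (T ` S)"
    and T: "\<And>x. x \<in> S \<Longrightarrow> (T has_derivative (\<lambda>v. J x *v v)) (at x)"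
    and h: "homeomorphism S (T ` S) T h"
    and J: "continuous_on S (\<lambda>x. det (J x))" and f: "f \<in> borel_measurable borel"
  shows "(\<integral>\<^sup>+y\<in>T ` S. f y \<partial>lborel) = (\<integral>\<^sup>+x\<in>S. f (T x) * ennreal \<bar>det (J x)\<bar> \<partial>lborel)"
proof -
  (* The extension by 0 makes the map measurable on the whole space. *)
  define T' where "T' x = (if x \<in> S then T x else 0)" for x
  have inj: "inj_on T S" using h unfolding homeomorphism_def by (metis inj_on_inverseI)
  have T'm: "T' \<in> borel_measurable borel" unfolding T'_def
    using S h by (intro borel_measurable_continuous_on_if) (auto simp: homeomorphism_def)
  have dm: "(\<lambda>x. indicator S x * ennreal \<bar>det (J x)\<bar>) \<in> borel_measurable borel"
  proof -
    have "(\<lambda>x. indicator S x *\<^sub>R \<bar>det (J x)\<bar>) \<in> borel_measurable borel"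
      by (rule borel_measurable_continuous_on_indicator) (use S J in \<open>auto intro!: continuous_intros\<close>)
    then have "(\<lambda>x. ennreal (indicator S x *\<^sub>R \<bar>det (J x)\<bar>)) \<in> borel_measurable borel" by auto
    also have "(\<lambda>x. ennreal (indicator S x *\<^sub>R \<bar>det (J x)\<bar>)) = (\<lambda>x. indicator S x * ennreal \<bar>det (J x)\<bar>)"
      by (auto simp: indicator_def)
    finally show ?thesis .
  qed
  let ?\<mu>1 = "density lborel (indicator (T ` S))"
  let ?\<mu>2 = "distr (density lborel (\<lambda>x. indicator S x * ennreal \<bar>det (J x)\<bar>)) borel T'"
  have "?\<mu>1 = ?\<mu>2"
  proof (rule measure_eqI)
    fix E assume "E \<in> sets ?\<mu>1"
    then have E: "E \<in> sets borel" by simp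
    let ?B = "S \<inter> T' -` E"
    have B: "?B \<in> sets borel" using S measurable_sets_borel[OF T'm E] by (auto intro: borel_open)
    have TB: "T ` ?B = T ` S \<inter> E" by (auto simp: T'_def)
    have "emeasure ?\<mu>1 E = emeasure lborel (T ` S \<inter> E)"
    proof -
      have "emeasure ?\<mu>1 E = (\<integral>\<^sup>+y. indicator (T ` S) y * indicator E y \<partial>lborel)"
        using E TS by (intro emeasure_density) (auto intro: borel_open)
      also have "\<dots> = (\<integral>\<^sup>+y. indicator (T ` S \<inter> E) y \<partial>lborel)"
        by (intro nn_integral_cong) (simp add: indicator_inter_arith)
      finally show ?thesis using E TS by (simp add: borel_open)
    qed
    also have "\<dots> = (\<integral>\<^sup>+x\<in>?B. ennreal \<bar>det (J x)\<bar> \<partial>lborel)"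
      unfolding TB[symmetric]
      by (rule emeasure_C1_image[OF B _ S _ T inj J]) (use E TS TB in \<open>auto intro: borel_open\<close>)
    also have "\<dots> = emeasure ?\<mu>2 E"
      using T'm E dm measurable_sets_borel[OF T'm E]
      by (subst emeasure_distr; simp add: emeasure_density) (auto intro!: nn_integral_cong simp: indicator_def)
    finally show "emeasure ?\<mu>1 E = emeasure ?\<mu>2 E" .
  qed simp
  then have "(\<integral>\<^sup>+y. f y \<partial>?\<mu>1) = (\<integral>\<^sup>+y. f y \<partial>?\<mu>2)" by simp
  moreover have "(\<integral>\<^sup>+y. f y \<partial>?\<mu>1) = (\<integral>\<^sup>+y\<in>T ` S. f y \<partial>lborel)"
    using TS f by (subst nn_integral_density) (auto intro: borel_open simp: mult.commute)
  moreover have "(\<integral>\<^sup>+y. f y \<partial>?\<mu>2) = (\<integral>\<^sup>+x\<in>S. f (T x) * ennreal \<bar>det (J x)\<bar> \<partial>lborel)"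
  proof -
    have "(\<lambda>x. f (T' x)) \<in> borel_measurable borel" using measurable_compose[OF T'm f] .
    then have "(\<integral>\<^sup>+y. f y \<partial>?\<mu>2) = (\<integral>\<^sup>+x. indicator S x * ennreal \<bar>det (J x)\<bar> * f (T' x) \<partial>lborel)"
      using T'm f dm by (subst nn_integral_distr; simp add: nn_integral_density)
    then show ?thesis by (auto intro!: nn_integral_cong simp: indicator_def T'_def mult.commute)
  qed
  ultimately show ?thesis by simp
qed

section \<open>The Riemannian volume\<close>

text \<open>Along the segment from the identity matrix to \<open>G\<close> all matrices are positive definite, hence
  invertible, so the determinant does not change sign.\<close>

lemma det_pos_definite:
  fixes G :: "real^'n^'n"
  assumes pos: "\<And>v. v \<noteq> 0 \<Longrightarrow> v \<bullet> (G *v v) > 0"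
  shows "det G > 0"
proof (rule ccontr)
  assume n: "\<not> det G > 0"
  define A where "A t = (1 - t) *\<^sub>R mat 1 + t *\<^sub>R G" for t
  have nz: "det (A t) \<noteq> 0" if "0 \<le> t" "t \<le> 1" for t
  proof -
    have "invertible (A t)"
    proof (rule invertible_if_injective)
      fix v assume 0: "A t *v v = 0"
      have "v \<bullet> (A t *v v) = (1 - t) * (v \<bullet> v) + t * (v \<bullet> (G *v v))"
        by (simp add: A_def matrix_vector_mult_add_rdistrib scaleR_matrix_vector_assoc[symmetric] inner_add_right)
      then have e: "(1 - t) * (v \<bullet> v) + t * (v \<bullet> (G *v v)) = 0" using 0 by simp
      show "v = 0"
      proof (rule ccontr)
        assume v: "v \<noteq> 0"
        have "(1 - t) * (v \<bullet> v) \<ge> 0" "t * (v \<bullet> (G *v v)) \<ge> 0" using that pos[OF v] by auto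
        then have "(1 - t) * (v \<bullet> v) = 0" "t * (v \<bullet> (G *v v)) = 0" using e by linarith+
        then show False using v pos[OF v] by auto
      qed
    qed
    then show ?thesis by (simp add: invertible_det_nz)
  qed
  have "continuous_on {0..1} (\<lambda>t. det (A t))"
    by (intro continuous_on_matrix_det) (auto simp: A_def intro!: continuous_intros)
  moreover have "det (A 1) \<le> 0" "0 \<le> det (A 0)" using n by (simp_all add: A_def)
  ultimately obtain t where "0 \<le> t" "t \<le> 1" "det (A t) = 0"
    using IVT2'[of "\<lambda>t. det (A t)" 1 0 0] by auto
  then show False using nz by blast
qed

context riemannian begin

definition vol_density :: "('a, 'm) chart \<Rightarrow> real^'m \<Rightarrow> real" where
  "vol_density c x = (if x \<in> coord c ` dom c then sqrt (det (gram M c (param c x))) else 0)"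

lemma continuous_on_vol_density: "c \<in> atlas M \<Longrightarrow> continuous_on (coord c ` dom c) (vol_density c)"
proof -
  assume c: "c \<in> atlas M"
  have "continuous_on (coord c ` dom c) (\<lambda>x. sqrt (det (gram M c (param c x))))"
    by (intro continuous_intros continuous_on_matrix_det Ck_on_imp_continuous_on[OF Ck_on_gram[OF c, of 0]])
  then show ?thesis by (rule continuous_on_eq) (simp add: vol_density_def)
qed

lemma measurable_vol_density: "c \<in> atlas M \<Longrightarrow> vol_density c \<in> borel_measurable borel"
proof -
  assume c: "c \<in> atlas M"
  have "(\<lambda>x. indicator (coord c ` dom c) x *\<^sub>R vol_density c x) \<in> borel_measurable borel"
    by (rule borel_measurable_continuous_on_indicator)
       (auto intro: continuous_on_vol_density[OF c] borel_open open_coord_dom[OF c])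
  also have "(\<lambda>x. indicator (coord c ` dom c) x *\<^sub>R vol_density c x) = vol_density c"
    by (auto simp: vol_density_def fun_eq_iff)
  finally show ?thesis .
qed

lemma vol_density_pos: "c \<in> atlas M \<Longrightarrow> x \<in> coord c ` dom c \<Longrightarrow> vol_density c x > 0"
proof -
  assume c: "c \<in> atlas M" and x: "x \<in> coord c ` dom c"
  have "det (gram M c (param c x)) > 0"
    by (rule det_pos_definite) (rule gram_pos[OF c param_in_dom[OF c x]])
  then show ?thesis using x by (simp add: vol_density_def)
qed

lemma param_measurable:
  assumes c: "c \<in> atlas M"
  shows "(\<lambda>x. if x \<in> coord c ` dom c then param c x else undefined) \<in> borel_measurable borel"
  by (subst measurable_If_restrict_space_iff)
     (auto intro!: borel_measurable_continuous_on_restrict continuous_on_param[OF c] borel_open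
        simp: open_coord_dom[OF c])

text \<open>The image of \<open>sqrt (det G) dx\<close> under the parametrization. The density vanishes outside the
  coordinate range, so the value \<open>undefined\<close> of the parametrization there does not matter.\<close>

definition chart_volume :: "('a, 'm) chart \<Rightarrow> 'a measure" where
  "chart_volume c = distr (density lborel (\<lambda>x. ennreal (vol_density c x))) borel
     (\<lambda>x. if x \<in> coord c ` dom c then param c x else undefined)"

lemma coord_image_eq:
  "c \<in> atlas M \<Longrightarrow> coord c ` (A \<inter> dom c) = coord c ` dom c \<inter> param c -` A"
  by (auto simp: coord_param param_in_dom intro: rev_image_eqI)

lemma coord_image_borel:
  assumes c: "c \<in> atlas M" and A: "A \<in> sets borel"
  shows "coord c ` (A \<inter> dom c) \<in> sets borel"
proof -
  have "coord c ` (A \<inter> dom c) = coord c ` dom c \<inter> ((\<lambda>x. if x \<in> coord c ` dom c then param c x else undefined) -` A)"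
    unfolding coord_image_eq[OF c] by auto
  then show ?thesis
    using measurable_sets_borel[OF param_measurable[OF c] A] by (auto intro: borel_open open_coord_dom[OF c])
qed

lemma emeasure_chart_volume:
  assumes c: "c \<in> atlas M" and A: "A \<in> sets borel"
  shows "emeasure (chart_volume c) A = (\<integral>\<^sup>+x\<in>coord c ` (A \<inter> dom c). ennreal (vol_density c x) \<partial>lborel)"
proof -
  let ?P = "\<lambda>x. if x \<in> coord c ` dom c then param c x else undefined"
  have "emeasure (chart_volume c) A = emeasure (density lborel (\<lambda>x. ennreal (vol_density c x))) (?P -` A)"
    unfolding chart_volume_def using param_measurable[OF c] A by (subst emeasure_distr) auto
  also have "\<dots> = (\<integral>\<^sup>+x. ennreal (vol_density c x) * indicator (?P -` A) x \<partial>lborel)"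
    using measurable_vol_density[OF c] measurable_sets_borel[OF param_measurable[OF c] A]
    by (subst emeasure_density) auto
  also have "\<dots> = (\<integral>\<^sup>+x\<in>coord c ` (A \<inter> dom c). ennreal (vol_density c x) \<partial>lborel)"
    unfolding coord_image_eq[OF c] by (intro nn_integral_cong) (auto simp: indicator_def vol_density_def)
  finally show ?thesis .
qed

lemma sets_chart_volume [simp]: "sets (chart_volume c) = sets borel"
  by (simp add: chart_volume_def)

lemma chart_volume_density:
  assumes c: "c \<in> atlas M"
  shows "(\<integral>\<^sup>+x\<in>coord c ` (A \<inter> dom c). ennreal (vol_density c x) \<partial>lborel)
     = (\<integral>\<^sup>+x\<in>coord c ` (A \<inter> dom c). ennreal (sqrt (det (gram M c (param c x)))) \<partial>lborel)"
  by (intro nn_integral_cong) (auto simp: vol_density_def indicator_def)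

lemma homeomorphism_transition:
  assumes c: "c \<in> atlas M" and d: "d \<in> atlas M"
  shows "homeomorphism (coord c ` (dom c \<inter> dom d)) (transition c d ` (coord c ` (dom c \<inter> dom d)))
     (transition c d) (transition d c)"
    "transition c d ` (coord c ` (dom c \<inter> dom d)) = coord d ` (dom c \<inter> dom d)"
proof -
  show im: "transition c d ` (coord c ` (dom c \<inter> dom d)) = coord d ` (dom c \<inter> dom d)"
    by (force simp: transition_coord[OF c d] image_iff)
  show "homeomorphism (coord c ` (dom c \<inter> dom d)) (transition c d ` (coord c ` (dom c \<inter> dom d)))
     (transition c d) (transition d c)"
    unfolding homeomorphism_def
  proof (intro conjI ballI)
    show "continuous_on (coord c ` (dom c \<inter> dom d)) (transition c d)"
      using Ck_on_transition[OF c d, of 0] by simp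
    show "continuous_on (transition c d ` (coord c ` (dom c \<inter> dom d))) (transition d c)"
      unfolding im using Ck_on_transition[OF d c, of 0] by (simp add: Int_commute)
    show "transition d c ` (transition c d ` coord c ` (dom c \<inter> dom d)) = coord c ` (dom c \<inter> dom d)"
      unfolding im by (force simp: transition_coord[OF d c] image_iff)
  qed (auto simp: transition_coord[OF d c] transition_coord[OF c d])
qed

text \<open>The densities of two charts correspond under the change of coordinates, because
  \<open>det G\<^sub>c = (det J)\<^sup>2 det G\<^sub>d\<close>.\<close>

lemma emeasure_chart_volume_change:
  assumes c: "c \<in> atlas M" and d: "d \<in> atlas M" and A: "A \<in> sets borel" "A \<subseteq> dom c" "A \<subseteq> dom d"
  shows "emeasure (chart_volume c) A = emeasure (chart_volume d) A"
proof -
  let ?T = "transition c d" let ?S = "coord c ` (dom c \<inter> dom d)"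
  define J where "J x = jac c d (param c x)" for x
  have S: "open ?S" by (rule open_coord_image[OF c open_dom[OF d]])
  have TS: "?T ` ?S = coord d ` (dom c \<inter> dom d)" by (rule homeomorphism_transition(2)[OF c d])
  have oT: "open (?T ` ?S)" unfolding TS using open_coord_image[OF d open_dom[OF c]] by (simp add: Int_commute)
  have Tder: "(?T has_derivative (\<lambda>v. J x *v v)) (at x)" if "x \<in> ?S" for x
    using that transition_derivative[OF c d] by (auto simp: J_def c)
  have Jc: "continuous_on ?S (\<lambda>x. det (J x))"
  proof (rule continuous_on_matrix_det)
    fix i j
    have "Ck_on 1 ?S ?T" by (rule Ck_on_transition[OF c d])
    then have "continuous_on ?S (\<lambda>x. frechet_derivative ?T (at x) (axis j 1))"
      using axis_in_Basis_iff[of j "1::real"] by auto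
    then have "continuous_on ?S (\<lambda>x. frechet_derivative ?T (at x) (axis j 1) $ i)"
      by (intro continuous_intros)
    moreover have "frechet_derivative ?T (at x) (axis j 1) $ i = J x $ i $ j" if "x \<in> ?S" for x
    proof -
      have "frechet_derivative ?T (at x) (axis j 1) = J x *v axis j 1"
        using frechet_derivative_at[OF Tder[OF that]] by metis
      then show ?thesis by (simp add: matrix_vector_mul_component inner_axis)
    qed
    ultimately show "continuous_on ?S (\<lambda>x. J x $ i $ j)" by (rule continuous_on_eq)
  qed
  have dens: "vol_density c x = vol_density d (?T x) * \<bar>det (J x)\<bar>" if x: "x \<in> ?S" for x
  proof -
    obtain p where p: "p \<in> dom c" "p \<in> dom d" "x = coord c p" using x by auto
    have "det (gram M c p) = (det (J x))\<^sup>2 * det (gram M d p)"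
      using gram_change[OF c d p(1,2)] by (simp add: det_mul det_transpose J_def p c power2_eq_square)
    then show ?thesis using p by (simp add: vol_density_def c d transition_coord[OF c d] real_sqrt_mult)
  qed
  have bd: "coord d ` (A \<inter> dom d) \<in> sets borel" by (rule coord_image_borel[OF d A(1)])
  have "emeasure (chart_volume d) A = (\<integral>\<^sup>+y\<in>?T ` ?S. ennreal (vol_density d y) * indicator (coord d ` (A \<inter> dom d)) y \<partial>lborel)"
    unfolding emeasure_chart_volume[OF d A(1)] TS using A
    by (intro nn_integral_cong) (auto simp: indicator_def)
  also have "\<dots> = (\<integral>\<^sup>+x\<in>?S. (ennreal (vol_density d (?T x)) * indicator (coord d ` (A \<inter> dom d)) (?T x)) * ennreal \<bar>det (J x)\<bar> \<partial>lborel)"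
    by (rule nn_integral_C1_image[OF S oT Tder homeomorphism_transition(1)[OF c d] Jc])
       (use measurable_vol_density[OF d] bd in auto)
  also have "\<dots> = emeasure (chart_volume c) A"
    unfolding emeasure_chart_volume[OF c A(1)]
  proof (intro nn_integral_cong)
    fix x
    show "ennreal (vol_density d (?T x)) * indicator (coord d ` (A \<inter> dom d)) (?T x) * ennreal \<bar>det (J x)\<bar> * indicator ?S x
      = ennreal (vol_density c x) * indicator (coord c ` (A \<inter> dom c)) x"
    proof (cases "x \<in> ?S")
      case True
      then obtain p where p: "p \<in> dom c" "p \<in> dom d" "x = coord c p" by auto
      have "?T x \<in> coord d ` (A \<inter> dom d) \<longleftrightarrow> p \<in> A"
        using p A inj_on_coord[OF d] by (auto simp: transition_coord[OF c d] inj_on_def)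
      moreover have "x \<in> coord c ` (A \<inter> dom c) \<longleftrightarrow> p \<in> A"
        using p A inj_on_coord[OF c] by (auto simp: inj_on_def)
      moreover have "vol_density d y \<ge> 0" for y
        using vol_density_pos[OF d, of y] by (cases "y \<in> coord d ` dom d") (auto simp: vol_density_def)
      ultimately show ?thesis using True dens[OF True] by (auto simp: indicator_def ennreal_mult)
    next
      case False
      then have "x \<notin> coord c ` (A \<inter> dom c)" using A by auto
      then show ?thesis using False by simp
    qed
  qed
  finally show ?thesis by simp
qed

lemma countable_charts:
  "\<exists>C :: nat \<Rightarrow> ('a, 'm) chart. (\<forall>n. C n \<in> atlas M) \<and> (\<Union>n. dom (C n)) = UNIV"
proof -
  have "\<And>S. S \<in> dom ` atlas M \<Longrightarrow> open S" using open_dom by auto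
  from Lindelof[OF this] obtain F where F: "F \<subseteq> dom ` atlas M" "countable F" "\<Union>F = \<Union>(dom ` atlas M)" by metis
  have un: "\<Union>F = UNIV" using F(3) chart_cover by auto
  then have ne: "F \<noteq> {}" by auto
  define C where "C n = (SOME c. c \<in> atlas M \<and> dom c = from_nat_into F n)" for n
  have C: "C n \<in> atlas M \<and> dom (C n) = from_nat_into F n" for n
  proof -
    have "from_nat_into F n \<in> dom ` atlas M" using from_nat_into[OF ne, of n] F(1) by (rule subsetD[rotated])
    then have "\<exists>c. c \<in> atlas M \<and> dom c = from_nat_into F n" by (metis imageE)
    then show ?thesis unfolding C_def by (rule someI_ex)
  qed
  have "(\<Union>n. dom (C n)) = \<Union>(range (from_nat_into F))" using C by auto
  also have "\<dots> = UNIV" using un range_from_nat_into[OF ne F(2)] by simp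
  finally show ?thesis using C by blast
qed

definition is_volume :: "'a measure \<Rightarrow> bool" where
  "is_volume \<nu> \<longleftrightarrow> sets \<nu> = sets borel \<and>
     (\<forall>c\<in>atlas M. \<forall>A\<in>sets borel. A \<subseteq> dom c \<longrightarrow> emeasure \<nu> A = emeasure (chart_volume c) A)"

lemma riemannian_volume_eq: "riemannian_volume M = (THE \<nu>. is_volume \<nu>)"
proof -
  have "is_volume \<nu> \<longleftrightarrow> sets \<nu> = sets borel \<and>
     (\<forall>c\<in>atlas M. \<forall>A\<in>sets borel. A \<subseteq> fst c \<longrightarrow>
        emeasure \<nu> A = (\<integral>\<^sup>+x\<in>snd c ` A. ennreal (sqrt (det (gram M c (param c x)))) \<partial>lborel))" for \<nu>
    unfolding is_volume_def
  proof (intro conj_cong refl ball_cong imp_cong)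
    fix c A assume c: "c \<in> atlas M" and A: "A \<in> sets borel" "A \<subseteq> dom c"
    have "A \<inter> dom c = A" using A by auto
    then show "emeasure \<nu> A = emeasure (chart_volume c) A \<longleftrightarrow>
        emeasure \<nu> A = (\<integral>\<^sup>+x\<in>coord c ` A. ennreal (sqrt (det (gram M c (param c x)))) \<partial>lborel)"
      using emeasure_chart_volume[OF c A(1)] chart_volume_density[OF c, of A] by simp
  qed
  then show ?thesis unfolding riemannian_volume_def by presburger
qed

text \<open>Countably many charts cover the manifold and cut it into disjoint Borel sets, each contained in the
  domain of a chart. A volume is determined by its values on subsets of these pieces; conversely
  the sum of the chart measures of the pieces is a volume, since the chart measures agree on common
  subsets of the domains.\<close>

lemma is_volume_unique_exists: "\<exists>!\<nu>. is_volume \<nu>"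
proof -
  obtain C :: "nat \<Rightarrow> ('a, 'm) chart" where C: "\<And>n. C n \<in> atlas M" "(\<Union>n. dom (C n)) = UNIV"
    using countable_charts by blast
  define P where "P = disjointed (\<lambda>n. dom (C n))"
  have P: "P n \<subseteq> dom (C n)" "P n \<in> sets borel" "disjoint_family P" "(\<Union>n. P n) = UNIV" for n
  proof -
    show "P n \<subseteq> dom (C n)" unfolding P_def by (rule disjointed_subset)
    show "P n \<in> sets borel" unfolding P_def disjointed_def
      by (intro sets.Diff sets.countable_UN') (auto intro!: borel_open open_dom C)
    show "disjoint_family P" unfolding P_def by (rule disjoint_family_disjointed)
    show "(\<Union>n. P n) = UNIV" unfolding P_def UN_disjointed_eq using C by simp
  qed
  have split: "emeasure \<nu> A = (\<Sum>n. emeasure \<nu> (A \<inter> P n))" if "sets \<nu> = sets borel" "A \<in> sets borel" for \<nu> A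
  proof -
    have "(\<Sum>n. emeasure \<nu> (A \<inter> P n)) = emeasure \<nu> (\<Union>n. A \<inter> P n)"
      using that P by (intro suminf_emeasure) (auto intro: disjoint_family_on_bisimulation[OF P(3)])
    also have "(\<Union>n. A \<inter> P n) = A" using P(4) by auto
    finally show ?thesis by simp
  qed
  define \<mu> where "\<mu> A = (\<Sum>n. emeasure (chart_volume (C n)) (A \<inter> P n))" for A
  define \<nu> where "\<nu> = measure_of UNIV (sets borel) \<mu>"
  have sets: "sets \<nu> = sets borel" unfolding \<nu>_def using sets.sets_measure_of_eq[of borel] by simp
  have em: "emeasure \<nu> A = \<mu> A" if A: "A \<in> sets borel" for A
  proof (rule emeasure_measure_of[OF \<nu>_def])
    show "positive (sets \<nu>) \<mu>" by (simp add: positive_def \<mu>_def)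
    show "countably_additive (sets \<nu>) \<mu>"
      unfolding countably_additive_def sets
    proof (intro allI impI)
      fix B :: "nat \<Rightarrow> 'a set" assume B: "range B \<subseteq> sets borel" "disjoint_family B" "\<Union> (range B) \<in> sets borel"
      have "(\<Sum>i. \<mu> (B i)) = (\<Sum>i. \<integral>\<^sup>+n. emeasure (chart_volume (C n)) (B i \<inter> P n) \<partial>count_space UNIV)"
        by (simp add: \<mu>_def nn_integral_count_space_nat)
      also have "\<dots> = (\<integral>\<^sup>+n. (\<Sum>i. emeasure (chart_volume (C n)) (B i \<inter> P n)) \<partial>count_space UNIV)"
        by (rule nn_integral_suminf[symmetric]) simp
      also have "\<dots> = (\<integral>\<^sup>+n. emeasure (chart_volume (C n)) (\<Union>i. B i \<inter> P n) \<partial>count_space UNIV)"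
        using B P by (intro nn_integral_cong suminf_emeasure) (auto intro: disjoint_family_on_bisimulation[OF B(2)])
      also have "\<dots> = \<mu> (\<Union> (range B))"
        by (simp add: \<mu>_def nn_integral_count_space_nat)
      finally show "(\<Sum>i. \<mu> (B i)) = \<mu> (\<Union> (range B))" .
    qed
  qed (use A sets sets.space_closed in auto)
  have "is_volume \<nu>" unfolding is_volume_def
  proof (intro conjI ballI impI sets)
    fix c A assume c: "c \<in> atlas M" and A: "A \<in> sets borel" "A \<subseteq> dom c"
    have "emeasure \<nu> A = (\<Sum>n. emeasure (chart_volume (C n)) (A \<inter> P n))" by (simp add: em[OF A(1)] \<mu>_def)
    also have "\<dots> = (\<Sum>n. emeasure (chart_volume c) (A \<inter> P n))"
      using A P(1,2) by (intro suminf_cong emeasure_chart_volume_change C(1) c) auto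
    also have "\<dots> = emeasure (chart_volume c) A" using split[of "chart_volume c" A] A by simp
    finally show "emeasure \<nu> A = emeasure (chart_volume c) A" .
  qed
  moreover have "\<nu>' = \<nu>" if v: "is_volume \<nu>'" for \<nu>'
  proof (rule measure_eqI)
    show "sets \<nu>' = sets \<nu>" using v sets by (simp add: is_volume_def)
    fix A assume "A \<in> sets \<nu>'"
    then have A: "A \<in> sets borel" using v by (simp add: is_volume_def)
    have "emeasure \<nu>' A = (\<Sum>n. emeasure \<nu>' (A \<inter> P n))" using split A v by (simp add: is_volume_def)
    also have "\<dots> = (\<Sum>n. emeasure (chart_volume (C n)) (A \<inter> P n))"
      using v A P C(1) unfolding is_volume_def by (intro suminf_cong) (metis sets.Int le_infI2)
    also have "\<dots> = emeasure \<nu> A" by (simp add: em[OF A] \<mu>_def)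
    finally show "emeasure \<nu>' A = emeasure \<nu> A" .
  qed
  ultimately show ?thesis by blast
qed

abbreviation vol :: "'a measure" where "vol \<equiv> riemannian_volume M"

lemma is_volume_vol: "is_volume vol"
  unfolding riemannian_volume_eq by (rule theI'[OF is_volume_unique_exists])

lemma sets_vol [simp, measurable_cong]: "sets vol = sets borel"
  using is_volume_vol by (simp add: is_volume_def)

lemma space_vol [simp]: "space vol = UNIV"
  using sets_eq_imp_space_eq[OF sets_vol] by simp

lemma emeasure_vol_chart:
  "c \<in> atlas M \<Longrightarrow> A \<in> sets borel \<Longrightarrow> A \<subseteq> dom c \<Longrightarrow> emeasure vol A = emeasure (chart_volume c) A"
  using is_volume_vol by (simp add: is_volume_def)

text \<open>In a chart the volume has a positive density, and non-empty open sets are not Lebesgue null sets.\<close>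

lemma vol_open_pos:
  assumes W: "open W" "W \<noteq> {}" shows "emeasure vol W > 0"
proof -
  obtain p where p: "p \<in> W" using W by auto
  obtain c where c: "c \<in> atlas M" "p \<in> dom c" using chart_cover by blast
  let ?V = "coord c ` (dom c \<inter> W)"
  have V: "open ?V" "?V \<noteq> {}" using open_coord_image[OF c(1) W(1)] p c by auto
  have "emeasure vol (W \<inter> dom c) \<noteq> 0"
  proof
    have b: "W \<inter> dom c \<in> sets borel" using W open_dom[OF c(1)] by (auto intro: borel_open)
    assume "emeasure vol (W \<inter> dom c) = 0"
    then have "(\<integral>\<^sup>+x\<in>?V. ennreal (vol_density c x) \<partial>lborel) = 0"
      using emeasure_vol_chart[OF c(1) b] emeasure_chart_volume[OF c(1) b] by (simp add: Int_ac)
    then have "AE x in lborel. ennreal (vol_density c x) * indicator ?V x = 0"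
      using measurable_vol_density[OF c(1)] V
      by (subst (asm) nn_integral_0_iff_AE) (auto intro: borel_open)
    then have "AE x in lborel. x \<notin> ?V"
    proof (rule AE_mp, intro AE_I2 impI)
      fix x assume "ennreal (vol_density c x) * indicator ?V x = 0"
      then show "x \<notin> ?V" using vol_density_pos[OF c(1), of x] by (auto simp: indicator_def ennreal_eq_0_iff split: if_splits)
    qed
    then have "?V \<in> null_sets lborel" using V(1) by (subst (asm) AE_iff_null_sets[symmetric]) (auto intro: borel_open)
    then have "negligible ?V" using null_sets_completionI negligible_iff_null_sets by blast
    then show False using open_not_negligible[OF V] by simp
  qed
  moreover have "emeasure vol (W \<inter> dom c) \<le> emeasure vol W"
    using W by (intro emeasure_mono) (auto intro: borel_open)
  ultimately show ?thesis by (metis not_gr_zero le_zero_eq)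
qed

lemma coord_ball:
  assumes c: "c \<in> atlas M" and p: "p \<in> dom c" "p \<in> W" and W: "open W"
  obtains e where "e > 0" "cball (coord c p) e \<subseteq> coord c ` (dom c \<inter> W)"
  using open_coord_image[OF c W] p open_contains_cball by (metis IntI imageI)

lemma vol_locally_finite: "\<exists>W. open W \<and> p \<in> W \<and> emeasure vol W < \<infinity>"
proof -
  obtain c where c: "c \<in> atlas M" "p \<in> dom c" using chart_cover by blast
  obtain e where e: "e > 0" "cball (coord c p) e \<subseteq> coord c ` (dom c \<inter> UNIV)"
    by (rule coord_ball[OF c _ open_UNIV]) auto
  let ?B = "ball (coord c p) e" let ?W = "param c ` ?B"
  have sub: "?B \<subseteq> coord c ` dom c" using e by auto
  have W: "open ?W" by (rule open_param_image[OF c(1) open_ball sub])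
  have pW: "p \<in> ?W" using c e(1) by (metis centre_in_ball image_eqI param_coord)
  have Wd: "?W \<subseteq> dom c" using sub param_in_dom[OF c(1)] by auto
  obtain b where b: "\<And>x. x \<in> cball (coord c p) e \<Longrightarrow> norm (vol_density c x) \<le> b"
    using compact_imp_bounded[OF compact_continuous_image[OF continuous_on_subset[OF continuous_on_vol_density[OF c(1)]] compact_cball]] e
    unfolding bounded_iff by (metis (no_types, lifting) Int_UNIV_right image_eqI)
  have "emeasure vol ?W = (\<integral>\<^sup>+x\<in>coord c ` (?W \<inter> dom c). ennreal (vol_density c x) \<partial>lborel)"
    using emeasure_vol_chart[OF c(1) borel_open[OF W] Wd] emeasure_chart_volume[OF c(1) borel_open[OF W]] by simp
  also have "\<dots> \<le> (\<integral>\<^sup>+x. ennreal b * indicator ?B x \<partial>lborel)"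
  proof (intro nn_integral_mono)
    fix x
    show "ennreal (vol_density c x) * indicator (coord c ` (?W \<inter> dom c)) x \<le> ennreal b * indicator ?B x"
    proof (cases "x \<in> coord c ` (?W \<inter> dom c)")
      case True
      then have "x \<in> ?B" using sub coord_param[OF c(1)] by auto
      then show ?thesis using b[of x] True by (auto intro: ennreal_leI)
    qed auto
  qed
  also have "\<dots> = ennreal b * emeasure lborel ?B" by (simp add: nn_integral_cmult_indicator)
  also have "\<dots> < \<infinity>" using emeasure_bounded_finite[of ?B] by (simp add: ennreal_mult_less_top)
  finally show ?thesis using W pW by blast
qed

lemma vol_compact_finite:
  assumes K: "compact K" shows "emeasure vol K < \<infinity>"
proof -
  obtain W where W: "\<And>p. open (W p) \<and> p \<in> W p \<and> emeasure vol (W p) < \<infinity>" using vol_locally_finite by metis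
  obtain F where F: "F \<subseteq> K" "finite F" "K \<subseteq> (\<Union>p\<in>F. W p)"
    using compactE_image[OF K, of K W] W by (metis UN_I subsetI)
  have "emeasure vol K \<le> emeasure vol (\<Union>p\<in>F. W p)"
    using F W by (intro emeasure_mono) (auto intro!: borel_open)
  also have "\<dots> \<le> (\<Sum>p\<in>F. emeasure vol (W p))"
    using F W by (intro emeasure_subadditive_finite) (auto intro: borel_open)
  also have "\<dots> < \<infinity>" using F W by (simp add: ennreal_sum_less_top)
  finally show ?thesis .
qed

lemma integrable_vol_compact_support:
  fixes f :: "'a \<Rightarrow> real"
  assumes f: "f \<in> borel_measurable borel" and K: "compact K"
    and b: "\<And>x. x \<in> K \<Longrightarrow> \<bar>f x\<bar> \<le> b" and z: "\<And>x. x \<notin> K \<Longrightarrow> f x = 0"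
  shows "integrable vol f"
proof (rule Bochner_Integration.integrable_bound[of vol "\<lambda>x. b * indicator K x"])
  show "integrable vol (\<lambda>x. b * indicator K x)"
    using vol_compact_finite[OF K] K
    by (intro integrable_mult_right integrable_real_indicator) (auto intro: borel_closed compact_imp_closed)
  show "f \<in> borel_measurable vol" using f by (simp add: measurable_cong_sets[OF sets_vol refl])
  show "AE x in vol. norm (f x) \<le> norm (b * indicator K x)"
  proof (rule AE_I2)
    fix x show "norm (f x) \<le> norm (b * indicator K x)"
      using b[of x] z[of x] by (cases "x \<in> K") auto
  qed
qed

end

section \<open>Piecewise \<open>C\<^sup>1\<close> curves and their length\<close>

lemma continuous_on_matrix_vector_mult:
  fixes A :: "'a::topological_space \<Rightarrow> real^'n^'k"
  assumes "continuous_on S A" "continuous_on S b"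
  shows "continuous_on S (\<lambda>x. A x *v b x)"
  unfolding matrix_vector_mult_def by (intro continuous_intros assms)

context riemannian begin

lemma continuous_on_jac:
  assumes c: "c \<in> atlas M" and d: "d \<in> atlas M"
  shows "continuous_on (dom c \<inter> dom d) (\<lambda>p. jac c d p *v v)"
proof -
  have j: "continuous_on (dom c \<inter> dom d) (\<lambda>p. jac c d p *v axis j 1)" for j
  proof -
    have "Ck_on 1 (coord c ` (dom c \<inter> dom d)) (transition c d)" by (rule Ck_on_transition[OF c d])
    then have "continuous_on (coord c ` (dom c \<inter> dom d)) (\<lambda>x. frechet_derivative (transition c d) (at x) (axis j 1))"
      using axis_in_Basis_iff[of j "1::real"] by auto
    from continuous_on_compose2[OF this continuous_on_subset[OF continuous_on_coord[OF c]], of "dom c \<inter> dom d"]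
    have "continuous_on (dom c \<inter> dom d) (\<lambda>p. frechet_derivative (transition c d) (at (coord c p)) (axis j 1))" by auto
    then show ?thesis
    proof (rule continuous_on_eq)
      fix p assume "p \<in> dom c \<inter> dom d"
      then show "frechet_derivative (transition c d) (at (coord c p)) (axis j 1) = jac c d p *v axis j 1"
        using frechet_derivative_at[OF transition_derivative[OF c d, of p]] by (metis IntD1 IntD2)
    qed
  qed
  have "continuous_on (dom c \<inter> dom d) (\<lambda>p. \<Sum>j\<in>UNIV. v $ j *\<^sub>R (jac c d p *v axis j 1))"
    by (intro continuous_intros j)
  moreover have "(\<Sum>j\<in>UNIV. v $ j *\<^sub>R (jac c d p *v axis j 1)) = jac c d p *v v" for p
  proof -
    have "jac c d p *v v = jac c d p *v (\<Sum>j\<in>UNIV. v $ j *\<^sub>R axis j 1)"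
      using basis_expansion[of v] by (simp add: scalar_mult_eq_scaleR)
    also have "\<dots> = (\<Sum>j\<in>UNIV. v $ j *\<^sub>R (jac c d p *v axis j 1))"
      by (simp add: linear_sum[OF matrix_vector_mul_linear] matrix_vector_mult_scaleR)
    finally show ?thesis by simp
  qed
  ultimately show ?thesis by simp
qed

text \<open>The speed computed from the derivative relative to the parameter interval; unlike the
  two-sided one, it is continuous up to the end points.\<close>

definition speed_within :: "real \<Rightarrow> real \<Rightarrow> (real \<Rightarrow> 'a) \<Rightarrow> real \<Rightarrow> real" where
  "speed_within a b \<gamma> t =
     (let c = chart_at M (\<gamma> t); v = vector_derivative (coord c \<circ> \<gamma>) (at t within {a..b})
      in sqrt (metric_in M c (\<gamma> t) v v))"

lemma eventually_in_dom:
  assumes \<gamma>: "continuous_on S \<gamma>" and t: "t \<in> S" "\<gamma> t \<in> W" and W: "open W"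
  shows "eventually (\<lambda>s. \<gamma> s \<in> W) (at t within S)"
proof -
  have "(\<gamma> \<longlongrightarrow> \<gamma> t) (at t within S)" using \<gamma> t(1) by (simp add: continuous_on_def)
  from topological_tendstoD[OF this W t(2)] show ?thesis .
qed

lemma vector_derivative_change:
  assumes \<gamma>: "continuous_on S \<gamma>" and t: "t \<in> S"
    and c: "c \<in> atlas M" "\<gamma> t \<in> dom c" and d: "d \<in> atlas M" "\<gamma> t \<in> dom d"
    and w: "(coord c \<circ> \<gamma> has_vector_derivative w) (at t within S)"
  shows "(coord d \<circ> \<gamma> has_vector_derivative jac c d (\<gamma> t) *v w) (at t within S)"
proof -
  have "((\<lambda>s. transition c d ((coord c \<circ> \<gamma>) s)) has_derivative (\<lambda>h. jac c d (\<gamma> t) *v (h *\<^sub>R w))) (at t within S)"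
    by (rule has_derivative_compose[OF w[unfolded has_vector_derivative_def]])
       (use transition_derivative[OF c(1) d(1) c(2) d(2)] in simp)
  then have "(coord d \<circ> \<gamma> has_derivative (\<lambda>h. jac c d (\<gamma> t) *v (h *\<^sub>R w))) (at t within S)"
  proof (rule has_derivative_transform_eventually)
    show "\<forall>\<^sub>F s in at t within S. transition c d ((coord c \<circ> \<gamma>) s) = (coord d \<circ> \<gamma>) s"
      using eventually_in_dom[OF \<gamma> t c(2) open_dom[OF c(1)]]
      by eventually_elim (simp add: transition_coord[OF c(1) d(1)])
  qed (use c t in \<open>auto simp: transition_coord[OF c(1) d(1)]\<close>)
  then show ?thesis by (simp add: has_vector_derivative_def matrix_vector_mult_scaleR)
qed

lemma speed_within_eq:
  assumes ab: "a < b" and \<gamma>: "continuous_on {a..b} \<gamma>" and t: "t \<in> {a..b}"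
    and c: "c \<in> atlas M" "\<gamma> t \<in> dom c" and w: "(coord c \<circ> \<gamma> has_vector_derivative w) (at t within {a..b})"
  shows "speed_within a b \<gamma> t = sqrt (metric_in M c (\<gamma> t) w w)"
proof -
  let ?d = "chart_at M (\<gamma> t)"
  have "(coord ?d \<circ> \<gamma> has_vector_derivative jac c ?d (\<gamma> t) *v w) (at t within {a..b})"
    by (rule vector_derivative_change[OF \<gamma> t c chart_at w])
  then have "vector_derivative (coord ?d \<circ> \<gamma>) (at t within {a..b}) = jac c ?d (\<gamma> t) *v w"
    using ab t by (intro vector_derivative_within_closed_interval) auto
  then show ?thesis
    unfolding speed_within_def Let_def metric_in_change[OF c(1) chart_at(1) c(2) chart_at(2)] by simp
qed

lemma speed_eq_speed_within:
  assumes "a < t" "t < b" shows "speed M \<gamma> t = speed_within a b \<gamma> t"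
proof -
  have "at t within {a..b} = at t" by (rule at_within_Icc_at) (use assms in auto)
  then show ?thesis by (simp add: speed_def speed_within_def)
qed

lemma continuous_on_speed_within:
  assumes ab: "a < b" and \<gamma>: "C1_curve_on M a b \<gamma>"
  shows "continuous_on {a..b} (speed_within a b \<gamma>)"
  unfolding continuous_on_eq_continuous_within
proof
  fix t assume t: "t \<in> {a..b}"
  have cont: "continuous_on {a..b} \<gamma>" using \<gamma> by (simp add: C1_curve_on_def)
  obtain c where c: "c \<in> atlas M" "\<gamma> t \<in> dom c" using chart_cover by blast
  let ?S = "{t\<in>{a..b}. \<gamma> t \<in> dom c}"
  obtain v where v: "continuous_on ?S v"
    "\<And>t. t \<in> ?S \<Longrightarrow> (coord c \<circ> \<gamma> has_vector_derivative v t) (at t within {a..b})"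
    using \<gamma> c(1) unfolding C1_curve_on_def by blast
  have "continuous_on ?S (\<lambda>t. sqrt (metric_in M c (\<gamma> t) (v t) (v t)))"
    unfolding metric_in_def
    by (intro continuous_intros continuous_on_matrix_vector_mult v continuous_on_compose2[OF continuous_on_gram[OF c(1)]] continuous_on_subset[OF cont]) auto
  then have "continuous_on ?S (speed_within a b \<gamma>)"
  proof (rule continuous_on_eq)
    fix t assume t: "t \<in> ?S"
    then show "sqrt (metric_in M c (\<gamma> t) (v t) (v t)) = speed_within a b \<gamma> t"
      using speed_within_eq[OF ab cont _ c(1) _ v(2)[OF t]] by simp
  qed
  then have cS: "continuous (at t within ?S) (speed_within a b \<gamma>)"
    using t c continuous_on_eq_continuous_within by blast
  obtain T where T: "open T" "T \<inter> {a..b} = \<gamma> -` dom c \<inter> {a..b}"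
    using cont open_dom[OF c(1)] unfolding continuous_on_open_invariant by blast
  have "at t within ?S = at t within {a..b}"
  proof (rule at_within_nhd[of t T])
    show "t \<in> T" "?S \<inter> T - {t} = {a..b} \<inter> T - {t}" using T(2) t c(2) by blast+
  qed (rule T(1))
  then show "continuous (at t within {a..b}) (speed_within a b \<gamma>)" using cS by (simp only:)
qed

lemma speed_has_integral_C1:
  assumes ab: "a < b" and \<gamma>: "C1_curve_on M a b \<gamma>"
  shows "(speed M \<gamma> has_integral integral {a..b} (speed_within a b \<gamma>)) {a..b}"
proof -
  have "(speed_within a b \<gamma> has_integral integral {a..b} (speed_within a b \<gamma>)) {a..b}"
    using integrable_continuous_real[OF continuous_on_speed_within[OF ab \<gamma>]] by blast
  then show ?thesis
    by (rule has_integral_spike_interior[where a=a and b=b and f="speed_within a b \<gamma>", unfolded cbox_interval box_real(1)])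
       (use speed_eq_speed_within in auto)
qed

text \<open>Piecewise \<open>C\<^sup>1\<close> curves on arbitrary, possibly degenerate intervals. Free intervals make
  concatenation and restriction immediate, and the inductive form allows induction over the pieces.\<close>

inductive pw_curve :: "real \<Rightarrow> real \<Rightarrow> (real \<Rightarrow> 'a) \<Rightarrow> bool" where
  pw_curve_refl: "pw_curve a a \<gamma>"
| pw_curve_step: "pw_curve a b \<gamma> \<Longrightarrow> b < c \<Longrightarrow> C1_curve_on M b c \<gamma> \<Longrightarrow> pw_curve a c \<gamma>"

lemma pw_curve_le: "pw_curve a b \<gamma> \<Longrightarrow> a \<le> b"
  by (induction rule: pw_curve.induct) auto

lemma piecewise_C1_curve_iff: "piecewise_C1_curve M \<gamma> \<longleftrightarrow> pw_curve 0 1 \<gamma>"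
proof
  assume "piecewise_C1_curve M \<gamma>"
  then obtain n s where s: "s 0 = 0" "s n = 1" "\<And>i. i < n \<Longrightarrow> s i < s (Suc i) \<and> C1_curve_on M (s i) (s (Suc i)) \<gamma>"
    by (auto simp: piecewise_C1_curve_def)
  have "i \<le> n \<Longrightarrow> pw_curve 0 (s i) \<gamma>" for i
    by (induction i) (auto simp: s intro: pw_curve.intros)
  then show "pw_curve 0 1 \<gamma>" using s by (metis order_refl)
next
  have "\<exists>n s. s 0 = a \<and> s n = b \<and> (\<forall>i<n. s i < s (Suc i) \<and> C1_curve_on M (s i) (s (Suc i)) \<gamma>)"
    if "pw_curve a b \<gamma>" for a b
    using that
  proof (induction rule: pw_curve.induct)
    case (pw_curve_refl a \<gamma>)
    then show ?case by (intro exI[of _ 0] exI[of _ "\<lambda>_. a"]) auto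
  next
    case (pw_curve_step a b \<gamma> c)
    then obtain n s where s: "s 0 = a" "s n = b" "\<forall>i<n. s i < s (Suc i) \<and> C1_curve_on M (s i) (s (Suc i)) \<gamma>" by blast
    show ?case
      using s pw_curve_step
      by (intro exI[of _ "Suc n"] exI[of _ "\<lambda>i. if i \<le> n then s i else c"]) (auto simp: less_Suc_eq le_less)
  qed
  then show "pw_curve 0 1 \<gamma> \<Longrightarrow> piecewise_C1_curve M \<gamma>" unfolding piecewise_C1_curve_def by metis
qed

definition len :: "real \<Rightarrow> real \<Rightarrow> (real \<Rightarrow> 'a) \<Rightarrow> real" where
  "len a b \<gamma> = integral {a..b} (speed M \<gamma>)"

lemma speed_nonneg: "speed M \<gamma> t \<ge> 0"
  unfolding speed_def Let_def metric_in_def using gram_nonneg[OF chart_at] by simp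

lemma pw_curve_integrable: "pw_curve a b \<gamma> \<Longrightarrow> speed M \<gamma> integrable_on {a..b}"
proof (induction rule: pw_curve.induct)
  case (pw_curve_step a b \<gamma> c)
  then show ?case
    using speed_has_integral_C1 pw_curve_le Henstock_Kurzweil_Integration.integrable_combine[of a b c]
    by (metis has_integral_integrable less_imp_le)
qed (metis integrable_on_refl box_real(2))

lemma pw_curve_continuous: "pw_curve a b \<gamma> \<Longrightarrow> continuous_on {a..b} \<gamma>"
proof (induction rule: pw_curve.induct)
  case (pw_curve_step a b \<gamma> c)
  then have "{a..c} = {a..b} \<union> {b..c}" using pw_curve_le by fastforce
  moreover have "continuous_on {b..c} \<gamma>" using pw_curve_step by (simp add: C1_curve_on_def)
  ultimately show ?case using pw_curve_step continuous_on_closed_Un[of "{a..b}" "{b..c}" \<gamma>] by simp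
qed simp

lemma len_nonneg: "pw_curve a b \<gamma> \<Longrightarrow> len a b \<gamma> \<ge> 0"
  unfolding len_def by (intro integral_nonneg pw_curve_integrable speed_nonneg)

lemma pw_curve_trans: "pw_curve b c \<gamma> \<Longrightarrow> pw_curve a b \<gamma> \<Longrightarrow> pw_curve a c \<gamma>"
  by (induction rule: pw_curve.induct) (auto intro: pw_curve.intros)

lemma len_add:
  assumes "pw_curve a b \<gamma>" "pw_curve b c \<gamma>" shows "len a c \<gamma> = len a b \<gamma> + len b c \<gamma>"
  unfolding len_def
  using Henstock_Kurzweil_Integration.integral_combine[of a b c "speed M \<gamma>"] assms
    pw_curve_integrable[OF pw_curve_trans[OF assms(2,1)]] pw_curve_le by metis

lemma C1_curve_on_subset:
  assumes \<gamma>: "C1_curve_on M a b \<gamma>" and s: "a \<le> a'" "b' \<le> b"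
  shows "C1_curve_on M a' b' \<gamma>"
  unfolding C1_curve_on_def
proof (intro conjI ballI)
  have sub: "{a'..b'} \<subseteq> {a..b}" using s by auto
  show "continuous_on {a'..b'} \<gamma>" using \<gamma> sub by (auto simp: C1_curve_on_def intro: continuous_on_subset)
  fix c assume "c \<in> atlas M"
  then obtain v where v: "continuous_on {t \<in> {a..b}. \<gamma> t \<in> dom c} v"
    "\<forall>t\<in>{a..b}. \<gamma> t \<in> dom c \<longrightarrow> (coord c \<circ> \<gamma> has_vector_derivative v t) (at t within {a..b})"
    using \<gamma> unfolding C1_curve_on_def by blast
  show "\<exists>v. continuous_on {t \<in> {a'..b'}. \<gamma> t \<in> dom c} v \<and>
      (\<forall>t\<in>{a'..b'}. \<gamma> t \<in> dom c \<longrightarrow> (coord c \<circ> \<gamma> has_vector_derivative v t) (at t within {a'..b'}))"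
  proof (intro exI conjI ballI impI)
    show "continuous_on {t \<in> {a'..b'}. \<gamma> t \<in> dom c} v" by (rule continuous_on_subset[OF v(1)]) (use sub in auto)
    show "(coord c \<circ> \<gamma> has_vector_derivative v t) (at t within {a'..b'})" if "t \<in> {a'..b'}" "\<gamma> t \<in> dom c" for t
      by (rule has_vector_derivative_within_subset[OF _ sub]) (use v that sub in auto)
  qed
qed

lemma pw_curve_split:
  "pw_curve a b \<gamma> \<Longrightarrow> a \<le> t \<Longrightarrow> t \<le> b \<Longrightarrow> pw_curve a t \<gamma> \<and> pw_curve t b \<gamma>"
proof (induction arbitrary: t rule: pw_curve.induct)
  case (pw_curve_refl a \<gamma>)
  then show ?case by (auto intro: pw_curve.intros)
next
  case (pw_curve_step a b \<gamma> c)
  show ?case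
  proof (cases "t \<le> b")
    case True
    then show ?thesis using pw_curve_step by (blast intro: pw_curve.intros)
  next
    case False
    have 1: "C1_curve_on M b t \<gamma>" "C1_curve_on M t c \<gamma>"
      using C1_curve_on_subset[OF pw_curve_step.hyps(3)] False pw_curve_step.prems by auto
    have "pw_curve a t \<gamma>" using pw_curve.pw_curve_step[OF pw_curve_step.hyps(1) _ 1(1)] False by simp
    moreover have "pw_curve t c \<gamma>"
      using 1(2) pw_curve_step.prems(2) pw_curve.pw_curve_step[OF pw_curve.pw_curve_refl, of t c \<gamma>]
        pw_curve.pw_curve_refl by (cases "t = c") auto
    ultimately show ?thesis ..
  qed
qed

lemma C1_curve_on_affine:
  assumes \<gamma>: "C1_curve_on M a b \<gamma>" and m: "m \<noteq> 0" and im: "(\<lambda>t. m * t + k) ` {a'..b'} = {a..b}"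
  shows "C1_curve_on M a' b' (\<lambda>t. \<gamma> (m * t + k))"
  unfolding C1_curve_on_def
proof (intro conjI ballI)
  have cont: "continuous_on {a..b} \<gamma>" using \<gamma> by (simp add: C1_curve_on_def)
  have mem: "m * t + k \<in> {a..b}" if "t \<in> {a'..b'}" for t using im that by blast
  show "continuous_on {a'..b'} (\<lambda>t. \<gamma> (m * t + k))"
    by (rule continuous_on_compose2[OF cont]) (use im in \<open>auto intro!: continuous_intros\<close>)
  fix c assume "c \<in> atlas M"
  then obtain v where v: "continuous_on {t \<in> {a..b}. \<gamma> t \<in> dom c} v"
    "\<And>t. t\<in>{a..b} \<Longrightarrow> \<gamma> t \<in> dom c \<Longrightarrow> (coord c \<circ> \<gamma> has_vector_derivative v t) (at t within {a..b})"
    using \<gamma> unfolding C1_curve_on_def by blast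
  show "\<exists>v. continuous_on {t \<in> {a'..b'}. \<gamma> (m * t + k) \<in> dom c} v \<and>
      (\<forall>t\<in>{a'..b'}. \<gamma> (m * t + k) \<in> dom c \<longrightarrow>
        (coord c \<circ> (\<lambda>t. \<gamma> (m * t + k)) has_vector_derivative v t) (at t within {a'..b'}))"
  proof (intro exI[of _ "\<lambda>t. m *\<^sub>R v (m * t + k)"] conjI ballI impI)
    show "continuous_on {t \<in> {a'..b'}. \<gamma> (m * t + k) \<in> dom c} (\<lambda>t. m *\<^sub>R v (m * t + k))"
      by (intro continuous_intros continuous_on_compose2[OF v(1)]) (use mem in auto)
    fix t assume t: "t \<in> {a'..b'}" "\<gamma> (m * t + k) \<in> dom c"
    have "((\<lambda>t. m * t + k) has_vector_derivative m) (at t within {a'..b'})"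
      by (auto intro!: derivative_eq_intros simp: has_real_derivative_iff_has_vector_derivative[symmetric])
    from vector_diff_chain_within[OF this, of "coord c \<circ> \<gamma>" "v (m * t + k)"] im v(2)[OF mem[OF t(1)] t(2)]
    show "(coord c \<circ> (\<lambda>t. \<gamma> (m * t + k)) has_vector_derivative m *\<^sub>R v (m * t + k)) (at t within {a'..b'})"
      by (auto simp: o_def)
  qed
qed

lemma speed_within_affine:
  assumes \<gamma>: "C1_curve_on M a b \<gamma>" and ab: "a < b" "a' < b'" and m: "m \<noteq> 0"
    and im: "(\<lambda>t. m * t + k) ` {a'..b'} = {a..b}" and t: "t \<in> {a'..b'}"
  shows "speed_within a' b' (\<lambda>t. \<gamma> (m * t + k)) t = \<bar>m\<bar> * speed_within a b \<gamma> (m * t + k)"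
proof -
  have cont: "continuous_on {a..b} \<gamma>" using \<gamma> by (simp add: C1_curve_on_def)
  have cont': "continuous_on {a'..b'} (\<lambda>t. \<gamma> (m * t + k))"
    using C1_curve_on_affine[OF \<gamma> m im] by (simp add: C1_curve_on_def)
  let ?c = "chart_at M (\<gamma> (m * t + k))"
  have ti: "m * t + k \<in> {a..b}" using im t by blast
  obtain v where v: "(coord ?c \<circ> \<gamma> has_vector_derivative v) (at (m * t + k) within {a..b})"
    using \<gamma> chart_at ti unfolding C1_curve_on_def by blast
  have "((\<lambda>t. m * t + k) has_vector_derivative m) (at t within {a'..b'})"
    by (auto intro!: derivative_eq_intros simp: has_real_derivative_iff_has_vector_derivative[symmetric])
  from vector_diff_chain_within[OF this, of "coord ?c \<circ> \<gamma>" v] im v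
  have "(coord ?c \<circ> (\<lambda>t. \<gamma> (m * t + k)) has_vector_derivative m *\<^sub>R v) (at t within {a'..b'})"
    by (auto simp: o_def)
  from speed_within_eq[OF ab(2) cont' t chart_at this]
  have "speed_within a' b' (\<lambda>t. \<gamma> (m * t + k)) t = sqrt (m\<^sup>2 * metric_in M ?c (\<gamma> (m * t + k)) v v)"
    by (simp add: metric_in_def matrix_vector_mult_scaleR power2_eq_square mult.assoc)
  then show ?thesis using speed_within_eq[OF ab(1) cont ti chart_at v] by (simp add: real_sqrt_mult)
qed

lemma len_affine_C1:
  assumes \<gamma>: "C1_curve_on M a b \<gamma>" and ab: "a < b" "a' < b'" and m: "m \<noteq> 0"
    and im: "(\<lambda>t. m * t + k) ` {a'..b'} = {a..b}"
  shows "len a' b' (\<lambda>t. \<gamma> (m * t + k)) = len a b \<gamma>"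
proof -
  let ?g = "\<lambda>t. \<gamma> (m * t + k)"
  have "((\<lambda>t. speed_within a b \<gamma> (m *\<^sub>R t + k)) has_integral
      (1 / \<bar>m\<bar> ^ DIM(real)) *\<^sub>R integral {a..b} (speed_within a b \<gamma>))
      ((\<lambda>x. (1 / m) *\<^sub>R x + - ((1 / m) *\<^sub>R k)) ` cbox a b)"
    by (rule has_integral_affinity[OF _ m])
       (use integrable_continuous_real[OF continuous_on_speed_within[OF ab(1) \<gamma>]] in auto)
  moreover have "(\<lambda>x. (1 / m) *\<^sub>R x + - ((1 / m) *\<^sub>R k)) ` cbox a b = {a'..b'}"
    unfolding cbox_interval im[symmetric] image_image using m by (simp add: field_simps)
  ultimately have "((\<lambda>t. speed_within a b \<gamma> (m * t + k)) has_integral (1 / \<bar>m\<bar>) * integral {a..b} (speed_within a b \<gamma>)) {a'..b'}"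
    by simp
  from has_integral_mult_right[OF this, of "\<bar>m\<bar>"]
  have "((\<lambda>t. \<bar>m\<bar> * speed_within a b \<gamma> (m * t + k)) has_integral integral {a..b} (speed_within a b \<gamma>)) {a'..b'}"
    using m by simp
  then have "(speed_within a' b' ?g has_integral integral {a..b} (speed_within a b \<gamma>)) {a'..b'}"
    by (rule has_integral_eq[rotated]) (use speed_within_affine[OF \<gamma> ab m im] in auto)
  then have "integral {a'..b'} (speed_within a' b' ?g) = integral {a..b} (speed_within a b \<gamma>)" by blast
  then show ?thesis
    using speed_has_integral_C1[OF ab(1) \<gamma>] speed_has_integral_C1[OF ab(2) C1_curve_on_affine[OF \<gamma> m im]]
    unfolding len_def by (metis integral_unique)
qed

lemma len_refl [simp]: "len a a \<gamma> = 0" by (simp add: len_def)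

lemma pw_curve_C1: "C1_curve_on M a b \<gamma> \<Longrightarrow> a < b \<Longrightarrow> pw_curve a b \<gamma>"
  using pw_curve.intros by blast

lemma pw_curve_affine_pos:
  assumes "m > 0"
  shows "pw_curve a b \<gamma> \<Longrightarrow> pw_curve ((a - k) / m) ((b - k) / m) (\<lambda>t. \<gamma> (m * t + k)) \<and>
    len ((a - k) / m) ((b - k) / m) (\<lambda>t. \<gamma> (m * t + k)) = len a b \<gamma>"
proof (induction rule: pw_curve.induct)
  case (pw_curve_refl a \<gamma>)
  then show ?case by (auto intro: pw_curve.intros)
next
  case (pw_curve_step a b \<gamma> c)
  let ?g = "\<lambda>t. \<gamma> (m * t + k)" let ?b = "(b - k) / m" let ?c = "(c - k) / m"
  have lt: "?b < ?c" using assms pw_curve_step by (simp add: divide_strict_right_mono)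
  have im: "(\<lambda>t. m * t + k) ` {?b..?c} = {b..c}"
  proof -
    have "(\<lambda>t. m * t + k) ` {?b..?c} = {m * ?b + k .. m * ?c + k}"
      using image_affinity_atLeastAtMost[of m k ?b ?c] assms lt by auto
    then show ?thesis using assms by simp
  qed
  have C1: "C1_curve_on M ?b ?c ?g" using C1_curve_on_affine[OF pw_curve_step.hyps(3) _ im] assms by simp
  have l: "len ?b ?c ?g = len b c \<gamma>"
    using len_affine_C1[OF pw_curve_step.hyps(3) pw_curve_step.hyps(2) lt _ im] assms by simp
  show ?case
    using pw_curve_step pw_curve.pw_curve_step[OF _ lt C1] len_add[OF _ pw_curve_C1[OF C1 lt]]
      len_add[OF pw_curve_step.hyps(1) pw_curve_C1[OF pw_curve_step.hyps(3,2)]] l by auto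
qed

lemma pw_curve_reverse:
  "pw_curve a b \<gamma> \<Longrightarrow> pw_curve (- b) (- a) (\<lambda>t. \<gamma> (- t)) \<and> len (- b) (- a) (\<lambda>t. \<gamma> (- t)) = len a b \<gamma>"
proof (induction rule: pw_curve.induct)
  case (pw_curve_refl a \<gamma>)
  then show ?case by (auto intro: pw_curve.intros)
next
  case (pw_curve_step a b \<gamma> c)
  let ?g = "\<lambda>t. \<gamma> (- t)"
  have im: "(\<lambda>t. - 1 * t + 0) ` {-c..-b} = {b..c}" by (auto simp: image_iff intro!: bexI[of _ "- _"])
  have lt: "- c < - b" using pw_curve_step by simp
  have C1: "C1_curve_on M (- c) (- b) ?g" using C1_curve_on_affine[OF pw_curve_step.hyps(3) _ im] by simp
  have l: "len (- c) (- b) ?g = len b c \<gamma>"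
    using len_affine_C1[OF pw_curve_step.hyps(3) pw_curve_step.hyps(2) lt _ im] by simp
  show ?case
    using pw_curve_step pw_curve_trans[OF _ pw_curve_C1[OF C1 lt]] len_add[OF pw_curve_C1[OF C1 lt]]
      len_add[OF pw_curve_step.hyps(1) pw_curve_C1[OF pw_curve_step.hyps(3,2)]] l by auto
qed

lemma C1_curve_on_cong:
  assumes ab: "a < b" and eq: "\<And>t. t \<in> {a..b} \<Longrightarrow> \<gamma> t = \<gamma>' t" and \<gamma>: "C1_curve_on M a b \<gamma>"
  shows "C1_curve_on M a b \<gamma>'" "len a b \<gamma>' = len a b \<gamma>"
proof -
  have sets: "{t \<in> {a..b}. \<gamma>' t \<in> dom c} = {t \<in> {a..b}. \<gamma> t \<in> dom c}" for c using eq by auto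
  have der: "(coord c \<circ> \<gamma> has_vector_derivative v) (at t within {a..b}) \<Longrightarrow>
      (coord c \<circ> \<gamma>' has_vector_derivative v) (at t within {a..b})" if "t \<in> {a..b}" for c v t
    by (rule has_vector_derivative_transform[OF that, of _ "coord c \<circ> \<gamma>"]) (simp_all add: eq)
  have cont: "continuous_on {a..b} \<gamma>" using \<gamma> by (simp add: C1_curve_on_def)
  then have cont': "continuous_on {a..b} \<gamma>'" by (rule continuous_on_eq) (rule eq)
  show C1: "C1_curve_on M a b \<gamma>'" unfolding C1_curve_on_def
  proof (intro conjI ballI cont')
    fix c assume "c \<in> atlas M"
    then obtain v where "continuous_on {t \<in> {a..b}. \<gamma> t \<in> dom c} v"
      "\<forall>t\<in>{a..b}. \<gamma> t \<in> dom c \<longrightarrow> (coord c \<circ> \<gamma> has_vector_derivative v t) (at t within {a..b})"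
      using \<gamma> unfolding C1_curve_on_def by blast
    then show "\<exists>v. continuous_on {t \<in> {a..b}. \<gamma>' t \<in> dom c} v \<and>
      (\<forall>t\<in>{a..b}. \<gamma>' t \<in> dom c \<longrightarrow> (coord c \<circ> \<gamma>' has_vector_derivative v t) (at t within {a..b}))"
      unfolding sets using der eq by (intro exI[of _ v]) auto
  qed
  have "speed_within a b \<gamma>' t = speed_within a b \<gamma> t" if t: "t \<in> {a..b}" for t
  proof -
    obtain v where v: "(coord (chart_at M (\<gamma> t)) \<circ> \<gamma> has_vector_derivative v) (at t within {a..b})"
      using \<gamma> chart_at t unfolding C1_curve_on_def by blast
    show ?thesis
      using speed_within_eq[OF ab cont t chart_at v] speed_within_eq[OF ab cont' t chart_at(1) _ der[OF t v]]
        eq[OF t] chart_at by metis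
  qed
  then show "len a b \<gamma>' = len a b \<gamma>"
    using speed_has_integral_C1[OF ab \<gamma>] speed_has_integral_C1[OF ab C1]
    unfolding len_def by (metis (no_types, lifting) integral_cong integral_unique)
qed

lemma pw_curve_cong:
  "pw_curve a b \<gamma> \<Longrightarrow> (\<And>t. t \<in> {a..b} \<Longrightarrow> \<gamma> t = \<gamma>' t) \<Longrightarrow> pw_curve a b \<gamma>' \<and> len a b \<gamma>' = len a b \<gamma>"
proof (induction rule: pw_curve.induct)
  case (pw_curve_refl a \<gamma>)
  then show ?case by (auto intro: pw_curve.intros)
next
  case (pw_curve_step a b \<gamma> c)
  have le: "a \<le> b" using pw_curve_le pw_curve_step by blast
  have 1: "pw_curve a b \<gamma>'" "len a b \<gamma>' = len a b \<gamma>"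
  proof -
    have "\<gamma> t = \<gamma>' t" if "t \<in> {a..b}" for t
      by (rule pw_curve_step.prems) (use that pw_curve_step.hyps(2) in simp)
    from pw_curve_step.IH[OF this] show "pw_curve a b \<gamma>'" "len a b \<gamma>' = len a b \<gamma>" by auto
  qed
  have 2: "C1_curve_on M b c \<gamma>'" "len b c \<gamma>' = len b c \<gamma>"
    by (rule C1_curve_on_cong[OF pw_curve_step.hyps(2) _ pw_curve_step.hyps(3)],
        rule pw_curve_step.prems, use le in simp)+
  show ?case
    using 1 2 pw_curve.pw_curve_step[OF 1(1) pw_curve_step.hyps(2) 2(1)]
      len_add[OF 1(1) pw_curve_C1[OF 2(1) pw_curve_step.hyps(2)]]
      len_add[OF pw_curve_step.hyps(1) pw_curve_C1[OF pw_curve_step.hyps(3,2)]] by simp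
qed

text \<open>The set of lengths \<open>l\<close> with \<open>joins x y l\<close> is closed under concatenation and reversal, and its
  infimum is the distance. Curves on all intervals are admitted, so that no reparametrization is
  involved in concatenating them.\<close>

definition joins :: "'a \<Rightarrow> 'a \<Rightarrow> real \<Rightarrow> bool" where
  "joins x y l \<longleftrightarrow> (\<exists>a b \<gamma>. pw_curve a b \<gamma> \<and> \<gamma> a = x \<and> \<gamma> b = y \<and> len a b \<gamma> = l)"

lemma joins_refl: "joins x x 0"
  unfolding joins_def by (intro exI[of _ 0] exI[of _ 0] exI[of _ "\<lambda>_. x"]) (simp add: pw_curve.intros)

lemma joins_sym: "joins x y l \<Longrightarrow> joins y x l"
proof -
  assume "joins x y l"
  then obtain a b \<gamma> where 1: "pw_curve a b \<gamma>" "\<gamma> a = x" "\<gamma> b = y" "len a b \<gamma> = l" by (auto simp: joins_def)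
  then show "joins y x l" unfolding joins_def using pw_curve_reverse[OF 1(1)]
    by (intro exI[of _ "- b"] exI[of _ "- a"] exI[of _ "\<lambda>t. \<gamma> (- t)"]) auto
qed

lemma joins_nonneg: "joins x y l \<Longrightarrow> l \<ge> 0"
  unfolding joins_def using len_nonneg by blast

lemma joins_trans:
  assumes "joins x y l" "joins y z l'" shows "joins x z (l + l')"
proof -
  obtain a b \<gamma> where 1: "pw_curve a b \<gamma>" "\<gamma> a = x" "\<gamma> b = y" "len a b \<gamma> = l" using assms(1) by (auto simp: joins_def)
  obtain a' b' \<gamma>' where 2: "pw_curve a' b' \<gamma>'" "\<gamma>' a' = y" "\<gamma>' b' = z" "len a' b' \<gamma>' = l'" using assms(2) by (auto simp: joins_def)
  define k where "k = a' - b"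
  define g where "g t = (if t \<le> b then \<gamma> t else \<gamma>' (1 * t + k))" for t
  have g1: "pw_curve a b g" "len a b g = l"
    using pw_curve_cong[OF 1(1), of g] 1 by (auto simp: g_def)
  have "pw_curve b (b' - k) (\<lambda>t. \<gamma>' (1 * t + k)) \<and> len b (b' - k) (\<lambda>t. \<gamma>' (1 * t + k)) = l'"
    using pw_curve_affine_pos[OF _ 2(1), of 1 k] 2 by (simp add: k_def)
  then have g2: "pw_curve b (b' - k) g" "len b (b' - k) g = l'"
  proof -
    assume *: "pw_curve b (b' - k) (\<lambda>t. \<gamma>' (1 * t + k)) \<and> len b (b' - k) (\<lambda>t. \<gamma>' (1 * t + k)) = l'"
    have eq: "\<gamma>' (1 * t + k) = g t" if "t \<in> {b..b' - k}" for t
      using that 1(3) 2(2) by (cases "t = b") (auto simp: g_def k_def)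
    show "pw_curve b (b' - k) g" "len b (b' - k) g = l'"
      using pw_curve_cong[OF conjunct1[OF *] eq] * by auto
  qed
  have "b \<le> b' - k" "a \<le> b" using pw_curve_le g2 g1 by auto
  then have "g a = x" "g (b' - k) = z" using 1 2 by (auto simp: g_def k_def)
  then show ?thesis unfolding joins_def
    using pw_curve_trans[OF g2(1) g1(1)] len_add[OF g1(1) g2(1)] g1 g2 by blast
qed

text \<open>A curve on an interval of positive length is rescaled to the unit interval, and a curve on a single
  point is replaced by a constant one.\<close>

lemma rdist_eq_Inf_joins: "rdist M x y = Inf {l. joins x y l}"
proof -
  have "(\<exists>\<gamma>. l = curve_length M \<gamma> \<and> piecewise_C1_curve M \<gamma> \<and> \<gamma> 0 = x \<and> \<gamma> 1 = y) \<longleftrightarrow> joins x y l" for l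
  proof
    assume "\<exists>\<gamma>. l = curve_length M \<gamma> \<and> piecewise_C1_curve M \<gamma> \<and> \<gamma> 0 = x \<and> \<gamma> 1 = y"
    then show "joins x y l" unfolding joins_def piecewise_C1_curve_iff curve_length_def len_def by blast
  next
    assume "joins x y l"
    then obtain a b \<gamma> where 1: "pw_curve a b \<gamma>" "\<gamma> a = x" "\<gamma> b = y" "len a b \<gamma> = l" by (auto simp: joins_def)
    have "\<exists>\<gamma>. pw_curve 0 1 \<gamma> \<and> \<gamma> 0 = x \<and> \<gamma> 1 = y \<and> len 0 1 \<gamma> = l"
    proof (cases "a = b")
      case False
      then have ab: "b - a > 0" using pw_curve_le[OF 1(1)] by simp
      show ?thesis
        using pw_curve_affine_pos[OF ab 1(1), of a] ab 1 by (intro exI[of _ "\<lambda>t. \<gamma> ((b - a) * t + a)"]) auto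
    next
      case True
      obtain d where d: "d \<in> atlas M" "x \<in> dom d" using chart_cover by blast
      have der: "(coord c \<circ> (\<lambda>_. x) has_vector_derivative 0) (at t within {0..1})" for c t
        by (auto simp: o_def)
      then have C1: "C1_curve_on M 0 1 (\<lambda>_. x)" unfolding C1_curve_on_def
        by (auto intro!: exI[of _ "\<lambda>_. 0"])
      have "speed_within 0 1 (\<lambda>_. x) t = 0" if "t \<in> {0..1}" for t
        using speed_within_eq[OF zero_less_one _ that d der] by (simp add: metric_in_def)
      then have "len 0 1 (\<lambda>_. x) = 0"
        using speed_has_integral_C1[OF zero_less_one C1] unfolding len_def
        by (metis (no_types, lifting) integral_cong integral_unique integral_0)
      then show ?thesis using pw_curve_C1[OF C1] True 1 by (intro exI[of _ "\<lambda>_. x"]) auto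
    qed
    then show "\<exists>\<gamma>. l = curve_length M \<gamma> \<and> piecewise_C1_curve M \<gamma> \<and> \<gamma> 0 = x \<and> \<gamma> 1 = y"
      unfolding piecewise_C1_curve_iff curve_length_def len_def by auto
  qed
  then show ?thesis unfolding rdist_def by presburger
qed

text \<open>The segment from \<open>x\<close> to \<open>y\<close> in coordinates has constant coordinate velocity \<open>y - x\<close>.\<close>

lemma joins_segment:
  assumes c: "c \<in> atlas M" and seg: "closed_segment x y \<subseteq> coord c ` dom c"
    and b: "\<And>z. z \<in> closed_segment x y \<Longrightarrow> sqrt (metric_in M c (param c z) (y - x) (y - x)) \<le> L"
  shows "\<exists>l\<le>L. joins (param c x) (param c y) l"
proof -
  define \<gamma> where "\<gamma> t = param c (x + t *\<^sub>R (y - x))" for t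
  have sg: "x + t *\<^sub>R (y - x) \<in> closed_segment x y" if "t \<in> {0..1}" for t
    using that by (auto simp: closed_segment_def algebra_simps intro!: exI[of _ t])
  have \<gamma>d: "\<gamma> t \<in> dom c" "coord c (\<gamma> t) = x + t *\<^sub>R (y - x)" if "t \<in> {0..1}" for t
    unfolding \<gamma>_def using sg[OF that] seg param_in_dom[OF c] coord_param[OF c] by auto
  have cont: "continuous_on {0..1} \<gamma>" unfolding \<gamma>_def
    by (rule continuous_on_compose2[OF continuous_on_param[OF c]]) (use sg seg in \<open>auto intro!: continuous_intros\<close>)
  have der: "(coord c \<circ> \<gamma> has_vector_derivative (y - x)) (at t within {0..1})" if t: "t \<in> {0..1}" for t
  proof (rule has_vector_derivative_transform[OF t])
    show "((\<lambda>t. x + t *\<^sub>R (y - x)) has_vector_derivative (y - x)) (at t within {0..1})"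
      by (auto intro!: derivative_eq_intros)
  qed (use \<gamma>d in auto)
  have C1: "C1_curve_on M 0 1 \<gamma>" unfolding C1_curve_on_def
  proof (intro conjI ballI cont)
    fix d assume d: "d \<in> atlas M"
    show "\<exists>v. continuous_on {t \<in> {0..1}. \<gamma> t \<in> dom d} v \<and>
      (\<forall>t\<in>{0..1}. \<gamma> t \<in> dom d \<longrightarrow> (coord d \<circ> \<gamma> has_vector_derivative v t) (at t within {0..1}))"
    proof (intro exI[of _ "\<lambda>t. jac c d (\<gamma> t) *v (y - x)"] conjI ballI impI)
      show "continuous_on {t \<in> {0..1}. \<gamma> t \<in> dom d} (\<lambda>t. jac c d (\<gamma> t) *v (y - x))"
        by (rule continuous_on_compose2[OF continuous_on_jac[OF c d] continuous_on_subset[OF cont]]) (use \<gamma>d in auto)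
      show "(coord d \<circ> \<gamma> has_vector_derivative jac c d (\<gamma> t) *v (y - x)) (at t within {0..1})"
        if "t \<in> {0..1}" "\<gamma> t \<in> dom d" for t
        by (rule vector_derivative_change[OF cont that(1) c \<gamma>d(1) d that(2) der]) (use that in auto)
    qed
  qed
  have sp: "speed_within 0 1 \<gamma> t \<le> L" if t: "t \<in> {0..1}" for t
    using speed_within_eq[OF zero_less_one cont t c \<gamma>d(1)[OF t] der[OF t]] b[OF sg[OF t]] by (simp add: \<gamma>_def)
  have "len 0 1 \<gamma> = integral {0..1} (speed_within 0 1 \<gamma>)"
    unfolding len_def using speed_has_integral_C1[OF zero_less_one C1] by blast
  also have "\<dots> \<le> integral {0..1} (\<lambda>_::real. L)"
    by (rule integral_le) (use sp integrable_continuous_real[OF continuous_on_speed_within[OF zero_less_one C1]] in auto)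
  finally have "len 0 1 \<gamma> \<le> L" by simp
  moreover have "\<gamma> 0 = param c x" "\<gamma> 1 = param c y" by (simp_all add: \<gamma>_def)
  ultimately show ?thesis unfolding joins_def using pw_curve_C1[OF C1 zero_less_one] by blast
qed

text \<open>A curve inside a chart is at least as long as the coordinate distance of its end points,
  up to the constant that compares the metric with the Euclidean one.\<close>

lemma len_lower_bound:
  assumes c: "c \<in> atlas M" and l: "l > 0"
    and b: "\<And>z v. z \<in> B \<Longrightarrow> l * norm v \<le> sqrt (metric_in M c z v v)" and B: "B \<subseteq> dom c"
  shows "pw_curve a b \<gamma> \<Longrightarrow> (\<And>t. t \<in> {a..b} \<Longrightarrow> \<gamma> t \<in> B) \<Longrightarrow>
    l * norm (coord c (\<gamma> b) - coord c (\<gamma> a)) \<le> len a b \<gamma>"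
proof (induction rule: pw_curve.induct)
  case (pw_curve_step a b \<gamma> d)
  have ab: "a \<le> b" using pw_curve_le pw_curve_step by blast
  have in_B: "\<gamma> t \<in> B" if "t \<in> {b..d}" for t using pw_curve_step.prems that ab by auto
  obtain v where v: "continuous_on {t \<in> {b..d}. \<gamma> t \<in> dom c} v"
    "\<And>t. t\<in>{b..d} \<Longrightarrow> \<gamma> t \<in> dom c \<Longrightarrow> (coord c \<circ> \<gamma> has_vector_derivative v t) (at t within {b..d})"
    using pw_curve_step.hyps c unfolding C1_curve_on_def by blast
  have S: "{t \<in> {b..d}. \<gamma> t \<in> dom c} = {b..d}" using in_B B by auto
  have v': "continuous_on {b..d} v" using v(1) unfolding S .
  have cont: "continuous_on {b..d} \<gamma>" using pw_curve_step.hyps by (simp add: C1_curve_on_def)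
  have ftc: "(v has_integral (coord c \<circ> \<gamma>) d - (coord c \<circ> \<gamma>) b) {b..d}"
  proof (rule fundamental_theorem_of_calculus)
    show "b \<le> d" using pw_curve_step by simp
    show "(coord c \<circ> \<gamma> has_vector_derivative v t) (at t within {b..d})" if "t \<in> {b..d}" for t
      by (rule v(2)[OF that]) (use in_B[OF that] B in auto)
  qed
  have "norm (integral {b..d} v) \<le> integral {b..d} (\<lambda>t. speed_within b d \<gamma> t / l)"
  proof (rule integral_norm_bound_integral)
    show "v integrable_on {b..d}" using ftc by blast
    show "(\<lambda>t. speed_within b d \<gamma> t / l) integrable_on {b..d}"
      using continuous_on_speed_within[OF pw_curve_step.hyps(2,3)] l
      by (intro integrable_continuous_real continuous_intros) auto
    show "norm (v t) \<le> speed_within b d \<gamma> t / l" if t: "t \<in> {b..d}" for t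
      using b[OF in_B[OF t], of "v t"] speed_within_eq[OF pw_curve_step.hyps(2) cont t c _ v(2)[OF t]] in_B[OF t] B l
      by (auto simp: field_simps subset_iff)
  qed
  also have "integral {b..d} v = coord c (\<gamma> d) - coord c (\<gamma> b)" using ftc by (simp add: integral_unique)
  also have "integral {b..d} (\<lambda>t. speed_within b d \<gamma> t / l) = integral {b..d} (speed_within b d \<gamma>) / l"
    by simp
  also have "integral {b..d} (speed_within b d \<gamma>) = len b d \<gamma>"
    unfolding len_def using speed_has_integral_C1[OF pw_curve_step.hyps(2,3)] by (simp add: integral_unique)
  finally have 2: "l * norm (coord c (\<gamma> d) - coord c (\<gamma> b)) \<le> len b d \<gamma>" using l by (simp add: field_simps)
  have 1: "l * norm (coord c (\<gamma> b) - coord c (\<gamma> a)) \<le> len a b \<gamma>"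
    using pw_curve_step.IH pw_curve_step.prems pw_curve_step.hyps(2) by auto
  have "norm (coord c (\<gamma> d) - coord c (\<gamma> a)) \<le> norm (coord c (\<gamma> d) - coord c (\<gamma> b)) + norm (coord c (\<gamma> b) - coord c (\<gamma> a))"
    using norm_triangle_ineq[of "coord c (\<gamma> d) - coord c (\<gamma> b)" "coord c (\<gamma> b) - coord c (\<gamma> a)"] by simp
  then have "l * norm (coord c (\<gamma> d) - coord c (\<gamma> a)) \<le> l * norm (coord c (\<gamma> d) - coord c (\<gamma> b)) + l * norm (coord c (\<gamma> b) - coord c (\<gamma> a))"
    using l by (simp add: distrib_left[symmetric])
  also have "\<dots> \<le> len a d \<gamma>"
    using 1 2 len_add[OF pw_curve_step.hyps(1) pw_curve_C1[OF pw_curve_step.hyps(3,2)]] by simp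
  finally show ?case .
qed simp

text \<open>To leave a coordinate ball, a curve has to cross it.\<close>

lemma len_exit_ball:
  assumes c: "c \<in> atlas M" and p: "p \<in> dom c" and l: "l > 0" and e: "e > 0"
    and sub: "cball (coord c p) e \<subseteq> coord c ` dom c"
    and b: "\<And>z v. z \<in> param c ` cball (coord c p) e \<Longrightarrow> l * norm v \<le> sqrt (metric_in M c z v v)"
    and \<gamma>: "pw_curve a d \<gamma>" "\<gamma> a = p" "\<gamma> d \<notin> param c ` ball (coord c p) e"
  shows "l * e \<le> len a d \<gamma>"
proof -
  let ?B = "param c ` ball (coord c p) e" let ?K = "param c ` cball (coord c p) e"
  have oB: "open ?B" by (rule open_param_image[OF c open_ball]) (use sub in auto)
  have cK: "closed ?K" by (rule compact_imp_closed[OF compact_param_image[OF c compact_cball sub]])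
  have Kd: "?K \<subseteq> dom c" using sub param_in_dom[OF c] by auto
  have ad: "a \<le> d" using pw_curve_le[OF \<gamma>(1)] .
  have cont: "continuous_on {a..d} \<gamma>" by (rule pw_curve_continuous[OF \<gamma>(1)])
  define S where "S = {a..d} \<inter> \<gamma> -` (- ?B)"
  have clS: "closed S" unfolding S_def using continuous_closed_preimage[OF cont] oB by auto
  have S: "S \<noteq> {}" "bdd_below S" using \<gamma>(3) ad by (auto simp: S_def intro: bdd_belowI[of _ a])
  (* The time of the first exit from the open coordinate ball. *)
  define T where "T = Inf S"
  have TS: "T \<in> S" unfolding T_def by (rule closed_contains_Inf[OF S clS])
  have before: "\<gamma> t \<in> ?B" if "t \<in> {a..<T}" for t
  proof (rule ccontr)
    assume "\<gamma> t \<notin> ?B"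
    then have "t \<in> S" using that TS by (auto simp: S_def)
    then show False using cInf_lower[OF _ S(2), of t] that by (simp add: T_def)
  qed
  have "p \<in> ?B" using p e c by (metis centre_in_ball image_eqI param_coord)
  then have aT: "a < T" using TS \<gamma>(2) by (cases "a = T") (auto simp: S_def)
  have "\<gamma> T \<in> ?K"
  proof -
    have "closure {a..<T} = {a..T}" using aT by (simp add: closure_atLeastLessThan)
    then have "continuous_on (closure {a..<T}) \<gamma>"
      using TS by (auto simp: S_def intro: continuous_on_subset[OF cont])
    then have "\<gamma> ` closure {a..<T} \<subseteq> ?K"
    proof (rule image_closure_subset[OF _ cK])
      show "\<gamma> ` {a..<T} \<subseteq> ?K" using before image_mono[OF ball_subset_cball, of "param c"] by blast
    qed
    then have "\<gamma> ` {a..T} \<subseteq> ?K" using aT by (simp add: closure_atLeastLessThan)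
    then show ?thesis using aT by (meson atLeastAtMost_iff image_subset_iff less_imp_le order_refl)
  qed
  then obtain x where x: "x \<in> cball (coord c p) e" "\<gamma> T = param c x" by auto
  have "x \<notin> ball (coord c p) e" using TS x by (auto simp: S_def)
  then have nx: "norm (x - coord c p) = e" using x by (simp add: dist_norm norm_minus_commute)
  have split: "pw_curve a T \<gamma>" "pw_curve T d \<gamma>" using pw_curve_split[OF \<gamma>(1), of T] aT TS by (auto simp: S_def)
  have "l * norm (coord c (\<gamma> T) - coord c (\<gamma> a)) \<le> len a T \<gamma>"
  proof (rule len_lower_bound[OF c l b Kd split(1)])
    fix t assume t: "t \<in> {a..T}"
    show "\<gamma> t \<in> ?K"
    proof (cases "t = T")
      case False
      then have "\<gamma> t \<in> ?B" using before t by auto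
      then show ?thesis using ball_subset_cball by blast
    qed (use \<open>\<gamma> T \<in> ?K\<close> in simp)
  qed
  moreover have "coord c (\<gamma> T) = x" using x sub coord_param[OF c] by auto
  ultimately have "l * e \<le> len a T \<gamma>" using nx \<gamma>(2) by simp
  then show ?thesis using len_add[OF split] len_nonneg[OF split(2)] by simp
qed

end

section \<open>The Riemannian distance\<close>

context riemannian begin

text \<open>On a small coordinate ball the metric is comparable with the Euclidean one, and with itself
  at different points up to a factor close to one.\<close>

lemma metric_bounds:
  assumes c: "c \<in> atlas M" and p: "p \<in> dom c" "p \<in> W" and W: "open W" and \<epsilon>: "\<epsilon> > 0"
  obtains e l L where "e > 0" "l > 0" "L > 0" "cball (coord c p) e \<subseteq> coord c ` (dom c \<inter> W)"
    "\<And>x v. x \<in> cball (coord c p) e \<Longrightarrow> l * norm v \<le> sqrt (metric_in M c (param c x) v v)"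
    "\<And>x v. x \<in> cball (coord c p) e \<Longrightarrow> sqrt (metric_in M c (param c x) v v) \<le> L * norm v"
    "\<And>x y v. x \<in> cball (coord c p) e \<Longrightarrow> y \<in> cball (coord c p) e \<Longrightarrow>
      sqrt (metric_in M c (param c x) v v) \<le> (1 + \<epsilon>) * sqrt (metric_in M c (param c y) v v)"
proof -
  obtain e0 where e0: "e0 > 0" "cball (coord c p) e0 \<subseteq> coord c ` (dom c \<inter> W)"
    by (rule coord_ball[OF c p W])
  define Q where "Q x v = metric_in M c (param c x) v v" for x v
  let ?B = "cball (coord c p) e0" let ?S = "sphere (0::real^'m) 1"
  have Bd: "?B \<subseteq> coord c ` dom c" using e0 by auto
  (* By homogeneity all bounds follow from compactness of the product of the ball and the unit sphere. *)
  have Qc: "continuous_on (?B \<times> ?S) (\<lambda>(x, v). Q x v)"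
    unfolding Q_def metric_in_def split_beta
    by (intro continuous_intros continuous_on_matrix_vector_mult
        continuous_on_compose2[OF Ck_on_imp_continuous_on[OF Ck_on_gram[OF c, of 0]]]) (use Bd in auto)
  have cp: "compact (?B \<times> ?S)" by (intro compact_Times) auto
  have ne: "?B \<times> ?S \<noteq> {}"
  proof -
    have "(coord c p, axis undefined 1) \<in> ?B \<times> ?S" using e0(1) by simp
    then show ?thesis by blast
  qed
  obtain z where z: "z \<in> ?B \<times> ?S" "\<And>y. y \<in> ?B \<times> ?S \<Longrightarrow> (\<lambda>(x, v). Q x v) z \<le> (\<lambda>(x, v). Q x v) y"
    using continuous_attains_inf[OF cp ne Qc] by blast
  obtain z' where z': "z' \<in> ?B \<times> ?S" "\<And>y. y \<in> ?B \<times> ?S \<Longrightarrow> (\<lambda>(x, v). Q x v) y \<le> (\<lambda>(x, v). Q x v) z'"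
    using continuous_attains_sup[OF cp ne Qc] by blast
  define l2 where "l2 = (\<lambda>(x, v). Q x v) z"
  define L2 where "L2 = (\<lambda>(x, v). Q x v) z'"
  have Qpos: "Q x v > 0" if "x \<in> ?B" "v \<noteq> 0" for x v
    unfolding Q_def metric_in_def using gram_pos[OF c param_in_dom[OF c]] that Bd by auto
  have l2: "l2 > 0" using z(1) Qpos[of "fst z" "snd z"] norm_zero by (force simp: l2_def split_beta)
  have L2: "L2 > 0" using z'(1) Qpos[of "fst z'" "snd z'"] norm_zero by (force simp: L2_def split_beta)
  have hom: "Q x v = (norm v)\<^sup>2 * Q x (v /\<^sub>R norm v)" if "v \<noteq> 0" for x v
    using that by (simp add: Q_def metric_in_def matrix_vector_mult_scaleR power2_eq_square field_simps)
  have nS: "v /\<^sub>R norm v \<in> ?S" if "v \<noteq> 0" for v :: "real^'m" using that by simp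
  have lo: "sqrt l2 * norm v \<le> sqrt (Q x v)" if x: "x \<in> ?B" for x v
  proof (cases "v = 0")
    case False
    have "l2 \<le> Q x (v /\<^sub>R norm v)" using z(2)[of "(x, v /\<^sub>R norm v)"] x nS[OF False] by (simp add: l2_def)
    then have "(norm v)\<^sup>2 * l2 \<le> Q x v" unfolding hom[OF False] by (intro mult_left_mono) auto
    then have "sqrt ((norm v)\<^sup>2 * l2) \<le> sqrt (Q x v)" by (rule real_sqrt_le_mono)
    then show ?thesis by (simp add: real_sqrt_mult mult.commute)
  qed (simp add: Q_def metric_in_def)
  have hi: "sqrt (Q x v) \<le> sqrt L2 * norm v" if x: "x \<in> ?B" for x v
  proof (cases "v = 0")
    case False
    have "Q x (v /\<^sub>R norm v) \<le> L2" using z'(2)[of "(x, v /\<^sub>R norm v)"] x nS[OF False] by (simp add: L2_def)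
    then have "Q x v \<le> (norm v)\<^sup>2 * L2" unfolding hom[OF False] by (intro mult_left_mono) auto
    then have "sqrt (Q x v) \<le> sqrt ((norm v)\<^sup>2 * L2)" by (rule real_sqrt_le_mono)
    then show ?thesis by (simp add: real_sqrt_mult mult.commute)
  qed (simp add: Q_def metric_in_def)
  define f where "f = (\<lambda>(x, v). Q x v)"
  have "uniformly_continuous_on (?B \<times> ?S) f"
    unfolding f_def by (rule compact_uniformly_continuous[OF Qc cp])
  moreover have "\<epsilon> * l2 > 0" using \<epsilon> l2 by simp
  ultimately have "\<exists>\<delta>>0. \<forall>y\<in>?B \<times> ?S. \<forall>y'\<in>?B \<times> ?S. dist y' y < \<delta> \<longrightarrow> dist (f y') (f y) < \<epsilon> * l2"
    unfolding uniformly_continuous_on_def by (simp only:)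
  then obtain \<delta> where d: "\<delta> > 0"
    "\<forall>y\<in>?B \<times> ?S. \<forall>y'\<in>?B \<times> ?S. dist y' y < \<delta> \<longrightarrow> dist (f y') (f y) < \<epsilon> * l2"
    by (elim exE conjE) (rule that)
  note \<delta> = d(1) d(2)[rule_format]
  define e where "e = min e0 (\<delta> / 3)"
  have e: "e > 0" "e \<le> e0" "2 * e < \<delta>" using e0 \<delta>(1) by (auto simp: e_def)
  have sub: "cball (coord c p) e \<subseteq> ?B" using e by auto
  have ratio: "sqrt (Q x v) \<le> (1 + \<epsilon>) * sqrt (Q y v)"
    if x: "x \<in> cball (coord c p) e" and y: "y \<in> cball (coord c p) e" for x y v
  proof (cases "v = 0")
    case False
    let ?w = "v /\<^sub>R norm v"
    have "dist x y \<le> 2 * e" using x y dist_triangle_le[of x "coord c p" y "2*e"] by (simp add: dist_commute)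
    then have "dist (x, ?w) (y, ?w) < \<delta>" using e by (simp add: dist_Pair_Pair)
    then have "Q x ?w < Q y ?w + \<epsilon> * l2"
      using \<delta>(2)[of "(y, ?w)" "(x, ?w)"] x y e(2) nS[OF False] by (auto simp: dist_real_def f_def)
    also have "\<epsilon> * l2 \<le> \<epsilon> * Q y ?w"
      using z(2)[of "(y, ?w)"] y sub nS[OF False] \<epsilon> by (auto simp: l2_def)
    also have "Q y ?w + \<epsilon> * Q y ?w \<le> (1 + \<epsilon>)\<^sup>2 * Q y ?w"
    proof -
      have "Q y ?w \<ge> 0" using Qpos[of y ?w] y sub False by auto
      then show ?thesis using \<epsilon> by (simp add: power2_eq_square algebra_simps)
    qed
    finally have "(norm v)\<^sup>2 * Q x ?w \<le> (norm v)\<^sup>2 * ((1 + \<epsilon>)\<^sup>2 * Q y ?w)"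
      by (intro mult_left_mono) auto
    then have "Q x v \<le> (1 + \<epsilon>)\<^sup>2 * Q y v" unfolding hom[OF False] by (simp add: mult_ac)
    then have "sqrt (Q x v) \<le> sqrt ((1 + \<epsilon>)\<^sup>2 * Q y v)" by (rule real_sqrt_le_mono)
    then show ?thesis using \<epsilon> by (simp add: real_sqrt_mult)
  qed (simp add: Q_def metric_in_def)
  show ?thesis
    by (rule that[of e "sqrt l2" "sqrt L2"]) (use e l2 L2 e0 sub lo hi ratio in \<open>auto simp: Q_def\<close>)
qed

end

locale connected_riemannian = riemannian +
  assumes connected: "connected (UNIV :: 'a set)"
begin

lemma locally_joined:
  obtains W where "open W" "p \<in> W" "\<And>q. q \<in> W \<Longrightarrow> \<exists>l. joins p q l"
proof -
  obtain c where c: "c \<in> atlas M" "p \<in> dom c" using chart_cover by blast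
  obtain e l L where e: "e > 0" "L > 0" "cball (coord c p) e \<subseteq> coord c ` (dom c \<inter> UNIV)"
    "\<And>x v. x \<in> cball (coord c p) e \<Longrightarrow> sqrt (metric_in M c (param c x) v v) \<le> L * norm v"
    by (rule metric_bounds[OF c UNIV_I open_UNIV zero_less_one]) blast
  show ?thesis
  proof (rule that[of "param c ` ball (coord c p) e"])
    show "open (param c ` ball (coord c p) e)" by (rule open_param_image[OF c(1)]) (use e in auto)
    show "p \<in> param c ` ball (coord c p) e" using c e(1) by (metis centre_in_ball image_eqI param_coord)
    fix q assume "q \<in> param c ` ball (coord c p) e"
    then obtain x where x: "x \<in> ball (coord c p) e" "q = param c x" by auto
    have seg: "closed_segment (coord c p) x \<subseteq> cball (coord c p) e"
      using x(1) e(1) by (intro closed_segment_subset) auto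
    have "\<exists>l\<le>L * norm (x - coord c p). joins (param c (coord c p)) (param c x) l"
      by (rule joins_segment[OF c(1)]) (use seg e in blast)+
    then show "\<exists>l. joins p q l" using x c by auto
  qed
qed

text \<open>Being joined by a curve is an equivalence relation with open classes.\<close>

lemma ex_joins: "\<exists>l. joins x y l"
proof (rule connected_equivalence_relation[OF connected UNIV_I UNIV_I, where R="\<lambda>x y. \<exists>l. joins x y l"])
  fix a show "\<exists>T. openin (top_of_set UNIV) T \<and> a \<in> T \<and> (\<forall>x\<in>T. \<exists>l. joins a x l)"
    by (rule locally_joined[of a]) auto
qed (use joins_sym joins_trans in blast)+

lemma rdist_le: "joins x y l \<Longrightarrow> rdist M x y \<le> l"
  unfolding rdist_eq_Inf_joins by (rule cInf_lower) (auto intro: joins_nonneg bdd_belowI)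

lemma rdist_ge: "(\<And>l. joins x y l \<Longrightarrow> a \<le> l) \<Longrightarrow> a \<le> rdist M x y"
  unfolding rdist_eq_Inf_joins by (rule cInf_greatest) (use ex_joins in auto)

lemma rdist_approx: "rdist M x y < a \<Longrightarrow> \<exists>l<a. joins x y l"
  by (meson not_le rdist_ge)

lemma rdist_nonneg: "0 \<le> rdist M x y" by (rule rdist_ge) (rule joins_nonneg)

lemma rdist_refl [simp]: "rdist M x x = 0"
  using rdist_le[OF joins_refl] rdist_nonneg by (metis antisym)

lemma rdist_sym: "rdist M x y = rdist M y x"
  by (intro antisym rdist_ge rdist_le) (auto intro: joins_sym)

lemma rdist_triangle: "rdist M x z \<le> rdist M x y + rdist M y z"
proof (rule field_le_epsilon)
  fix e :: real assume e: "e > 0"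
  obtain l where l: "l < rdist M x y + e/2" "joins x y l" using rdist_approx[of x y "rdist M x y + e/2"] e by auto
  obtain l' where l': "l' < rdist M y z + e/2" "joins y z l'" using rdist_approx[of y z "rdist M y z + e/2"] e by auto
  show "rdist M x z \<le> rdist M x y + rdist M y z + e" using rdist_le[OF joins_trans[OF l(2) l'(2)]] l l' by simp
qed

lemma rdist_diff_le: "\<bar>rdist M p0 x - rdist M p0 y\<bar> \<le> rdist M x y"
  using rdist_triangle[of p0 x y] rdist_triangle[of p0 y x] rdist_sym[of x y] by simp

lemma rdist_exit_ball:
  assumes c: "c \<in> atlas M" and p: "p \<in> dom c" and l: "l > 0" and e: "e > 0"
    and sub: "cball (coord c p) e \<subseteq> coord c ` dom c"
    and b: "\<And>x v. x \<in> cball (coord c p) e \<Longrightarrow> l * norm v \<le> sqrt (metric_in M c (param c x) v v)"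
    and q: "q \<notin> param c ` ball (coord c p) e"
  shows "l * e \<le> rdist M p q"
proof (rule rdist_ge)
  fix l' assume "joins p q l'"
  then obtain a d \<gamma> where "pw_curve a d \<gamma>" "\<gamma> a = p" "\<gamma> d = q" "len a d \<gamma> = l'" by (auto simp: joins_def)
  moreover have "l * norm v \<le> sqrt (metric_in M c z v v)" if "z \<in> param c ` cball (coord c p) e" for z v
    using that b by auto
  ultimately show "l * e \<le> l'" using len_exit_ball[OF c p l e sub, of a d \<gamma>] q by blast
qed

text \<open>A curve to \<open>y \<noteq> x\<close> has to leave a coordinate ball around \<open>x\<close> which avoids \<open>y\<close>.\<close>

lemma rdist_eq_0: "rdist M x y = 0 \<longleftrightarrow> x = y"
proof
  assume 0: "rdist M x y = 0"
  show "x = y"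
  proof (rule ccontr)
    assume xy: "x \<noteq> y"
    obtain c where c: "c \<in> atlas M" "x \<in> dom c" using chart_cover by blast
    have xW: "x \<in> - {y}" "open (- {y})" using xy by auto
    obtain e l L where e: "e > 0" "l > 0" "cball (coord c x) e \<subseteq> coord c ` (dom c \<inter> - {y})"
      "\<And>z v. z \<in> cball (coord c x) e \<Longrightarrow> l * norm v \<le> sqrt (metric_in M c (param c z) v v)"
      by (rule metric_bounds[OF c xW zero_less_one]) blast
    have "y \<notin> param c ` ball (coord c x) e"
    proof
      assume "y \<in> param c ` ball (coord c x) e"
      then obtain z where z: "z \<in> cball (coord c x) e" "y = param c z" using ball_subset_cball by blast
      have "z \<in> coord c ` (dom c \<inter> - {y})" using z(1) e(3) by blast
      then obtain q where "q \<in> dom c" "q \<noteq> y" "z = coord c q" by auto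
      then show False using z(2) c by simp
    qed
    from rdist_exit_ball[OF c e(2,1) _ e(4) this] e(3)
    have "l * e \<le> rdist M x y" by auto
    moreover have "l * e > 0" using e by simp
    ultimately show False using 0 by linarith
  qed
qed simp

sublocale rd: Metric_space UNIV "rdist M"
  by unfold_locales (auto simp: rdist_nonneg rdist_sym rdist_eq_0 rdist_triangle)

lemma rdist_ball_in_open:
  assumes W: "open W" "p \<in> W" shows "\<exists>r>0. \<forall>q. rdist M p q < r \<longrightarrow> q \<in> W"
proof -
  obtain c where c: "c \<in> atlas M" "p \<in> dom c" using chart_cover by blast
  obtain e l L where e: "e > 0" "l > 0" "cball (coord c p) e \<subseteq> coord c ` (dom c \<inter> W)"
    "\<And>z v. z \<in> cball (coord c p) e \<Longrightarrow> l * norm v \<le> sqrt (metric_in M c (param c z) v v)"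
    by (rule metric_bounds[OF c W(2,1) zero_less_one]) blast
  have "q \<in> W" if "rdist M p q < l * e" for q
  proof (rule ccontr)
    assume q: "q \<notin> W"
    have "q \<notin> param c ` ball (coord c p) e"
    proof
      assume "q \<in> param c ` ball (coord c p) e"
      then obtain z where z: "z \<in> cball (coord c p) e" "q = param c z" using ball_subset_cball by blast
      have "z \<in> coord c ` (dom c \<inter> W)" using z(1) e(3) by blast
      then obtain q' where "q' \<in> dom c" "q' \<in> W" "z = coord c q'" by auto
      then show False using z(2) c q by simp
    qed
    from rdist_exit_ball[OF c e(2,1) _ e(4) this] e(3) show False using that by auto
  qed
  then show ?thesis using e by (intro exI[of _ "l * e"]) auto
qed

lemma rdist_small_nbhd:
  assumes r: "r > 0" obtains W where "open W" "p \<in> W" "\<And>q. q \<in> W \<Longrightarrow> rdist M p q < r"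
proof -
  obtain c where c: "c \<in> atlas M" "p \<in> dom c" using chart_cover by blast
  obtain e l L where e: "e > 0" "L > 0" "cball (coord c p) e \<subseteq> coord c ` (dom c \<inter> UNIV)"
    "\<And>x v. x \<in> cball (coord c p) e \<Longrightarrow> sqrt (metric_in M c (param c x) v v) \<le> L * norm v"
    by (rule metric_bounds[OF c UNIV_I open_UNIV zero_less_one]) blast
  define e' where "e' = min e (r / L)"
  have e': "e' > 0" "e' \<le> e" "L * e' \<le> r" using e r by (auto simp: e'_def min_def field_simps)
  show ?thesis
  proof (rule that[of "param c ` ball (coord c p) e'"])
    show "open (param c ` ball (coord c p) e')" by (rule open_param_image[OF c(1)]) (use e e' in auto)
    show "p \<in> param c ` ball (coord c p) e'" using c e'(1) by (metis centre_in_ball image_eqI param_coord)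
    fix q assume "q \<in> param c ` ball (coord c p) e'"
    then obtain x where x: "x \<in> ball (coord c p) e'" "q = param c x" by auto
    have seg: "closed_segment (coord c p) x \<subseteq> cball (coord c p) e"
      using x(1) e(1) e' by (intro closed_segment_subset) auto
    have "\<exists>l\<le>L * norm (x - coord c p). joins (param c (coord c p)) (param c x) l"
      by (rule joins_segment[OF c(1)]) (use seg e in blast)+
    then have "rdist M p q \<le> L * norm (x - coord c p)" using x c rdist_le by fastforce
    also have "\<dots> < L * e'" using x e by (simp add: dist_norm norm_minus_commute)
    finally show "rdist M p q < r" using e' by simp
  qed
qed

lemma open_rdist_ball: "open {q. rdist M p q < r}"
proof (rule Topological_Spaces.openI)
  fix q assume "q \<in> {q. rdist M p q < r}"
  then have r: "r - rdist M p q > 0" by simp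
  obtain W where W: "open W" "q \<in> W" "\<And>z. z \<in> W \<Longrightarrow> rdist M q z < r - rdist M p q"
    by (rule rdist_small_nbhd[OF r]) blast
  have "W \<subseteq> {q. rdist M p q < r}"
  proof
    fix z assume "z \<in> W"
    then show "z \<in> {q. rdist M p q < r}" using W(3)[of z] rdist_triangle[of p z q] by simp
  qed
  then show "\<exists>T. open T \<and> q \<in> T \<and> T \<subseteq> {q. rdist M p q < r}" using W by blast
qed

lemma mtopology_eq_euclidean: "rd.mtopology = euclidean"
proof -
  have "openin rd.mtopology W \<longleftrightarrow> open W" for W
  proof
    assume W: "openin rd.mtopology W"
    show "open W"
    proof (rule Topological_Spaces.openI)
      fix p assume "p \<in> W"
      then obtain r where "r > 0" "rd.mball p r \<subseteq> W" using W by (auto simp: rd.openin_mtopology)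
      then show "\<exists>T. open T \<and> p \<in> T \<and> T \<subseteq> W" using open_rdist_ball[of p r]
        by (intro exI[of _ "{q. rdist M p q < r}"]) (auto simp: rd.mball_def)
    qed
  next
    assume W: "open W"
    show "openin rd.mtopology W" unfolding rd.openin_mtopology
      using rdist_ball_in_open[OF W] by (fastforce simp: rd.mball_def)
  qed
  then show ?thesis by (simp add: topology_eq)
qed

lemma continuous_on_rdist: "continuous_on S (rdist M p)"
proof -
  have "isCont (rdist M p) q" for q
    unfolding isCont_def tendsto_iff
  proof (intro allI impI)
    fix e :: real assume e: "e > 0"
    show "\<forall>\<^sub>F x in at q. dist (rdist M p x) (rdist M p q) < e"
      unfolding eventually_at_topological
    proof (intro exI conjI ballI impI)
      show "open {x. rdist M q x < e}" by (rule open_rdist_ball)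
      fix x assume "x \<in> {x. rdist M q x < e}"
      then show "dist (rdist M p x) (rdist M p q) < e"
        using rdist_diff_le[of p x q] rdist_sym[of q x] by (simp add: dist_real_def)
    qed (use e in simp)
  qed
  then show ?thesis by (simp add: continuous_at_imp_continuous_on)
qed

lemma closed_rdist_cball: "closed {q. rdist M p q \<le> r}"
  by (intro closed_Collect_le continuous_on_rdist continuous_on_const)

text \<open>The distance is a length metric: the radius of a ball can be reached in the direction of any
  farther point at almost no extra cost.\<close>

lemma rdist_intermediate:
  assumes R: "0 \<le> R" "R \<le> rdist M p x" and e: "e > 0"
  obtains y where "rdist M p y = R" "rdist M y x < rdist M p x - R + e"
proof -
  obtain l where l: "l < rdist M p x + e" "joins p x l" using rdist_approx[of p x "rdist M p x + e"] e by auto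
  then obtain a d \<gamma> where \<gamma>: "pw_curve a d \<gamma>" "\<gamma> a = p" "\<gamma> d = x" "len a d \<gamma> = l" by (auto simp: joins_def)
  have "continuous_on {a..d} (\<lambda>t. rdist M p (\<gamma> t))"
    by (rule continuous_on_compose2[OF continuous_on_rdist[of UNIV] pw_curve_continuous[OF \<gamma>(1)]]) auto
  then obtain t where t: "a \<le> t" "t \<le> d" "rdist M p (\<gamma> t) = R"
    using IVT'[of "\<lambda>t. rdist M p (\<gamma> t)" a R d] \<gamma> R pw_curve_le[OF \<gamma>(1)] by auto
  have s: "pw_curve a t \<gamma>" "pw_curve t d \<gamma>" using pw_curve_split[OF \<gamma>(1) t(1,2)] by auto
  have "joins p (\<gamma> t) (len a t \<gamma>)" "joins (\<gamma> t) x (len t d \<gamma>)" using s \<gamma> by (auto simp: joins_def)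
  then have "R \<le> len a t \<gamma>" "rdist M (\<gamma> t) x \<le> len t d \<gamma>" using rdist_le t(3) by fastforce+
  then have "rdist M (\<gamma> t) x < rdist M p x - R + e" using len_add[OF s] \<gamma>(4) l(1) by linarith
  then show ?thesis using that t(3) by blast
qed

lemma locally_compact_nbhd: fixes p :: 'a obtains W K where "open W" "p \<in> W" "W \<subseteq> K" "compact K"
proof -
  obtain c where c: "c \<in> atlas M" "p \<in> dom c" using chart_cover by blast
  obtain e where e: "e > 0" "cball (coord c p) e \<subseteq> coord c ` (dom c \<inter> UNIV)"
    by (rule coord_ball[OF c UNIV_I open_UNIV]) blast
  show ?thesis
  proof (rule that[of "param c ` ball (coord c p) e" "param c ` cball (coord c p) e"])
    show "open (param c ` ball (coord c p) e)" by (rule open_param_image[OF c(1)]) (use e in auto)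
    show "p \<in> param c ` ball (coord c p) e" using c e(1) by (metis centre_in_ball image_eqI param_coord)
    show "compact (param c ` cball (coord c p) e)" by (rule compact_param_image[OF c(1)]) (use e in auto)
  qed auto
qed

end

section \<open>The Hopf-Rinow theorem\<close>

locale complete_riemannian = connected_riemannian +
  assumes complete: "complete_manifold M"
begin

text \<open>A compact ball is covered by finitely many small balls whose doubles lie in compact sets. Since the distance is a length metric, every point of a slightly larger ball is close to a
  point of the given one.\<close>

lemma compact_ball_extend:
  assumes K: "compact {q. rdist M p q \<le> R}" and R: "R \<ge> 0"
  shows "\<exists>e>0. compact {q. rdist M p q \<le> R + e}"
proof -
  let ?C = "{q. rdist M p q \<le> R}"
  have "\<forall>q::'a. \<exists>N. open (fst N) \<and> q \<in> fst N \<and> fst N \<subseteq> snd N \<and> compact (snd N)"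
  proof
    fix q :: 'a
    obtain W K where "open W" "q \<in> W" "W \<subseteq> K" "compact K" by (rule locally_compact_nbhd[of q])
    then show "\<exists>N. open (fst N) \<and> q \<in> fst N \<and> fst N \<subseteq> snd N \<and> compact (snd N)"
      by (intro exI[of _ "(W, K)"]) simp
  qed
  from choice[OF this] obtain N :: "'a \<Rightarrow> 'a set \<times> 'a set"
    where N: "\<forall>q. open (fst (N q)) \<and> q \<in> fst (N q) \<and> fst (N q) \<subseteq> snd (N q) \<and> compact (snd (N q))" ..
  define W where "W q = fst (N q)" for q
  define L where "L q = snd (N q)" for q
  have W: "open (W q)" "q \<in> W q" "W q \<subseteq> L q" "compact (L q)" for q
    using N by (simp_all add: W_def L_def)
  have "\<exists>r>0. \<forall>z. rdist M q z < 2 * r \<longrightarrow> z \<in> W q" for q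
  proof -
    obtain r where "r > 0" "\<forall>z. rdist M q z < r \<longrightarrow> z \<in> W q" using rdist_ball_in_open[OF W(1,2)] by blast
    then show ?thesis by (intro exI[of _ "r/2"]) auto
  qed
  then obtain r where r: "\<And>q. r q > 0" "\<And>q z. rdist M q z < 2 * r q \<Longrightarrow> z \<in> W q" by metis
  have cov: "?C \<subseteq> (\<Union>q\<in>?C. {z. rdist M q z < r q})" using r(1) by auto
  obtain F where F: "F \<subseteq> ?C" "finite F" "?C \<subseteq> (\<Union>q\<in>F. {z. rdist M q z < r q})"
    by (rule compactE_image[OF K open_rdist_ball cov])
  have ne: "F \<noteq> {}" using F(3) R by (metis (mono_tags, lifting) UN_E empty_iff mem_Collect_eq rdist_refl subsetD)
  define e where "e = Min (r ` F)"
  have e: "e > 0" "\<And>q. q \<in> F \<Longrightarrow> e \<le> r q" using F(2) ne r(1) by (auto simp: e_def)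
  have "{q. rdist M p q \<le> R + e / 2} \<subseteq> (\<Union>q\<in>F. L q)"
  proof
    fix x assume x: "x \<in> {q. rdist M p q \<le> R + e / 2}"
    obtain y where y: "rdist M p y \<le> R" "rdist M y x < e"
    proof (cases "rdist M p x \<le> R")
      case True then show ?thesis using that[of x] e by simp
    next
      case False
      obtain y where "rdist M p y = R" "rdist M y x < rdist M p x - R + e / 2"
        by (rule rdist_intermediate[of R p x "e / 2"]) (use R False e in auto)
      then show ?thesis using that[of y] x by simp
    qed
    then obtain q where q: "q \<in> F" "rdist M q y < r q" using F(3) by auto
    have "rdist M q x < 2 * r q" using rdist_triangle[of q x y] q y e(2)[OF q(1)] by simp
    then show "x \<in> (\<Union>q\<in>F. L q)" using r(2) W(3) q(1) by blast
  qed
  moreover have "compact (\<Union>q\<in>F. L q)" using F(2) W(4) by (intro compact_UN) auto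
  ultimately have "compact {q. rdist M p q \<le> R + e / 2}"
    using closed_rdist_cball compact_Int_closed by (metis inf.absorb_iff2)
  then show ?thesis using e(1) by (intro exI[of _ "e / 2"]) simp
qed

text \<open>Since the distance is a length metric, every point of the ball is close to a point of a smaller,
  compact ball. So the ball is totally bounded, and completeness applies.\<close>

lemma compact_ball_limit:
  assumes K: "\<And>R'. 0 \<le> R' \<Longrightarrow> R' < R \<Longrightarrow> compact {q. rdist M p q \<le> R'}" and R: "R > 0"
  shows "compact {q. rdist M p q \<le> R}"
proof -
  let ?C = "{q. rdist M p q \<le> R}"
  have "rd.mtotally_bounded ?C"
    unfolding rd.mtotally_bounded_def
  proof (intro allI impI)
    fix \<epsilon> :: real assume \<epsilon>: "\<epsilon> > 0"
    define R' where "R' = max 0 (R - \<epsilon> / 4)"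
    have R': "0 \<le> R'" "R' < R" "R - R' \<le> \<epsilon> / 4" using \<epsilon> R by (auto simp: R'_def max_def)
    have cK: "compact {q. rdist M p q \<le> R'}" by (rule K[OF R'(1,2)])
    have cov: "{q. rdist M p q \<le> R'} \<subseteq> (\<Union>q\<in>{q. rdist M p q \<le> R'}. {z. rdist M q z < \<epsilon> / 2})" using \<epsilon> by auto
    obtain F where F: "F \<subseteq> {q. rdist M p q \<le> R'}" "finite F" "{q. rdist M p q \<le> R'} \<subseteq> (\<Union>q\<in>F. {z. rdist M q z < \<epsilon> / 2})"
      by (rule compactE_image[OF cK open_rdist_ball cov])
    have "?C \<subseteq> (\<Union>q\<in>F. rd.mball q \<epsilon>)"
    proof
      fix x assume x: "x \<in> ?C"
      obtain y where y: "rdist M p y \<le> R'" "rdist M y x < \<epsilon> / 2"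
      proof (cases "rdist M p x \<le> R'")
        case True then show ?thesis using that[of x] \<epsilon> by simp
      next
        case False
        obtain y where "rdist M p y = R'" "rdist M y x < rdist M p x - R' + \<epsilon> / 4"
          by (rule rdist_intermediate[of R' p x "\<epsilon> / 4"]) (use R' False \<epsilon> in auto)
        then show ?thesis using that[of y] x R' by simp
      qed
      then obtain q where q: "q \<in> F" "rdist M q y < \<epsilon> / 2" using F(3) by auto
      have "rdist M q x < \<epsilon>" using rdist_triangle[of q x y] q y by simp
      then show "x \<in> (\<Union>q\<in>F. rd.mball q \<epsilon>)" using q(1) by (auto simp: rd.mball_def)
    qed
    moreover have "F \<subseteq> ?C" using F(1) R' by auto
    ultimately show "\<exists>K. finite K \<and> K \<subseteq> ?C \<and> ?C \<subseteq> (\<Union>x\<in>K. rd.mball x \<epsilon>)" using F(2) by blast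
  qed
  then have "compactin rd.mtopology (rd.mtopology closure_of ?C)"
    using rd.mtotally_bounded_eq_compact_closure_of complete by (simp add: complete_manifold_def)
  then show ?thesis
    unfolding mtopology_eq_euclidean using closed_rdist_cball[of p R] by (simp add: closure_closed)
qed

text \<open>The Hopf-Rinow theorem in the form of Cohn-Vossen: the set of radii of compact balls is closed by
  completeness and open by local compactness.\<close>

theorem compact_rdist_cball: "compact {q. rdist M p q \<le> R}"
proof (cases "R < 0")
  case True
  then have "{q. rdist M p q \<le> R} = {}" using rdist_nonneg by (auto simp: not_le intro: less_le_trans)
  then show ?thesis by simp
next
  case False
  define C where "C R = {q. rdist M p q \<le> R}" for R
  have down: "compact (C R')" if "compact (C R)" "R' \<le> R" for R R'
  proof -
    have "C R' = C R \<inter> C R'" using that by (auto simp: C_def)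
    then show ?thesis using compact_Int_closed[OF that(1)] closed_rdist_cball by (metis C_def)
  qed
  show ?thesis
  proof (rule ccontr)
    assume "\<not> compact {q. rdist M p q \<le> R}"
    then have RS: "R \<in> {R. R \<ge> 0 \<and> \<not> compact (C R)}" (is "_ \<in> ?S") using False by (simp add: C_def)
    define T where "T = Inf ?S"
    have bb: "bdd_below ?S" by (auto intro: bdd_belowI)
    have T0: "T \<ge> 0" unfolding T_def by (rule cInf_greatest) (use RS in auto)
    have below: "compact (C R')" if "0 \<le> R'" "R' < T" for R'
      using that cInf_lower[OF _ bb, of R'] unfolding T_def by fastforce
    have "compact (C T)"
    proof (cases "T = 0")
      case True
      have "C 0 = {p}" using rdist_nonneg rdist_eq_0 by (auto simp: C_def) (metis antisym rdist_eq_0 rdist_nonneg)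
      then show ?thesis using True by simp
    next
      case False
      then show ?thesis using compact_ball_limit[of T p] below T0 by (simp add: C_def)
    qed
    then obtain e where e: "e > 0" "compact (C (T + e))" using compact_ball_extend[of p T] T0 by (auto simp: C_def)
    obtain R' where "R' \<in> ?S" "R' < T + e"
      using cInf_lessD[of ?S "T + e"] RS e by (auto simp: T_def)
    then show False using down[OF e(2), of R'] by auto
  qed
qed

end

section \<open>Approximation in \<open>C\<^sup>1\<close>\<close>

lemma uniformly_continuous_compact_support:
  fixes f :: "'a::euclidean_space \<Rightarrow> 'b::metric_space"
  assumes f: "continuous_on UNIV f" and K: "compact K" "\<And>x. x \<notin> K \<Longrightarrow> f x = z" and e: "e > 0"
  shows "\<exists>d>0. \<forall>x y. dist x y < d \<longrightarrow> dist (f x) (f y) < e"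
proof (cases "K = {}")
  case True
  then show ?thesis using K e by (intro exI[of _ 1]) auto
next
  case False
  let ?K = "{x. infdist x K \<le> 1}"
  have cK: "compact ?K" by (rule compact_infdist_le[OF False K(1)]) simp
  have "uniformly_continuous_on ?K f"
    by (rule compact_uniformly_continuous[OF continuous_on_subset[OF f] cK]) simp
  then obtain d where d: "d > 0" "\<forall>x\<in>?K. \<forall>x'\<in>?K. dist x' x < d \<longrightarrow> dist (f x') (f x) < e"
    unfolding uniformly_continuous_on_def using e by meson
  show ?thesis
  proof (intro exI[of _ "min d 1"] conjI allI impI)
    fix x y :: 'a assume xy: "dist x y < min d 1"
    show "dist (f x) (f y) < e"
    proof (cases "x \<in> K \<or> y \<in> K")
      case True
      have "infdist x K \<le> 1" "infdist y K \<le> 1"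
        using True xy infdist_le[of x K y] infdist_le[of y K x] infdist_zero[of x K] infdist_zero[of y K]
        by (auto simp: dist_commute)
      then show ?thesis using d(2) xy by simp
    next
      case False
      then show ?thesis using K(2) e by simp
    qed
  qed (use d in simp)
qed

lemma continuous_bounded_on_compact:
  fixes f :: "'a::topological_space \<Rightarrow> real"
  assumes "continuous_on UNIV f" "compact K"
  obtains B where "\<And>x. x \<in> K \<Longrightarrow> \<bar>f x\<bar> \<le> B"
proof -
  have "bounded (f ` K)"
    by (rule compact_imp_bounded[OF compact_continuous_image[OF continuous_on_subset[OF assms(1)] assms(2)]]) simp
  then show ?thesis using that by (auto simp: bounded_iff)
qed

text \<open>By uniform continuity of the derivative, \<open>h\<close> minus its derivative at \<open>x\<close> has Lipschitz constant at
  most \<open>\<eta>\<close> on a ball around \<open>x\<close> whose radius does not depend on \<open>x\<close>.\<close>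

lemma mollify_C1:
  fixes h :: "'a::euclidean_space \<Rightarrow> real"
  assumes h: "Ck_on 1 UNIV h" and K: "compact K" "\<And>x. x \<notin> K \<Longrightarrow> h x = 0" and \<eta>: "\<eta> > 0" and r: "r > 0"
  obtains \<delta> where "\<delta> > 0" "\<delta> \<le> r" "\<And>x. \<bar>conv (moll \<delta>) h x - h x\<bar> \<le> \<eta>"
    "\<And>x D D' v. (conv (moll \<delta>) h has_derivative D) (at x) \<Longrightarrow> (h has_derivative D') (at x) \<Longrightarrow> \<bar>D v - D' v\<bar> \<le> \<eta> * norm v"
proof -
  obtain h' where h': "\<And>x. (h has_derivative h' x) (at x)" "\<And>i. i \<in> Basis \<Longrightarrow> Ck_on 0 UNIV (\<lambda>x. h' x i)"
    using Ck_on_SucE[of UNIV 0 h] h by (metis One_nat_def UNIV_I open_UNIV)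
  have hc: "continuous_on UNIV h" by (rule Ck_on_imp_continuous_on[OF h])
  have h'0: "h' x i = 0" if "x \<notin> K" for x i
  proof -
    have "(h has_derivative (\<lambda>_. 0)) (at x)"
      by (rule has_derivative_transform_within_open[OF has_derivative_const[of 0], of "- K"])
         (use that K in \<open>auto simp: compact_imp_closed\<close>)
    then show ?thesis using has_derivative_unique[OF h'(1)] by metis
  qed
  obtain d1 where d1: "d1 > 0" "\<And>x y. dist x y < d1 \<Longrightarrow> dist (h x) (h y) < \<eta>"
    using uniformly_continuous_compact_support[OF hc K \<eta>] by blast
  define \<eta>' where "\<eta>' = \<eta> / DIM('a)"
  have \<eta>': "\<eta>' > 0" using \<eta> by (simp add: \<eta>'_def)
  have "\<exists>d>0. \<forall>x y. dist x y < d \<longrightarrow> dist (h' x i) (h' y i) < \<eta>'" if "i \<in> Basis" for i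
  proof -
    have "continuous_on UNIV (\<lambda>x. h' x i)" using h'(2)[OF that] by simp
    from uniformly_continuous_compact_support[OF this K(1) h'0 \<eta>'] show ?thesis .
  qed
  then obtain dd where dd: "\<And>i. i \<in> Basis \<Longrightarrow> dd i > 0"
    "\<And>i x y. i \<in> Basis \<Longrightarrow> dist x y < dd i \<Longrightarrow> dist (h' x i) (h' y i) < \<eta>'" by metis
  define d2 where "d2 = Min (dd ` Basis)"
  have d2: "d2 > 0" "\<And>i. i \<in> Basis \<Longrightarrow> d2 \<le> dd i" using dd(1) by (auto simp: d2_def)
  have lin: "linear (h' x)" for x using h'(1) has_derivative_linear by blast
  have dh: "\<bar>h' w v - h' x v\<bar> \<le> \<eta> * norm v" if wx: "dist w x < d2" for w x v
  proof -
    have l: "linear (\<lambda>v. h' w v - h' x v)" using lin by (intro linear_compose_sub)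
    have "h' w v - h' x v = (\<Sum>i\<in>Basis. (v \<bullet> i) * (h' w i - h' x i))"
    proof -
      have "h' w v - h' x v = (\<lambda>v. h' w v - h' x v) (\<Sum>i\<in>Basis. (v \<bullet> i) *\<^sub>R i)" by (simp add: euclidean_representation)
      also have "\<dots> = (\<Sum>i\<in>Basis. (v \<bullet> i) *\<^sub>R (h' w i - h' x i))"
        unfolding linear_sum[OF l] linear_scale[OF l] ..
      finally show ?thesis by simp
    qed
    also have "\<bar>\<dots>\<bar> \<le> (\<Sum>i\<in>Basis. \<bar>(v \<bullet> i) * (h' w i - h' x i)\<bar>)" by (rule sum_abs)
    also have "\<dots> \<le> (\<Sum>i\<in>(Basis::'a set). norm v * \<eta>')"
    proof (rule sum_mono)
      fix i :: 'a assume i: "i \<in> Basis"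
      have "\<bar>h' w i - h' x i\<bar> \<le> \<eta>'" using dd(2)[OF i, of w x] d2(2)[OF i] wx by (simp add: dist_real_def)
      then show "\<bar>(v \<bullet> i) * (h' w i - h' x i)\<bar> \<le> norm v * \<eta>'"
        unfolding abs_mult by (intro mult_mono Basis_le_norm i) auto
    qed
    also have "\<dots> = \<eta> * norm v" by (simp add: \<eta>'_def)
    finally show ?thesis .
  qed
  define \<delta> where "\<delta> = min r (min (d1 / 2) (d2 / 3))"
  have \<delta>: "\<delta> > 0" "\<delta> \<le> r" "\<delta> < d1" "2 * \<delta> < d2" using r d1(1) d2(1) by (auto simp: \<delta>_def)
  show ?thesis
  proof (rule that[of \<delta>])
    show "\<bar>conv (moll \<delta>) h x - h x\<bar> \<le> \<eta>" for x
    proof (rule conv_moll_close[OF \<delta>(1) hc])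
      fix y assume "dist x y \<le> \<delta>"
      then have "dist (h y) (h x) < \<eta>" using \<delta>(3) by (intro d1(2)) (simp add: dist_commute)
      then show "\<bar>h y - h x\<bar> \<le> \<eta>" by (simp add: dist_real_def)
    qed
    fix x D D' v assume D: "(conv (moll \<delta>) h has_derivative D) (at x)" and "(h has_derivative D') (at x)"
    then have D': "D' = h' x" using has_derivative_unique h'(1) by blast
    show "\<bar>D v - D' v\<bar> \<le> \<eta> * norm v" unfolding D'
    proof (rule conv_moll_derivative_close[OF \<delta>(1) hc lin _ _ D])
      fix y z assume yz: "dist x y \<le> 2 * \<delta>" "dist x z \<le> 2 * \<delta>"
      have "norm ((h y - h' x y) - (h z - h' x z)) \<le> \<eta> * norm (y - z)"
      proof (rule differentiable_bound[where S = "cball x (2 * \<delta>)" and f' = "\<lambda>w v. h' w v - h' x v"])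
        fix w assume w: "w \<in> cball x (2 * \<delta>)"
        show "((\<lambda>y. h y - h' x y) has_derivative (\<lambda>v. h' w v - h' x v)) (at w within cball x (2 * \<delta>))"
          by (intro has_derivative_diff has_derivative_at_withinI[OF h'(1)] linear_imp_has_derivative lin)
        show "onorm (\<lambda>v. h' w v - h' x v) \<le> \<eta>"
          by (rule onorm_le) (use dh[of w x] w \<delta>(4) in \<open>auto simp: dist_commute\<close>)
      qed (use yz in auto)
      then show "\<bar>h y - h z - h' x (y - z)\<bar> \<le> \<eta> * norm (y - z)"
        using linear_diff[OF lin, of x y z] by simp
    qed auto
  qed (use \<delta> in auto)
qed

context riemannian begin

section \<open>Calculus of differentials\<close>

lemma has_differential_cong:
  assumes c: "c \<in> atlas M" and p: "p \<in> dom c" "p \<in> W" and W: "open W" and eq: "\<And>q. q \<in> W \<Longrightarrow> f q = g q"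
    and f: "has_differential c f p w"
  shows "has_differential c g p w"
  unfolding has_differential_def
  by (rule has_derivative_transform_within_open[OF f[unfolded has_differential_def] open_coord_image[OF c W]])
     (use p eq c in auto)

lemma has_differential_const: "has_differential c (\<lambda>_. a) p 0"
  by (simp add: has_differential_def o_def)

lemma has_differential_add:
  "has_differential c f p w \<Longrightarrow> has_differential c g p w' \<Longrightarrow> has_differential c (\<lambda>q. f q + g q) p (w + w')"
  unfolding has_differential_def o_def inner_add_left by (rule has_derivative_add)

lemma has_differential_sum:
  "(\<And>i. i \<in> I \<Longrightarrow> has_differential c (f i) p (w i)) \<Longrightarrow> has_differential c (\<lambda>q. \<Sum>i\<in>I. f i q) p (\<Sum>i\<in>I. w i)"
  by (induction I rule: infinite_finite_induct) (auto intro: has_differential_const has_differential_add)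

lemma has_differential_mult:
  assumes c: "c \<in> atlas M" "p \<in> dom c"
    and f: "has_differential c f p w" and g: "has_differential c g p w'"
  shows "has_differential c (\<lambda>q. f q * g q) p (f p *\<^sub>R w' + g p *\<^sub>R w)"
  using has_derivative_mult[OF f[unfolded has_differential_def] g[unfolded has_differential_def]] c
  by (simp add: has_differential_def o_def inner_add_left mult.commute)

lemma has_differential_compose:
  assumes c: "c \<in> atlas M" "p \<in> dom c"
    and f: "has_differential c f p w" and P: "(P has_real_derivative P') (at (f p))"
  shows "has_differential c (\<lambda>q. P (f q)) p (P' *\<^sub>R w)"
proof -
  have "((\<lambda>x. P ((f \<circ> param c) x)) has_derivative (\<lambda>v. P' * (w \<bullet> v))) (at (coord c p))"
    by (rule has_derivative_compose[OF f[unfolded has_differential_def]])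
       (use P c in \<open>simp add: has_field_derivative_def\<close>)
  then show ?thesis by (simp add: has_differential_def o_def)
qed

lemma has_differential_eqI:
  "has_differential c f p w \<Longrightarrow> differential c f p = w"
  unfolding differential_def by (rule has_differential_unique)

lemma differential_zero:
  assumes c: "c \<in> atlas M" and p: "p \<in> dom c" "p \<in> W" and W: "open W" and eq: "\<And>q. q \<in> W \<Longrightarrow> f q = 0"
  shows "has_differential c f p 0"
  by (rule has_differential_cong[OF c p W _ has_differential_const[of c 0]]) (simp add: eq)

lemma grad_inner_linear:
  assumes c: "c \<in> atlas M" "p \<in> dom c" and u: "has_differential c u p w"
    and f: "has_differential c f p x" and g: "has_differential c g p y" and h: "has_differential c h p (a *\<^sub>R x + b *\<^sub>R y)"
  shows "grad_inner M u h p = a * grad_inner M u f p + b * grad_inner M u g p"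
  using grad_inner_eq[OF c u f] grad_inner_eq[OF c u g] grad_inner_eq[OF c u h]
  by (simp add: dual_inner_add_right dual_inner_scaleR_right)

lemma inner_le_dual_norm:
  assumes c: "c \<in> atlas M" and p: "p \<in> dom c"
  shows "w \<bullet> v \<le> sqrt (dual_inner c p w w) * sqrt (metric_in M c p v v)"
proof -
  let ?G = "gram M c p"
  have 1: "matrix_inv ?G *v (?G *v v) = v" by (rule matrix_inv_works(1)[OF invertible_gram[OF c p]])
  have "w \<bullet> v = dual_inner c p (?G *v v) w" by (simp add: dual_inner_def 1 inner_commute)
  also have "\<dots> \<le> sqrt (dual_inner c p w w) * sqrt (dual_inner c p (?G *v v) (?G *v v))"
    using dual_inner_cauchy_schwarz[OF c p, of "?G *v v" w] by (simp add: mult.commute)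
  also have "dual_inner c p (?G *v v) (?G *v v) = metric_in M c p v v"
    by (simp add: dual_inner_def 1 metric_in_def)
  finally show ?thesis .
qed

lemma grad_norm_eq:
  "c \<in> atlas M \<Longrightarrow> p \<in> dom c \<Longrightarrow> has_differential c f p w \<Longrightarrow> grad_norm M f p = sqrt (dual_inner c p w w)"
  by (simp add: grad_norm_def grad_inner_eq)

lemma inner_le_grad_norm:
  "c \<in> atlas M \<Longrightarrow> p \<in> dom c \<Longrightarrow> has_differential c f p w \<Longrightarrow> w \<bullet> v \<le> grad_norm M f p * sqrt (metric_in M c p v v)"
  using inner_le_dual_norm[of c p w v] by (simp add: grad_norm_eq)

lemma grad_norm_le:
  "c \<in> atlas M \<Longrightarrow> p \<in> dom c \<Longrightarrow> has_differential c f p w \<Longrightarrow> C \<ge> 0 \<Longrightarrow>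
    (\<And>v. w \<bullet> v \<le> C * sqrt (metric_in M c p v v)) \<Longrightarrow> grad_norm M f p \<le> C"
  by (simp add: grad_norm_eq dual_norm_le)

lemma grad_norm_ge_0: "Ck_fun_on 1 W f \<Longrightarrow> p \<in> W \<Longrightarrow> grad_norm M f p \<ge> 0"
  unfolding grad_norm_def using grad_norm_nonneg by simp

lemma continuous_on_grad_norm: "Ck_fun_on 1 W f \<Longrightarrow> continuous_on W (grad_norm M f)"
  unfolding grad_norm_def by (intro continuous_intros continuous_on_grad_inner)

lemma grad_zero_outside:
  assumes u: "Ck_fun_on 1 UNIV u" and K: "compact K" "\<And>q. q \<notin> K \<Longrightarrow> f q = 0" and p: "p \<notin> K"
  shows "grad_inner M u f p = 0"
proof -
  have "has_differential (chart_at M p) f p 0"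
    by (rule differential_zero[OF chart_at, of p "- K"]) (use K p in \<open>auto simp: compact_imp_closed\<close>)
  then show ?thesis
    using grad_inner_eq[OF chart_at has_differential[OF u chart_at UNIV_I]] by (simp add: dual_inner_def)
qed

section \<open>Smooth bump functions\<close>

definition bump :: "('a, 'm) chart \<Rightarrow> 'a \<Rightarrow> real \<Rightarrow> 'a \<Rightarrow> real" where
  "bump c p e = chart_extend c (\<lambda>x. flat_exp 0 (e\<^sup>2 - (x - coord c p) \<bullet> (x - coord c p)))"

lemma Ck_on_bump_euclidean:
  "Ck_on k UNIV (\<lambda>x::real^'m. flat_exp 0 (e\<^sup>2 - (x - a) \<bullet> (x - a)))"
proof -
  have A: "Ck_on k UNIV (\<lambda>x::real^'m. x - a)"
    using Ck_on_add[OF open_UNIV Ck_on_bounded_linear[OF bounded_linear_ident open_UNIV] Ck_on_const[of k UNIV "- a"]] by simp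
  have "Ck_on k UNIV (\<lambda>x::real^'m. e\<^sup>2 + (-1) *\<^sub>R ((x - a) \<bullet> (x - a)))"
    by (intro Ck_on_add Ck_on_const Ck_on_bounded_linear_comp[OF bounded_linear_scaleR_right]
        Ck_on_bilinear[OF bounded_bilinear_inner] A open_UNIV)
  then show ?thesis
    using Ck_on_compose[OF open_UNIV open_UNIV _ Ck_on_flat_exp[of k 0], of "\<lambda>x::real^'m. e\<^sup>2 - (x - a) \<bullet> (x - a)"] by simp
qed

lemma bump_euclidean_pos_iff: "e > 0 \<Longrightarrow> flat_exp 0 (e\<^sup>2 - (x - a) \<bullet> (x - a)) > 0 \<longleftrightarrow> x \<in> ball a e"
proof -
  assume e: "e > 0"
  have "(x - a) \<bullet> (x - a) < e\<^sup>2 \<longleftrightarrow> norm (x - a) < e"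
    unfolding power2_norm_eq_inner[symmetric]
    using e power_strict_mono[of "norm (x - a)" e 2] power2_less_imp_less[of "norm (x - a)" e] by auto
  then show ?thesis by (auto simp: dist_norm norm_minus_commute)
qed

context
  fixes c p e
  assumes c: "c \<in> atlas M" and p: "p \<in> dom c" and e: "e > 0" and sub: "cball (coord c p) e \<subseteq> coord c ` dom c"
begin

lemma bump_nonneg: "bump c p e q \<ge> 0"
  by (simp add: bump_def chart_extend_def)

lemma bump_pos_iff: "bump c p e q > 0 \<longleftrightarrow> q \<in> param c ` ball (coord c p) e"
proof -
  have "q \<in> dom c \<and> coord c q \<in> ball (coord c p) e \<longleftrightarrow> q \<in> param c ` ball (coord c p) e" (is "?l \<longleftrightarrow> ?r")
  proof
    assume ?l then show ?r using param_coord[OF c] by (metis imageI)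
  next
    assume ?r
    then obtain x where x: "x \<in> ball (coord c p) e" "q = param c x" by blast
    then have "x \<in> coord c ` dom c" using sub ball_subset_cball by blast
    then show ?l using x param_in_dom[OF c] coord_param[OF c] by simp
  qed
  then show ?thesis
    using bump_euclidean_pos_iff[OF e, of "coord c q" "coord c p"] by (auto simp: bump_def chart_extend_def)
qed

lemma Ck_fun_on_bump: "Ck_fun_on k UNIV (bump c p e)"
  unfolding bump_def
proof (rule Ck_fun_on_chart_extend[OF c _ compact_cball sub])
  show "Ck_on k (coord c ` dom c) (\<lambda>x. flat_exp 0 (e\<^sup>2 - (x - coord c p) \<bullet> (x - coord c p)))"
    by (rule Ck_on_subset[OF Ck_on_bump_euclidean]) simp
  fix x assume "x \<notin> cball (coord c p) e"
  then have "\<not> flat_exp 0 (e\<^sup>2 - (x - coord c p) \<bullet> (x - coord c p)) > 0"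
    unfolding bump_euclidean_pos_iff[OF e] by auto
  moreover have "flat_exp 0 t \<ge> 0" for t by simp
  ultimately show "flat_exp 0 (e\<^sup>2 - (x - coord c p) \<bullet> (x - coord c p)) = 0"
    by (meson antisym not_le)
qed

end

section \<open>The weak inequality for test functions of class \<open>C\<^sup>1\<close>\<close>

text \<open>For \<open>a = |\<nabla>u|\<^sup>-\<^sup>1 \<phi>(|\<nabla>u|) D\<close> and \<open>b = K (1 + r)\<^sup>-\<^sup>\<mu> |\<nabla>u|\<^sup>\<chi> D\<close> the differential inequality holds weakly if
  and only if this functional is non-positive on the non-negative test functions. The coefficients
  are only measurable, \<open>a\<close> being possibly discontinuous at critical points of \<open>u\<close>; they enter the estimates
  through a continuous function \<open>g\<close> which dominates both \<open>a |\<nabla>u|\<close> and \<open>b\<close>.\<close>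

definition weak_form :: "('a \<Rightarrow> real) \<Rightarrow> ('a \<Rightarrow> real) \<Rightarrow> ('a \<Rightarrow> real) \<Rightarrow> ('a \<Rightarrow> real) \<Rightarrow> real" where
  "weak_form u a b \<psi> = (LINT x|vol. a x * grad_inner M u \<psi> x + b x * \<psi> x)"

context
  fixes u a b g :: "'a \<Rightarrow> real"
  assumes u: "Ck_fun_on 1 UNIV u" and a: "a \<in> borel_measurable borel" and b: "b \<in> borel_measurable borel"
    and g: "continuous_on UNIV g" and ag: "\<And>x. \<bar>a x\<bar> * grad_norm M u x \<le> g x" and bg: "\<And>x. \<bar>b x\<bar> \<le> g x"
begin

lemma weak_form_integrand_bound:
  assumes \<psi>: "Ck_fun_on 1 UNIV \<psi>" and b1: "\<bar>\<psi> x\<bar> \<le> \<eta>" and b2: "grad_norm M \<psi> x \<le> \<eta>"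
  shows "\<bar>a x * grad_inner M u \<psi> x + b x * \<psi> x\<bar> \<le> 2 * \<eta> * g x"
proof -
  have g0: "g x \<ge> 0" using bg[of x] by simp
  have "\<bar>a x * grad_inner M u \<psi> x\<bar> \<le> \<bar>a x\<bar> * (grad_norm M u x * grad_norm M \<psi> x)"
    unfolding abs_mult by (intro mult_left_mono grad_inner_cauchy_schwarz[OF u \<psi>]) auto
  also have "\<dots> = (\<bar>a x\<bar> * grad_norm M u x) * grad_norm M \<psi> x" by simp
  also have "\<dots> \<le> g x * \<eta>" using ag g0 b2 grad_norm_ge_0[OF \<psi>] by (intro mult_mono) auto
  finally have 1: "\<bar>a x * grad_inner M u \<psi> x\<bar> \<le> g x * \<eta>" .
  have "\<bar>b x * \<psi> x\<bar> \<le> g x * \<eta>" unfolding abs_mult using bg b1 g0 by (intro mult_mono) auto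
  then show ?thesis using 1 by (simp add: mult_ac)
qed

lemma weak_form_integrable:
  assumes \<psi>: "Ck_fun_on 1 UNIV \<psi>" and K: "compact K" "\<And>q. q \<notin> K \<Longrightarrow> \<psi> q = 0"
  shows "integrable vol (\<lambda>x. a x * grad_inner M u \<psi> x + b x * \<psi> x)"
proof -
  have c: "continuous_on UNIV (\<lambda>x. 2 * max \<bar>\<psi> x\<bar> (grad_norm M \<psi> x) * g x)"
    by (intro continuous_intros continuous_on_max g continuous_on_grad_norm[OF \<psi>] Ck_fun_on_imp_continuous_on[OF \<psi>])
  obtain B where B: "\<And>x. x \<in> K \<Longrightarrow> \<bar>2 * max \<bar>\<psi> x\<bar> (grad_norm M \<psi> x) * g x\<bar> \<le> B"
    by (rule continuous_bounded_on_compact[OF c K(1)]) blast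
  show ?thesis
  proof (rule integrable_vol_compact_support[OF _ K(1)])
    show "(\<lambda>x. a x * grad_inner M u \<psi> x + b x * \<psi> x) \<in> borel_measurable borel"
      using a b borel_measurable_continuous_onI[OF continuous_on_grad_inner[OF u \<psi>]]
        borel_measurable_continuous_onI[OF Ck_fun_on_imp_continuous_on[OF \<psi>]] by measurable
    show "\<bar>a x * grad_inner M u \<psi> x + b x * \<psi> x\<bar> \<le> B" if "x \<in> K" for x
      using weak_form_integrand_bound[OF \<psi>, of x "max \<bar>\<psi> x\<bar> (grad_norm M \<psi> x)"] B[OF that] by simp
    show "a x * grad_inner M u \<psi> x + b x * \<psi> x = 0" if "x \<notin> K" for x
      using K(2)[OF that] grad_zero_outside[OF u K that] by simp
  qed
qed

text \<open>The functional is continuous in the \<open>C\<^sup>1\<close> norm on functions supported in a fixed compact set.\<close>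

lemma weak_form_bound:
  assumes \<psi>: "Ck_fun_on 1 UNIV \<psi>" and K: "compact K" "\<And>q. q \<notin> K \<Longrightarrow> \<psi> q = 0"
    and b1: "\<And>x. x \<in> K \<Longrightarrow> \<bar>\<psi> x\<bar> \<le> \<eta>" and b2: "\<And>x. x \<in> K \<Longrightarrow> grad_norm M \<psi> x \<le> \<eta>"
  shows "\<bar>weak_form u a b \<psi>\<bar> \<le> 2 * \<eta> * (LINT x|vol. indicator K x * g x)"
proof -
  obtain B where B: "\<And>x. x \<in> K \<Longrightarrow> \<bar>g x\<bar> \<le> B"
    by (rule continuous_bounded_on_compact[OF g K(1)]) blast
  have gi: "integrable vol (\<lambda>x. indicator K x * g x)"
    by (rule integrable_vol_compact_support[OF _ K(1), where b=B])
       (use B borel_measurable_continuous_onI[OF g] K(1) in \<open>auto intro!: borel_measurable_times borel_measurable_indicator borel_closed compact_imp_closed\<close>)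
  have "\<bar>weak_form u a b \<psi>\<bar> \<le> (LINT x|vol. \<bar>a x * grad_inner M u \<psi> x + b x * \<psi> x\<bar>)"
    unfolding weak_form_def by (rule integral_abs_bound)
  also have "\<dots> \<le> (LINT x|vol. 2 * \<eta> * (indicator K x * g x))"
  proof (rule integral_mono)
    show "integrable vol (\<lambda>x. \<bar>a x * grad_inner M u \<psi> x + b x * \<psi> x\<bar>)"
      by (intro integrable_abs weak_form_integrable[OF \<psi> K])
    show "\<bar>a x * grad_inner M u \<psi> x + b x * \<psi> x\<bar> \<le> 2 * \<eta> * (indicator K x * g x)" for x
      using weak_form_integrand_bound[OF \<psi> b1 b2, of x] K(2)[of x] grad_zero_outside[OF u K] by (cases "x \<in> K") auto
  qed (use gi in simp)
  also have "\<dots> = 2 * \<eta> * (LINT x|vol. indicator K x * g x)" by simp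
  finally show ?thesis .
qed

lemma grad_inner_diff:
  assumes f: "Ck_fun_on 1 UNIV f" and h: "Ck_fun_on 1 UNIV h"
  shows "grad_inner M u (\<lambda>x. f x - h x) x = grad_inner M u f x - grad_inner M u h x"
    "Ck_fun_on 1 UNIV (\<lambda>x. f x - h x)"
    "c \<in> atlas M \<Longrightarrow> x \<in> dom c \<Longrightarrow> has_differential c (\<lambda>x. f x - h x) x (differential c f x - differential c h x)"
proof -
  have "Ck_fun_on 1 UNIV (\<lambda>x. f x + (- 1) * h x)"
    by (intro Ck_fun_on_add Ck_fun_on_mult Ck_fun_on_const f h) auto
  then show "Ck_fun_on 1 UNIV (\<lambda>x. f x - h x)" by simp
  show *: "has_differential c (\<lambda>x. f x - h x) x (differential c f x - differential c h x)"
    if c: "c \<in> atlas M" "x \<in> dom c" for c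
    using has_differential_add[OF has_differential[OF f c UNIV_I]
       has_differential_mult[OF c has_differential_const[of c "- 1"] has_differential[OF h c UNIV_I]]] by simp
  show "grad_inner M u (\<lambda>x. f x - h x) x = grad_inner M u f x - grad_inner M u h x"
    using grad_inner_linear[OF chart_at has_differential[OF u chart_at UNIV_I] has_differential[OF f chart_at UNIV_I]
        has_differential[OF h chart_at UNIV_I], where h="\<lambda>x. f x - h x" and a=1 and b="- 1"] *[OF chart_at] by simp
qed

lemma weak_form_diff:
  assumes \<psi>: "Ck_fun_on 1 UNIV \<psi>" and K: "compact K" "\<And>q. q \<notin> K \<Longrightarrow> \<psi> q = 0"
    and \<psi>': "Ck_fun_on 1 UNIV \<psi>'" and K': "\<And>q. q \<notin> K \<Longrightarrow> \<psi>' q = 0"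
  shows "weak_form u a b (\<lambda>x. \<psi> x - \<psi>' x) = weak_form u a b \<psi> - weak_form u a b \<psi>'"
proof -
  have "weak_form u a b \<psi> - weak_form u a b \<psi>'
     = (LINT x|vol. (a x * grad_inner M u \<psi> x + b x * \<psi> x) - (a x * grad_inner M u \<psi>' x + b x * \<psi>' x))"
    unfolding weak_form_def
    by (rule Bochner_Integration.integral_diff[symmetric])
       (use weak_form_integrable[OF \<psi> K] weak_form_integrable[OF \<psi>' K(1) K'] in auto)
  also have "\<dots> = weak_form u a b (\<lambda>x. \<psi> x - \<psi>' x)"
    unfolding weak_form_def by (rule Bochner_Integration.integral_cong) (simp_all add: grad_inner_diff[OF \<psi> \<psi>'] algebra_simps)
  finally show ?thesis by simp
qed

lemma weak_form_sum:
  assumes I: "finite I" and \<psi>: "\<And>i. i \<in> I \<Longrightarrow> Ck_fun_on 1 UNIV (\<psi> i)" and K: "compact K" "\<And>i q. i \<in> I \<Longrightarrow> q \<notin> K \<Longrightarrow> \<psi> i q = 0"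
  shows "weak_form u a b (\<lambda>x. \<Sum>i\<in>I. \<psi> i x) = (\<Sum>i\<in>I. weak_form u a b (\<psi> i))"
proof -
  have gi: "grad_inner M u (\<lambda>x. \<Sum>i\<in>I. \<psi> i x) x = (\<Sum>i\<in>I. grad_inner M u (\<psi> i) x)" for x
  proof -
    let ?c = "chart_at M x"
    have s: "has_differential ?c (\<lambda>x. \<Sum>i\<in>I. \<psi> i x) x (\<Sum>i\<in>I. differential ?c (\<psi> i) x)"
      by (intro has_differential_sum has_differential[OF \<psi> chart_at UNIV_I])
    have "dual_inner ?c x w (\<Sum>i\<in>I. z i) = (\<Sum>i\<in>I. dual_inner ?c x w (z i))" for w z
      by (simp add: dual_inner_def inner_sum_right)
    then show ?thesis
      using grad_inner_eq[OF chart_at has_differential[OF u chart_at UNIV_I] s]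
        grad_inner_eq[OF chart_at has_differential[OF u chart_at UNIV_I] has_differential[OF \<psi> chart_at UNIV_I]] by simp
  qed
  have "(\<Sum>i\<in>I. weak_form u a b (\<psi> i)) = (LINT x|vol. (\<Sum>i\<in>I. a x * grad_inner M u (\<psi> i) x + b x * \<psi> i x))"
    unfolding weak_form_def
    by (rule Bochner_Integration.integral_sum[symmetric]) (use weak_form_integrable[OF \<psi> K(1)] K(2) in auto)
  also have "\<dots> = weak_form u a b (\<lambda>x. \<Sum>i\<in>I. \<psi> i x)"
    unfolding weak_form_def gi
    by (rule Bochner_Integration.integral_cong) (simp_all add: sum.distrib sum_distrib_left)
  finally show ?thesis by simp
qed

text \<open>Test functions of class \<open>C\<^sup>1\<close> supported in a small coordinate ball are approximated by
  mollification.\<close>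

lemma weak_form_C1_local:
  assumes test: "\<And>\<psi>. test_function M \<Omega> \<psi> \<Longrightarrow> (\<And>x. 0 \<le> \<psi> x) \<Longrightarrow> weak_form u a b \<psi> \<le> 0"
    and c: "c \<in> atlas M" and p: "p \<in> dom c" and e: "e > 0" and l: "l > 0"
    and sub: "cball (coord c p) e \<subseteq> coord c ` (dom c \<inter> \<Omega>)"
    and met: "\<And>x v. x \<in> cball (coord c p) e \<Longrightarrow> l * norm v \<le> sqrt (metric_in M c (param c x) v v)"
    and \<psi>: "Ck_fun_on 1 UNIV \<psi>" "\<And>x. \<psi> x \<ge> 0" and supp: "\<And>q. q \<notin> param c ` cball (coord c p) (e/2) \<Longrightarrow> \<psi> q = 0"
  shows "weak_form u a b \<psi> \<le> 0"
proof -
  have sub': "cball (coord c p) e \<subseteq> coord c ` dom c" using sub by auto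
  let ?V = "coord c ` dom c" let ?k = "cball (coord c p) (e/2)"
  have k: "?k \<subseteq> cball (coord c p) e" using e by auto
  define h where "h x = (if x \<in> ?V then \<psi> (param c x) else 0)" for x
  have h0: "h x = 0" if "x \<notin> ?k" for x
  proof (cases "x \<in> ?V")
    case True
    have "param c x \<notin> param c ` ?k"
    proof
      assume "param c x \<in> param c ` ?k"
      then obtain y where y: "y \<in> ?k" "param c x = param c y" by blast
      then have "y \<in> ?V" using k sub' by blast
      then have "x = y" using y True coord_param[OF c] by metis
      then show False using that y by simp
    qed
    then show ?thesis using supp True by (simp add: h_def)
  qed (simp add: h_def)
  have hC1: "Ck_on 1 UNIV h"
  proof (rule Ck_on_local)
    fix x :: "real^'m"
    show "\<exists>U. open U \<and> x \<in> U \<and> Ck_on 1 U h"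
    proof (cases "x \<in> ?V")
      case True
      have "Ck_on 1 ?V (\<psi> \<circ> param c)" using \<psi>(1) c by (simp add: Ck_fun_on_def)
      then have "Ck_on 1 ?V h" by (rule Ck_on_cong[OF open_coord_dom[OF c], rotated]) (simp add: h_def)
      then show ?thesis using True open_coord_dom[OF c] by blast
    next
      case False
      have "Ck_on 1 (- ?k) h"
        by (rule Ck_on_cong[of _ "\<lambda>_. 0"]) (auto simp: h0 intro: Ck_on_const)
      moreover have "x \<in> - ?k" using False k sub' by auto
      ultimately show ?thesis by (intro exI[of _ "- ?k"]) auto
    qed
  qed
  have hc: "continuous_on UNIV h" by (rule Ck_on_imp_continuous_on[OF hC1])
  let ?K = "param c ` cball (coord c p) e"
  have K: "compact ?K" by (rule compact_param_image[OF c compact_cball sub'])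
  have \<psi>h: "\<psi> q = h (coord c q)" if "q \<in> dom c" for q using that c by (simp add: h_def)
  have key: "weak_form u a b \<psi> \<le> 2 * \<eta> * (LINT x|vol. indicator ?K x * g x)" if \<eta>: "\<eta> > 0" for \<eta>
  proof -
    define \<eta>' where "\<eta>' = min \<eta> (\<eta> * l)"
    have \<eta>': "\<eta>' > 0" "\<eta>' \<le> \<eta>" "\<eta>' / l \<le> \<eta>" using \<eta> l by (auto simp: \<eta>'_def field_simps)
    obtain \<delta> where \<delta>: "\<delta> > 0" "\<delta> \<le> e / 2" "\<And>x. \<bar>conv (moll \<delta>) h x - h x\<bar> \<le> \<eta>'"
      "\<And>x D D' v. (conv (moll \<delta>) h has_derivative D) (at x) \<Longrightarrow> (h has_derivative D') (at x) \<Longrightarrow> \<bar>D v - D' v\<bar> \<le> \<eta>' * norm v"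
      by (rule mollify_C1[OF hC1 compact_cball[of "coord c p" "e/2"] h0 \<eta>'(1), where r="e/2"]) (use e in auto)
    let ?f = "conv (moll \<delta>) h"
    define \<psi>' where "\<psi>' = chart_extend c ?f"
    have f0: "?f x = 0" if x: "x \<notin> cball (coord c p) e" for x
    proof -
      have "\<bar>?f x - h x\<bar> \<le> 0"
      proof (rule conv_moll_close[OF \<delta>(1) hc])
        fix y assume y: "dist x y \<le> \<delta>"
        have "y \<notin> ?k" using x y \<delta>(2) dist_triangle[of "coord c p" x y] by (auto simp: dist_commute)
        moreover have "x \<notin> ?k" using x k by blast
        ultimately show "\<bar>h y - h x\<bar> \<le> 0" using h0 by simp
      qed
      moreover have "h x = 0" using h0[of x] x k by blast
      ultimately show ?thesis by simp
    qed
    have f_nonneg: "?f x \<ge> 0" for x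
      unfolding conv_def using \<psi>(2) moll_nonneg[OF \<delta>(1)]
      by (intro integral_nonneg_AE AE_I2 mult_nonneg_nonneg) (simp_all add: h_def)
    have ck: "Ck_fun_on k UNIV \<psi>'" for k
      unfolding \<psi>'_def
      by (rule Ck_fun_on_chart_extend[OF c _ compact_cball sub' f0])
         (rule Ck_on_subset[OF Ck_on_conv_moll[OF \<delta>(1) hc]], simp)
    have s': "\<psi>' q = 0" if "q \<notin> ?K" for q
      using that f0 param_coord[OF c] unfolding \<psi>'_def chart_extend_def by (metis imageI)
    have s: "\<psi> q = 0" if "q \<notin> ?K" for q using supp[of q] that k by blast
    have "closure {x. \<psi>' x \<noteq> 0} \<subseteq> ?K"
      using s' by (intro closure_minimal compact_imp_closed[OF K]) auto
    moreover have "?K \<subseteq> \<Omega>"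
    proof
      fix q assume "q \<in> ?K"
      then obtain x where "x \<in> cball (coord c p) e" "q = param c x" by blast
      then obtain q' where "q' \<in> dom c" "q' \<in> \<Omega>" "q = param c (coord c q')" using sub by auto
      then show "q \<in> \<Omega>" using c by simp
    qed
    ultimately have "test_function M \<Omega> \<psi>'"
      unfolding test_function_def smooth_function_def Ck_function_iff using ck
      by (auto intro: compact_closure[THEN iffD2] bounded_subset) (metis K closed_closure compact_Int_closed inf.absorb_iff2)
    moreover have "\<psi>' q \<ge> 0" for q using f_nonneg by (simp add: \<psi>'_def chart_extend_def)
    ultimately have neg: "weak_form u a b \<psi>' \<le> 0" by (rule test)
    have "\<bar>weak_form u a b (\<lambda>x. \<psi> x - \<psi>' x)\<bar> \<le> 2 * \<eta> * (LINT x|vol. indicator ?K x * g x)"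
    proof (rule weak_form_bound[OF grad_inner_diff(2)[OF \<psi>(1) ck] K])
      show "q \<notin> ?K \<Longrightarrow> \<psi> q - \<psi>' q = 0" for q using s s' by simp
      fix q assume "q \<in> ?K"
      then obtain x where x: "x \<in> cball (coord c p) e" "q = param c x" by blast
      have q: "q \<in> dom c" "coord c q = x" using x sub' param_in_dom[OF c] coord_param[OF c] by auto
      show "\<bar>\<psi> q - \<psi>' q\<bar> \<le> \<eta>"
        using \<delta>(3)[of x] \<eta>'(2) q by (simp add: \<psi>'_def chart_extend_def \<psi>h abs_minus_commute)
      have d1: "has_differential c \<psi> q (differential c \<psi> q)" "has_differential c \<psi>' q (differential c \<psi>' q)"
        by (rule has_differential[OF _ c q(1) UNIV_I], rule \<psi> ck)+
      have o: "open ?V" "x \<in> ?V" using open_coord_dom[OF c] q by auto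
      have h1: "(h has_derivative (\<lambda>v. differential c \<psi> q \<bullet> v)) (at x)"
        by (rule has_derivative_transform_within_open[OF d1(1)[unfolded has_differential_def q(2)] o]) (simp add: h_def)
      have h2: "(?f has_derivative (\<lambda>v. differential c \<psi>' q \<bullet> v)) (at x)"
        by (rule has_derivative_transform_within_open[OF d1(2)[unfolded has_differential_def q(2)] o])
           (auto simp: \<psi>'_def chart_extend_def param_in_dom[OF c] coord_param[OF c] c)
      show "grad_norm M (\<lambda>x. \<psi> x - \<psi>' x) q \<le> \<eta>"
      proof (rule grad_norm_le[OF c q(1) grad_inner_diff(3)[OF \<psi>(1) ck c q(1)]])
        fix v
        have m: "l * norm v \<le> sqrt (metric_in M c q v v)" using met[OF x(1)] x(2) by simp
        have "(differential c \<psi> q - differential c \<psi>' q) \<bullet> v \<le> \<eta>' * norm v"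
          using \<delta>(4)[OF h2 h1, of v] by (simp add: inner_diff_left)
        also have "\<dots> = (\<eta>' / l) * (l * norm v)" using l by simp
        also have "\<dots> \<le> \<eta> * sqrt (metric_in M c q v v)"
          using \<eta>' l m \<eta> by (intro mult_mono) auto
        finally show "(differential c \<psi> q - differential c \<psi>' q) \<bullet> v \<le> \<eta> * sqrt (metric_in M c q v v)" .
      qed (use \<eta> in simp)
    qed
    moreover have "weak_form u a b (\<lambda>x. \<psi> x - \<psi>' x) = weak_form u a b \<psi> - weak_form u a b \<psi>'"
      by (rule weak_form_diff[OF \<psi>(1) K s ck s'])
    ultimately show ?thesis using neg by linarith
  qed
  define I where "I = (LINT x|vol. indicator ?K x * g x)"
  have I: "I \<ge> 0" unfolding I_def using bg abs_ge_zero order_trans by (intro integral_nonneg_AE AE_I2) (auto simp: indicator_def intro: order_trans[OF abs_ge_zero bg])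
  show ?thesis
  proof (rule field_le_epsilon)
    fix \<epsilon> :: real assume \<epsilon>: "\<epsilon> > 0"
    have "2 * (\<epsilon> / (2 * (I + 1))) * I \<le> \<epsilon>" using I \<epsilon> by (simp add: field_simps)
    then show "weak_form u a b \<psi> \<le> 0 + \<epsilon>"
      using key[of "\<epsilon> / (2 * (I + 1))"] \<epsilon> I unfolding I_def[symmetric] by simp
  qed
qed

end

end

section \<open>Partitions of unity and the smoothed distance\<close>

lemma Ck_on_1_realI:
  fixes P :: "real \<Rightarrow> real"
  assumes T: "open T" and P: "\<And>t. t \<in> T \<Longrightarrow> (P has_real_derivative P' t) (at t)" and c: "continuous_on T P'"
  shows "Ck_on 1 T P"
  unfolding One_nat_def
  by (rule Ck_on_SucI[OF T, where f' = "\<lambda>t v. P' t * v"])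
     (use P c in \<open>auto simp: has_field_derivative_def intro!: continuous_intros\<close>)

lemma Ck_on_inverse: "Ck_on 1 {0<..} (inverse :: real \<Rightarrow> real)"
  by (rule Ck_on_1_realI[where P' = "\<lambda>t. - (inverse t * inverse t)"])
     (auto intro!: derivative_eq_intros continuous_intros)

context riemannian begin

context
  fixes u a b g :: "'a \<Rightarrow> real"
  assumes u: "Ck_fun_on 1 UNIV u" and a: "a \<in> borel_measurable borel" and b: "b \<in> borel_measurable borel"
    and g: "continuous_on UNIV g" and ag: "\<And>x. \<bar>a x\<bar> * grad_norm M u x \<le> g x" and bg: "\<And>x. \<bar>b x\<bar> \<le> g x"
begin

text \<open>A partition of unity reduces the general case to functions supported in one chart.\<close>

lemma weak_form_C1:
  assumes test: "\<And>\<psi>. test_function M \<Omega> \<psi> \<Longrightarrow> (\<And>x. 0 \<le> \<psi> x) \<Longrightarrow> weak_form u a b \<psi> \<le> 0"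
    and \<Omega>: "open \<Omega>" and \<psi>: "Ck_fun_on 1 UNIV \<psi>" "\<And>x. \<psi> x \<ge> 0"
    and K: "compact K" "K \<subseteq> \<Omega>" "\<And>q. q \<notin> K \<Longrightarrow> \<psi> q = 0"
  shows "weak_form u a b \<psi> \<le> 0"
proof -
  define good where "good p N \<longleftrightarrow> (case N of (c, e, l) \<Rightarrow> c \<in> atlas M \<and> p \<in> dom c \<and> e > 0 \<and> l > 0 \<and>
     cball (coord c p) e \<subseteq> coord c ` (dom c \<inter> \<Omega>) \<and>
     (\<forall>x v. x \<in> cball (coord c p) e \<longrightarrow> l * norm v \<le> sqrt (metric_in M c (param c x) v v)))" for p N
  have "\<exists>N. p \<in> K \<longrightarrow> good p N" for p
  proof (cases "p \<in> K")
    case True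
    obtain c where c: "c \<in> atlas M" "p \<in> dom c" using chart_cover by blast
    have p\<Omega>: "p \<in> \<Omega>" using True K by auto
    obtain e l L where "e > 0" "l > 0" "cball (coord c p) e \<subseteq> coord c ` (dom c \<inter> \<Omega>)"
      "\<And>x v. x \<in> cball (coord c p) e \<Longrightarrow> l * norm v \<le> sqrt (metric_in M c (param c x) v v)"
      by (rule metric_bounds[OF c p\<Omega> \<Omega> zero_less_one]) blast
    then have "good p (c, e, l)" using c by (simp add: good_def)
    then show ?thesis by blast
  qed simp
  then obtain N where N: "\<And>p. p \<in> K \<Longrightarrow> good p (N p)" by metis
  define C where "C p = fst (N p)" for p
  define E where "E p = fst (snd (N p))" for p
  define L where "L p = snd (snd (N p))" for p
  have C: "C p \<in> atlas M" "p \<in> dom (C p)" "E p > 0" "L p > 0"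
     "cball (coord (C p) p) (E p) \<subseteq> coord (C p) ` (dom (C p) \<inter> \<Omega>)"
     "\<And>x v. x \<in> cball (coord (C p) p) (E p) \<Longrightarrow> L p * norm v \<le> sqrt (metric_in M (C p) (param (C p) x) v v)"
    if "p \<in> K" for p
    using N[OF that] by (simp_all add: good_def C_def E_def L_def split_beta)
  have sub2: "cball (coord (C p) p) (E p / 2) \<subseteq> coord (C p) ` dom (C p)" if "p \<in> K" for p
  proof -
    have "cball (coord (C p) p) (E p / 2) \<subseteq> cball (coord (C p) p) (E p)" using C(3)[OF that] by auto
    then show ?thesis using C(5)[OF that] by blast
  qed
  define U where "U p = param (C p) ` ball (coord (C p) p) (E p / 2)" for p
  have U: "open (U p)" "p \<in> U p" if "p \<in> K" for p
  proof -
    have b: "ball (coord (C p) p) (E p / 2) \<subseteq> coord (C p) ` dom (C p)" using sub2[OF that] ball_subset_cball by blast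
    show "open (U p)" unfolding U_def by (rule open_param_image[OF C(1)[OF that] open_ball b])
    have "coord (C p) p \<in> ball (coord (C p) p) (E p / 2)" using C(3)[OF that] by simp
    then show "p \<in> U p" unfolding U_def using C(1,2)[OF that] by (metis image_eqI param_coord)
  qed
  have cov: "K \<subseteq> (\<Union>p\<in>K. U p)" using U by blast
  obtain F where F: "F \<subseteq> K" "finite F" "K \<subseteq> (\<Union>p\<in>F. U p)"
    by (rule compactE_image[OF K(1) U(1) cov]) auto
  define \<theta> where "\<theta> p = bump (C p) p (E p / 2)" for p
  have E2: "E p / 2 > 0" if "p \<in> K" for p using C(3)[OF that] by simp
  have \<theta>: "Ck_fun_on 1 UNIV (\<theta> p)" "\<theta> p q \<ge> 0" "\<theta> p q > 0 \<longleftrightarrow> q \<in> U p" if "p \<in> F" for p q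
  proof -
    have pK: "p \<in> K" using that F by auto
    show "Ck_fun_on 1 UNIV (\<theta> p)" unfolding \<theta>_def by (rule Ck_fun_on_bump[OF C(1,2)[OF pK] E2[OF pK] sub2[OF pK]])
    show "\<theta> p q \<ge> 0" unfolding \<theta>_def by (rule bump_nonneg[OF C(1,2)[OF pK] E2[OF pK] sub2[OF pK]])
    show "\<theta> p q > 0 \<longleftrightarrow> q \<in> U p" unfolding \<theta>_def U_def by (rule bump_pos_iff[OF C(1,2)[OF pK] E2[OF pK] sub2[OF pK]])
  qed
  define \<Theta> where "\<Theta> q = (\<Sum>p\<in>F. \<theta> p q)" for q
  have \<Theta>1: "Ck_fun_on 1 UNIV \<Theta>" unfolding \<Theta>_def by (rule Ck_fun_on_sum[OF open_UNIV \<theta>(1)])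
  have \<Theta>pos: "\<Theta> q > 0" if q: "q \<in> K" for q
  proof -
    obtain p where "p \<in> F" "q \<in> U p" using F q by auto
    then show ?thesis unfolding \<Theta>_def using \<theta> F(2) by (intro sum_pos2[of F p]) auto
  qed
  have oW: "open {q. \<Theta> q > 0}"
    by (intro open_Collect_less continuous_on_const Ck_fun_on_imp_continuous_on[OF \<Theta>1])
  define \<psi>' where "\<psi>' p q = \<psi> q * (\<theta> p q * inverse (\<Theta> q))" for p q
  have \<psi>': "Ck_fun_on 1 UNIV (\<psi>' p)" if p: "p \<in> F" for p
  proof (rule Ck_fun_on_local[OF _ open_UNIV])
    fix q
    show "\<exists>V. Ck_fun_on 1 V (\<psi>' p) \<and> q \<in> V"
    proof (cases "\<Theta> q > 0")
      case True
      have "Ck_fun_on 1 {q. \<Theta> q > 0} (\<psi>' p)" unfolding \<psi>'_def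
        by (intro Ck_fun_on_mult Ck_fun_on_compose[OF Ck_on_inverse] Ck_fun_on_subset[OF \<psi>(1)]
            Ck_fun_on_subset[OF \<theta>(1)[OF p]] Ck_fun_on_subset[OF \<Theta>1] oW) auto
      then show ?thesis using True by blast
    next
      case False
      then have "q \<in> - K" using \<Theta>pos by blast
      moreover have "Ck_fun_on 1 (- K) (\<psi>' p)"
        by (rule Ck_fun_on_zero) (use K in \<open>auto simp: \<psi>'_def compact_imp_closed\<close>)
      ultimately show ?thesis by blast
    qed
  qed
  have sum: "\<psi> q = (\<Sum>p\<in>F. \<psi>' p q)" for q
  proof (cases "q \<in> K")
    case True
    have "(\<Sum>p\<in>F. \<psi>' p q) = \<psi> q * (\<Theta> q * inverse (\<Theta> q))"
      by (simp add: \<psi>'_def \<Theta>_def sum_distrib_left sum_distrib_right)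
    then show ?thesis using \<Theta>pos[OF True] by simp
  qed (simp add: \<psi>'_def K(3))
  have "weak_form u a b \<psi> = weak_form u a b (\<lambda>q. \<Sum>p\<in>F. \<psi>' p q)" using sum by presburger
  also have "\<dots> = (\<Sum>p\<in>F. weak_form u a b (\<psi>' p))"
    by (rule weak_form_sum[OF u a b g ag bg F(2) \<psi>' K(1)]) (auto simp: \<psi>'_def K(3))
  also have "\<dots> \<le> 0"
  proof (rule sum_nonpos)
    fix p assume p: "p \<in> F"
    then have pK: "p \<in> K" using F by auto
    show "weak_form u a b (\<psi>' p) \<le> 0"
    proof (rule weak_form_C1_local[OF u a b g ag bg test C(1,2,3,4,5,6)[OF pK] \<psi>'[OF p]])
      show "\<psi>' p x \<ge> 0" for x
        unfolding \<psi>'_def \<Theta>_def using \<psi>(2) \<theta>(2) p by (intro mult_nonneg_nonneg) (auto intro: sum_nonneg)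
      fix q assume "q \<notin> param (C p) ` cball (coord (C p) p) (E p / 2)"
      then have "q \<notin> U p" unfolding U_def using ball_subset_cball by blast
      then have "\<theta> p q = 0" using \<theta>(2,3)[OF p, of q] by linarith
      then show "\<psi>' p q = 0" by (simp add: \<psi>'_def)
    qed
  qed
  finally show ?thesis .
qed

end

end

context connected_riemannian begin

text \<open>Mollifying the distance in a small chart hardly increases its Lipschitz constant.\<close>

lemma smooth_rdist_local:
  assumes c: "c \<in> atlas M" and p: "p \<in> dom c" and e: "e > 0" and L: "L > 0" and \<epsilon>: "\<epsilon> > 0" and \<eta>: "\<eta> > 0"
    and sub: "cball (coord c p) e \<subseteq> coord c ` dom c"
    and up: "\<And>x v. x \<in> cball (coord c p) e \<Longrightarrow> sqrt (metric_in M c (param c x) v v) \<le> L * norm v"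
    and ratio: "\<And>x y v. x \<in> cball (coord c p) e \<Longrightarrow> y \<in> cball (coord c p) e \<Longrightarrow>
      sqrt (metric_in M c (param c x) v v) \<le> (1 + \<epsilon>) * sqrt (metric_in M c (param c y) v v)"
  shows "\<exists>f. Ck_on 1 UNIV f \<and> (\<forall>x\<in>cball (coord c p) (e/2). \<bar>f x - rdist M p0 (param c x)\<bar> \<le> \<eta> \<and>
    (\<forall>D v. (f has_derivative D) (at x) \<longrightarrow> \<bar>D v\<bar> \<le> (1 + \<epsilon>) * sqrt (metric_in M c (param c x) v v)))"
proof -
  let ?B = "cball (coord c p) e"
  (* The projection to the ball extends the distance to a continuous function on the whole coordinate space. *)
  define h where "h y = rdist M p0 (param c (closest_point ?B y))" for y
  have cp: "closest_point ?B y \<in> ?B" for y by (rule closest_point_in_set) (use e in auto)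
  have hc: "continuous_on UNIV h"
    unfolding h_def
  proof (rule continuous_on_compose2[OF continuous_on_rdist[of UNIV]])
    show "continuous_on UNIV (\<lambda>y. param c (closest_point ?B y))"
      by (rule continuous_on_compose2[OF continuous_on_param[OF c] continuous_on_closest_point])
         (use cp sub e in auto)
  qed simp
  have hB: "h y = rdist M p0 (param c y)" if "y \<in> ?B" for y using that by (simp add: h_def closest_point_self)
  have lip: "\<bar>h y - h z\<bar> \<le> (1 + \<epsilon>) * sqrt (metric_in M c (param c x) (y - z) (y - z))"
    if x: "x \<in> ?B" and y: "y \<in> ?B" and z: "z \<in> ?B" for x y z
  proof -
    have seg: "closed_segment z y \<subseteq> ?B" by (intro closed_segment_subset z y) auto
    have "\<exists>l\<le>(1 + \<epsilon>) * sqrt (metric_in M c (param c x) (y - z) (y - z)). joins (param c z) (param c y) l"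
      by (rule joins_segment[OF c]) (use seg sub ratio x in blast)+
    then have "rdist M (param c z) (param c y) \<le> (1 + \<epsilon>) * sqrt (metric_in M c (param c x) (y - z) (y - z))"
      using rdist_le order_trans by blast
    then show ?thesis using rdist_diff_le[of p0 "param c y" "param c z"] hB[OF y] hB[OF z] rdist_sym[of "param c y"] by simp
  qed
  define \<delta> where "\<delta> = min (e / 4) (\<eta> / ((1 + \<epsilon>) * L))"
  have \<delta>: "\<delta> > 0" "4 * \<delta> \<le> e" "(1 + \<epsilon>) * (L * \<delta>) \<le> \<eta>"
  proof -
    show "\<delta> > 0" "4 * \<delta> \<le> e" using e \<epsilon> L \<eta> by (auto simp: \<delta>_def)
    have "\<delta> \<le> \<eta> / ((1 + \<epsilon>) * L)" by (simp add: \<delta>_def)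
    then have "\<delta> * ((1 + \<epsilon>) * L) \<le> \<eta>" using \<epsilon> L by (simp add: pos_le_divide_eq)
    then show "(1 + \<epsilon>) * (L * \<delta>) \<le> \<eta>" by (simp add: mult_ac)
  qed
  have near: "y \<in> ?B" if "x \<in> cball (coord c p) (e/2)" "dist x y \<le> 2 * \<delta>" for x y
    using that \<delta>(2) dist_triangle[of "coord c p" y x] by auto
  have hb: "cball (coord c p) (e/2) \<subseteq> ?B" using e by auto
  show ?thesis
  proof (intro exI[of _ "conv (moll \<delta>) h"] conjI ballI allI impI)
    show "Ck_on 1 UNIV (conv (moll \<delta>) h)" by (rule Ck_on_conv_moll[OF \<delta>(1) hc])
    fix x assume x: "x \<in> cball (coord c p) (e/2)"
    have xB: "x \<in> ?B" using x hb by auto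
    have "\<bar>conv (moll \<delta>) h x - h x\<bar> \<le> \<eta>"
    proof (rule conv_moll_close[OF \<delta>(1) hc])
      fix y assume y: "dist x y \<le> \<delta>"
      have "\<bar>h y - h x\<bar> \<le> (1 + \<epsilon>) * sqrt (metric_in M c (param c x) (y - x) (y - x))"
        by (rule lip[OF xB near[OF x] xB]) (use y \<delta>(1) in simp)
      also have "\<dots> \<le> (1 + \<epsilon>) * (L * norm (y - x))" using up[OF xB] \<epsilon> by (intro mult_left_mono) auto
      also have "\<dots> \<le> (1 + \<epsilon>) * (L * \<delta>)" using y \<epsilon> L by (intro mult_left_mono) (auto simp: dist_norm norm_minus_commute)
      finally show "\<bar>h y - h x\<bar> \<le> \<eta>" using \<delta>(3) by simp
    qed
    then show "\<bar>conv (moll \<delta>) h x - rdist M p0 (param c x)\<bar> \<le> \<eta>" using hB[OF xB] by simp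
    fix D v assume D: "(conv (moll \<delta>) h has_derivative D) (at x)"
    have "\<bar>D v - 0\<bar> \<le> (1 + \<epsilon>) * sqrt (metric_in M c (param c x) v v)"
    proof (rule conv_moll_derivative_close[OF \<delta>(1) hc, where L = "\<lambda>_. 0" and N = "\<lambda>v. (1 + \<epsilon>) * sqrt (metric_in M c (param c x) v v)"])
      show "linear (\<lambda>_::real^'m. 0::real)" by (simp add: linear_iff)
      show "(1 + \<epsilon>) * sqrt (metric_in M c (param c x) (k *\<^sub>R v) (k *\<^sub>R v)) = \<bar>k\<bar> * ((1 + \<epsilon>) * sqrt (metric_in M c (param c x) v v))" for k v
      proof -
        have "metric_in M c (param c x) (k *\<^sub>R v) (k *\<^sub>R v) = k\<^sup>2 * metric_in M c (param c x) v v"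
          by (simp add: metric_in_def matrix_vector_mult_scaleR power2_eq_square mult.assoc)
        then show ?thesis by (simp add: real_sqrt_mult)
      qed
      show "\<bar>h y - h z - 0\<bar> \<le> (1 + \<epsilon>) * sqrt (metric_in M c (param c x) (y - z) (y - z))"
        if "dist x y \<le> 2 * \<delta>" "dist x z \<le> 2 * \<delta>" for y z
        using lip[OF xB near[OF x that(1)] near[OF x that(2)]] by simp
    qed (rule D)
    then show "\<bar>D v\<bar> \<le> (1 + \<epsilon>) * sqrt (metric_in M c (param c x) v v)" by simp
  qed
qed

text \<open>The local approximations \<open>f\<^sub>p\<close> are glued with a partition of unity \<open>\<theta>\<^sub>p / \<Theta>\<close>. The differential of the
  result \<open>\<rho>\<close> at a point is the average of the \<open>df\<^sub>p\<close> with weights \<open>\<theta>\<^sub>p / \<Theta>\<close> plus the sum of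
  \<open>(f\<^sub>p - \<rho>) d\<theta>\<^sub>p / \<Theta>\<close>. The differentials \<open>d\<theta>\<^sub>p\<close> are bounded on \<open>K\<close>, and the charts are fixed before the
  precision \<open>\<eta>\<close> of the local approximations, so the second sum can be made small.\<close>

lemma smooth_rdist:
  assumes K: "compact K" and \<epsilon>: "\<epsilon> > 0"
  obtains \<rho> W where "K \<subseteq> W" "Ck_fun_on 1 W \<rho>"
    "\<And>q. q \<in> W \<Longrightarrow> rdist M p0 q \<le> \<rho> q" "\<And>q. q \<in> W \<Longrightarrow> \<rho> q \<le> rdist M p0 q + \<epsilon>"
    "\<And>q. q \<in> K \<Longrightarrow> grad_norm M \<rho> q \<le> 1 + \<epsilon>"
proof (cases "K = {}")
  case True
  then show ?thesis using that[of "{}" "\<lambda>_. 0"] by (simp add: Ck_fun_on_zero)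
next
  case Kne: False
  define \<epsilon>1 where "\<epsilon>1 = \<epsilon> / 2"
  have \<epsilon>1: "\<epsilon>1 > 0" using \<epsilon> by (simp add: \<epsilon>1_def)
  define good where "good p N \<longleftrightarrow> (case N of (c, e, l) \<Rightarrow> c \<in> atlas M \<and> p \<in> dom c \<and> e > 0 \<and> l > 0 \<and>
     cball (coord c p) e \<subseteq> coord c ` dom c \<and>
     (\<forall>x v. x \<in> cball (coord c p) e \<longrightarrow> sqrt (metric_in M c (param c x) v v) \<le> l * norm v) \<and>
     (\<forall>x y v. x \<in> cball (coord c p) e \<longrightarrow> y \<in> cball (coord c p) e \<longrightarrow>
      sqrt (metric_in M c (param c x) v v) \<le> (1 + \<epsilon>1) * sqrt (metric_in M c (param c y) v v)))" for p N
  have "\<exists>N. good p N" for p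
  proof -
    obtain c where c: "c \<in> atlas M" "p \<in> dom c" using chart_cover by blast
    obtain e l L where "e > 0" "L > 0" "cball (coord c p) e \<subseteq> coord c ` (dom c \<inter> UNIV)"
      "\<And>x v. x \<in> cball (coord c p) e \<Longrightarrow> sqrt (metric_in M c (param c x) v v) \<le> L * norm v"
      "\<And>x y v. x \<in> cball (coord c p) e \<Longrightarrow> y \<in> cball (coord c p) e \<Longrightarrow>
        sqrt (metric_in M c (param c x) v v) \<le> (1 + \<epsilon>1) * sqrt (metric_in M c (param c y) v v)"
      by (rule metric_bounds[OF c UNIV_I open_UNIV \<epsilon>1]) blast
    then have "good p (c, e, L)" using c by (simp add: good_def)
    then show ?thesis by blast
  qed
  then obtain N where N: "\<And>p. good p (N p)" by metis
  define C where "C p = fst (N p)" for p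
  define E where "E p = fst (snd (N p))" for p
  define L where "L p = snd (snd (N p))" for p
  have C: "C p \<in> atlas M" "p \<in> dom (C p)" "E p > 0" "L p > 0"
     "cball (coord (C p) p) (E p) \<subseteq> coord (C p) ` dom (C p)"
     "\<And>x v. x \<in> cball (coord (C p) p) (E p) \<Longrightarrow> sqrt (metric_in M (C p) (param (C p) x) v v) \<le> L p * norm v"
     "\<And>x y v. x \<in> cball (coord (C p) p) (E p) \<Longrightarrow> y \<in> cball (coord (C p) p) (E p) \<Longrightarrow>
        sqrt (metric_in M (C p) (param (C p) x) v v) \<le> (1 + \<epsilon>1) * sqrt (metric_in M (C p) (param (C p) y) v v)"
    for p
    using N[of p] unfolding good_def C_def E_def L_def split_beta by blast+
  let ?k = "\<lambda>p. cball (coord (C p) p) (E p / 2)"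
  have sub2: "?k p \<subseteq> coord (C p) ` dom (C p)" for p
  proof -
    have "?k p \<subseteq> cball (coord (C p) p) (E p)" using C(3)[of p] by auto
    then show ?thesis using C(5)[of p] by blast
  qed
  have E2: "E p / 2 > 0" for p using C(3)[of p] by simp
  define U where "U p = param (C p) ` ball (coord (C p) p) (E p / 2)" for p
  have U: "open (U p)" "p \<in> U p" for p
  proof -
    have b: "ball (coord (C p) p) (E p / 2) \<subseteq> coord (C p) ` dom (C p)" using sub2[of p] ball_subset_cball by blast
    show "open (U p)" unfolding U_def by (rule open_param_image[OF C(1) open_ball b])
    have "coord (C p) p \<in> ball (coord (C p) p) (E p / 2)" using C(3)[of p] by simp
    then show "p \<in> U p" unfolding U_def using C(1,2)[of p] by (metis image_eqI param_coord)
  qed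
  have cov: "K \<subseteq> (\<Union>p\<in>K. U p)" using U by blast
  obtain F where F: "F \<subseteq> K" "finite F" "K \<subseteq> (\<Union>p\<in>F. U p)"
    by (rule compactE_image[OF K U(1) cov])
  define \<theta> where "\<theta> p = bump (C p) p (E p / 2)" for p
  have \<theta>1: "Ck_fun_on 1 UNIV (\<theta> p)" for p unfolding \<theta>_def by (rule Ck_fun_on_bump[OF C(1,2) E2 sub2])
  have \<theta>0: "\<theta> p q \<ge> 0" for p q unfolding \<theta>_def by (rule bump_nonneg[OF C(1,2) E2 sub2])
  have \<theta>U: "\<theta> p q > 0 \<longleftrightarrow> q \<in> U p" for p q unfolding \<theta>_def U_def by (rule bump_pos_iff[OF C(1,2) E2 sub2])
  have \<theta>z: "\<theta> p q = 0" if "q \<notin> param (C p) ` ?k p" for p q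
  proof -
    have "q \<notin> U p" unfolding U_def using that ball_subset_cball by blast
    then show ?thesis using \<theta>0[of p q] \<theta>U[of p q] by linarith
  qed
  have clk: "closed (param (C p) ` ?k p)" for p
    by (rule compact_imp_closed[OF compact_param_image[OF C(1) compact_cball sub2]])
  define \<Theta> where "\<Theta> q = (\<Sum>p\<in>F. \<theta> p q)" for q
  have \<Theta>1: "Ck_fun_on 1 UNIV \<Theta>" unfolding \<Theta>_def by (rule Ck_fun_on_sum[OF open_UNIV \<theta>1])
  define W where "W = {q. \<Theta> q > 0}"
  have oW: "open W" unfolding W_def
    by (intro open_Collect_less continuous_on_const Ck_fun_on_imp_continuous_on[OF \<Theta>1])
  have KW: "K \<subseteq> W"
  proof
    fix q assume "q \<in> K"
    then obtain p where "p \<in> F" "q \<in> U p" using F by auto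
    then show "q \<in> W" unfolding W_def \<Theta>_def using \<theta>0 \<theta>U F(2) by (auto intro!: sum_pos2[of F p])
  qed
  obtain t0 where t0: "t0 > 0" "\<And>q. q \<in> K \<Longrightarrow> t0 \<le> \<Theta> q"
  proof -
    obtain q0 where "q0 \<in> K" "\<forall>q\<in>K. \<Theta> q0 \<le> \<Theta> q"
      using continuous_attains_inf[OF K Kne continuous_on_subset[OF Ck_fun_on_imp_continuous_on[OF \<Theta>1]]] by blast
    then show ?thesis using that[of "\<Theta> q0"] KW by (auto simp: W_def)
  qed
  have "continuous_on UNIV (\<lambda>q. \<Sum>p\<in>F. grad_norm M (\<theta> p) q)"
    by (intro continuous_intros continuous_on_grad_norm \<theta>1)
  then obtain B where B: "\<And>q. q \<in> K \<Longrightarrow> \<bar>\<Sum>p\<in>F. grad_norm M (\<theta> p) q\<bar> \<le> B"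
    by (rule continuous_bounded_on_compact[OF _ K]) blast
  have B0: "B \<ge> 0" using B Kne by force
  (* Chosen such that 2 \<eta> times the sum of the |d\<theta>p| is at most \<epsilon>/2 times \<Theta> on K. *)
  define \<eta> where "\<eta> = min (\<epsilon> / 2) (\<epsilon> * t0 / (4 * (B + 1)))"
  have \<eta>: "\<eta> > 0" "2 * \<eta> \<le> \<epsilon>" "2 * \<eta> * B \<le> \<epsilon> / 2 * t0"
  proof -
    show "\<eta> > 0" "2 * \<eta> \<le> \<epsilon>" using \<epsilon> t0(1) B0 by (auto simp: \<eta>_def)
    have "\<eta> \<le> \<epsilon> * t0 / (4 * (B + 1))" by (simp add: \<eta>_def)
    then have "\<eta> * (4 * (B + 1)) \<le> \<epsilon> * t0" using B0 by (simp add: pos_le_divide_eq)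
    then show "2 * \<eta> * B \<le> \<epsilon> / 2 * t0" using \<open>\<eta> > 0\<close> by (simp add: algebra_simps)
  qed
  define r where "r = rdist M p0"
  have "\<exists>f. Ck_on 1 UNIV f \<and> (\<forall>x\<in>?k p. \<bar>f x - r (param (C p) x)\<bar> \<le> \<eta> \<and>
    (\<forall>D v. (f has_derivative D) (at x) \<longrightarrow> \<bar>D v\<bar> \<le> (1 + \<epsilon>1) * sqrt (metric_in M (C p) (param (C p) x) v v)))" for p
    unfolding r_def by (rule smooth_rdist_local[OF C(1-4)[of p] _ _ _ C(6,7)]) (use \<epsilon>1 \<eta> C(5)[of p] in auto)
  then obtain f where f: "\<And>p. Ck_on 1 UNIV (f p)"
    "\<And>p x. x \<in> ?k p \<Longrightarrow> \<bar>f p x - r (param (C p) x)\<bar> \<le> \<eta>"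
    "\<And>p x D v. x \<in> ?k p \<Longrightarrow> (f p has_derivative D) (at x) \<Longrightarrow> \<bar>D v\<bar> \<le> (1 + \<epsilon>1) * sqrt (metric_in M (C p) (param (C p) x) v v)"
    by metis
  (* Adding \<eta> makes the approximation an upper bound of the distance. *)
  define fc where "fc p q = f p (coord (C p) q) + \<eta>" for p q
  have fc1: "Ck_fun_on 1 (dom (C p)) (fc p)" for p
    unfolding fc_def
    by (intro Ck_fun_on_add Ck_fun_on_chart[OF C(1)] Ck_fun_on_const open_dom[OF C(1)] Ck_on_subset[OF f(1)]) auto
  define G where "G p q = \<theta> p q * fc p q" for p q
  have kq: "q \<in> dom (C p) \<and> coord (C p) q \<in> ?k p" if q: "q \<in> param (C p) ` ?k p" for p q
  proof -
    obtain x where x: "x \<in> ?k p" "q = param (C p) x" using q by blast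
    then have "x \<in> coord (C p) ` dom (C p)" using sub2 by blast
    then show ?thesis using x param_in_dom[OF C(1)] coord_param[OF C(1)] by simp
  qed
  have fcb: "r q \<le> fc p q \<and> fc p q \<le> r q + 2 * \<eta>" if "q \<in> param (C p) ` ?k p" for p q
    using f(2)[of "coord (C p) q" p] kq[OF that] C(1)[of p] by (auto simp: fc_def abs_le_iff)
  have G1: "Ck_fun_on 1 UNIV (G p)" for p
  proof (rule Ck_fun_on_local[OF _ open_UNIV])
    fix q
    show "\<exists>V. Ck_fun_on 1 V (G p) \<and> q \<in> V"
    proof (cases "q \<in> dom (C p)")
      case True
      have "Ck_fun_on 1 (dom (C p)) (G p)" unfolding G_def
        by (intro Ck_fun_on_mult fc1 Ck_fun_on_subset[OF \<theta>1] open_dom[OF C(1)]) auto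
      then show ?thesis using True by blast
    next
      case False
      then have "q \<in> - param (C p) ` ?k p" using kq by blast
      moreover have "Ck_fun_on 1 (- param (C p) ` ?k p) (G p)"
        by (rule Ck_fun_on_zero) (use clk \<theta>z in \<open>auto simp: G_def\<close>)
      ultimately show ?thesis by blast
    qed
  qed
  define \<rho> where "\<rho> q = (\<Sum>p\<in>F. G p q) * inverse (\<Theta> q)" for q
  have \<rho>1: "Ck_fun_on 1 W \<rho>" unfolding \<rho>_def
    by (intro Ck_fun_on_mult Ck_fun_on_sum Ck_fun_on_compose[OF Ck_on_inverse] Ck_fun_on_subset[OF G1]
        Ck_fun_on_subset[OF \<Theta>1] oW) (auto simp: W_def)
  have Gb: "\<theta> p q * r q \<le> G p q \<and> G p q \<le> \<theta> p q * (r q + 2 * \<eta>)" for p q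
  proof (cases "q \<in> param (C p) ` ?k p")
    case True
    then show ?thesis using fcb[OF True] \<theta>0[of p q] by (auto simp: G_def intro: mult_left_mono)
  qed (simp add: G_def \<theta>z)
  have \<rho>b: "r q \<le> \<rho> q \<and> \<rho> q \<le> r q + 2 * \<eta>" if q: "q \<in> W" for q
  proof -
    have T: "\<Theta> q > 0" using q by (simp add: W_def)
    have "\<Theta> q * r q \<le> (\<Sum>p\<in>F. G p q)" "(\<Sum>p\<in>F. G p q) \<le> \<Theta> q * (r q + 2 * \<eta>)"
      unfolding \<Theta>_def sum_distrib_right using Gb by (auto intro: sum_mono)
    then have "r q \<le> (\<Sum>p\<in>F. G p q) / \<Theta> q" "(\<Sum>p\<in>F. G p q) / \<Theta> q \<le> r q + 2 * \<eta>"
      using T by (simp_all add: pos_le_divide_eq pos_divide_le_eq mult.commute)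
    then show ?thesis by (simp add: \<rho>_def divide_inverse)
  qed
  show ?thesis
  proof (rule that[OF KW \<rho>1])
    show "rdist M p0 q \<le> \<rho> q" "\<rho> q \<le> rdist M p0 q + \<epsilon>" if "q \<in> W" for q
      using \<rho>b[OF that] \<eta>(2) by (auto simp: r_def)
    fix q assume q: "q \<in> K"
    then have qW: "q \<in> W" using KW by auto
    have T: "\<Theta> q > 0" using qW by (simp add: W_def)
    let ?d = "chart_at M q"
    define m where "m v = sqrt (metric_in M ?d q v v)" for v
    have m0: "m v \<ge> 0" for v unfolding m_def metric_in_def using gram_nonneg[OF chart_at] by simp
    define \<tau> where "\<tau> p = differential ?d (\<theta> p) q" for p
    have \<tau>: "has_differential ?d (\<theta> p) q (\<tau> p)" for p unfolding \<tau>_def by (rule has_differential[OF \<theta>1 chart_at UNIV_I])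
    have "\<exists>\<phi> \<xi>. has_differential ?d (G p) q (\<phi> *\<^sub>R \<tau> p + \<theta> p q *\<^sub>R \<xi>) \<and> r q \<le> \<phi> \<and> \<phi> \<le> r q + 2 * \<eta> \<and>
        (\<forall>v. \<xi> \<bullet> v \<le> (1 + \<epsilon>1) * m v)" for p
    proof (cases "q \<in> param (C p) ` ?k p")
      case True
      let ?x = "coord (C p) q"
      have qd: "q \<in> dom (C p)" "?x \<in> ?k p" using kq[OF True] by auto
      define \<xi> where "\<xi> = differential ?d (fc p) q"
      have \<xi>: "has_differential ?d (fc p) q \<xi>" unfolding \<xi>_def by (rule has_differential[OF fc1 chart_at qd(1)])
      have "grad_norm M (fc p) q \<le> 1 + \<epsilon>1"
      proof (rule grad_norm_le[OF C(1) qd(1) has_differential[OF fc1 C(1) qd(1) qd(1)]])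
        fix v
        let ?w = "differential (C p) (fc p) q"
        have "(fc p \<circ> param (C p) has_derivative (\<lambda>v. ?w \<bullet> v)) (at ?x)"
          using has_differential[OF fc1 C(1) qd(1) qd(1)] by (simp add: has_differential_def)
        then have "((\<lambda>x. f p x + \<eta>) has_derivative (\<lambda>v. ?w \<bullet> v)) (at ?x)"
          by (rule has_derivative_transform_within_open[OF _ open_coord_dom[OF C(1)]])
             (use qd in \<open>auto simp: fc_def C(1)\<close>)
        from has_derivative_diff[OF this has_derivative_const[of \<eta>]]
        have "(f p has_derivative (\<lambda>v. ?w \<bullet> v)) (at ?x)" by simp
        from f(3)[OF qd(2) this, of v] show "?w \<bullet> v \<le> (1 + \<epsilon>1) * sqrt (metric_in M (C p) q v v)"
          using qd(1) C(1)[of p] by simp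
      qed (use \<epsilon>1 in simp)
      then have "\<xi> \<bullet> v \<le> (1 + \<epsilon>1) * m v" for v
        using inner_le_grad_norm[OF chart_at \<xi>, where v=v] mult_right_mono[OF _ m0[of v]] unfolding m_def by (meson order_trans)
      moreover have "has_differential ?d (G p) q (fc p q *\<^sub>R \<tau> p + \<theta> p q *\<^sub>R \<xi>)"
        using has_differential_mult[OF chart_at \<tau> \<xi>] unfolding G_def by (simp add: add.commute)
      ultimately show ?thesis using fcb[OF True] by blast
    next
      case False
      then have qV: "q \<in> - param (C p) ` ?k p" by simp
      have oV: "open (- param (C p) ` ?k p)" using clk by auto
      have G0: "has_differential ?d (G p) q 0"
        by (rule differential_zero[OF chart_at qV oV]) (use \<theta>z in \<open>auto simp: G_def\<close>)
      have "has_differential ?d (\<theta> p) q 0"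
        by (rule differential_zero[OF chart_at qV oV]) (use \<theta>z in auto)
      then have "\<tau> p = 0" unfolding \<tau>_def by (rule has_differential_eqI)
      then show ?thesis using G0 \<eta>(1) \<epsilon>1 m0 by (intro exI[of _ "r q"] exI[of _ 0]) simp
    qed
    then obtain \<phi> \<xi> where \<phi>: "\<And>p. has_differential ?d (G p) q (\<phi> p *\<^sub>R \<tau> p + \<theta> p q *\<^sub>R \<xi> p)"
      "\<And>p. r q \<le> \<phi> p" "\<And>p. \<phi> p \<le> r q + 2 * \<eta>" "\<And>p v. \<xi> p \<bullet> v \<le> (1 + \<epsilon>1) * m v"
      by metis
    define w where "w = (\<Sum>p\<in>F. G p q) *\<^sub>R ((- (inverse (\<Theta> q) * inverse (\<Theta> q))) *\<^sub>R (\<Sum>p\<in>F. \<tau> p))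
       + inverse (\<Theta> q) *\<^sub>R (\<Sum>p\<in>F. \<phi> p *\<^sub>R \<tau> p + \<theta> p q *\<^sub>R \<xi> p)"
    have w: "has_differential ?d \<rho> q w"
      unfolding \<rho>_def w_def
    proof (rule has_differential_mult[OF chart_at has_differential_sum[OF \<phi>(1)]])
      show "has_differential ?d (\<lambda>q. inverse (\<Theta> q)) q ((- (inverse (\<Theta> q) * inverse (\<Theta> q))) *\<^sub>R (\<Sum>p\<in>F. \<tau> p))"
        unfolding \<Theta>_def
        by (rule has_differential_compose[OF chart_at has_differential_sum[OF \<tau>]])
           (use T in \<open>auto simp: \<Theta>_def intro!: derivative_eq_intros\<close>)
    qed
    have wv: "w \<bullet> v = inverse (\<Theta> q) * (\<Sum>p\<in>F. \<theta> p q * (\<xi> p \<bullet> v) + (\<phi> p - \<rho> q) * (\<tau> p \<bullet> v))" for v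
    proof -
      have "w \<bullet> v = inverse (\<Theta> q) * (\<Sum>p\<in>F. \<phi> p * (\<tau> p \<bullet> v) + \<theta> p q * (\<xi> p \<bullet> v)) - inverse (\<Theta> q) * (\<rho> q * (\<Sum>p\<in>F. \<tau> p \<bullet> v))"
        by (simp add: w_def \<rho>_def inner_add_left inner_diff_left inner_sum_left mult_ac)
      also have "\<dots> = inverse (\<Theta> q) * (\<Sum>p\<in>F. \<theta> p q * (\<xi> p \<bullet> v) + (\<phi> p - \<rho> q) * (\<tau> p \<bullet> v))"
        by (simp add: sum_distrib_left sum_subtractf sum.distrib algebra_simps)
      finally show ?thesis .
    qed
    show "grad_norm M \<rho> q \<le> 1 + \<epsilon>"
    proof (rule grad_norm_le[OF chart_at w])
      fix v
      have "\<theta> p q * (\<xi> p \<bullet> v) + (\<phi> p - \<rho> q) * (\<tau> p \<bullet> v) \<le> \<theta> p q * ((1 + \<epsilon>1) * m v) + 2 * \<eta> * (grad_norm M (\<theta> p) q * m v)" for p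
      proof -
        have "\<bar>\<phi> p - \<rho> q\<bar> \<le> 2 * \<eta>" using \<phi>(2,3)[of p] \<rho>b[OF qW] by (simp add: abs_le_iff)
        moreover have "\<bar>\<tau> p \<bullet> v\<bar> \<le> grad_norm M (\<theta> p) q * m v"
          using inner_le_grad_norm[OF chart_at \<tau>, where v=v] inner_le_grad_norm[OF chart_at \<tau>, where v="- v"]
            matrix_vector_mult_scaleR[of "gram M ?d q" "- 1" v]
          by (simp add: m_def metric_in_def abs_le_iff)
        ultimately have "\<bar>(\<phi> p - \<rho> q) * (\<tau> p \<bullet> v)\<bar> \<le> 2 * \<eta> * (grad_norm M (\<theta> p) q * m v)"
          unfolding abs_mult using \<eta>(1) by (intro mult_mono) auto
        moreover have "\<theta> p q * (\<xi> p \<bullet> v) \<le> \<theta> p q * ((1 + \<epsilon>1) * m v)"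
          using \<phi>(4) \<theta>0 by (intro mult_left_mono) auto
        ultimately show ?thesis by linarith
      qed
      then have "(\<Sum>p\<in>F. \<theta> p q * (\<xi> p \<bullet> v) + (\<phi> p - \<rho> q) * (\<tau> p \<bullet> v))
          \<le> (\<Sum>p\<in>F. \<theta> p q * ((1 + \<epsilon>1) * m v) + 2 * \<eta> * (grad_norm M (\<theta> p) q * m v))"
        by (rule sum_mono)
      also have "\<dots> = \<Theta> q * ((1 + \<epsilon>1) * m v) + 2 * \<eta> * (\<Sum>p\<in>F. grad_norm M (\<theta> p) q) * m v"
        by (simp add: \<Theta>_def sum.distrib sum_distrib_left sum_distrib_right mult_ac)
      also have "\<dots> \<le> \<Theta> q * ((1 + \<epsilon>1) * m v) + (\<epsilon> / 2 * \<Theta> q) * m v"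
      proof -
        have "2 * \<eta> * (\<Sum>p\<in>F. grad_norm M (\<theta> p) q) \<le> 2 * \<eta> * B" using B[OF q] \<eta>(1) by (intro mult_left_mono) auto
        also have "\<dots> \<le> \<epsilon> / 2 * t0" by (rule \<eta>(3))
        also have "\<dots> \<le> \<epsilon> / 2 * \<Theta> q" using t0(2)[OF q] \<epsilon> by (intro mult_left_mono) auto
        finally show ?thesis using m0[of v] by (intro add_left_mono mult_right_mono) auto
      qed
      also have "\<dots> = \<Theta> q * ((1 + \<epsilon>) * m v)" by (simp add: \<epsilon>1_def algebra_simps)
      finally have "w \<bullet> v \<le> inverse (\<Theta> q) * (\<Theta> q * ((1 + \<epsilon>) * m v))"
        unfolding wv using T by (intro mult_left_mono) auto
      also have "inverse (\<Theta> q) * (\<Theta> q * ((1 + \<epsilon>) * m v)) = (1 + \<epsilon>) * m v"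
        using T by (simp add: mult.assoc[symmetric])
      finally show "w \<bullet> v \<le> (1 + \<epsilon>) * sqrt (metric_in M ?d q v v)" by (simp add: m_def)
    qed (use \<epsilon> in simp)
  qed
qed

end

section \<open>Elementary inequalities for the test function\<close>

text \<open>The graph of \<open>t\<^sup>-\<^sup>a\<close> lies above its tangent at \<open>S\<close>.\<close>

lemma powr_neg_tangent:
  fixes t S a :: real
  assumes t: "t > 0" and S: "S > 0" and a: "a \<ge> 0"
  shows "S powr (- a) - a * S powr (- a - 1) * (t - S) \<le> t powr (- a)"
proof -
  have "1 - a * (t / S - 1) \<le> 1 + (- a * ln (t / S))"
    using ln_le_minus_one[of "t / S"] t S a by (simp add: mult_left_mono)
  also have "\<dots> \<le> exp (- a * ln (t / S))" by (rule exp_ge_add_one_self)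
  also have "\<dots> = (t / S) powr (- a)" using t S by (simp add: powr_def)
  finally have "S powr (- a) * (1 - a * (t / S - 1)) \<le> S powr (- a) * (t / S) powr (- a)"
    by (rule mult_left_mono) simp
  also have "S powr (- a) * (t / S) powr (- a) = t powr (- a)"
    using t S by (simp add: powr_divide)
  also have "S powr (- a) * (1 - a * (t / S - 1)) = S powr (- a) - a * S powr (- a - 1) * (t - S)"
    using S by (simp add: powr_diff field_simps)
  finally show ?thesis .
qed

text \<open>Writing \<open>k\<close> for a number slightly below \<open>K / A\<close>, the tangent at \<open>S\<close> to the convex function
  \<open>k t\<^sup>-\<^sup>a\<close> shows that \<open>q t + k t\<^sup>-\<^sup>a\<close> is minimal at \<open>t = S\<close> when \<open>q = a k S\<^sup>-\<^sup>a\<^sup>-\<^sup>1\<close>, with minimum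
  \<open>q S + k S\<^sup>-\<^sup>a\<close>. This exceeds \<open>q S + \<beta>\<close> exactly when \<open>k > \<beta> S\<^sup>a\<close>, which is where the sharp
  constant comes from; the strict inequality leaves room for the small parameters \<open>e\<close>, \<open>\<kappa>\<close>, \<open>\<epsilon>\<close>.\<close>

lemma parameter_choice:
  fixes A K S \<beta> a \<mu> :: real
  assumes A: "A > 0" and S: "S > 0" and a: "a > 0" and \<beta>: "\<beta> > 0" and K: "K > A * \<beta> * S powr a"
  obtains e \<kappa> \<epsilon> q k where "0 < e" "e < 1" "\<kappa> > 0" "\<epsilon> > 0" "q > 0" "k > 0"
    "A * k + \<kappa> = K * (1 + e) powr (- \<bar>\<mu>\<bar>)"
    "\<And>t. t > 0 \<Longrightarrow> (1 + e) * (q * S + \<beta>) \<le> (q - \<epsilon>) * t + k * t powr (- a)"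
proof -
  define k where "k = (K / A + \<beta> * S powr a) / 2"
  have kK: "A * k < K" and kl: "k > \<beta> * S powr a"
    using K A by (auto simp: k_def field_simps)
  have k0: "k > 0" using kl \<beta> S by (smt (verit) mult_pos_pos powr_gt_zero)
  define g where "g = k * S powr (- a) - \<beta>"
  have "\<beta> * S powr a * S powr (- a) < k * S powr (- a)" using kl S by simp
  then have g: "g > 0" using S by (simp add: g_def powr_add[symmetric] mult.assoc)
  define q0 where "q0 = a * k * S powr (- a - 1)"
  have q0: "q0 > 0" using a k0 S by (simp add: q0_def)
  define \<epsilon> where "\<epsilon> = g / (4 * S)"
  have \<epsilon>: "\<epsilon> > 0" "\<epsilon> * S = g / 4" using g S by (auto simp: \<epsilon>_def)
  define q where "q = q0 + \<epsilon>"
  have q: "q > 0" using q0 \<epsilon> by (simp add: q_def)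
  have "((\<lambda>e. K * (1 + e) powr (- \<bar>\<mu>\<bar>)) \<longlongrightarrow> K * (1 + 0) powr (- \<bar>\<mu>\<bar>)) (at_right 0)"
    by (intro tendsto_intros) auto
  then have "eventually (\<lambda>e. A * k < K * (1 + e) powr (- \<bar>\<mu>\<bar>)) (at_right 0)"
    using kK by (intro order_tendstoD) simp
  moreover have "eventually (\<lambda>e. e * (q * S + \<beta>) < g / 4) (at_right 0)"
  proof (rule order_tendstoD(2))
    show "((\<lambda>e. e * (q * S + \<beta>)) \<longlongrightarrow> 0 * (q * S + \<beta>)) (at_right 0)" by (intro tendsto_intros)
    show "0 * (q * S + \<beta>) < g / 4" using g by simp
  qed
  moreover have "eventually (\<lambda>e::real. 0 < e \<and> e < 1) (at_right 0)"
    by (rule eventually_at_rightI[of 0 1]) auto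
  ultimately have "eventually (\<lambda>e. A * k < K * (1 + e) powr (- \<bar>\<mu>\<bar>) \<and> e * (q * S + \<beta>) < g / 4 \<and> 0 < e \<and> e < 1) (at_right 0)"
    by eventually_elim auto
  then obtain e where e: "A * k < K * (1 + e) powr (- \<bar>\<mu>\<bar>)" "e * (q * S + \<beta>) < g / 4" "0 < e" "e < 1"
    using eventually_happens' trivial_limit_at_right_real by blast
  show ?thesis
  proof (rule that[of e "K * (1 + e) powr (- \<bar>\<mu>\<bar>) - A * k" \<epsilon> q k])
    fix t :: real assume t: "t > 0"
    have "k * (S powr (- a) - a * S powr (- a - 1) * (t - S)) \<le> k * t powr (- a)"
      using powr_neg_tangent[OF t S] a k0 by (intro mult_left_mono) auto
    then have "k * S powr (- a) - q0 * (t - S) \<le> k * t powr (- a)" by (simp add: q0_def algebra_simps)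
    moreover have "(1 + e) * (q * S + \<beta>) = e * (q * S + \<beta>) + q0 * S + \<epsilon> * S + \<beta>"
      by (simp add: q_def algebra_simps)
    ultimately show "(1 + e) * (q * S + \<beta>) \<le> (q - \<epsilon>) * t + k * t powr (- a)"
      using e(2) \<epsilon>(2) g unfolding g_def q_def by (simp add: algebra_simps)
  qed (use e \<epsilon> q k0 in auto)
qed

lemma powr_ratio_bound:
  fixes Y X e \<mu> :: real
  assumes Y: "1 \<le> Y" "Y \<le> X" "X \<le> Y + e" and e: "e > 0"
  shows "(1 + e) powr (- \<bar>\<mu>\<bar>) * X powr (- \<mu>) \<le> Y powr (- \<mu>)"
proof (cases "\<mu> \<ge> 0")
  case True
  have "X powr (- \<mu>) \<le> Y powr (- \<mu>)" using True Y by (intro powr_mono2') auto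
  moreover have "(1 + e) powr (- \<bar>\<mu>\<bar>) \<le> 1"
    using powr_mono[of "- \<bar>\<mu>\<bar>" 0 "1 + e"] e by simp
  ultimately show ?thesis using mult_mono[of "(1 + e) powr (- \<bar>\<mu>\<bar>)" 1 "X powr (- \<mu>)" "Y powr (- \<mu>)"] by simp
next
  case False
  have "1 * e \<le> Y * e" by (rule mult_right_mono) (use Y e in auto)
  then have "X \<le> Y * (1 + e)" using Y(3) unfolding distrib_left by linarith
  then have "X powr (- \<mu>) \<le> (Y * (1 + e)) powr (- \<mu>)" using False Y by (intro powr_mono2) auto
  also have "\<dots> = Y powr (- \<mu>) * (1 + e) powr (- \<mu>)" using Y e by (simp add: powr_mult)
  finally have "(1 + e) powr \<mu> * X powr (- \<mu>) \<le> (1 + e) powr \<mu> * (Y powr (- \<mu>) * (1 + e) powr (- \<mu>))"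
    by (rule mult_left_mono) simp
  also have "\<dots> = Y powr (- \<mu>)" using e by (simp add: powr_minus field_simps)
  finally show ?thesis using False by simp
qed

text \<open>With \<open>w = u - c\<close> and \<open>X = 1 + \<rho>\<close>, \<open>B\<close> is minus the derivative with respect to \<open>\<rho>\<close> of the exponent
  \<open>q w X\<^sup>-\<^sup>\<eta> - q b X\<^sup>\<sigma>\<^sup>-\<^sup>\<eta> - \<beta> H(X)\<close> of the weight, where \<open>H\<close> is a primitive of \<open>X\<^sup>\<sigma>\<^sup>-\<^sup>\<eta>\<^sup>-\<^sup>1\<close>. It is affine in \<open>w\<close>, and
  its maximum is attained at \<open>w = b X\<^sup>\<sigma>\<close> for \<open>\<eta> \<ge> 0\<close> and at \<open>w = 0\<close> for \<open>\<eta> < 0\<close>; this explains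
  the factor \<open>max \<sigma> (\<sigma> - \<eta>)\<close>.\<close>

lemma radial_coefficient_bound:
  fixes b \<sigma> \<eta> S q \<beta> X w :: real
  assumes b: "b \<ge> 0" and \<sigma>: "\<sigma> \<ge> 0" and m: "\<sigma> - \<eta> \<ge> 0" and S: "S \<ge> b * max \<sigma> (\<sigma> - \<eta>)"
    and q: "q > 0" and \<beta>: "\<beta> > 0" and X: "X \<ge> 1" and w: "0 \<le> w" "w \<le> b * X powr \<sigma>"
  defines "B \<equiv> q * \<eta> * w * X powr (- \<eta> - 1) + q * b * (\<sigma> - \<eta>) * X powr (\<sigma> - \<eta> - 1) + \<beta> * X powr (\<sigma> - \<eta> - 1)"
  shows "0 \<le> B" "B \<le> (q * S + \<beta>) * X powr (\<sigma> - \<eta> - 1)"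
proof -
  define Y where "Y = X powr (\<sigma> - \<eta> - 1)"
  have Y: "Y > 0" using X by (simp add: Y_def)
  define v where "v = w * X powr (- \<eta> - 1)"
  have v: "0 \<le> v" "v \<le> b * Y"
  proof -
    show "0 \<le> v" using w X by (simp add: v_def)
    have "v \<le> b * X powr \<sigma> * X powr (- \<eta> - 1)" unfolding v_def using w X by (intro mult_right_mono) auto
    also have "\<dots> = b * Y" using X by (simp add: Y_def mult.assoc powr_add[symmetric] algebra_simps)
    finally show "v \<le> b * Y" .
  qed
  have B: "B = q * (\<eta> * v + b * (\<sigma> - \<eta>) * Y) + \<beta> * Y"
    by (simp add: B_def v_def Y_def algebra_simps)
  have key: "0 \<le> \<eta> * v + b * (\<sigma> - \<eta>) * Y \<and> \<eta> * v + b * (\<sigma> - \<eta>) * Y \<le> S * Y"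
  proof (cases "\<eta> \<ge> 0")
    case True
    have "\<eta> * v \<le> \<eta> * (b * Y)" using True v by (intro mult_left_mono) auto
    moreover have "b * \<sigma> * Y \<le> S * Y"
    proof (rule mult_right_mono)
      have "b * \<sigma> \<le> b * max \<sigma> (\<sigma> - \<eta>)" using b by (intro mult_left_mono) auto
      then show "b * \<sigma> \<le> S" using S by simp
    qed (use Y in simp)
    moreover have "0 \<le> \<eta> * v" "0 \<le> b * (\<sigma> - \<eta>) * Y" using True v b m Y by auto
    ultimately show ?thesis by (simp add: algebra_simps)
  next
    case False
    have "\<eta> * (b * Y) \<le> \<eta> * v" using False v by (intro mult_left_mono_neg) auto
    moreover have "b * \<sigma> * Y \<ge> 0" using b \<sigma> Y by simp
    moreover have "b * (\<sigma> - \<eta>) * Y \<le> S * Y"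
    proof (rule mult_right_mono)
      have "b * (\<sigma> - \<eta>) \<le> b * max \<sigma> (\<sigma> - \<eta>)" using b by (intro mult_left_mono) auto
      then show "b * (\<sigma> - \<eta>) \<le> S" using S by simp
    qed (use Y in simp)
    moreover have "\<eta> * v \<le> 0" using False v by (simp add: mult_nonpos_nonneg)
    ultimately show ?thesis by (simp add: algebra_simps)
  qed
  have "0 \<le> q * (\<eta> * v + b * (\<sigma> - \<eta>) * Y)" by (rule mult_nonneg_nonneg) (use key q in auto)
  moreover have "0 \<le> \<beta> * Y" using \<beta> Y by simp
  ultimately show "0 \<le> B" unfolding B by linarith
  have "q * (\<eta> * v + b * (\<sigma> - \<eta>) * Y) \<le> q * (S * Y)" using key q by (intro mult_left_mono) auto
  then show "B \<le> (q * S + \<beta>) * X powr (\<sigma> - \<eta> - 1)" unfolding B Y_def[symmetric] by (simp add: algebra_simps)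
qed

text \<open>In terms of the rescaled slope \<open>t = s X\<^sup>1\<^sup>-\<^sup>\<sigma>\<close> all three terms carry the same power of \<open>X\<close>, by the
  definition of \<open>\<eta>\<close>, and after using \<open>\<phi> \<le> A s\<^sup>\<delta>\<close> to bound the source term from below by a multiple of
  \<open>\<phi>\<close>, the claim becomes the inequality \<open>tan\<close> of \<open>parameter_choice\<close>.\<close>

lemma main_term_bound:
  fixes A K S \<beta> \<mu> \<delta> chi \<sigma> \<eta> e \<kappa> \<epsilon> q k s X Y B \<phi> :: real
  assumes A: "A > 0" and eta: "\<eta> = \<mu> + (\<sigma> - 1) * (1 + \<delta> - chi)" and K: "K > 0"
    and e: "0 < e" and k: "k > 0" and kK: "A * k + \<kappa> = K * (1 + e) powr (- \<bar>\<mu>\<bar>)"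
    and tan: "\<And>t. t > 0 \<Longrightarrow> (1 + e) * (q * S + \<beta>) \<le> (q - \<epsilon>) * t + k * t powr (- (\<delta> - chi))"
    and s: "s > 0" and Y: "1 \<le> Y" "Y \<le> X" "X \<le> Y + e" and B: "B \<le> (q * S + \<beta>) * X powr (\<sigma> - \<eta> - 1)"
    and \<phi>: "\<phi> \<ge> 0" "\<phi> \<le> A * s powr \<delta>"
  shows "\<epsilon> * X powr (- \<eta>) * (\<phi> * s) + \<kappa> * X powr (- \<mu>) * s powr chi
     \<le> q * X powr (- \<eta>) * (\<phi> * s) - (1 + e) * B * \<phi> + K * Y powr (- \<mu>) * s powr chi"
proof -
  have X: "X \<ge> 1" using Y by simp
  define P where "P = X powr (\<sigma> - \<eta> - 1)"
  define t where "t = s * X powr (1 - \<sigma>)"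
  have t: "t > 0" using s X by (simp add: t_def)
  have P: "P \<ge> 0" by (simp add: P_def)
  have e1: "X powr (- \<eta>) * s = P * t"
  proof -
    have "P * t = s * (X powr (\<sigma> - \<eta> - 1) * X powr (1 - \<sigma>))" by (simp add: P_def t_def)
    also have "X powr (\<sigma> - \<eta> - 1) * X powr (1 - \<sigma>) = X powr (- \<eta>)" by (simp add: powr_add[symmetric])
    finally show ?thesis by (simp add: mult.commute)
  qed
  have e2: "X powr (- \<mu>) * s powr (- (\<delta> - chi)) = P * t powr (- (\<delta> - chi))"
  proof -
    have "t powr (- (\<delta> - chi)) = s powr (- (\<delta> - chi)) * X powr ((1 - \<sigma>) * (- (\<delta> - chi)))"
      using s X by (simp add: t_def powr_mult powr_powr)
    then have "P * t powr (- (\<delta> - chi)) = s powr (- (\<delta> - chi)) * (X powr (\<sigma> - \<eta> - 1) * X powr ((1 - \<sigma>) * (- (\<delta> - chi))))"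
      by (simp add: P_def)
    also have "X powr (\<sigma> - \<eta> - 1) * X powr ((1 - \<sigma>) * (- (\<delta> - chi))) = X powr (- \<mu>)"
      unfolding powr_add[symmetric] eta by (simp add: algebra_simps)
    finally show ?thesis by (simp add: mult.commute)
  qed
  have "K * (1 + e) powr (- \<bar>\<mu>\<bar>) * X powr (- \<mu>) * s powr chi \<le> K * Y powr (- \<mu>) * s powr chi"
    using powr_ratio_bound[OF Y e, of \<mu>] K by (intro mult_right_mono) (auto simp: mult.assoc)
  then have 1: "(A * k + \<kappa>) * X powr (- \<mu>) * s powr chi \<le> K * Y powr (- \<mu>) * s powr chi"
    unfolding kK .
  have "\<phi> * s powr (- (\<delta> - chi)) \<le> A * s powr \<delta> * s powr (- (\<delta> - chi))"
    using \<phi> by (intro mult_right_mono) auto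
  also have "\<dots> = A * s powr chi" by (simp add: mult.assoc powr_add[symmetric])
  finally have "k * X powr (- \<mu>) * (\<phi> * s powr (- (\<delta> - chi))) \<le> k * X powr (- \<mu>) * (A * s powr chi)"
    using k by (intro mult_left_mono) auto
  then have 2: "\<phi> * P * (k * t powr (- (\<delta> - chi))) \<le> A * k * X powr (- \<mu>) * s powr chi"
    using e2 by (simp add: mult_ac)
  have 3: "(1 + e) * B * \<phi> \<le> \<phi> * P * ((1 + e) * (q * S + \<beta>))"
    using mult_left_mono[OF B, of "(1 + e) * \<phi>"] e \<phi> by (simp add: P_def mult_ac)
  have "\<phi> * P * ((1 + e) * (q * S + \<beta>)) \<le> \<phi> * P * ((q - \<epsilon>) * t + k * t powr (- (\<delta> - chi)))"
    using tan[OF t] \<phi> P by (intro mult_left_mono) auto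
  moreover have "\<phi> * P * ((q - \<epsilon>) * t) = (q - \<epsilon>) * X powr (- \<eta>) * (\<phi> * s)"
    using e1 by (simp add: mult_ac)
  ultimately show ?thesis using 1 2 3 by (simp add: algebra_simps)
qed

text \<open>An inequality of Young type. If the cut-off term is not absorbed by the main term, then
  \<open>s \<le> X\<^sup>\<eta> z / (\<epsilon> \<zeta>)\<close>, and \<open>\<phi> \<le> A s\<^sup>\<delta>\<close> turns the cut-off term into a quantity free of \<open>s\<close>;
  the power \<open>\<zeta>\<^sup>N\<close> with \<open>N \<ge> 1 + \<delta>\<close> compensates the negative powers of \<open>\<zeta>\<close> that arise.\<close>

lemma cutoff_term_bound:
  fixes A \<delta> \<epsilon> \<eta> \<zeta> z C X s \<phi> :: real and N :: nat
  assumes A: "A > 0" and \<delta>: "\<delta> > 0" and N: "real N \<ge> 1 + \<delta>" and \<epsilon>: "\<epsilon> > 0"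
    and \<zeta>: "0 \<le> \<zeta>" "\<zeta> \<le> 1" and z: "0 \<le> z" "z \<le> C" and X: "X \<ge> 1" and s: "s > 0" and \<phi>: "\<phi> \<ge> 0" "\<phi> \<le> A * s powr \<delta>"
  shows "\<zeta> ^ (N - 1) * z * \<phi> \<le> \<epsilon> * \<zeta> ^ N * X powr (- \<eta>) * (\<phi> * s)
     + (if z = 0 then 0 else A * \<epsilon> powr (- \<delta>) * C powr (1 + \<delta>) * X powr (\<eta> * \<delta>))"
proof (cases "z = 0 \<or> \<zeta> = 0")
  case True
  have "N - 1 > 0" using N \<delta> by simp
  then have eq0: "\<zeta> ^ (N - 1) * z * \<phi> = 0" using True by auto
  moreover have "0 \<le> \<epsilon> * \<zeta> ^ N * X powr (- \<eta>) * (\<phi> * s)" using \<epsilon> \<zeta> \<phi> s by simp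
  moreover have "0 \<le> A * \<epsilon> powr (- \<delta>) * C powr (1 + \<delta>) * X powr (\<eta> * \<delta>)" using A by simp
  ultimately show ?thesis unfolding eq0 by auto
next
  case False
  then have z0: "z > 0" and \<zeta>0: "\<zeta> > 0" using z \<zeta> by auto
  let ?w = "X powr (- \<eta>)"
  have w: "?w > 0" using X by simp
  have err: "0 \<le> A * \<epsilon> powr (- \<delta>) * C powr (1 + \<delta>) * X powr (\<eta> * \<delta>)" using A by simp
  show ?thesis
  proof (cases "\<zeta> ^ (N - 1) * z \<le> \<epsilon> * \<zeta> ^ N * ?w * s")
    case True
    then have "\<zeta> ^ (N - 1) * z * \<phi> \<le> \<epsilon> * \<zeta> ^ N * ?w * s * \<phi>" using \<phi> by (intro mult_right_mono) auto
    then show ?thesis using err z0 by (simp add: mult_ac)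
  next
    case False
    have Nr: "\<zeta> ^ N = \<zeta> powr (real N)" "\<zeta> ^ (N - 1) = \<zeta> powr (real N - 1)"
    proof -
      show "\<zeta> ^ N = \<zeta> powr (real N)" using \<zeta>0 by (simp add: powr_realpow)
      have "real (N - 1) = real N - 1" using N \<delta> by simp
      then show "\<zeta> ^ (N - 1) = \<zeta> powr (real N - 1)" using powr_realpow[OF \<zeta>0, of "N - 1"] by simp
    qed
    define x where "x = \<zeta> powr (real N - 1) * z"
    have x: "x > 0" using \<zeta>0 z0 by (simp add: x_def)
    define d where "d = \<epsilon> * \<zeta> powr (real N) * ?w"
    have d: "d > 0" using \<epsilon> \<zeta>0 w by (simp add: d_def)
    have "d * s < x" using False unfolding Nr by (simp add: d_def x_def)
    then have "s \<le> x / d" using d by (simp add: field_simps)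
    then have "s powr \<delta> \<le> (x / d) powr \<delta>" using s \<delta> by (intro powr_mono2) auto
    then have "\<phi> \<le> A * (x / d) powr \<delta>" using \<phi>(2) A by (smt (verit) mult_left_mono)
    then have "x * \<phi> \<le> x * (A * (x / d) powr \<delta>)" using x by (intro mult_left_mono) auto
    also have "\<dots> = A * (x powr (1 + \<delta>) * d powr (- \<delta>))"
      using x d by (simp add: powr_divide powr_add powr_minus field_simps)
    also have "x powr (1 + \<delta>) * d powr (- \<delta>) = (\<epsilon> powr (- \<delta>) * X powr (\<eta> * \<delta>)) * z powr (1 + \<delta>) * \<zeta> powr ((real N - 1) * (1 + \<delta>) - real N * \<delta>)"
    proof -
      have x1: "x powr (1 + \<delta>) = \<zeta> powr ((real N - 1) * (1 + \<delta>)) * z powr (1 + \<delta>)"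
        using \<zeta>0 z0 unfolding x_def by (simp only: powr_mult powr_ge_zero less_imp_le powr_powr)
      have d1: "d powr (- \<delta>) = \<epsilon> powr (- \<delta>) * \<zeta> powr (real N * (- \<delta>)) * X powr ((- \<eta>) * (- \<delta>))"
        using \<epsilon> \<zeta>0 unfolding d_def
        by (simp only: powr_mult powr_ge_zero less_imp_le mult_nonneg_nonneg powr_powr)
      have "\<zeta> powr ((real N - 1) * (1 + \<delta>) - real N * \<delta>) = \<zeta> powr ((real N - 1) * (1 + \<delta>)) * \<zeta> powr (real N * (- \<delta>))"
        unfolding powr_add[symmetric] by simp
      then show ?thesis unfolding x1 d1 by (simp add: mult_ac)
    qed
    also have "\<dots> \<le> (\<epsilon> powr (- \<delta>) * X powr (\<eta> * \<delta>)) * C powr (1 + \<delta>) * 1"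
    proof (intro mult_mono mult_nonneg_nonneg)
      show "z powr (1 + \<delta>) \<le> C powr (1 + \<delta>)" using z z0 \<delta> by (intro powr_mono2) auto
      have "(real N - 1) * (1 + \<delta>) - real N * \<delta> \<ge> 0" using N by (simp add: algebra_simps)
      then show "\<zeta> powr ((real N - 1) * (1 + \<delta>) - real N * \<delta>) \<le> 1"
        using powr_mono2[of "(real N - 1) * (1 + \<delta>) - real N * \<delta>" \<zeta> 1] \<zeta>0 \<zeta> by simp
    qed auto
    finally have "x * \<phi> \<le> A * \<epsilon> powr (- \<delta>) * C powr (1 + \<delta>) * X powr (\<eta> * \<delta>)"
      using A by (simp add: mult_ac)
    moreover have "0 \<le> \<epsilon> * \<zeta> ^ N * ?w * (\<phi> * s)" using \<epsilon> \<zeta> \<phi> s by simp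
    ultimately show ?thesis using z0 unfolding x_def Nr by simp
  qed
qed

section \<open>The cut-off function\<close>

definition cutoff :: "real \<Rightarrow> real" where
  "cutoff t = flat_exp 0 (1 - t) / (flat_exp 0 (1 - t) + flat_exp 0 t)"

definition cutoff' :: "real \<Rightarrow> real" where
  "cutoff' t = - (flat_exp 2 (1 - t) * flat_exp 0 t + flat_exp 0 (1 - t) * flat_exp 2 t)
     / (flat_exp 0 (1 - t) + flat_exp 0 t)\<^sup>2"

lemma flat_exp_nonneg: "flat_exp k t \<ge> 0" by (simp add: flat_exp_eq)

lemma flat_exp_sum_pos: "flat_exp 0 (1 - t) + flat_exp 0 t > 0"
proof (cases "t > 0")
  case True then show ?thesis using flat_exp_nonneg[of 0 "1 - t"] by (simp add: flat_exp_eq add_nonneg_pos)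
next
  case False then show ?thesis using flat_exp_nonneg[of 0 t] by (simp add: flat_exp_eq add_pos_nonneg)
qed

lemma flat_exp_0_deriv: "(flat_exp 0 has_real_derivative flat_exp 2 t) (at t)"
  using flat_exp_deriv[of 0 t] by (simp only: of_nat_0 mult_zero_left diff_zero add_0)

lemma continuous_on_flat_exp: "continuous_on S (flat_exp k)"
  using Ck_on_imp_continuous_on[OF Ck_on_flat_exp[of 0 k]] continuous_on_subset by blast

lemma cutoff_deriv: "(cutoff has_real_derivative cutoff' t) (at t)"
proof -
  have 1: "((\<lambda>t. flat_exp 0 (1 - t)) has_real_derivative - flat_exp 2 (1 - t)) (at t)"
  proof -
    have "((\<lambda>t. flat_exp 0 (1 - t)) has_real_derivative flat_exp 2 (1 - t) * (- 1)) (at t)"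
      by (rule DERIV_chain2[where g = "\<lambda>t. 1 - t", OF flat_exp_0_deriv]) (auto intro!: derivative_eq_intros)
    then show ?thesis by (simp only: mult_minus1_right)
  qed
  have "(cutoff has_real_derivative
      ((- flat_exp 2 (1 - t)) * (flat_exp 0 (1 - t) + flat_exp 0 t) - flat_exp 0 (1 - t) * (- flat_exp 2 (1 - t) + flat_exp 2 t))
      / ((flat_exp 0 (1 - t) + flat_exp 0 t) * (flat_exp 0 (1 - t) + flat_exp 0 t))) (at t)"
    unfolding cutoff_def[abs_def] using flat_exp_sum_pos[of t]
    by (intro DERIV_divide DERIV_add 1 flat_exp_0_deriv) auto
  then show ?thesis by (simp add: cutoff'_def power2_eq_square algebra_simps del: flat_exp.simps)
qed

lemma continuous_on_cutoff': "continuous_on S cutoff'"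
  unfolding cutoff'_def[abs_def] using flat_exp_sum_pos
  by (intro continuous_intros continuous_on_compose2[OF continuous_on_flat_exp[of UNIV]])
     (auto simp: less_imp_neq[symmetric])

lemma cutoff_range: "0 \<le> cutoff t" "cutoff t \<le> 1"
  unfolding cutoff_def using flat_exp_sum_pos[of t] flat_exp_nonneg[of 0 t] flat_exp_nonneg[of 0 "1 - t"]
  by (simp_all add: divide_le_eq_1 del: flat_exp.simps)

lemma cutoff_eq: "t \<le> 0 \<Longrightarrow> cutoff t = 1" "t \<ge> 1 \<Longrightarrow> cutoff t = 0"
  by (auto simp: cutoff_def)

lemma cutoff'_eq: "t \<le> 0 \<Longrightarrow> cutoff' t = 0" "t \<ge> 1 \<Longrightarrow> cutoff' t = 0"
  by (auto simp: cutoff'_def flat_exp_eq)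

lemma cutoff'_bounded: obtains C where "C > 0" "\<And>t. \<bar>cutoff' t\<bar> \<le> C"
proof -
  obtain B where B: "\<And>t. t \<in> {0..1} \<Longrightarrow> \<bar>cutoff' t\<bar> \<le> B"
    by (rule continuous_bounded_on_compact[OF continuous_on_cutoff' compact_Icc]) blast
  show ?thesis
  proof (rule that[of "max B 1"])
    fix t show "\<bar>cutoff' t\<bar> \<le> max B 1"
      using B[of t] cutoff'_eq[of t] by (cases "t \<in> {0..1}") auto
  qed simp
qed

section \<open>The radial weight\<close>

text \<open>A primitive of \<open>X\<^sup>m\<^sup>-\<^sup>1\<close> on the positive half-line.\<close>

definition radial_primitive :: "real \<Rightarrow> real \<Rightarrow> real" where
  "radial_primitive m X = (if m = 0 then ln X else X powr m / m)"

lemma radial_primitive_deriv: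
  "X > 0 \<Longrightarrow> (radial_primitive m has_real_derivative X powr (m - 1)) (at X)"
proof (cases "m = 0")
  case True
  assume X: "X > 0"
  have "radial_primitive m = ln" by (auto simp: radial_primitive_def True)
  then show ?thesis using X True by (auto intro!: derivative_eq_intros simp: powr_minus divide_inverse)
next
  case False
  assume X: "X > 0"
  have "radial_primitive m = (\<lambda>X. X powr m / m)" by (auto simp: radial_primitive_def False)
  then show ?thesis using X False by (auto intro!: derivative_eq_intros)
qed

lemma radial_primitive_mono:
  "m \<ge> 0 \<Longrightarrow> 0 < X \<Longrightarrow> X \<le> Y \<Longrightarrow> radial_primitive m X \<le> radial_primitive m Y"
  by (auto simp: radial_primitive_def intro!: divide_right_mono powr_mono2)

text \<open>The integrand of the weak form for the test function \<open>\<zeta>\<^sup>N \<lambda>(u) E\<close>. Here \<open>s\<close> is the length of the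
  gradient of \<open>u\<close>, \<open>gi\<close> its inner product with the gradient of the smoothed distance, and \<open>Y \<le> X\<close> are
  \<open>1\<close> plus the exact and the smoothed distance. The three contributions are those of the weight
  (\<open>main_term_bound\<close>), of the cut-off (\<open>cutoff_term_bound\<close>), and of \<open>\<lambda>'(u) \<ge> 0\<close>, which has the good
  sign.\<close>

lemma pointwise_bound:
  fixes A K S \<beta> \<mu> \<delta> chi \<sigma> \<eta> e \<kappa> \<epsilon> q k s X Y B \<phi> lam lam' E \<zeta> dz Cz h gi :: real and N :: nat
  assumes A: "A > 0" and \<delta>: "\<delta> > 0" and eta: "\<eta> = \<mu> + (\<sigma> - 1) * (1 + \<delta> - chi)" and K: "K > 0"
    and e: "0 < e" and \<kappa>: "\<kappa> > 0" and \<epsilon>: "\<epsilon> > 0" and q: "q > 0" and k: "k > 0"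
    and kK: "A * k + \<kappa> = K * (1 + e) powr (- \<bar>\<mu>\<bar>)"
    and tan: "\<And>t. t > 0 \<Longrightarrow> (1 + e) * (q * S + \<beta>) \<le> (q - \<epsilon>) * t + k * t powr (- (\<delta> - chi))"
    and s: "s \<ge> 0" and Y: "1 \<le> Y" "Y \<le> X" "X \<le> Y + e"
    and B: "0 \<le> B" "B \<le> (q * S + \<beta>) * X powr (\<sigma> - \<eta> - 1)"
    and \<phi>: "\<phi> \<ge> 0" "s = 0 \<Longrightarrow> \<phi> = 0" "s > 0 \<Longrightarrow> \<phi> \<le> A * s powr \<delta>"
    and gi: "\<bar>gi\<bar> \<le> s * (1 + e)" and lam: "lam \<ge> 0" "lam' \<ge> 0" and E: "E \<ge> 0"
    and N: "real N \<ge> 1 + \<delta>" and \<zeta>: "0 \<le> \<zeta>" "\<zeta> \<le> 1" and dz: "\<bar>dz\<bar> \<le> Cz" and h: "h > 0"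
  shows "lam * E * (\<kappa> * X powr (- \<mu>) * rpow s chi * \<zeta> ^ N
      - (if dz = 0 then 0 else A * \<epsilon> powr (- \<delta>) * ((1 + e) * real N * Cz * h) powr (1 + \<delta>) * X powr (\<eta> * \<delta>)))
    \<le> inverse s * \<phi> * ((\<zeta> ^ N * lam' * E + \<zeta> ^ N * lam * E * (q * X powr (- \<eta>))) * s\<^sup>2
        + (real N * \<zeta> ^ (N - 1) * (dz * h) * lam * E - \<zeta> ^ N * lam * E * B) * gi)
      + K * Y powr (- \<mu>) * rpow s chi * (\<zeta> ^ N * lam * E)"
proof (cases "s = 0")
  case True
  have "\<kappa> \<le> K * (1 + e) powr (- \<bar>\<mu>\<bar>)" using kK A k by (smt (verit) mult_pos_pos)
  then have "\<kappa> * X powr (- \<mu>) \<le> K * ((1 + e) powr (- \<bar>\<mu>\<bar>) * X powr (- \<mu>))"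
    using mult_right_mono[of \<kappa> "K * (1 + e) powr (- \<bar>\<mu>\<bar>)" "X powr (- \<mu>)"] by (simp add: mult.assoc)
  also have "\<dots> \<le> K * Y powr (- \<mu>)" using powr_ratio_bound[OF Y e] K by (intro mult_left_mono) auto
  finally have *: "\<kappa> * X powr (- \<mu>) \<le> K * Y powr (- \<mu>)" .
  have rp: "rpow s chi * (\<zeta> ^ N * lam * E) \<ge> 0" using \<zeta> lam E by (simp add: rpow_def)
  have "\<kappa> * X powr (- \<mu>) * (rpow s chi * (\<zeta> ^ N * lam * E)) \<le> K * Y powr (- \<mu>) * (rpow s chi * (\<zeta> ^ N * lam * E))"
    by (rule mult_right_mono[OF * rp])
  moreover have "lam * E * (if dz = 0 then 0 else A * \<epsilon> powr (- \<delta>) * ((1 + e) * real N * Cz * h) powr (1 + \<delta>) * X powr (\<eta> * \<delta>)) \<ge> 0"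
    using A lam E by simp
  ultimately show ?thesis using \<phi>(2)[OF True] by (simp add: right_diff_distrib mult_ac)
next
  case False
  then have s0: "s > 0" using s by simp
  have rp: "rpow s chi = s powr chi" using s0 by (simp add: rpow_def)
  define err where "err = (if dz = 0 then 0 else A * \<epsilon> powr (- \<delta>) * ((1 + e) * real N * Cz * h) powr (1 + \<delta>) * X powr (\<eta> * \<delta>))"
  define z where "z = (1 + e) * real N * \<bar>dz\<bar> * h"
  have z: "0 \<le> z" "z \<le> (1 + e) * real N * Cz * h" using e h dz by (auto simp: z_def intro!: mult_right_mono mult_left_mono)
  have N0: "real N > 0" using N \<delta> by simp
  have z_iff: "z = 0 \<longleftrightarrow> dz = 0" using e h N0 by (auto simp: z_def)
  have cut: "\<zeta> ^ (N - 1) * z * \<phi> \<le> \<epsilon> * \<zeta> ^ N * X powr (- \<eta>) * (\<phi> * s) + err"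
    using cutoff_term_bound[OF A \<delta> N \<epsilon> \<zeta> z _ s0 \<phi>(1) \<phi>(3)[OF s0], of X \<eta>] Y z_iff unfolding err_def by simp
  have main: "\<epsilon> * X powr (- \<eta>) * (\<phi> * s) + \<kappa> * X powr (- \<mu>) * s powr chi
     \<le> q * X powr (- \<eta>) * (\<phi> * s) - (1 + e) * B * \<phi> + K * Y powr (- \<mu>) * s powr chi"
    by (rule main_term_bound[OF A eta K e k kK tan s0 Y B(2) \<phi>(1) \<phi>(3)[OF s0]])
  have Z0: "\<zeta> ^ N \<ge> 0" using \<zeta> by simp
  have lE: "lam * E \<ge> 0" using lam E by simp
  let ?a1 = "\<zeta> ^ N * lam' * E + \<zeta> ^ N * lam * E * (q * X powr (- \<eta>))"
  let ?a2 = "real N * \<zeta> ^ (N - 1) * (dz * h) * lam * E - \<zeta> ^ N * lam * E * B"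
  have i1: "inverse s * \<phi> * (?a1 * s\<^sup>2) = \<phi> * s * ?a1" using s0 by (simp add: power2_eq_square field_simps)
  have "0 \<le> \<phi> * s * (\<zeta> ^ N * lam' * E)" using \<phi> s Z0 lam E by simp
  then have j1: "lam * E * (\<zeta> ^ N * (q * X powr (- \<eta>) * (\<phi> * s))) \<le> inverse s * \<phi> * (?a1 * s\<^sup>2)"
    unfolding i1 by (simp add: algebra_simps)
  have a2: "\<bar>?a2\<bar> \<le> lam * E * (real N * \<zeta> ^ (N - 1) * (\<bar>dz\<bar> * h) + \<zeta> ^ N * B)"
  proof -
    have "\<bar>?a2\<bar> \<le> \<bar>real N * \<zeta> ^ (N - 1) * (dz * h) * lam * E\<bar> + \<bar>\<zeta> ^ N * lam * E * B\<bar>" by (rule abs_triangle_ineq4)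
    also have "\<dots> = lam * E * (real N * \<zeta> ^ (N - 1) * (\<bar>dz\<bar> * h) + \<zeta> ^ N * B)"
      using \<zeta> lam E B h by (simp add: abs_mult algebra_simps)
    finally show ?thesis .
  qed
  have "\<bar>inverse s * \<phi> * (?a2 * gi)\<bar> = inverse s * \<phi> * (\<bar>?a2\<bar> * \<bar>gi\<bar>)" using s \<phi> by (simp add: abs_mult)
  also have "\<dots> \<le> inverse s * \<phi> * ((lam * E * (real N * \<zeta> ^ (N - 1) * (\<bar>dz\<bar> * h) + \<zeta> ^ N * B)) * (s * (1 + e)))"
    using a2 gi s \<phi>(1) \<zeta> lam E B h by (intro mult_left_mono mult_mono) auto
  also have "\<dots> = \<phi> * (lam * E * (real N * \<zeta> ^ (N - 1) * (\<bar>dz\<bar> * h) + \<zeta> ^ N * B)) * (1 + e)"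
    using s0 by (simp add: field_simps)
  also have "\<dots> = lam * E * (\<zeta> ^ (N - 1) * z * \<phi> + \<zeta> ^ N * ((1 + e) * B * \<phi>))"
    by (simp add: z_def algebra_simps)
  finally have j2: "- (lam * E * (\<zeta> ^ (N - 1) * z * \<phi> + \<zeta> ^ N * ((1 + e) * B * \<phi>))) \<le> inverse s * \<phi> * (?a2 * gi)"
    by linarith
  have "\<zeta> ^ N * (\<epsilon> * X powr (- \<eta>) * (\<phi> * s) + \<kappa> * X powr (- \<mu>) * s powr chi)
     \<le> \<zeta> ^ N * (q * X powr (- \<eta>) * (\<phi> * s) - (1 + e) * B * \<phi> + K * Y powr (- \<mu>) * s powr chi)"
    by (rule mult_left_mono[OF main Z0])
  then have "\<kappa> * X powr (- \<mu>) * s powr chi * \<zeta> ^ N - err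
     \<le> \<zeta> ^ N * (q * X powr (- \<eta>) * (\<phi> * s)) - (\<zeta> ^ (N - 1) * z * \<phi> + \<zeta> ^ N * ((1 + e) * B * \<phi>))
       + \<zeta> ^ N * (K * Y powr (- \<mu>) * s powr chi)"
    using cut by (simp add: algebra_simps)
  then have "lam * E * (\<kappa> * X powr (- \<mu>) * s powr chi * \<zeta> ^ N - err)
     \<le> lam * E * (\<zeta> ^ N * (q * X powr (- \<eta>) * (\<phi> * s)) - (\<zeta> ^ (N - 1) * z * \<phi> + \<zeta> ^ N * ((1 + e) * B * \<phi>))
       + \<zeta> ^ N * (K * Y powr (- \<mu>) * s powr chi))"
    by (rule mult_left_mono[OF _ lE])
  also have "\<dots> = lam * E * (\<zeta> ^ N * (q * X powr (- \<eta>) * (\<phi> * s)))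
      - lam * E * (\<zeta> ^ (N - 1) * z * \<phi> + \<zeta> ^ N * ((1 + e) * B * \<phi>))
      + K * Y powr (- \<mu>) * s powr chi * (\<zeta> ^ N * lam * E)"
    by (simp add: algebra_simps)
  also have "\<dots> \<le> inverse s * \<phi> * (?a1 * s\<^sup>2) + inverse s * \<phi> * (?a2 * gi) + K * Y powr (- \<mu>) * s powr chi * (\<zeta> ^ N * lam * E)"
    using j1 j2 by linarith
  also have "\<dots> = inverse s * \<phi> * (?a1 * s\<^sup>2 + ?a2 * gi) + K * Y powr (- \<mu>) * s powr chi * (\<zeta> ^ N * lam * E)"
    by (simp only: distrib_left)
  finally show ?thesis unfolding rp err_def .
qed

section \<open>The differential inequality on a complete manifold\<close>

context riemannian begin

lemma integral_open_pos:
  assumes V: "open V" "V \<noteq> {}" "V \<subseteq> C" and C: "compact C" and f: "continuous_on UNIV f" "\<And>x. f x > (0::real)"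
  shows "integrable vol (\<lambda>x. indicator V x * f x)" "0 < (LINT x|vol. indicator V x * f x)"
proof -
  obtain b where b: "\<And>x. x \<in> C \<Longrightarrow> \<bar>f x\<bar> \<le> b" by (rule continuous_bounded_on_compact[OF f(1) C]) blast
  show int: "integrable vol (\<lambda>x. indicator V x * f x)"
  proof (rule integrable_vol_compact_support[OF _ C])
    show "(\<lambda>x. indicator V x * f x) \<in> borel_measurable borel"
      using borel_measurable_continuous_onI[OF f(1)] borel_open[OF V(1)] by measurable
    show "\<bar>indicator V x * f x\<bar> \<le> b" if "x \<in> C" for x
      using b[OF that] by (auto simp: indicator_def)
    show "indicator V x * f x = 0" if "x \<notin> C" for x
    proof -
      have "x \<notin> V" using that V(3) by blast
      then show ?thesis by simp
    qed
  qed
  have nn: "0 \<le> (LINT x|vol. indicator V x * f x)"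
    using f(2) by (intro integral_nonneg_AE AE_I2) (simp add: less_imp_le)
  show "0 < (LINT x|vol. indicator V x * f x)"
  proof (rule ccontr)
    assume "\<not> ?thesis"
    then have "(LINT x|vol. indicator V x * f x) = 0" using nn by simp
    then have "AE x in vol. indicator V x * f x = 0"
      using integral_nonneg_eq_0_iff_AE[OF int] f(2) by (simp add: less_imp_le)
    then have "AE x in vol. x \<notin> V"
    proof (rule AE_mp, intro AE_I2 impI)
      fix x assume 0: "indicator V x * f x = 0"
      show "x \<notin> V" using 0 f(2)[of x] by (auto simp: indicator_def)
    qed
    then have "V \<in> null_sets vol" using borel_open[OF V(1)] by (subst (asm) AE_iff_null_sets[symmetric]) auto
    then show False using vol_open_pos[OF V(1,2)] by (simp add: null_sets_def)
  qed
qed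

end

locale elliptic_inequality = complete_riemannian M
  for M :: "('a::{t2_space, second_countable_topology}, 'm::finite) riemannian_structure" +
  fixes org :: 'a and D u :: "'a \<Rightarrow> real" and \<phi> :: "real \<Rightarrow> real"
    and A \<delta> \<sigma> \<mu> chi \<eta> \<gamma> K :: real
  assumes D_cont: "continuous_on UNIV D" and D_pos: "\<And>x. D x > 0"
    and phi_C0: "continuous_on {0..} \<phi>" and phi_nonneg: "\<And>t. t \<ge> 0 \<Longrightarrow> \<phi> t \<ge> 0" and phi_0: "\<phi> 0 = 0"
    and A_pos: "A > 0" and delta_pos: "\<delta> > 0" and phi_bound: "\<And>t. t > 0 \<Longrightarrow> \<phi> t \<le> A * t powr \<delta>"
    and eta: "\<eta> = \<mu> + (\<sigma> - 1) * (1 + \<delta> - chi)"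
    and sigma: "\<sigma> \<ge> 0" and sigma_eta: "\<sigma> - \<eta> \<ge> 0" and chi_range: "0 \<le> chi" "chi < \<delta>"
    and u_C1: "Ck_fun_on 1 UNIV u"
    and ineq: "weak_inequality M org D \<phi> K \<mu> chi u {x. u x > \<gamma>}"
begin

abbreviation r :: "'a \<Rightarrow> real" where "r \<equiv> rdist M org"
abbreviation s :: "'a \<Rightarrow> real" where "s \<equiv> grad_norm M u"

definition flux_coeff :: "'a \<Rightarrow> real" where "flux_coeff x = inverse (s x) * \<phi> (s x) * D x"
definition source_coeff :: "'a \<Rightarrow> real" where
  "source_coeff x = K * ((1 + r x) powr (- \<mu>) * rpow (s x) chi * D x)"
definition coeff_bound :: "'a \<Rightarrow> real" where
  "coeff_bound x = (\<phi> (s x) + \<bar>K\<bar> * ((1 + r x) powr (- \<mu>) * rpow (s x) chi)) * D x"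

lemma s_nonneg: "s x \<ge> 0" by (rule grad_norm_ge_0[OF u_C1 UNIV_I])

lemma s_cont: "continuous_on UNIV s" by (rule continuous_on_grad_norm[OF u_C1])

lemma u_cont: "continuous_on UNIV u" by (rule Ck_fun_on_imp_continuous_on[OF u_C1])

lemma phi_s_cont: "continuous_on UNIV (\<lambda>x. \<phi> (s x))"
  by (rule continuous_on_compose2[OF phi_C0 s_cont]) (simp add: image_subset_iff s_nonneg)

lemma source_cont: "continuous_on UNIV (\<lambda>x. (1 + r x) powr (- \<mu>) * rpow (s x) chi)"
proof (rule continuous_on_mult)
  have "1 + r x \<noteq> 0" for x using rdist_nonneg[of org x] by linarith
  then show "continuous_on UNIV (\<lambda>x. (1 + r x) powr (- \<mu>))"
    by (intro continuous_on_powr continuous_intros continuous_on_rdist) auto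
  show "continuous_on UNIV (\<lambda>x. rpow (s x) chi)"
  proof (cases "chi = 0")
    case False
    then show ?thesis using chi_range s_nonneg unfolding rpow_def
      by (simp, intro continuous_on_powr' s_cont continuous_on_const) auto
  qed (simp add: rpow_def)
qed

lemma rpow_nonneg: "rpow t a \<ge> 0" by (simp add: rpow_def)

lemma coeff_facts:
  "flux_coeff \<in> borel_measurable borel" "source_coeff \<in> borel_measurable borel"
  "continuous_on UNIV coeff_bound" "\<bar>flux_coeff x\<bar> * s x \<le> coeff_bound x" "\<bar>source_coeff x\<bar> \<le> coeff_bound x"
proof -
  show "flux_coeff \<in> borel_measurable borel"
    unfolding flux_coeff_def[abs_def]
    using borel_measurable_continuous_onI[OF s_cont] borel_measurable_continuous_onI[OF phi_s_cont]
      borel_measurable_continuous_onI[OF D_cont] by measurable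
  show "source_coeff \<in> borel_measurable borel"
    unfolding source_coeff_def[abs_def]
    by (intro borel_measurable_continuous_onI continuous_on_mult[OF continuous_on_const] continuous_on_mult[OF source_cont D_cont])
  show "continuous_on UNIV coeff_bound"
    unfolding coeff_bound_def[abs_def]
    by (intro continuous_on_mult continuous_on_add phi_s_cont continuous_on_const source_cont D_cont)
  have p: "0 \<le> \<phi> (s x)" by (rule phi_nonneg[OF s_nonneg])
  have q: "0 \<le> (1 + r x) powr (- \<mu>) * rpow (s x) chi" by (simp add: rpow_nonneg)
  have Dx: "D x > 0" by (rule D_pos)
  have "\<bar>flux_coeff x\<bar> * s x = inverse (s x) * s x * \<phi> (s x) * D x"
    using p Dx s_nonneg[of x] by (simp add: flux_coeff_def abs_mult)
  also have "\<dots> \<le> 1 * \<phi> (s x) * D x"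
    using p Dx by (intro mult_right_mono) (auto simp: field_simps)
  also have "\<dots> \<le> coeff_bound x" using q Dx by (simp add: coeff_bound_def distrib_right)
  finally show "\<bar>flux_coeff x\<bar> * s x \<le> coeff_bound x" .
  show "\<bar>source_coeff x\<bar> \<le> coeff_bound x" using p q Dx by (simp add: source_coeff_def coeff_bound_def abs_mult distrib_right abs_of_nonneg[OF rpow_nonneg])
qed

lemma coeff_bound_nonneg: "coeff_bound x \<ge> 0" using coeff_facts(5)[of x] by linarith

lemma superlevel_open: "open {x. u x > c}"
  by (intro open_Collect_less continuous_on_const u_cont)

text \<open>The integrals over the superlevel set are integrals over the manifold, since the test function and
  its gradient vanish outside its support.\<close>

lemma weak_form_test:
  assumes \<psi>: "test_function M {x. u x > \<gamma>} \<psi>" and nn: "\<And>x. \<psi> x \<ge> 0"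
  shows "weak_form u flux_coeff source_coeff \<psi> \<le> 0"
proof -
  let ?\<Omega> = "{x. u x > \<gamma>}" let ?S = "closure {x. \<psi> x \<noteq> 0}"
  have S: "compact ?S" "?S \<subseteq> ?\<Omega>" and C1: "Ck_fun_on 1 UNIV \<psi>"
    using \<psi> unfolding test_function_def smooth_function_def Ck_function_iff by auto
  have z: "\<psi> x = 0" if "x \<notin> ?S" for x using that closure_subset[of "{x. \<psi> x \<noteq> 0}"] by auto
  have gz: "grad_inner M u \<psi> x = 0" if "x \<notin> ?S" for x by (rule grad_zero_outside[OF u_C1 S(1) z that])
  have cb: "continuous_on UNIV coeff_bound" by (rule coeff_facts)
  have i1: "integrable vol (\<lambda>x. flux_coeff x * grad_inner M u \<psi> x)"
    using weak_form_integrable[OF u_C1 coeff_facts(1) _ cb coeff_facts(4) _ C1 S(1) z, of "\<lambda>_. 0"] coeff_bound_nonneg by simp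
  have i2: "integrable vol (\<lambda>x. source_coeff x * \<psi> x)"
    using weak_form_integrable[OF u_C1 _ coeff_facts(2) cb _ coeff_facts(5) C1 S(1) z, of "\<lambda>_. 0"] coeff_bound_nonneg by simp
  have "(LINT x:?\<Omega>|vol. inverse (s x) * \<phi> (s x) * grad_inner M u \<psi> x * D x) = (LINT x|vol. flux_coeff x * grad_inner M u \<psi> x)"
    unfolding set_lebesgue_integral_def
  proof (rule Bochner_Integration.integral_cong[OF refl])
    fix x show "indicator ?\<Omega> x *\<^sub>R (inverse (s x) * \<phi> (s x) * grad_inner M u \<psi> x * D x) = flux_coeff x * grad_inner M u \<psi> x"
    proof (cases "x \<in> ?\<Omega>")
      case False
      then have "x \<notin> ?S" using S(2) by blast
      then have "grad_inner M u \<psi> x = 0" by (rule gz)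
      then show ?thesis by simp
    qed (simp add: flux_coeff_def)
  qed
  moreover have "K * (LINT x:?\<Omega>|vol. (1 + r x) powr (- \<mu>) * rpow (s x) chi * \<psi> x * D x) = (LINT x|vol. source_coeff x * \<psi> x)"
    unfolding set_lebesgue_integral_def integral_mult_right_zero[symmetric]
  proof (rule Bochner_Integration.integral_cong[OF refl])
    fix x show "K * (indicator ?\<Omega> x *\<^sub>R ((1 + r x) powr (- \<mu>) * rpow (s x) chi * \<psi> x * D x)) = source_coeff x * \<psi> x"
    proof (cases "x \<in> ?\<Omega>")
      case False
      then have "x \<notin> ?S" using S(2) by blast
      then have "\<psi> x = 0" by (rule z)
      then show ?thesis by simp
    qed (simp add: source_coeff_def)
  qed
  moreover have "- (LINT x:?\<Omega>|vol. inverse (s x) * \<phi> (s x) * grad_inner M u \<psi> x * D x)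
        \<ge> K * (LINT x:?\<Omega>|vol. (1 + r x) powr (- \<mu>) * rpow (s x) chi * \<psi> x * D x)"
    by (rule mp[OF spec[OF ineq[unfolded weak_inequality_def], of \<psi>]]) (intro conjI allI \<psi> nn)
  moreover have "weak_form u flux_coeff source_coeff \<psi> = (LINT x|vol. flux_coeff x * grad_inner M u \<psi> x) + (LINT x|vol. source_coeff x * \<psi> x)"
    unfolding weak_form_def by (rule Bochner_Integration.integral_add[OF i1 i2])
  ultimately show ?thesis by linarith
qed

lemma weak_form_nonpos:
  assumes "Ck_fun_on 1 UNIV \<psi>" "\<And>x. \<psi> x \<ge> 0" "compact C" "C \<subseteq> {x. u x > \<gamma>}" "\<And>x. x \<notin> C \<Longrightarrow> \<psi> x = 0"
  shows "weak_form u flux_coeff source_coeff \<psi> \<le> 0"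
  by (rule weak_form_C1[OF u_C1 coeff_facts weak_form_test superlevel_open assms])

lemma weighted_vol_ball:
  "integrable vol (\<lambda>x. indicator (geodesic_ball M org R) x * D x)"
  "weighted_vol M D (geodesic_ball M org R) = (LINT x|vol. indicator (geodesic_ball M org R) x * D x)"
proof -
  show "weighted_vol M D (geodesic_ball M org R) = (LINT x|vol. indicator (geodesic_ball M org R) x * D x)"
    by (simp add: weighted_vol_def set_lebesgue_integral_def)
  have o: "open (geodesic_ball M org R)" unfolding geodesic_ball_def by (rule open_rdist_ball)
  show "integrable vol (\<lambda>x. indicator (geodesic_ball M org R) x * D x)"
  proof (cases "geodesic_ball M org R = {}")
    case False
    show ?thesis
      by (rule integral_open_pos(1)[OF o False _ compact_rdist_cball[of org R] D_cont D_pos]) (auto simp: geodesic_ball_def)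
  qed simp
qed

lemma weighted_vol_mono:
  "R \<le> R' \<Longrightarrow> weighted_vol M D (geodesic_ball M org R) \<le> weighted_vol M D (geodesic_ball M org R')"
  unfolding weighted_vol_ball(2)
  by (intro integral_mono weighted_vol_ball(1)) (use D_pos in \<open>auto simp: indicator_def geodesic_ball_def less_imp_le\<close>)

lemma weighted_vol_pos: "R > 0 \<Longrightarrow> weighted_vol M D (geodesic_ball M org R) > 0"
  unfolding weighted_vol_ball(2)
  by (rule integral_open_pos(2)[OF _ _ _ compact_rdist_cball[of org R] D_cont D_pos])
     (auto simp: geodesic_ball_def open_rdist_ball intro!: exI[of _ org])

end

section \<open>The integral estimate\<close>

lemma flat_exp_0_mono: "0 < d \<Longrightarrow> d \<le> t \<Longrightarrow> flat_exp 0 d \<le> flat_exp 0 t"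
  by (simp add: le_imp_inverse_le)

lemma flat_exp_0_le_1: "flat_exp 0 t \<le> 1" by simp

lemma rpow_pos: "t > 0 \<Longrightarrow> rpow t a > 0" by (simp add: rpow_def)

lemma rpow_mono: "0 \<le> a \<Longrightarrow> 0 < t \<Longrightarrow> t \<le> t' \<Longrightarrow> rpow t a \<le> rpow t' a"
  by (auto simp: rpow_def intro: powr_mono2)

context elliptic_inequality begin

text \<open>The weak inequality tested with \<open>\<psi> = \<zeta>\<^sup>N \<lambda>(u) E\<close>, where \<open>\<zeta>\<close> cuts off between the radii \<open>\<theta> R\<close> and
  \<open>R\<close>, \<open>\<lambda>(u) = exp (- 1 / (u - \<gamma>'))\<close> on \<open>{u > \<gamma>'}\<close>, and
  \<open>E = exp (q (u - c) X\<^sup>-\<^sup>\<eta> - q b X\<^sup>\<sigma>\<^sup>-\<^sup>\<eta> - \<beta> H(X))\<close> with \<open>X = 1 + \<rho>\<close>. The constants \<open>c0\<close> and \<open>C2\<close> do not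
  depend on \<open>R\<close>: the left side is a lower bound for the gain on a fixed open set \<open>V\<close>, the right side an
  upper bound for the loss in the annulus of the cut-off, where \<open>E \<le> exp (- \<beta> H(1 + \<theta> R))\<close>.\<close>

lemma estimate:
  fixes \<gamma>' b c S \<beta> \<theta> e \<kappa> \<epsilon> q k Cz d s0 R1 R :: real and N :: nat
  assumes \<gamma>': "\<gamma> < \<gamma>'" and b: "b \<ge> 0"
    and bound: "\<And>x. u x > \<gamma>' \<Longrightarrow> 0 \<le> u x - c \<and> u x - c \<le> b * (1 + r x) powr \<sigma>"
    and S: "S \<ge> b * max \<sigma> (\<sigma> - \<eta>)" and \<beta>: "\<beta> > 0" and K0: "K > 0" and \<theta>: "0 < \<theta>" "\<theta> < 1"
    and par: "0 < e" "e < 1" "\<kappa> > 0" "\<epsilon> > 0" "q > 0" "k > 0" "A * k + \<kappa> = K * (1 + e) powr (- \<bar>\<mu>\<bar>)"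
    and tan: "\<And>t. t > 0 \<Longrightarrow> (1 + e) * (q * S + \<beta>) \<le> (q - \<epsilon>) * t + k * t powr (- (\<delta> - chi))"
    and Cz: "Cz > 0" "\<And>t. \<bar>cutoff' t\<bar> \<le> Cz" and N: "real N \<ge> 1 + \<delta>"
    and d: "d > 0" and s0: "s0 > 0" and R1: "R1 > 0" and R: "R > 0" "\<theta> * R \<ge> R1 + 1"
  defines "V \<equiv> {x. u x > \<gamma>' + d} \<inter> {x. s x > s0} \<inter> {x. r x < R1}"
  defines "c0 \<equiv> flat_exp 0 d * exp (- (q * b) * (2 + R1) powr (\<sigma> - \<eta>) - \<beta> * radial_primitive (\<sigma> - \<eta>) (2 + R1))
      * (\<kappa> * (2 + R1) powr (- \<bar>\<mu>\<bar>) * rpow s0 chi)"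
  defines "C2 \<equiv> A * \<epsilon> powr (- \<delta>) * ((1 + e) * real N * Cz) powr (1 + \<delta>) * (1 - \<theta>) powr (- (1 + \<delta>))"
  shows "c0 * (LINT x|vol. indicator V x * D x) \<le> C2 * (weighted_vol M D (geodesic_ball M org R) *
      (R powr (- (1 + \<delta>)) * (1 + R) powr (max (\<eta> * \<delta>) 0) * exp (- \<beta> * radial_primitive (\<sigma> - \<eta>) (1 + \<theta> * R))))"
proof -
  define m where "m = \<sigma> - \<eta>"
  have m: "m \<ge> 0" using sigma_eta by (simp add: m_def)
  define H where "H = radial_primitive m"
  let ?C = "{x. r x \<le> R}"
  have cC: "compact ?C" by (rule compact_rdist_cball)
  obtain \<rho> W where W: "?C \<subseteq> W" and \<rho>1: "Ck_fun_on 1 W \<rho>"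
    and \<rho>: "\<And>x. x \<in> W \<Longrightarrow> r x \<le> \<rho> x" "\<And>x. x \<in> W \<Longrightarrow> \<rho> x \<le> r x + e"
    and g\<rho>: "\<And>x. x \<in> ?C \<Longrightarrow> grad_norm M \<rho> x \<le> 1 + e"
    by (rule smooth_rdist[OF cC par(1), of org]) blast
  have oW: "open W" using \<rho>1 by (simp add: Ck_fun_on_def)
  have \<rho>0: "\<rho> x \<ge> 0" if "x \<in> W" for x using \<rho>(1)[OF that] rdist_nonneg[of org x] by linarith
  define h where "h = 1 / ((1 - \<theta>) * R)"
  have h: "h > 0" using \<theta> R by (simp add: h_def)
  have N0: "N > 0" using N delta_pos by (cases N) auto
  (* The factors of the test function and their derivatives: cut-off, truncation in u, and exponent. *)
  define P1 where "P1 y = cutoff ((y - \<theta> * R) * h) ^ N" for y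
  define P1' where "P1' y = real N * cutoff ((y - \<theta> * R) * h) ^ (N - 1) * (cutoff' ((y - \<theta> * R) * h) * h)" for y
  define P2 where "P2 z = flat_exp 0 (z - \<gamma>')" for z
  define P2' where "P2' z = flat_exp 2 (z - \<gamma>')" for z
  define P3 where "P3 y = - (q * b) * (1 + y) powr m - \<beta> * H (1 + y)" for y
  define P3' where "P3' y = - (q * b) * (m * (1 + y) powr (m - 1)) - \<beta> * (1 + y) powr (m - 1)" for y
  define P4 where "P4 y = q * (1 + y) powr (- \<eta>)" for y
  define P4' where "P4' y = q * (- \<eta> * (1 + y) powr (- \<eta> - 1))" for y
  have D1: "(P1 has_real_derivative P1' y) (at y)" for y
  proof -
    have "((\<lambda>y. cutoff ((y - \<theta> * R) * h)) has_real_derivative cutoff' ((y - \<theta> * R) * h) * h) (at y)"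
      by (rule DERIV_chain2[where g = "\<lambda>y. (y - \<theta> * R) * h", OF cutoff_deriv]) (auto intro!: derivative_eq_intros)
    from DERIV_power[OF this, of N] show ?thesis
      unfolding P1_def[abs_def] P1'_def by (simp add: mult_ac)
  qed
  have D2: "(P2 has_real_derivative P2' z) (at z)" for z
  proof -
    have "((\<lambda>z. flat_exp 0 (z - \<gamma>')) has_real_derivative flat_exp 2 (z - \<gamma>') * 1) (at z)"
      by (rule DERIV_chain2[where g = "\<lambda>z. z - \<gamma>'", OF flat_exp_0_deriv]) (auto intro!: derivative_eq_intros)
    then show ?thesis unfolding P2_def[abs_def] P2'_def by (simp only: mult_1_right)
  qed
  have D3: "(P3 has_real_derivative P3' y) (at y)" if "y > -1" for y
  proof -
    have "((\<lambda>y. H (1 + y)) has_real_derivative (1 + y) powr (m - 1) * 1) (at y)"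
      unfolding H_def
      by (rule DERIV_chain2[where g = "\<lambda>y. 1 + y", OF radial_primitive_deriv]) (use that in \<open>auto intro!: derivative_eq_intros\<close>)
    moreover have "((\<lambda>y. (1 + y) powr m) has_real_derivative m * (1 + y) powr (m - 1)) (at y)"
      using that by (auto intro!: derivative_eq_intros)
    ultimately show ?thesis unfolding P3_def[abs_def] P3'_def
      by (intro DERIV_diff DERIV_cmult) simp_all
  qed
  have D4: "(P4 has_real_derivative P4' y) (at y)" if "y > -1" for y
  proof -
    have "((\<lambda>y. (1 + y) powr (- \<eta>)) has_real_derivative - \<eta> * (1 + y) powr (- \<eta> - 1)) (at y)"
      using that by (auto intro!: derivative_eq_intros)
    then show ?thesis unfolding P4_def[abs_def] P4'_def by (rule DERIV_cmult)
  qed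
  have C1: "Ck_on 1 UNIV P1"
    by (rule Ck_on_1_realI[OF open_UNIV D1]) (auto simp: P1'_def cutoff_deriv intro!: continuous_intros
      continuous_on_compose2[OF continuous_on_cutoff'[of UNIV]]
      continuous_on_compose2[OF DERIV_continuous_on[of UNIV cutoff cutoff'], OF has_field_derivative_at_within[OF cutoff_deriv]])
  have C2': "Ck_on 1 UNIV P2"
    by (rule Ck_on_1_realI[OF open_UNIV D2]) (auto simp: P2'_def intro!: continuous_intros continuous_on_compose2[OF continuous_on_flat_exp[of UNIV]])
  have C3: "Ck_on 1 {-1<..} P3"
    by (rule Ck_on_1_realI[OF open_greaterThan D3]) (auto simp: P3'_def intro!: continuous_intros)
  have C4: "Ck_on 1 {-1<..} P4"
    by (rule Ck_on_1_realI[OF open_greaterThan D4]) (auto simp: P4'_def intro!: continuous_intros)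
  have Ce: "Ck_on 1 UNIV (exp :: real \<Rightarrow> real)"
    by (rule Ck_on_1_realI[where P' = exp]) (auto intro!: derivative_eq_intros continuous_intros)
  define Ex where "Ex x = exp ((u x + (- c)) * P4 (\<rho> x) + P3 (\<rho> x))" for x
  define \<psi>0 where "\<psi>0 x = P1 (\<rho> x) * P2 (u x) * Ex x" for x
  define \<psi> where "\<psi> x = (if x \<in> W then \<psi>0 x else 0)" for x
  have uW: "Ck_fun_on 1 W u" by (rule Ck_fun_on_subset[OF u_C1 _ oW]) simp
  have \<rho>T: "\<rho> x \<in> {-1<..}" if "x \<in> W" for x using \<rho>0[OF that] by simp
  have \<psi>0W: "Ck_fun_on 1 W \<psi>0"
    unfolding \<psi>0_def Ex_def
    by (intro Ck_fun_on_mult Ck_fun_on_add Ck_fun_on_compose[OF C1 open_UNIV \<rho>1] Ck_fun_on_compose[OF C2' open_UNIV uW]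
        Ck_fun_on_compose[OF Ce open_UNIV] Ck_fun_on_compose[OF C3 open_greaterThan \<rho>1 \<rho>T]
        Ck_fun_on_compose[OF C4 open_greaterThan \<rho>1 \<rho>T] uW Ck_fun_on_const oW) auto
  have P1z: "P1 y = 0" if "y \<ge> R" for y
  proof -
    have "(y - \<theta> * R) * h \<ge> 1"
      using that \<theta> R by (simp add: h_def pos_le_divide_eq algebra_simps)
    then show ?thesis using cutoff_eq(2) N0 by (simp add: P1_def)
  qed
  have \<psi>z: "\<psi> x = 0" if "x \<notin> ?C" for x
    using P1z[of "\<rho> x"] \<rho>(1)[of x] that by (auto simp: \<psi>_def \<psi>0_def)
  have clC: "closed ?C" by (rule closed_rdist_cball)
  have \<psi>1: "Ck_fun_on 1 UNIV \<psi>"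
  proof (rule Ck_fun_on_local[OF _ open_UNIV])
    fix x
    show "\<exists>V. Ck_fun_on 1 V \<psi> \<and> x \<in> V"
    proof (cases "x \<in> W")
      case True
      have "Ck_fun_on 1 W \<psi>" by (rule Ck_fun_on_cong[OF \<psi>0W]) (simp add: \<psi>_def)
      then show ?thesis using True by blast
    next
      case False
      then have "x \<in> - ?C" using W by blast
      moreover have "Ck_fun_on 1 (- ?C) \<psi>"
        by (rule Ck_fun_on_zero) (use clC \<psi>z in auto)
      ultimately show ?thesis by blast
    qed
  qed
  have P1r: "0 \<le> P1 y" for y unfolding P1_def using cutoff_range by simp
  have P2r: "0 \<le> P2 z" "P2 z \<le> 1" "0 \<le> P2' z" for z
    unfolding P2_def P2'_def by (rule flat_exp_nonneg flat_exp_0_le_1)+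
  have \<psi>nn: "\<psi> x \<ge> 0" for x using P1r P2r by (simp add: \<psi>_def \<psi>0_def Ex_def)
  let ?Cs = "?C \<inter> {x. u x \<ge> \<gamma>'}"
  have "closed {x. u x \<ge> \<gamma>'}" by (intro closed_Collect_le continuous_on_const u_cont)
  then have cCs: "compact ?Cs" by (rule compact_Int_closed[OF cC])
  have \<psi>z': "\<psi> x = 0" if "x \<notin> ?Cs" for x
  proof (cases "x \<in> ?C")
    case True
    then have "P2 (u x) = 0" using that by (simp add: P2_def)
    then show ?thesis by (simp add: \<psi>_def \<psi>0_def)
  qed (rule \<psi>z)
  have neg: "weak_form u flux_coeff source_coeff \<psi> \<le> 0"
    by (rule weak_form_nonpos[OF \<psi>1 \<psi>nn cCs _ \<psi>z']) (use \<gamma>' in auto)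
  define Mx where "Mx = C2 * (R powr (- (1 + \<delta>)) * (1 + R) powr (max (\<eta> * \<delta>) 0) * exp (- \<beta> * H (1 + \<theta> * R)))"
  have Mx0: "Mx \<ge> 0" using A_pos by (simp add: Mx_def C2_def)
  let ?B = "geodesic_ball M org R"
  have VC: "V \<subseteq> ?C" using R \<theta> R1 unfolding V_def
    by (smt (verit, best) IntE mem_Collect_eq mult_le_cancel_right2 subsetI)
  have pw: "D x * (c0 * indicator V x - Mx * indicator ?B x) \<le> flux_coeff x * grad_inner M u \<psi> x + source_coeff x * \<psi> x" for x
  proof (cases "x \<in> ?C")
    case False
    have "grad_inner M u \<psi> x = 0" by (rule grad_zero_outside[OF u_C1 cC \<psi>z False])
    moreover have "\<psi> x = 0" by (rule \<psi>z[OF False])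
    moreover have "x \<notin> V" using False VC by blast
    moreover have "x \<notin> ?B" using False by (simp add: geodesic_ball_def)
    ultimately show ?thesis by simp
  next
    case True
    then have xW: "x \<in> W" using W by blast
    let ?d = "chart_at M x"
    define X where "X = 1 + \<rho> x"
    have X: "1 \<le> 1 + r x" "1 + r x \<le> X" "X \<le> 1 + r x + e"
      using \<rho>[OF xW] rdist_nonneg[of org x] by (auto simp: X_def)
    define B where "B = q * \<eta> * (u x - c) * X powr (- \<eta> - 1) + q * b * (\<sigma> - \<eta>) * X powr (\<sigma> - \<eta> - 1) + \<beta> * X powr (\<sigma> - \<eta> - 1)"
    define t where "t = (\<rho> x - \<theta> * R) * h"
    have wu: "has_differential ?d u x (differential ?d u x)" by (rule has_differential[OF u_C1 chart_at UNIV_I])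
    have w\<rho>: "has_differential ?d \<rho> x (differential ?d \<rho> x)" by (rule has_differential[OF \<rho>1 chart_at xW])
    let ?wu = "differential ?d u x" let ?wr = "differential ?d \<rho> x"
    have h1: "has_differential ?d (\<lambda>x. P1 (\<rho> x)) x (P1' (\<rho> x) *\<^sub>R ?wr)" by (rule has_differential_compose[OF chart_at w\<rho> D1])
    have h2: "has_differential ?d (\<lambda>x. P2 (u x)) x (P2' (u x) *\<^sub>R ?wu)" by (rule has_differential_compose[OF chart_at wu D2])
    have h3: "has_differential ?d (\<lambda>x. P3 (\<rho> x)) x (P3' (\<rho> x) *\<^sub>R ?wr)"
      by (rule has_differential_compose[OF chart_at w\<rho> D3]) (use \<rho>T[OF xW] in simp)
    have h4: "has_differential ?d (\<lambda>x. P4 (\<rho> x)) x (P4' (\<rho> x) *\<^sub>R ?wr)"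
      by (rule has_differential_compose[OF chart_at w\<rho> D4]) (use \<rho>T[OF xW] in simp)
    have hu: "has_differential ?d (\<lambda>x. u x + (- c)) x (?wu + 0)" by (rule has_differential_add[OF wu has_differential_const])
    have hE: "has_differential ?d Ex x (Ex x *\<^sub>R (((u x + (- c)) *\<^sub>R (P4' (\<rho> x) *\<^sub>R ?wr) + P4 (\<rho> x) *\<^sub>R (?wu + 0)) + P3' (\<rho> x) *\<^sub>R ?wr))"
      unfolding Ex_def
      by (rule has_differential_compose[OF chart_at has_differential_add[OF has_differential_mult[OF chart_at hu h4] h3]])
         (auto intro!: derivative_eq_intros)
    define a1 where "a1 = P1 (\<rho> x) * P2' (u x) * Ex x + P1 (\<rho> x) * P2 (u x) * Ex x * (q * X powr (- \<eta>))"
    define a2 where "a2 = real N * cutoff t ^ (N - 1) * (cutoff' t * h) * P2 (u x) * Ex x - P1 (\<rho> x) * P2 (u x) * Ex x * B"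
    have P1't: "P1' (\<rho> x) = real N * cutoff t ^ (N - 1) * (cutoff' t * h)" by (simp add: P1'_def t_def)
    have P4t: "P4 (\<rho> x) = q * X powr (- \<eta>)" by (simp add: P4_def X_def)
    have Bt: "(u x + (- c)) * P4' (\<rho> x) + P3' (\<rho> x) = - B"
      by (simp add: B_def P4'_def P3'_def X_def m_def algebra_simps)
    have "has_differential ?d \<psi>0 x ((P1 (\<rho> x) * P2 (u x)) *\<^sub>R (Ex x *\<^sub>R (((u x + (- c)) *\<^sub>R (P4' (\<rho> x) *\<^sub>R ?wr) + P4 (\<rho> x) *\<^sub>R (?wu + 0)) + P3' (\<rho> x) *\<^sub>R ?wr))
       + Ex x *\<^sub>R (P1 (\<rho> x) *\<^sub>R (P2' (u x) *\<^sub>R ?wu) + P2 (u x) *\<^sub>R (P1' (\<rho> x) *\<^sub>R ?wr)))" (is "has_differential _ _ _ ?w")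
      unfolding \<psi>0_def by (rule has_differential_mult[OF chart_at has_differential_mult[OF chart_at h1 h2] hE])
    also have "?w = a1 *\<^sub>R ?wu + a2 *\<^sub>R ?wr"
    proof -
      have "?w = a1 *\<^sub>R ?wu + (P1 (\<rho> x) * P2 (u x) * Ex x * ((u x + (- c)) * P4' (\<rho> x) + P3' (\<rho> x)) + P1' (\<rho> x) * P2 (u x) * Ex x) *\<^sub>R ?wr"
        unfolding a1_def P4t[symmetric] by (simp add: scaleR_add_right scaleR_add_left mult_ac distrib_left)
      then show ?thesis unfolding Bt a2_def P1't by (simp add: algebra_simps)
    qed
    finally have h0: "has_differential ?d \<psi>0 x (a1 *\<^sub>R ?wu + a2 *\<^sub>R ?wr)" .
    have h\<psi>: "has_differential ?d \<psi> x (a1 *\<^sub>R ?wu + a2 *\<^sub>R ?wr)"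
      by (rule has_differential_cong[OF chart_at xW oW _ h0]) (simp add: \<psi>_def)
    have uu: "grad_inner M u u x = (s x)\<^sup>2" using grad_norm_nonneg[OF u_C1 UNIV_I] by (simp add: grad_norm_def)
    have gi: "grad_inner M u \<psi> x = a1 * (s x)\<^sup>2 + a2 * grad_inner M u \<rho> x"
      using grad_inner_linear[OF chart_at wu wu w\<rho> h\<psi>] uu by simp
    have gb: "\<bar>grad_inner M u \<rho> x\<bar> \<le> s x * (1 + e)"
    proof -
      have "\<bar>grad_inner M u \<rho> x\<bar> \<le> s x * grad_norm M \<rho> x"
        by (rule grad_inner_cauchy_schwarz[OF uW \<rho>1 xW])
      also have "\<dots> \<le> s x * (1 + e)" using g\<rho>[OF True] s_nonneg by (intro mult_left_mono) auto
      finally show ?thesis .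
    qed
    have \<psi>x: "\<psi> x = P1 (\<rho> x) * P2 (u x) * Ex x" using xW by (simp add: \<psi>_def \<psi>0_def)
    have Ex0: "Ex x > 0" by (simp add: Ex_def)
    (* The integrand of the weak form, without the positive factor D. *)
    define Q where "Q = inverse (s x) * \<phi> (s x) * (a1 * (s x)\<^sup>2 + a2 * grad_inner M u \<rho> x)
      + K * (1 + r x) powr (- \<mu>) * rpow (s x) chi * (P1 (\<rho> x) * P2 (u x) * Ex x)"
    have JQ: "flux_coeff x * grad_inner M u \<psi> x + source_coeff x * \<psi> x = D x * Q"
      unfolding gi \<psi>x flux_coeff_def source_coeff_def Q_def by (simp add: algebra_simps)
    have "c0 * indicator V x - Mx * indicator ?B x \<le> Q"
    proof (cases "u x > \<gamma>'")
      case False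
      then have z: "P2 (u x) = 0" "P2' (u x) = 0" by (auto simp: P2_def P2'_def flat_exp_eq)
      have "Q = 0" unfolding Q_def a1_def a2_def z by simp
      moreover have "x \<notin> V" using False d by (simp add: V_def)
      ultimately show ?thesis using Mx0 by (simp add: indicator_def)
    next
      case ux: True
      have w: "0 \<le> u x - c" "u x - c \<le> b * (1 + r x) powr \<sigma>" using bound[OF ux] by auto
      have w2: "u x - c \<le> b * X powr \<sigma>"
      proof -
        have "(1 + r x) powr \<sigma> \<le> X powr \<sigma>" using X sigma by (intro powr_mono2) auto
        then show ?thesis using w(2) b mult_left_mono order_trans by blast
      qed
      have X1: "1 \<le> X" using X by linarith
      have Bb: "0 \<le> B" "B \<le> (q * S + \<beta>) * X powr (\<sigma> - \<eta> - 1)"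
        unfolding B_def by (rule radial_coefficient_bound[OF b sigma sigma_eta S par(5) \<beta> X1 w(1) w2])+
      define err where "err = (if cutoff' t = 0 then 0 else A * \<epsilon> powr (- \<delta>) * ((1 + e) * real N * Cz * h) powr (1 + \<delta>) * X powr (\<eta> * \<delta>))"
      have P1t: "P1 (\<rho> x) = cutoff t ^ N" by (simp add: P1_def t_def)
      have main: "P2 (u x) * Ex x * (\<kappa> * X powr (- \<mu>) * rpow (s x) chi * cutoff t ^ N - err) \<le> Q"
        unfolding Q_def a1_def a2_def err_def P1t
      proof (rule pointwise_bound[where S=S and \<beta>=\<beta> and k=k])
        show "s x = 0 \<Longrightarrow> \<phi> (s x) = 0" using phi_0 by simp
        show "s x > 0 \<Longrightarrow> \<phi> (s x) \<le> A * s x powr \<delta>" by (rule phi_bound)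
        show "0 \<le> \<phi> (s x)" by (rule phi_nonneg[OF s_nonneg])
        show "\<And>t. t > 0 \<Longrightarrow> (1 + e) * (q * S + \<beta>) \<le> (q - \<epsilon>) * t + k * t powr (- (\<delta> - chi))"
          by (rule tan)
        show "\<eta> = \<mu> + (\<sigma> - 1) * (1 + \<delta> - chi)" by (rule eta)
        show "A * k + \<kappa> = K * (1 + e) powr (- \<bar>\<mu>\<bar>)" by (rule par(7))
        show "B \<le> (q * S + \<beta>) * X powr (\<sigma> - \<eta> - 1)" by (rule Bb(2))
      qed (use A_pos delta_pos K0 par(1-6) s_nonneg X Bb(1) gb P2r Ex0 N cutoff_range Cz h in auto)
      have wP: "(u x + (- c)) * P4 (\<rho> x) \<ge> 0" using w(1) par(5) by (simp add: P4_def)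
      have wP2: "(u x + (- c)) * P4 (\<rho> x) \<le> q * b * X powr m"
      proof -
        have "(u x + (- c)) * P4 (\<rho> x) \<le> (b * X powr \<sigma>) * P4 (\<rho> x)"
          by (rule mult_right_mono) (use w2 par(5) in \<open>auto simp: P4_def\<close>)
        also have "\<dots> = q * b * (X powr \<sigma> * X powr (- \<eta>))" by (simp add: P4t)
        also have "X powr \<sigma> * X powr (- \<eta>) = X powr m" by (simp add: m_def powr_add[symmetric])
        finally show ?thesis .
      qed
      have P3t: "P3 (\<rho> x) = - (q * b * X powr m) - \<beta> * H X" by (simp add: P3_def X_def)
      have Exu: "Ex x \<le> exp (- \<beta> * H X)" unfolding Ex_def using wP2 by (simp add: P3t)
      have first: "c0 * indicator V x \<le> P2 (u x) * Ex x * (\<kappa> * X powr (- \<mu>) * rpow (s x) chi * cutoff t ^ N)"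
      proof (cases "x \<in> V")
        case False
        have "0 \<le> P2 (u x) * Ex x * (\<kappa> * X powr (- \<mu>) * rpow (s x) chi * cutoff t ^ N)"
          using P2r Ex0 par(3) rpow_nonneg cutoff_range by (intro mult_nonneg_nonneg) (auto simp: less_imp_le)
        then show ?thesis using False by simp
      next
        case True
        then have V: "u x > \<gamma>' + d" "s x > s0" "r x < R1" by (auto simp: V_def)
        have XR: "X \<le> 2 + R1" using X(3) V(3) par(2) by simp
        have "\<rho> x \<le> \<theta> * R" using \<rho>(2)[OF xW] V(3) par(2) R(2) by simp
        then have "t \<le> 0" using h by (simp add: t_def mult_nonpos_nonneg)
        then have ct: "cutoff t ^ N = 1" using cutoff_eq(1) by simp
        have f1: "flat_exp 0 d \<le> P2 (u x)" unfolding P2_def by (rule flat_exp_0_mono[OF d]) (use V in simp)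
        have f2: "exp (- (q * b) * (2 + R1) powr m - \<beta> * H (2 + R1)) \<le> Ex x"
        proof -
          have "X powr m \<le> (2 + R1) powr m" using XR X1 m by (intro powr_mono2) auto
          then have "q * b * X powr m \<le> q * b * (2 + R1) powr m" using par(5) b by (intro mult_left_mono) auto
          moreover have "\<beta> * H X \<le> \<beta> * H (2 + R1)"
            using radial_primitive_mono[OF m _ XR] X1 \<beta> unfolding H_def by (intro mult_left_mono) auto
          ultimately show ?thesis unfolding Ex_def P3t using wP by simp
        qed
        have f3: "(2 + R1) powr (- \<bar>\<mu>\<bar>) \<le> X powr (- \<mu>)"
        proof -
          have "(2 + R1) powr (- \<bar>\<mu>\<bar>) \<le> X powr (- \<bar>\<mu>\<bar>)" using XR X1 by (intro powr_mono2') auto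
          also have "\<dots> \<le> X powr (- \<mu>)" using X1 by (intro powr_mono) auto
          finally show ?thesis .
        qed
        have f4: "rpow s0 chi \<le> rpow (s x) chi" using rpow_mono[OF chi_range(1) s0] V(2) by simp
        have "c0 \<le> P2 (u x) * Ex x * (\<kappa> * X powr (- \<mu>) * rpow (s x) chi)"
          unfolding c0_def m_def[symmetric] H_def[symmetric]
        proof (intro mult_mono f1 f2 f3 f4 order_refl)
        qed (use P2r Ex0 par(3) rpow_nonneg flat_exp_nonneg[of 0 d] in \<open>auto intro!: mult_nonneg_nonneg simp del: flat_exp.simps\<close>)
        then show ?thesis using True ct by simp
      qed
      have second: "P2 (u x) * Ex x * err \<le> Mx * indicator ?B x"
      proof (cases "cutoff' t = 0")
        case True
        then show ?thesis using Mx0 by (simp add: err_def)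
      next
        case False
        then have "0 < t" "t < 1" using cutoff'_eq[of t] by (meson not_le)+
        then have "\<theta> * R < \<rho> x" "\<rho> x < R"
        proof -
          show "\<theta> * R < \<rho> x" using \<open>0 < t\<close> h by (simp add: t_def zero_less_mult_iff)
          have "\<rho> x - \<theta> * R < (1 - \<theta>) * R" using \<open>t < 1\<close> \<theta> R by (simp add: t_def h_def pos_divide_less_eq)
          then show "\<rho> x < R" by (simp add: algebra_simps)
        qed
        then have xB: "x \<in> ?B" using \<rho>(1)[OF xW] by (simp add: geodesic_ball_def)
        have XR: "1 + \<theta> * R \<le> X" "X \<le> 1 + R" using \<open>\<theta> * R < \<rho> x\<close> \<open>\<rho> x < R\<close> by (auto simp: X_def)
        have "Ex x \<le> exp (- \<beta> * H (1 + \<theta> * R))"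
        proof -
          have "H (1 + \<theta> * R) \<le> H X" unfolding H_def using XR(1) m \<theta> R by (intro radial_primitive_mono) (auto intro: add_pos_pos)
          then have "- \<beta> * H X \<le> - \<beta> * H (1 + \<theta> * R)" using \<beta> by simp
          then show ?thesis using Exu by (meson exp_le_cancel_iff order_trans)
        qed
        then have PE: "P2 (u x) * Ex x \<le> 1 * exp (- \<beta> * H (1 + \<theta> * R))"
          using P2r Ex0 by (intro mult_mono) auto
        have Xe: "X powr (\<eta> * \<delta>) \<le> (1 + R) powr (max (\<eta> * \<delta>) 0)"
        proof -
          have "X powr (\<eta> * \<delta>) \<le> X powr (max (\<eta> * \<delta>) 0)" using X1 by (intro powr_mono) auto
          also have "\<dots> \<le> (1 + R) powr (max (\<eta> * \<delta>) 0)" using X1 XR by (intro powr_mono2) auto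
          finally show ?thesis .
        qed
        have hp: "((1 + e) * real N * Cz * h) powr (1 + \<delta>) = ((1 + e) * real N * Cz) powr (1 + \<delta>) * (1 - \<theta>) powr (- (1 + \<delta>)) * R powr (- (1 + \<delta>))"
        proof -
          have hq: "h powr (1 + \<delta>) = ((1 - \<theta>) * R) powr (- (1 + \<delta>))"
            using \<theta> R unfolding h_def by (simp add: powr_divide powr_minus_divide del: minus_add_distrib)
          have "h powr (1 + \<delta>) = (1 - \<theta>) powr (- (1 + \<delta>)) * R powr (- (1 + \<delta>))"
            using \<theta> R by (simp add: hq powr_mult)
          then show ?thesis using par Cz h N by (simp add: powr_mult mult_ac)
        qed
        have "P2 (u x) * Ex x * err \<le> exp (- \<beta> * H (1 + \<theta> * R)) * (A * \<epsilon> powr (- \<delta>) * ((1 + e) * real N * Cz * h) powr (1 + \<delta>) * (1 + R) powr (max (\<eta> * \<delta>) 0))"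
          unfolding err_def if_not_P[OF False]
        proof (rule mult_mono[OF PE[unfolded mult_1]])
          show "A * \<epsilon> powr (- \<delta>) * ((1 + e) * real N * Cz * h) powr (1 + \<delta>) * X powr (\<eta> * \<delta>)
            \<le> A * \<epsilon> powr (- \<delta>) * ((1 + e) * real N * Cz * h) powr (1 + \<delta>) * (1 + R) powr (max (\<eta> * \<delta>) 0)"
            using A_pos by (intro mult_left_mono[OF Xe]) auto
        qed (use A_pos in auto)
        also have "\<dots> = Mx" unfolding hp Mx_def C2_def by (simp add: mult_ac)
        finally show ?thesis using xB by simp
      qed
      show ?thesis using main first second by (simp add: right_diff_distrib)
    qed
    then show ?thesis unfolding JQ using D_pos[of x] by (intro mult_left_mono) (auto simp: less_imp_le)
  qed
  have oV: "open V" unfolding V_def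
    by (intro open_Int open_Collect_less continuous_on_const u_cont s_cont continuous_on_rdist)
  have iV: "integrable vol (\<lambda>x. indicator V x * D x)"
  proof (cases "V = {}")
    case False
    show ?thesis by (rule integral_open_pos(1)[OF oV False VC cC D_cont D_pos])
  qed simp
  have "(LINT x|vol. D x * (c0 * indicator V x - Mx * indicator ?B x)) \<le> weak_form u flux_coeff source_coeff \<psi>"
    unfolding weak_form_def
  proof (rule integral_mono[OF _ _ pw])
    have "integrable vol (\<lambda>x. c0 * (indicator V x * D x) - Mx * (indicator ?B x * D x))"
      by (intro Bochner_Integration.integrable_diff integrable_mult_right iV weighted_vol_ball(1))
    then show "integrable vol (\<lambda>x. D x * (c0 * indicator V x - Mx * indicator ?B x))"
      by (simp add: right_diff_distrib mult_ac)
    show "integrable vol (\<lambda>x. flux_coeff x * grad_inner M u \<psi> x + source_coeff x * \<psi> x)"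
      by (rule weak_form_integrable[OF u_C1 coeff_facts \<psi>1 cC \<psi>z])
  qed
  also have "(LINT x|vol. D x * (c0 * indicator V x - Mx * indicator ?B x))
     = (LINT x|vol. c0 * (indicator V x * D x) - Mx * (indicator ?B x * D x))"
    by (rule Bochner_Integration.integral_cong) (auto simp: right_diff_distrib mult_ac)
  also have "\<dots> = c0 * (LINT x|vol. indicator V x * D x) - Mx * weighted_vol M D ?B"
    unfolding weighted_vol_ball(2)
    by (subst Bochner_Integration.integral_diff) (use iV weighted_vol_ball(1) in auto)
  finally have "c0 * (LINT x|vol. indicator V x * D x) \<le> Mx * weighted_vol M D ?B" using neg by linarith
  then show ?thesis unfolding Mx_def H_def m_def by (simp only: mult_ac)
qed

text \<open>If \<open>\<beta>\<close> beats the volume growth, the right side of \<open>estimate\<close> tends to zero along a sequence of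
  radii, whereas the left side is a positive constant as soon as \<open>V\<close> contains a point where the
  gradient does not vanish.\<close>

lemma contradiction_from_growth:
  fixes \<gamma>' b c S \<beta> \<theta> :: real
  assumes \<gamma>': "\<gamma> < \<gamma>'" and x0: "u x0 > \<gamma>'" "s x0 \<noteq> 0" and b: "b \<ge> 0"
    and bound: "\<And>x. u x > \<gamma>' \<Longrightarrow> 0 \<le> u x - c \<and> u x - c \<le> b * (1 + r x) powr \<sigma>"
    and S: "S > 0" "S \<ge> b * max \<sigma> (\<sigma> - \<eta>)" and \<beta>: "\<beta> > 0" and K: "K > A * \<beta> * S powr (\<delta> - chi)"
    and \<theta>: "0 < \<theta>" "\<theta> < 1"
    and growth: "\<And>\<epsilon> R0. \<epsilon> > 0 \<Longrightarrow> \<exists>R\<ge>R0. R > 0 \<and> weighted_vol M D (geodesic_ball M org R) *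
      (R powr (- (1 + \<delta>)) * (1 + R) powr (max (\<eta> * \<delta>) 0) * exp (- \<beta> * radial_primitive (\<sigma> - \<eta>) (1 + \<theta> * R))) < \<epsilon>"
  shows False
proof -
  have "A * \<beta> * S powr (\<delta> - chi) > 0" using A_pos \<beta> S by simp
  then have K0: "K > 0" using K by linarith
  have a: "\<delta> - chi > 0" using chi_range by simp
  obtain e \<kappa> \<epsilon> q k where par: "0 < e" "e < 1" "\<kappa> > 0" "\<epsilon> > 0" "q > 0" "k > 0"
    "A * k + \<kappa> = K * (1 + e) powr (- \<bar>\<mu>\<bar>)"
    and tan: "\<And>t. t > 0 \<Longrightarrow> (1 + e) * (q * S + \<beta>) \<le> (q - \<epsilon>) * t + k * t powr (- (\<delta> - chi))"
    by (rule parameter_choice[OF A_pos S(1) a \<beta> K]) blast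
  obtain Cz where Cz: "Cz > 0" "\<And>t. \<bar>cutoff' t\<bar> \<le> Cz" by (rule cutoff'_bounded) blast
  obtain N :: nat where N: "real N \<ge> 1 + \<delta>" using real_arch_simple by blast
  define d where "d = (u x0 - \<gamma>') / 2"
  define s0 where "s0 = s x0 / 2"
  define R1 where "R1 = r x0 + 1"
  have sx: "s x0 > 0" using x0(2) s_nonneg[of x0] by simp
  have R1: "R1 > 0" using rdist_nonneg[of org x0] unfolding R1_def by linarith
  have pos: "d > 0" "s0 > 0" "R1 > 0" using x0 sx R1 by (auto simp: d_def s0_def)
  define V where "V = {x. u x > \<gamma>' + d} \<inter> {x. s x > s0} \<inter> {x. r x < R1}"
  define c0 where "c0 = flat_exp 0 d * exp (- (q * b) * (2 + R1) powr (\<sigma> - \<eta>) - \<beta> * radial_primitive (\<sigma> - \<eta>) (2 + R1))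
      * (\<kappa> * (2 + R1) powr (- \<bar>\<mu>\<bar>) * rpow s0 chi)"
  define C2 where "C2 = A * \<epsilon> powr (- \<delta>) * ((1 + e) * real N * Cz) powr (1 + \<delta>) * (1 - \<theta>) powr (- (1 + \<delta>))"
  have c0: "c0 > 0" unfolding c0_def using pos par rpow_pos by (simp add: add_pos_pos)
  have C2: "C2 \<ge> 0" unfolding C2_def using A_pos by simp
  have oV: "open V" unfolding V_def
    by (intro open_Int open_Collect_less continuous_on_const u_cont s_cont continuous_on_rdist)
  have "x0 \<in> V" using x0 sx by (auto simp: V_def d_def s0_def R1_def field_simps)
  then have "V \<noteq> {}" by blast
  then have I: "0 < (LINT x|vol. indicator V x * D x)"
    by (rule integral_open_pos(2)[OF oV _ _ compact_rdist_cball[of org R1] D_cont D_pos]) (auto simp: V_def)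
  define I where "I = (LINT x|vol. indicator V x * D x)"
  have I0: "I > 0" using I by (simp add: I_def)
  have "c0 * I / (C2 + 1) > 0" using c0 I0 C2 by simp
  from growth[OF this, of "(R1 + 1) / \<theta>"] obtain R where R: "R \<ge> (R1 + 1) / \<theta>" "R > 0"
    "weighted_vol M D (geodesic_ball M org R) *
      (R powr (- (1 + \<delta>)) * (1 + R) powr (max (\<eta> * \<delta>) 0) * exp (- \<beta> * radial_primitive (\<sigma> - \<eta>) (1 + \<theta> * R))) < c0 * I / (C2 + 1)" (is "?G < _")
    by blast
  have \<theta>R: "\<theta> * R \<ge> R1 + 1" using R(1) \<theta> by (simp add: pos_divide_le_eq mult.commute)
  have "c0 * I \<le> C2 * ?G"
    unfolding I_def V_def c0_def C2_def
    by (rule estimate[OF \<gamma>' b bound S(2) \<beta> K0 \<theta> par tan Cz N pos R(2) \<theta>R])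
  also have "\<dots> \<le> C2 * (c0 * I / (C2 + 1))" using R(3) C2 by (intro mult_left_mono) auto
  also have "\<dots> < c0 * I"
  proof -
    have "C2 * (c0 * I) < (C2 + 1) * (c0 * I)" using c0 I0 by (intro mult_strict_right_mono) auto
    then show ?thesis using C2 by (simp add: field_simps)
  qed
  finally show False by simp
qed

end

section \<open>Volume growth and the sharp constant\<close>

context connected_riemannian begin

text \<open>If the gradient vanished on a superlevel set, the level sets in it would be open as well as
  closed, since a function is constant on a coordinate ball where its derivative vanishes.\<close>

lemma ex_grad_nonzero:
  assumes f: "Ck_fun_on 1 UNIV f" and nc: "\<not> f constant_on UNIV" and ne: "f p > a"
  shows "\<exists>x. f x > a \<and> grad_norm M f x \<noteq> 0"
proof (rule ccontr)
  assume "\<not> ?thesis"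
  then have z: "grad_norm M f x = 0" if "f x > a" for x using that by blast
  have cont: "continuous_on UNIV f" by (rule Ck_fun_on_imp_continuous_on[OF f])
  have o: "open {x. f x > a}" by (rule open_Collect_less[OF continuous_on_const cont])
  let ?S = "{x. f x = f p}"
  have "closed ?S" by (rule closed_Collect_eq[OF cont continuous_on_const])
  moreover have "open ?S"
  proof (subst open_subopen, intro ballI)
    fix q assume "q \<in> ?S"
    then have q: "f q = f p" by simp
    define c where "c = chart_at M q"
    have c: "c \<in> atlas M" "q \<in> dom c" using chart_at by (auto simp: c_def)
    have "open (coord c ` (dom c \<inter> {x. f x > a}))" by (rule open_coord_image[OF c(1) o])
    moreover have "coord c q \<in> coord c ` (dom c \<inter> {x. f x > a})" using c(2) q ne by auto
    ultimately obtain \<epsilon> where \<epsilon>: "\<epsilon> > 0" "ball (coord c q) \<epsilon> \<subseteq> coord c ` (dom c \<inter> {x. f x > a})"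
      using open_contains_ball by blast
    let ?B = "ball (coord c q) \<epsilon>"
    have sub: "?B \<subseteq> coord c ` dom c" using \<epsilon>(2) by blast
    have der: "(f \<circ> param c has_derivative (\<lambda>v. 0)) (at y within ?B)" if y: "y \<in> ?B" for y
    proof -
      obtain x where x: "x \<in> dom c" "f x > a" "y = coord c x" using y \<epsilon>(2) by blast
      have d: "has_differential c f x (differential c f x)" by (rule has_differential[OF f c(1) x(1) UNIV_I])
      have "dual_inner c x (differential c f x) (differential c f x) = 0"
        using z[OF x(2)] grad_norm_eq[OF c(1) x(1) d] by simp
      then have "differential c f x = 0" by (rule dual_inner_eq_0[OF c(1) x(1)])
      then have "(f \<circ> param c has_derivative (\<lambda>v. 0)) (at y)"
        using d x(3) by (simp add: has_differential_def)
      then show ?thesis by (rule has_derivative_at_withinI)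
    qed
    obtain k where k: "\<And>y. y \<in> ?B \<Longrightarrow> (f \<circ> param c) y = k"
      using has_derivative_zero_constant[OF convex_ball der] by blast
    have mem: "coord c q \<in> ?B" using \<epsilon>(1) by simp
    have k': "k = f p" using k[OF mem] c q by simp
    show "\<exists>T. open T \<and> q \<in> T \<and> T \<subseteq> ?S"
    proof (intro exI conjI subsetI)
      show "open (param c ` ?B)" by (rule open_param_image[OF c(1) open_ball sub])
      show "q \<in> param c ` ?B" using mem c(1,2) by (metis image_eqI param_coord)
      show "x \<in> ?S" if "x \<in> param c ` ?B" for x using that k k' by auto
    qed
  qed
  ultimately have "?S = {} \<or> ?S = UNIV" using connected connected_clopen[of "UNIV :: 'a set"]
    by (metis closed_closedin open_openin subtopology_UNIV)
  then have "f x = f p" for x by blast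
  then show False using nc unfolding constant_on_def by blast
qed

end

lemma Liminf_less_frequently:
  fixes f :: "real \<Rightarrow> real"
  assumes "Liminf at_top (\<lambda>R. ereal (f R)) = ereal d" and "d < d'"
  shows "\<exists>R\<ge>R0. f R < d'"
proof (rule ccontr)
  assume "\<not> ?thesis"
  then have "\<forall>R\<ge>R0. ereal d' \<le> ereal (f R)" by (auto simp: not_less)
  then have "eventually (\<lambda>R. ereal d' \<le> ereal (f R)) at_top" unfolding eventually_at_top_linorder by blast
  then have "ereal d' \<le> Liminf at_top (\<lambda>R. ereal (f R))" by (rule Liminf_bounded)
  then show False using assms by simp
qed

context elliptic_inequality begin

definition ball_vol :: "real \<Rightarrow> real" where "ball_vol R = weighted_vol M D (geodesic_ball M org R)"

text \<open>The weight \<open>exp (- \<beta> H)\<close> makes the error caused by the cut-off negligible for a sequence of radii.\<close>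

definition admissible_rate :: "real \<Rightarrow> bool" where
  "admissible_rate \<beta> \<longleftrightarrow> \<beta> > 0 \<and> (\<exists>\<theta>. 0 < \<theta> \<and> \<theta> < 1 \<and> (\<forall>\<epsilon>>0. \<forall>R0. \<exists>R\<ge>R0. R > 0 \<and> ball_vol R *
      (R powr (- (1 + \<delta>)) * (1 + R) powr (max (\<eta> * \<delta>) 0) * exp (- \<beta> * radial_primitive (\<sigma> - \<eta>) (1 + \<theta> * R))) < \<epsilon>))"

lemma bound_by_rate:
  assumes nc: "\<not> u constant_on UNIV" and rate: "admissible_rate \<beta>" and \<gamma>': "\<gamma> < \<gamma>'" and p: "u p > \<gamma>'" and b: "b \<ge> 0"
    and bound: "\<And>x. u x > \<gamma>' \<Longrightarrow> 0 \<le> u x - c \<and> u x - c \<le> b * (1 + r x) powr \<sigma>"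
    and S: "S > 0" "S \<ge> b * max \<sigma> (\<sigma> - \<eta>)"
  shows "K \<le> A * \<beta> * S powr (\<delta> - chi)"
proof (rule ccontr)
  assume "\<not> ?thesis"
  then have K: "K > A * \<beta> * S powr (\<delta> - chi)" by simp
  obtain x0 where x0: "u x0 > \<gamma>'" "s x0 \<noteq> 0" using ex_grad_nonzero[OF u_C1 nc p] by blast
  obtain \<theta> where \<theta>: "0 < \<theta>" "\<theta> < 1" and \<beta>: "\<beta> > 0"
    and g: "\<forall>\<epsilon>>0. \<forall>R0. \<exists>R\<ge>R0. R > 0 \<and> ball_vol R *
      (R powr (- (1 + \<delta>)) * (1 + R) powr (max (\<eta> * \<delta>) 0) * exp (- \<beta> * radial_primitive (\<sigma> - \<eta>) (1 + \<theta> * R))) < \<epsilon>"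
    using rate unfolding admissible_rate_def by blast
  show False
    by (rule contradiction_from_growth[OF \<gamma>' x0 b bound S \<beta> K \<theta>]) (use g in \<open>auto simp: ball_vol_def\<close>)
qed

text \<open>Take \<open>c = \<gamma>'\<close> close to the supremum of \<open>u\<close>. Then \<open>b\<close>, and with it \<open>S\<close>, can be chosen arbitrarily
  small, whereas \<open>\<beta>\<close> is fixed.\<close>

lemma bounded_imp_nonpos:
  assumes nc: "\<not> u constant_on UNIV" and rate: "admissible_rate \<beta>" and p: "u p > \<gamma>" and bdd: "bdd_above (range u)"
  shows "K \<le> 0"
proof (rule ccontr)
  assume "\<not> K \<le> 0"
  then have K: "K > 0" by simp
  have \<beta>: "\<beta> > 0" using rate by (simp add: admissible_rate_def)
  have a: "\<delta> - chi > 0" using chi_range by simp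
  define S where "S = (K / (2 * A * \<beta>)) powr (1 / (\<delta> - chi))"
  have S: "S > 0" using K A_pos \<beta> by (simp add: S_def)
  have Sa: "S powr (\<delta> - chi) = K / (2 * A * \<beta>)" using K A_pos \<beta> a by (simp add: S_def powr_powr)
  define t where "t = max \<sigma> (\<sigma> - \<eta>)"
  have t: "t \<ge> 0" using sigma by (simp add: t_def)
  define b where "b = S / (t + 1)"
  have b: "b > 0" "b * t \<le> S" using S t by (auto simp: b_def field_simps)
  define m where "m = Sup (range u)"
  have m: "u x \<le> m" for x unfolding m_def by (rule cSup_upper[OF _ bdd]) auto
  define \<gamma>' where "\<gamma>' = (max \<gamma> (m - b) + m) / 2"
  have "\<gamma> < m" using p m[of p] by linarith
  then have g: "\<gamma> < \<gamma>'" "m - b < \<gamma>'" "\<gamma>' < m" using b(1) by (auto simp: \<gamma>'_def max_def)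
  obtain x where x: "u x > \<gamma>'" using g(3) unfolding m_def by (subst (asm) less_cSup_iff[OF _ bdd]) auto
  have "K \<le> A * \<beta> * S powr (\<delta> - chi)"
  proof (rule bound_by_rate[OF nc rate g(1) x, of b \<gamma>'])
    show "b \<ge> 0" "S > 0" "S \<ge> b * max \<sigma> (\<sigma> - \<eta>)" using b S by (auto simp: t_def)
    fix y assume y: "u y > \<gamma>'"
    have "1 \<le> (1 + r y) powr \<sigma>" using sigma rdist_nonneg[of org y] by (intro ge_one_powr_ge_zero) auto
    then have "b \<le> b * (1 + r y) powr \<sigma>" using b(1) by simp
    moreover have "u y - \<gamma>' \<le> b" using m[of y] g(2) by linarith
    ultimately show "0 \<le> u y - \<gamma>' \<and> u y - \<gamma>' \<le> b * (1 + r y) powr \<sigma>" using y by linarith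
  qed
  also have "\<dots> = K / 2" using Sa A_pos \<beta> by simp
  finally show False using K by simp
qed

text \<open>Take \<open>c = 0\<close> and \<open>\<gamma>'\<close> larger than the maximum of \<open>u\<close> on the ball outside which the growth bound
  holds.\<close>

lemma unbounded_bound:
  assumes nc: "\<not> u constant_on UNIV" and rate: "admissible_rate \<beta>" and ub: "\<not> bdd_above (range u)"
    and b: "b > 0" and R0: "\<And>x. r x \<ge> R0 \<Longrightarrow> u x \<le> b * r x powr \<sigma>"
  shows "K \<le> A * \<beta> * (b * max \<sigma> (\<sigma> - \<eta>)) powr (\<delta> - chi)" and "\<sigma> > 0"
proof -
  obtain B where B: "\<And>x. r x \<le> R0 \<Longrightarrow> u x \<le> B"
  proof -
    have "bounded (u ` {x. r x \<le> R0})"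
      by (intro compact_imp_bounded compact_continuous_image compact_rdist_cball continuous_on_subset[OF u_cont]) auto
    then obtain B where "\<forall>y\<in>u ` {x. r x \<le> R0}. norm y \<le> B" unfolding bounded_iff by blast
    then show ?thesis using that[of B] by force
  qed
  have pb: "u x \<le> b * (1 + r x) powr \<sigma>" if "r x \<ge> R0" for x
  proof -
    have "r x powr \<sigma> \<le> (1 + r x) powr \<sigma>" using sigma rdist_nonneg[of org x] by (intro powr_mono2) auto
    then show ?thesis using R0[OF that] b mult_left_mono[of "r x powr \<sigma>" "(1 + r x) powr \<sigma>" b] by linarith
  qed
  show s0: "\<sigma> > 0"
  proof (rule ccontr)
    assume "\<not> \<sigma> > 0"
    then have "\<sigma> = 0" using sigma by simp
    have "u x \<le> max B b" for x
    proof (cases "r x \<le> R0")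
      case True then show ?thesis using B[OF True] by simp
    next
      case False
      have "1 + r x \<noteq> 0" using rdist_nonneg[of org x] by linarith
      then have "(1 + r x) powr \<sigma> = 1" using \<open>\<sigma> = 0\<close> by simp
      then show ?thesis using pb[of x] False by simp
    qed
    then show False using ub by (auto simp: bdd_above_def)
  qed
  define \<gamma>' where "\<gamma>' = max (max \<gamma> 0) B + 1"
  obtain p where p: "u p > \<gamma>'" using ub unfolding bdd_above_def by (auto simp: not_le)
  show "K \<le> A * \<beta> * (b * max \<sigma> (\<sigma> - \<eta>)) powr (\<delta> - chi)"
  proof (rule bound_by_rate[OF nc rate _ p, of b 0])
    show "\<gamma> < \<gamma>'" by (simp add: \<gamma>'_def)
    show "b * max \<sigma> (\<sigma> - \<eta>) > 0" using b s0 by (simp add: less_max_iff_disj)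
    fix y assume y: "u y > \<gamma>'"
    then have "u y > B" "u y > 0" by (auto simp: \<gamma>'_def max_def split: if_splits)
    then show "0 \<le> u y - 0 \<and> u y - 0 \<le> b * (1 + r y) powr \<sigma>" using B[of y] pb[of y] by force
  qed (use b in auto)
qed

text \<open>Let \<open>\<beta>\<close> and \<open>b\<close> decrease to \<open>\<beta>0\<close> and \<open>b0\<close>.\<close>

lemma bound_from_rates:
  assumes nc: "\<not> u constant_on UNIV" and p: "u p > \<gamma>" and \<beta>0: "\<beta>0 \<ge> 0" and rate: "\<And>\<beta>. \<beta> > \<beta>0 \<Longrightarrow> admissible_rate \<beta>"
    and b0: "b0 \<ge> 0" and growth: "\<And>b. b > b0 \<Longrightarrow> \<exists>R0. \<forall>x. r x \<ge> R0 \<longrightarrow> u x \<le> b * r x powr \<sigma>"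
  shows "K \<le> (if \<sigma> = 0 then 0 else A * \<beta>0 * max \<sigma> (\<sigma> - \<eta>) powr (\<delta> - chi)) * b0 powr (\<delta> - chi)"
proof (cases "K \<le> 0")
  case True
  have "0 \<le> (if \<sigma> = 0 then 0 else A * \<beta>0 * max \<sigma> (\<sigma> - \<eta>) powr (\<delta> - chi)) * b0 powr (\<delta> - chi)"
    using A_pos \<beta>0 by simp
  then show ?thesis using True by linarith
next
  case False
  have ub: "\<not> bdd_above (range u)" using bounded_imp_nonpos[OF nc rate[of "\<beta>0 + 1"] p] False by auto
  define t where "t = max \<sigma> (\<sigma> - \<eta>)"
  have a: "\<delta> - chi > 0" using chi_range by simp
  have kb: "K \<le> A * \<beta> * (b * t) powr (\<delta> - chi)" "\<sigma> > 0" if \<beta>: "\<beta> > \<beta>0" and b: "b > b0" for \<beta> b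
  proof -
    obtain R0 where "\<forall>x. r x \<ge> R0 \<longrightarrow> u x \<le> b * r x powr \<sigma>" using growth[OF b] by blast
    then show "K \<le> A * \<beta> * (b * t) powr (\<delta> - chi)" "\<sigma> > 0"
      using unbounded_bound[OF nc rate[OF \<beta>] ub, of b R0] b b0 unfolding t_def by auto
  qed
  have s0: "\<sigma> > 0" using kb(2)[of "\<beta>0 + 1" "b0 + 1"] by simp
  have t: "t > 0" using s0 by (simp add: t_def less_max_iff_disj)
  have "((\<lambda>h. A * (\<beta>0 + h) * ((b0 + h) * t) powr (\<delta> - chi)) \<longlongrightarrow> A * (\<beta>0 + 0) * ((b0 + 0) * t) powr (\<delta> - chi)) (at_right 0)"
    by (intro tendsto_intros tendsto_powr' ) (use a b0 t in \<open>auto simp: eventually_at_right_less intro!: eventually_at_rightI[of 0 1]\<close>)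
  moreover have "eventually (\<lambda>h. K \<le> A * (\<beta>0 + h) * ((b0 + h) * t) powr (\<delta> - chi)) (at_right 0)"
    by (rule eventually_at_rightI[of 0 1]) (auto intro!: kb)
  ultimately have "K \<le> A * (\<beta>0 + 0) * ((b0 + 0) * t) powr (\<delta> - chi)"
    by (rule tendsto_lowerbound) simp
  also have "\<dots> = A * \<beta>0 * t powr (\<delta> - chi) * b0 powr (\<delta> - chi)" using b0 t by (simp add: powr_mult mult_ac)
  finally show ?thesis using s0 by (simp add: t_def)
qed

text \<open>Since \<open>\<beta> H(X) = (\<beta> / m) X\<^sup>m\<close> with \<open>m = \<sigma> - \<eta>\<close>, the weight decays like \<open>exp (- d\<^sub>2 R\<^sup>m)\<close> on the annulus
  when \<open>\<theta>\<close> is close to \<open>1\<close>, while for a sequence of radii the volume is at most \<open>exp (d\<^sub>1 R\<^sup>m)\<close>; here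
  \<open>d < d\<^sub>1 < d\<^sub>2 < \<beta> / m\<close>.\<close>

lemma admissible_rate_exp:
  assumes m: "\<sigma> - \<eta> > 0" and lim: "Liminf at_top (\<lambda>R. ereal (ln (ball_vol R) / R powr (\<sigma> - \<eta>))) = ereal d"
    and d: "d \<ge> 0" and \<beta>: "\<beta> > d * (\<sigma> - \<eta>)"
  shows "admissible_rate \<beta>"
proof -
  define m where "m = \<sigma> - \<eta>"
  have m0: "m > 0" using m by (simp add: m_def)
  have "0 \<le> d * m" using d m0 by simp
  then have \<beta>0: "\<beta> > 0" using \<beta> by (simp add: m_def)
  define d1 where "d1 = (2 * d + \<beta> / m) / 3"
  define d2 where "d2 = (d + 2 * (\<beta> / m)) / 3"
  have "d < \<beta> / m" using \<beta> m0 by (simp add: m_def pos_less_divide_eq)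
  then have dd: "d < d1" "d1 < d2" "d2 < \<beta> / m" "0 < d2" using d unfolding d1_def d2_def by argo+
  define \<theta> where "\<theta> = (d2 / (\<beta> / m)) powr (1 / m)"
  have \<theta>m: "\<theta> powr m = d2 / (\<beta> / m)" using dd m0 \<beta>0 by (simp add: \<theta>_def powr_powr)
  have \<theta>: "0 < \<theta>" "\<theta> < 1"
  proof -
    show "0 < \<theta>" using dd \<beta>0 m0 by (simp add: \<theta>_def)
    have "\<beta> / m > 0" using \<beta>0 m0 by simp
    then have "d2 / (\<beta> / m) < 1" using dd(3) by (subst divide_less_eq_1_pos)
    then show "\<theta> < 1" unfolding \<theta>_def using dd \<beta>0 m0 powr_less_mono2[of "1 / m" "d2 / (\<beta> / m)" 1] by simp
  qed
  define e where "e = d2 - d1"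
  have e: "e > 0" using dd by (simp add: e_def)
  define p where "p = max (\<eta> * \<delta>) 0"
  have "p \<ge> 0" by (simp add: p_def)
  have lim0: "((\<lambda>R. R powr (- (1 + \<delta>)) * (1 + R) powr p * exp (- e * R powr m)) \<longlongrightarrow> 0) at_top"
    using e m0 delta_pos by real_asymp
  have "\<exists>R\<ge>R0. R > 0 \<and> ball_vol R * (R powr (- (1 + \<delta>)) * (1 + R) powr p
      * exp (- \<beta> * radial_primitive m (1 + \<theta> * R))) < \<epsilon>" if \<epsilon>: "\<epsilon> > 0" for \<epsilon> R0
  proof -
    from order_tendstoD(2)[OF lim0 \<epsilon>] obtain R1 where
      R1: "\<And>R. R \<ge> R1 \<Longrightarrow> R powr (- (1 + \<delta>)) * (1 + R) powr p * exp (- e * R powr m) < \<epsilon>"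
      unfolding eventually_at_top_linorder by blast
    obtain R where R: "R \<ge> max 1 (max R0 R1)" "ln (ball_vol R) / R powr m < d1"
      using Liminf_less_frequently[OF lim dd(1)] unfolding m_def by blast
    have R0: "R > 0" using R(1) by simp
    have V: "ball_vol R > 0" unfolding ball_vol_def by (rule weighted_vol_pos[OF R0])
    have "ln (ball_vol R) < d1 * R powr m" using R(2) R0 by (simp add: pos_divide_less_eq)
    then have VR: "ball_vol R \<le> exp (d1 * R powr m)" using V by (metis exp_le_cancel_iff exp_ln less_imp_le)
    have "d2 * R powr m = \<beta> / m * (\<theta> * R) powr m" using \<theta> R0 \<theta>m dd \<beta>0 m0 by (simp add: powr_mult)
    also have "\<dots> \<le> \<beta> / m * (1 + \<theta> * R) powr m"
      using \<theta> R0 \<beta>0 m0 by (intro mult_left_mono powr_mono2) auto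
    also have "\<dots> = \<beta> * radial_primitive m (1 + \<theta> * R)" using m0 by (simp add: radial_primitive_def)
    finally have rp: "d2 * R powr m \<le> \<beta> * radial_primitive m (1 + \<theta> * R)" .
    have "ball_vol R * exp (- \<beta> * radial_primitive m (1 + \<theta> * R)) \<le> exp (d1 * R powr m) * exp (- (d2 * R powr m))"
      using VR rp by (intro mult_mono) auto
    also have "\<dots> = exp (- e * R powr m)" by (simp add: e_def exp_add[symmetric] algebra_simps)
    finally have "R powr (- (1 + \<delta>)) * (1 + R) powr p * (ball_vol R * exp (- \<beta> * radial_primitive m (1 + \<theta> * R)))
      \<le> R powr (- (1 + \<delta>)) * (1 + R) powr p * exp (- e * R powr m)" by (intro mult_left_mono) auto
    also have "\<dots> < \<epsilon>" using R1 R(1) by simp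
    finally show ?thesis using R(1) R0 by (intro exI[of _ R]) (simp add: mult_ac)
  qed
  then show ?thesis using \<beta>0 \<theta> unfolding admissible_rate_def m_def p_def by blast
qed

text \<open>Now \<open>exp (- \<beta> H(X)) = X\<^sup>-\<^sup>\<beta>\<close> and \<open>\<eta> = \<sigma>\<close>, so for a sequence of radii the error is at most a constant times
  \<open>R\<close> to the power \<open>d\<^sub>1 - (1 + \<delta>) + \<sigma> \<delta> - \<beta>\<close>, which is negative for \<open>d\<^sub>1\<close> close to \<open>d\<close>.\<close>

lemma admissible_rate_poly:
  assumes m: "\<sigma> - \<eta> = 0" and lim: "Liminf at_top (\<lambda>R. ereal (ln (ball_vol R) / ln R)) = ereal d"
    and \<beta>0: "\<beta> > 0" and \<beta>: "\<beta> > \<delta> * (\<sigma> - 1) + d - 1"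
  shows "admissible_rate \<beta>"
proof -
  define p where "p = \<sigma> * \<delta>"
  have p: "p \<ge> 0" "max (\<eta> * \<delta>) 0 = p" using m sigma delta_pos by (auto simp: p_def)
  define d1 where "d1 = d + (\<beta> - (\<delta> * (\<sigma> - 1) + d - 1)) / 2"
  have d1: "d < d1" "d1 - (1 + \<delta>) + p - \<beta> < 0" using \<beta> by (auto simp: d1_def p_def field_simps)
  define a where "a = d1 - (1 + \<delta>) + p - \<beta>"
  have lim0: "((\<lambda>R. 2 powr p * 2 powr \<beta> * R powr a) \<longlongrightarrow> 0) at_top"
    using d1(2) unfolding a_def[symmetric] by real_asymp
  have "\<exists>R\<ge>R0. R > 0 \<and> ball_vol R * (R powr (- (1 + \<delta>)) * (1 + R) powr p
      * exp (- \<beta> * radial_primitive (\<sigma> - \<eta>) (1 + (1 / 2) * R))) < \<epsilon>" if \<epsilon>: "\<epsilon> > 0" for \<epsilon> R0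
  proof -
    from order_tendstoD(2)[OF lim0 \<epsilon>] obtain R1 where
      R1: "\<And>R. R \<ge> R1 \<Longrightarrow> 2 powr p * 2 powr \<beta> * R powr a < \<epsilon>"
      unfolding eventually_at_top_linorder by blast
    obtain R where R: "R \<ge> max 2 (max R0 R1)" "ln (ball_vol R) / ln R < d1"
      using Liminf_less_frequently[OF lim d1(1)] by blast
    have R0: "R \<ge> 2" using R(1) by simp
    have V: "ball_vol R > 0" unfolding ball_vol_def by (rule weighted_vol_pos) (use R0 in simp)
    have "ln (ball_vol R) < d1 * ln R" using R(2) R0 by (simp add: pos_divide_less_eq)
    then have "exp (ln (ball_vol R)) \<le> exp (d1 * ln R)" by simp
    then have VR: "ball_vol R \<le> R powr d1" using V R0 by (simp add: powr_def)
    have "exp (- \<beta> * radial_primitive (\<sigma> - \<eta>) (1 + (1 / 2) * R)) = (1 + (1 / 2) * R) powr (- \<beta>)"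
      using R0 m by (simp add: radial_primitive_def powr_def)
    also have "\<dots> \<le> (R / 2) powr (- \<beta>)" using R0 \<beta>0 by (intro powr_mono2') auto
    also have "\<dots> = 2 powr \<beta> * R powr (- \<beta>)" using R0 by (simp add: powr_divide powr_minus field_simps)
    finally have E: "exp (- \<beta> * radial_primitive (\<sigma> - \<eta>) (1 + (1 / 2) * R)) \<le> 2 powr \<beta> * R powr (- \<beta>)" .
    have P: "(1 + R) powr p \<le> 2 powr p * R powr p"
      using R0 p powr_mono2[of p "1 + R" "2 * R"] by (simp add: powr_mult)
    have "ball_vol R * (R powr (- (1 + \<delta>)) * (1 + R) powr p * exp (- \<beta> * radial_primitive (\<sigma> - \<eta>) (1 + (1 / 2) * R)))
      \<le> R powr d1 * (R powr (- (1 + \<delta>)) * (2 powr p * R powr p) * (2 powr \<beta> * R powr (- \<beta>)))"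
      by (intro mult_mono VR P E order_refl) auto
    also have "\<dots> = 2 powr p * 2 powr \<beta> * (R powr d1 * R powr (- (1 + \<delta>)) * R powr p * R powr (- \<beta>))"
      by (simp only: mult_ac)
    also have "R powr d1 * R powr (- (1 + \<delta>)) * R powr p * R powr (- \<beta>) = R powr a"
      unfolding powr_add[symmetric] by (rule arg_cong[where f = "\<lambda>x. R powr x"]) (simp add: a_def)
    also have "2 powr p * 2 powr \<beta> * R powr a < \<epsilon>" using R1 R(1) by simp
    finally show ?thesis using R(1) R0 by (intro exI[of _ R]) simp
  qed
  then have "\<forall>\<epsilon>>0. \<forall>R0. \<exists>R\<ge>R0. R > 0 \<and> ball_vol R * (R powr (- (1 + \<delta>)) * (1 + R) powr p
      * exp (- \<beta> * radial_primitive (\<sigma> - \<eta>) (1 + (1 / 2) * R))) < \<epsilon>" by blast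
  moreover have "0 < (1 / 2 :: real)" "(1 / 2 :: real) < 1" by auto
  ultimately show ?thesis using \<beta>0 unfolding admissible_rate_def p(2) by blast
qed

text \<open>For a negative rate the volume of a sequence of growing balls would tend to zero.\<close>

lemma exp_rate_nonneg:
  assumes m: "\<sigma> - \<eta> > 0" and lim: "Liminf at_top (\<lambda>R. ereal (ln (ball_vol R) / R powr (\<sigma> - \<eta>))) = ereal d"
  shows "d \<ge> 0"
proof (rule ccontr)
  assume d: "\<not> d \<ge> 0"
  define m where "m = \<sigma> - \<eta>"
  have m0: "m > 0" using m by (simp add: m_def)
  have "filterlim (\<lambda>R::real. R powr m) at_top at_top" using m0 by real_asymp
  then have "eventually (\<lambda>R. 2 * ln (ball_vol 1) / d \<le> R powr m) at_top" unfolding filterlim_at_top by blast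
  then obtain R1 where R1: "\<And>R. R \<ge> R1 \<Longrightarrow> 2 * ln (ball_vol 1) / d \<le> R powr m"
    unfolding eventually_at_top_linorder by blast
  have d2: "d < d / 2" using d by simp
  obtain R where R: "R \<ge> max 1 R1" "ln (ball_vol R) / R powr m < d / 2"
    using Liminf_less_frequently[OF lim d2, of "max 1 R1"] unfolding m_def by blast
  have "ball_vol 1 > 0" unfolding ball_vol_def by (rule weighted_vol_pos) simp
  moreover have "ball_vol 1 \<le> ball_vol R" unfolding ball_vol_def by (rule weighted_vol_mono) (use R in simp)
  ultimately have "ln (ball_vol 1) \<le> ln (ball_vol R)" by simp
  also have "\<dots> < d / 2 * R powr m" using R by (simp add: pos_divide_less_eq)
  finally have "2 * ln (ball_vol 1) < d * R powr m" by simp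
  then have "R powr m < 2 * ln (ball_vol 1) / d" using d by (simp add: neg_less_divide_eq mult.commute)
  then show False using R1[of R] R(1) by simp
qed

end

theorem theorem5p1:
  fixes M :: "('a::{t2_space, second_countable_topology}, 'm::finite) riemannian_structure"
    and org :: 'a
    and D u :: "'a \<Rightarrow> real"
    and \<phi> :: "real \<Rightarrow> real"
    and A \<delta> \<sigma> \<mu> chi \<eta> d\<^sub>0 \<gamma> K :: real
    and u_hat :: ereal
  assumes manifold: "riemannian_manifold M"
    and dim: "CARD('m) \<ge> 2"
    and complete: "complete_manifold M"
    and noncompact: "\<not> compact (UNIV :: 'a set)"
    and connected: "connected (UNIV :: 'a set)"
    and D_cont: "continuous_on UNIV D"
    and D_pos: "\<And>x. D x > 0"
    and phi_C0: "continuous_on {0..} \<phi>"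
    and phi_C1: "\<phi> C1_differentiable_on {0<..}"
    and phi_nonneg: "\<And>t. t \<ge> 0 \<Longrightarrow> \<phi> t \<ge> 0"
    and phi_0: "\<phi> 0 = 0"
    and A_pos: "A > 0"
    and delta_pos: "\<delta> > 0"
    and phi_bound: "\<And>t. t > 0 \<Longrightarrow> \<phi> t \<le> A * t powr \<delta>"
    and eta: "\<eta> = \<mu> + (\<sigma> - 1) * (1 + \<delta> - chi)"
    and sigma: "\<sigma> \<ge> 0"
    and sigma_eta: "\<sigma> - \<eta> \<ge> 0"
    and chi_range: "0 \<le> chi" "chi < \<delta>"
    and u_C1: "Ck_function M 1 u"
    and u_nonconst: "\<not> u constant_on UNIV"
    and u_hat: "u_hat = Limsup (filtercomap (rdist M org) at_top)
                  (\<lambda>x. ereal (u x / rdist M org x powr \<sigma>))"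
    and u_hat_finite: "u_hat < \<infinity>"
    and vol_exp: "\<sigma> - \<eta> > 0 \<Longrightarrow>
          Liminf at_top (\<lambda>R::real.
            ereal (ln (weighted_vol M D (geodesic_ball M org R)) / R powr (\<sigma> - \<eta>))) = ereal d\<^sub>0"
    and vol_poly: "\<sigma> - \<eta> = 0 \<Longrightarrow>
          Liminf at_top (\<lambda>R::real.
            ereal (ln (weighted_vol M D (geodesic_ball M org R)) / ln R)) = ereal d\<^sub>0"
    and nonempty: "{x. u x > \<gamma>} \<noteq> {}"
    and ineq: "weak_inequality M org D \<phi> K \<mu> chi u {x. u x > \<gamma>}"
  shows "K \<le> bound_const A \<delta> chi \<sigma> \<eta> d\<^sub>0 * real_of_ereal (max u_hat 0) powr (\<delta> - chi)"
proof -
  interpret elliptic_inequality M org D u \<phi> A \<delta> \<sigma> \<mu> chi \<eta> \<gamma> K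
  proof -
    interpret riemannian M by unfold_locales (rule manifold)
    show "elliptic_inequality M org D u \<phi> A \<delta> \<sigma> \<mu> chi \<eta> \<gamma> K"
      by unfold_locales (use connected complete D_cont D_pos phi_C0 phi_nonneg phi_0 A_pos delta_pos phi_bound
        eta sigma sigma_eta chi_range u_C1[unfolded Ck_function_iff] ineq in auto)
  qed
  (* Since u_hat is not +\<infinity>, its positive part is a real number; u_hat itself may be -\<infinity>. *)
  define b0 where "b0 = real_of_ereal (max u_hat 0)"
  have b0: "b0 \<ge> 0" by (simp add: b0_def real_of_ereal_pos)
  have b0': "max u_hat 0 = ereal b0" unfolding b0_def
    using u_hat_finite by (subst ereal_real) (auto simp: max_def)
  have growth: "\<exists>R0. \<forall>x. r x \<ge> R0 \<longrightarrow> u x \<le> b * r x powr \<sigma>" if "b > b0" for b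
  proof -
    have "u_hat \<le> ereal b0" using b0' by (metis max.cobounded1)
    then have "u_hat < ereal b" using that by (metis ereal_less_eq(3) ereal_less(2) le_less_trans less_ereal.simps(1))
    then have "eventually (\<lambda>x. ereal (u x / r x powr \<sigma>) < ereal b) (filtercomap r at_top)"
      unfolding u_hat by (rule Limsup_lessD)
    then obtain P where P: "eventually P at_top" "\<And>x. P (r x) \<Longrightarrow> ereal (u x / r x powr \<sigma>) < ereal b"
      unfolding eventually_filtercomap by blast
    then obtain R0 where R0: "\<And>t. t \<ge> R0 \<Longrightarrow> P t" unfolding eventually_at_top_linorder by blast
    have "u x \<le> b * r x powr \<sigma>" if "r x \<ge> max R0 1" for x
    proof -
      have "u x / r x powr \<sigma> < b" using P(2)[OF R0] that by simp
      moreover have "r x powr \<sigma> > 0" using that by auto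
      ultimately show ?thesis by (simp add: pos_divide_less_eq)
    qed
    then show ?thesis by blast
  qed
  obtain p where p: "u p > \<gamma>" using nonempty by blast
  show ?thesis
  proof (cases "\<sigma> - \<eta> > 0")
    case True
    note lim = vol_exp[OF True, folded ball_vol_def]
    have d0: "d\<^sub>0 \<ge> 0" by (rule exp_rate_nonneg[OF True lim])
    have "K \<le> (if \<sigma> = 0 then 0 else A * (d\<^sub>0 * (\<sigma> - \<eta>)) * max \<sigma> (\<sigma> - \<eta>) powr (\<delta> - chi)) * b0 powr (\<delta> - chi)"
      by (rule bound_from_rates[OF u_nonconst p _ admissible_rate_exp[OF True lim d0] b0 growth]) (use d0 True in auto)
    also have "(if \<sigma> = 0 then 0 else A * (d\<^sub>0 * (\<sigma> - \<eta>)) * max \<sigma> (\<sigma> - \<eta>) powr (\<delta> - chi)) = bound_const A \<delta> chi \<sigma> \<eta> d\<^sub>0"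
    proof -
      have "1 + \<delta> - chi = 1 + (\<delta> - chi)" by simp
      then have "(\<sigma> - \<eta>) powr (1 + \<delta> - chi) = (\<sigma> - \<eta>) * (\<sigma> - \<eta>) powr (\<delta> - chi)"
        using True by (simp only: powr_add) simp
      then show ?thesis using True by (simp add: bound_const_def max_def mult_ac)
    qed
    finally show ?thesis unfolding b0_def .
  next
    case False
    then have m: "\<sigma> - \<eta> = 0" using sigma_eta by simp
    note lim = vol_poly[OF m, folded ball_vol_def]
    define L where "L = max 0 (\<delta> * (\<sigma> - 1) + d\<^sub>0 - 1)"
    have "K \<le> (if \<sigma> = 0 then 0 else A * L * max \<sigma> (\<sigma> - \<eta>) powr (\<delta> - chi)) * b0 powr (\<delta> - chi)"
      by (rule bound_from_rates[OF u_nonconst p _ admissible_rate_poly[OF m lim] b0 growth]) (auto simp: L_def)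
    also have "(if \<sigma> = 0 then 0 else A * L * max \<sigma> (\<sigma> - \<eta>) powr (\<delta> - chi)) = bound_const A \<delta> chi \<sigma> \<eta> d\<^sub>0"
      using m sigma by (auto simp: bound_const_def L_def max_def mult_ac)
    finally show ?thesis unfolding b0_def .
  qed
qed

end
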